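(* Assume that: (A1) $\Phi$ satisfies: there exist $\delta_1\in(0,2]$ and $a_1\in(0,1)$ such that $a_1\lambda^{\delta_1}\Phi(r)\le \Phi(\lambda r)$ for all $\lambda\ge 1$, $r\ge 1$; and $\int_0^1 \frac{\Phi(r)}{r}\,dr=C_*<\infty$; (A2) $J:\mathbb{R}^d\to(0,\infty)$ satisfies $J(x)=J(-x)$ for all $x$, and there is $\gamma_0>0$ with $\gamma_0^{-1}j(|y|)\le J(y)\le \gamma_0 j(|y|)$ for all $y\in\mathbb{R}^d\setminus\{0\}$; (A3) $\kappa:\mathbb{R}^d\times\mathbb{R}^d\to\mathbb{R}$ is a Borel function with $0<\kappa_0\le\kappa(x,z)\le\kappa_1$, $\kappa(x,z)=\kappa(x,-z)$, and, for some $\beta\in(0,1]$, $|\kappa(x,z)-\kappa(y,z)|\le\kappa_2|x-y|^\beta$ for all $x,y,z\in\mathbb{R}^d$; (A4) there exists a function $g:\mathbb{R}^d\to(0,\infty)$ such that $\lim_{x\to\infty}g(x)=\infty$ and $\mathcal{L}^\kappa g(x)/g(x)$ is bounded from above. Let $p^\kappa$ be the heat kernel of $\mathcal{L}^\kappa$ described in the context, and let $P^\kappa_tf(x)=\int_{\mathbb{R}^d}p^\kappa(t,x,y)f(y)\,dy$ for $t>0$, $P_0^\kappa=\mathrm{Id}$. Then: (1) (Generator) Let $\varepsilon>0$. For any $f\in C_b^{2,\varepsilon}(\mathbb{R}^d)$, $$\lim_{t\downarrow0}\frac1t\left(P_t^\kappa f(x)-f(x)\right)=\mathcal{L}^\kappa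 f(x),$$ and the convergence is uniform (in $x\in\mathbb{R}^d$). (2) (Analyticity) The semigroup $(P_t^\kappa)_{t\ge0}$ of $\mathcal{L}^\kappa$ is analytic in $L^p(\mathbb{R}^d)$ for every $p\in[1,\infty)$.
   Context: Let $d\ge1$ and let $\phi:(0,\infty)\to(0,\infty)$ be a Bernstein function without drift and killing, i.e. $\phi(\lambda)=\int_{(0,\infty)}(1-e^{-\lambda t})\mu(dt)$ for a measure $\mu$ on $(0,\infty)$ with $\int_{(0,\infty)}(t\wedge1)\mu(dt)<\infty$, normalized so that $\phi(1)=1$. Define $\Phi(r)=\phi(r^2)$ for $r>0$ and let $\Phi^{-1}$ be its inverse. Let $$j(r)=\int_{(0,\infty)}(4\pi t)^{-d/2}e^{-r^2/(4t)}\mu(dt),\quad r>0.$$ For $t>0$, $x\in\mathbb{R}^d$ define $$\rho(t,x)=\Phi\left(\left(\tfrac{1}{\Phi^{-1}(t^{-1})}+|x|\right)^{-1}\right)\left(\tfrac{1}{\Phi^{-1}(t^{-1})}+|x|\right)^{-d}.$$ The operators are $$\mathcal{L}^{\kappa,\varepsilon}f(x)=\int_{|z|>\varepsilon}(f(x+z)-f(x))\kappa(x,z)J(z)\,dz\ (\varepsilon>0),\qquad \mathcal{L}^{\kappa}f(x)=\mathcal{L}^{\kappa,0}f(x)=\lim_{\varepsilon\downarrow0}\mathcal{L}^{\kappa,\varepsilon}f(x).$$ $C_b^{2,\varepsilon}(\mathbb{R}^d)$ is the space of bounded twice differentiable functions on $\mathbb{R}^d$ whose second derivatives are uniformly Hölder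 continuous (with exponent $\varepsilon$). Notation: $a\wedge b=\min\{a,b\}$. Heat kernel: under (A1)–(A4), $p^\kappa$ denotes the unique (it exists) non-negative jointly continuous function on $(0,\infty)\times\mathbb{R}^d\times\mathbb{R}^d$ solving $\partial_tp^\kappa(t,x,y)=\mathcal{L}^\kappa p^\kappa(t,\cdot,y)(x)$ for $x\neq y$ and satisfying: (i) for every $T\ge1$ there is $c_1>0$ with $p^\kappa(t,x,y)\le c_1t\rho(t,x-y)$ for all $t\in(0,T]$, $x,y\in\mathbb{R}^d$; (ii) for $x\ne y$, $t\mapsto\mathcal{L}^\kappa p^\kappa(t,\cdot,y)(x)$ is continuous on $(0,\infty)$, and for each $T\ge1$ there is $c_2>0$ with $|\mathcal{L}^{\kappa,\varepsilon}p^\kappa(t,\cdot,y)(x)|\le c_2\rho(t,x-y)$ for all $t\in(0,T]$, $\varepsilon\in[0,1]$, $x,y\in\mathbb{R}^d$; (iii) for every bounded uniformly continuous $f$, $\lim_{t\downarrow0}\sup_x|\int p^\kappa(t,x,y)f(y)\,dy-f(x)|=0$. Under these assumptions $(P^\kappa_t)_{t\ge0}$ is a semigroup. *)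

theory Defs
  imports "HOL-Analysis.Analysis"
begin

section \<open>Bernstein functions and the associated scale functions\<close>

text \<open>
  \<open>\<mu>\<close> lives on the measurable space \<open>(0,\<infinity>)\<close>, so integrals over \<open>\<mu>\<close> are integrals over \<open>(0,\<infinity>)\<close>.
  Only the values of \<open>\<phi>\<close> on \<open>(0,\<infinity>)\<close> are constrained. For \<open>u > 0\<close> the integrand is dominated by
  a multiple of \<open>min t 1\<close>, so the Bochner integral never takes a default value.
\<close>

definition bernstein_repr :: "(real \<Rightarrow> real) \<Rightarrow> real measure \<Rightarrow> bool" where
  "bernstein_repr \<phi> \<mu> \<longleftrightarrow>
     sets \<mu> = sets (restrict_space borel {0<..}) \<and>
     integrable \<mu> (\<lambda>t. min t 1) \<and>
     (\<forall>u>0. \<phi> u = (LINT t|\<mu>. 1 - exp (- (u * t))))"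

definition Phi :: "(real \<Rightarrow> real) \<Rightarrow> real \<Rightarrow> real" where
  "Phi \<phi> r = \<phi> (r\<^sup>2)"

text \<open>The inverse of \<open>\<Phi>\<close> as a function on \<open>(0,\<infinity>)\<close>.\<close>

definition Phi_inv :: "(real \<Rightarrow> real) \<Rightarrow> real \<Rightarrow> real" where
  "Phi_inv \<phi> = the_inv_into {0<..} (Phi \<phi>)"

definition levy_density :: "nat \<Rightarrow> real measure \<Rightarrow> real \<Rightarrow> real" where
  "levy_density d \<mu> r =
     (LINT t|\<mu>. (4 * pi * t) powr (- (real d / 2)) * exp (- (r\<^sup>2 / (4 * t))))"

definition rho :: "(real \<Rightarrow> real) \<Rightarrow> real \<Rightarrow> 'a::euclidean_space \<Rightarrow> real" where
  "rho \<phi> t x =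
     (let w = 1 / Phi_inv \<phi> (1 / t) + norm x
      in Phi \<phi> (1 / w) * w powr (- real DIM('a)))"

section \<open>The non-local operator\<close>

definition jump_integrand ::
  "('a::euclidean_space \<Rightarrow> 'a \<Rightarrow> real) \<Rightarrow> ('a \<Rightarrow> real) \<Rightarrow> ('a \<Rightarrow> real) \<Rightarrow> 'a \<Rightarrow> 'a \<Rightarrow> real" where
  "jump_integrand \<kappa> J f x z = (f (x + z) - f x) * \<kappa> x z * J z"

definition trunc_op ::
  "('a::euclidean_space \<Rightarrow> 'a \<Rightarrow> real) \<Rightarrow> ('a \<Rightarrow> real) \<Rightarrow> real \<Rightarrow> ('a \<Rightarrow> real) \<Rightarrow> 'a \<Rightarrow> real" where
  "trunc_op \<kappa> J \<epsilon> f x = (LINT z:{z. \<epsilon> < norm z}|lebesgue. jump_integrand \<kappa> J f x z)"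

text \<open>
  The case \<open>\<epsilon> = 0\<close> is the principal value, not an absolutely convergent integral.
  \<open>nonlocal_op\<close> is meaningful only together with \<open>nonlocal_defined\<close>, which says that the
  integrals converge absolutely and, for \<open>\<epsilon> = 0\<close>, that the limit exists in the reals.
\<close>

definition nonlocal_op ::
  "('a::euclidean_space \<Rightarrow> 'a \<Rightarrow> real) \<Rightarrow> ('a \<Rightarrow> real) \<Rightarrow> real \<Rightarrow> ('a \<Rightarrow> real) \<Rightarrow> 'a \<Rightarrow> real" where
  "nonlocal_op \<kappa> J \<epsilon> f x =
     (if \<epsilon> = 0 then Lim (at_right 0) (\<lambda>e. trunc_op \<kappa> J e f x) else trunc_op \<kappa> J \<epsilon> f x)"

definition nonlocal_defined ::
  "('a::euclidean_space \<Rightarrow> 'a \<Rightarrow> real) \<Rightarrow> ('a \<Rightarrow> real) \<Rightarrow> real \<Rightarrow> ('a \<Rightarrow> real) \<Rightarrow> 'a \<Rightarrow> bool" where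
  "nonlocal_defined \<kappa> J \<epsilon> f x \<longleftrightarrow>
     (if \<epsilon> = 0
      then (\<forall>e>0. set_integrable lebesgue {z. e < norm z} (jump_integrand \<kappa> J f x)) \<and>
           (\<exists>v. ((\<lambda>e. trunc_op \<kappa> J e f x) \<longlongrightarrow> v) (at_right 0))
      else set_integrable lebesgue {z. \<epsilon> < norm z} (jump_integrand \<kappa> J f x))"

text \<open>
  Bounded, twice (Frechet) differentiable functions with globally \<open>\<epsilon>\<close>-Hoelder continuous second
  derivative.
\<close>

definition C_b2 :: "real \<Rightarrow> ('a::euclidean_space \<Rightarrow> real) set" where
  "C_b2 \<epsilon> = {f. bounded (range f) \<and>
     (\<exists>(D1 :: 'a \<Rightarrow> 'a \<Rightarrow>\<^sub>L real) (D2 :: 'a \<Rightarrow> 'a \<Rightarrow>\<^sub>L 'a \<Rightarrow>\<^sub>L real).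
        (\<forall>x. (f has_derivative blinfun_apply (D1 x)) (at x)) \<and>
        (\<forall>x. (D1 has_derivative blinfun_apply (D2 x)) (at x)) \<and>
        (\<exists>C. \<forall>x y. norm (D2 x - D2 y) \<le> C * norm (x - y) powr \<epsilon>))}"

section \<open>The heat kernel and its semigroup\<close>

text \<open>
  \<open>P\<^sub>t\<close> acts on real functions as well as on complex ones (needed for analyticity on the complex
  spaces \<open>L\<^sup>q\<close>).
\<close>

definition kernel_semigroup ::
  "(real \<Rightarrow> 'a::euclidean_space \<Rightarrow> 'a \<Rightarrow> real) \<Rightarrow> real \<Rightarrow>
   ('a \<Rightarrow> 'b::{banach, second_countable_topology}) \<Rightarrow> 'a \<Rightarrow> 'b" where
  "kernel_semigroup p t f x = (if t = 0 then f x else (LINT y|lebesgue. p t x y *\<^sub>R f y))"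

text \<open>
  The defining properties of the heat kernel \<open>p\<close>; only its values for \<open>t > 0\<close> matter.
\<close>

definition is_heat_kernel ::
  "(real \<Rightarrow> real) \<Rightarrow> ('a::euclidean_space \<Rightarrow> 'a \<Rightarrow> real) \<Rightarrow> ('a \<Rightarrow> real) \<Rightarrow>
   (real \<Rightarrow> 'a \<Rightarrow> 'a \<Rightarrow> real) \<Rightarrow> bool" where
  "is_heat_kernel \<phi> \<kappa> J p \<longleftrightarrow>
     (\<forall>t>0. \<forall>x y. 0 \<le> p t x y) \<and>
     continuous_on ({0<..} \<times> UNIV \<times> UNIV) (\<lambda>(t, x, y). p t x y) \<and>
     (\<forall>t>0. \<forall>x y. x \<noteq> y \<longrightarrow>
        nonlocal_defined \<kappa> J 0 (\<lambda>u. p t u y) x \<and>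
        ((\<lambda>s. p s x y) has_real_derivative nonlocal_op \<kappa> J 0 (\<lambda>u. p t u y) x) (at t)) \<and>
     (\<forall>T\<ge>1. \<exists>c>0. \<forall>t\<in>{0<..T}. \<forall>x y. p t x y \<le> c * t * rho \<phi> t (x - y)) \<and>
     (\<forall>x y. x \<noteq> y \<longrightarrow> continuous_on {0<..} (\<lambda>t. nonlocal_op \<kappa> J 0 (\<lambda>u. p t u y) x)) \<and>
     (\<forall>T\<ge>1. \<exists>c>0. \<forall>t\<in>{0<..T}. \<forall>\<epsilon>\<in>{0..1}. \<forall>x y.
        nonlocal_defined \<kappa> J \<epsilon> (\<lambda>u. p t u y) x \<and>
        \<bar>nonlocal_op \<kappa> J \<epsilon> (\<lambda>u. p t u y) x\<bar> \<le> c * rho \<phi> t (x - y)) \<and>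
     (\<forall>f :: 'a \<Rightarrow> real. bounded (range f) \<and> uniformly_continuous_on UNIV f \<longrightarrow>
        uniform_limit UNIV (\<lambda>t. kernel_semigroup p t f) f (at_right 0))"

section \<open>Analytic semigroups on \<open>L\<^sup>q\<close>\<close>

text \<open>
  Elements of the complex space \<open>L\<^sup>q\<close>, \<open>1 \<le> q < \<infinity>\<close>, are represented by functions; identities
  in \<open>L\<^sup>q\<close> are identities almost everywhere.
\<close>

definition Lp_fun :: "real \<Rightarrow> ('a::euclidean_space \<Rightarrow> complex) set" where
  "Lp_fun q = {f \<in> borel_measurable lebesgue. integrable lebesgue (\<lambda>x. norm (f x) powr q)}"

definition Lp_norm :: "real \<Rightarrow> ('a::euclidean_space \<Rightarrow> complex) \<Rightarrow> real" where
  "Lp_norm q f = (LINT x|lebesgue. norm (f x) powr q) powr (1 / q)"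

text \<open>
  Linearity and the norm bound together force \<open>T\<close> to respect equality almost everywhere, so
  \<open>T\<close> induces a bounded linear operator on the quotient space.
\<close>

definition Lp_bounded_linear ::
  "real \<Rightarrow> (('a::euclidean_space \<Rightarrow> complex) \<Rightarrow> 'a \<Rightarrow> complex) \<Rightarrow> bool" where
  "Lp_bounded_linear q T \<longleftrightarrow>
     (\<forall>f\<in>Lp_fun q. T f \<in> Lp_fun q) \<and>
     (\<forall>f\<in>Lp_fun q. \<forall>g\<in>Lp_fun q. AE x in lebesgue. T (\<lambda>y. f y + g y) x = T f x + T g x) \<and>
     (\<forall>c. \<forall>f\<in>Lp_fun q. AE x in lebesgue. T (\<lambda>y. c * f y) x = c * T f x) \<and>
     (\<exists>C. \<forall>f\<in>Lp_fun q. Lp_norm q (T f) \<le> C * Lp_norm q f)"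

definition sector :: "real \<Rightarrow> complex set" where
  "sector \<theta> = {z. z \<noteq> 0 \<and> \<bar>Arg z\<bar> < \<theta>}"

text \<open>Complex differentiability at \<open>z\<close> with respect to the operator norm on \<open>L\<^sup>q\<close>.\<close>

definition Lp_complex_differentiable_at ::
  "real \<Rightarrow> (complex \<Rightarrow> ('a::euclidean_space \<Rightarrow> complex) \<Rightarrow> 'a \<Rightarrow> complex) \<Rightarrow> complex \<Rightarrow> bool" where
  "Lp_complex_differentiable_at q T z \<longleftrightarrow>
     (\<exists>D. Lp_bounded_linear q D \<and>
        (\<forall>e>0. \<forall>\<^sub>F h in at 0. \<forall>f\<in>Lp_fun q.
           Lp_norm q (\<lambda>x. (T (z + h) f x - T z f x) / h - D f x) \<le> e * Lp_norm q f))"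

text \<open>
  \<open>(S t)\<close>, \<open>t \<ge> 0\<close>, is an analytic semigroup on \<open>L\<^sup>q\<close>: it extends to an analytic semigroup of some
  angle \<open>\<theta> \<in> (0, \<pi>/2]\<close>. No uniform bound on the sector is required, i.e. the semigroup need not be
  a bounded analytic one.
\<close>

definition Lp_analytic_semigroup ::
  "real \<Rightarrow> (real \<Rightarrow> ('a::euclidean_space \<Rightarrow> complex) \<Rightarrow> 'a \<Rightarrow> complex) \<Rightarrow> bool" where
  "Lp_analytic_semigroup q S \<longleftrightarrow>
     (\<exists>\<theta> T. 0 < \<theta> \<and> \<theta> \<le> pi / 2 \<and>
        (\<forall>t\<ge>0. \<forall>f\<in>Lp_fun q. AE x in lebesgue. T (complex_of_real t) f x = S t f x) \<and>
        (\<forall>z\<in>insert 0 (sector \<theta>). Lp_bounded_linear q (T z)) \<and>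
        (\<forall>f\<in>Lp_fun q. AE x in lebesgue. T 0 f x = f x) \<and>
        (\<forall>z\<in>insert 0 (sector \<theta>). \<forall>w\<in>insert 0 (sector \<theta>). \<forall>f\<in>Lp_fun q.
           AE x in lebesgue. T (z + w) f x = T z (T w f) x) \<and>
        (\<forall>z\<in>sector \<theta>. Lp_complex_differentiable_at q T z) \<and>
        (\<forall>\<theta>'\<in>{0<..<\<theta>}. \<forall>f\<in>Lp_fun q.
           ((\<lambda>z. Lp_norm q (\<lambda>x. T z f x - f x)) \<longlongrightarrow> 0) (at 0 within sector \<theta>')))"

end

theory Submission
  imports Defs "HOL-Complex_Analysis.Complex_Analysis"
begin

text \<open>
  Write \<open>P\<^sub>t f(x) = \<integral> p(t,x,y) f(y) dy\<close>, \<open>q = \<partial>\<^sub>t p\<close> and \<open>\<rho>\<^sub>t = \<rho>(t,\<cdot>)\<close>. The heat kernel enters through its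
  equation, the bounds \<open>p \<le> c t \<rho>\<^sub>t(x - y)\<close> and \<open>\<bar>q\<bar> \<le> c \<rho>\<^sub>t(x - y)\<close>, and its initial condition. Two
  properties of \<open>\<rho>\<close> make these bounds effective. The scaling of \<open>\<Phi>\<close> at infinity and the integrability
  of \<open>\<Phi>(r)/r\<close> at zero give \<open>\<integral> \<rho>\<^sub>t \<le> M/t\<close> for bounded \<open>t\<close> (\<open>nn_integral_rho\<close>), and doubling of \<open>\<rho>\<close> gives
  \<open>\<rho>\<^sub>s(x - z) \<rho>\<^sub>s(z - y) \<le> C \<rho>\<^sub>s(x - y) (\<rho>\<^sub>s(x - z) + \<rho>\<^sub>s(z - y))\<close> (\<open>rho_mult_le\<close>). By the first one,
  \<open>u(t,x) = P\<^sub>t f(x)\<close> is, for bounded \<open>f\<close>, a bounded solution of \<open>\<partial>\<^sub>t u = \<L> u\<close> (\<open>has_gen_P\<close>,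
  \<open>P_has_derivative\<close>), and bounded solutions are compared by a \<open>maximum_principle\<close> on the whole space.

  Generator. Let \<open>e > 0\<close>. For \<open>f \<in> C\<^sub>b\<^bsup>2,\<epsilon>\<^esup>\<close> the function \<open>h = \<L> f\<close> is bounded and uniformly continuous
  (\<open>C_b2_generator\<close>), so \<open>P\<^sub>\<eta> h\<close> is within \<open>e/4\<close> of \<open>h\<close> for a small fixed \<open>\<eta>\<close>. The function
  \<open>v(t,x) = P\<^sub>t f(x) - f(x) - t P\<^sub>\<eta> h(x)\<close> starts at zero and satisfies
  \<open>\<partial>\<^sub>t v - \<L> v = (h - P\<^sub>\<eta> h) + t \<L> P\<^sub>\<eta> h\<close>, which is at most \<open>e/2\<close> in absolute value for small \<open>t\<close>. The maximum principle
  turns this into \<open>\<bar>v(t,x)\<bar> \<le> e t / 2\<close>, that is, \<open>(P\<^sub>t f - f)/t\<close> is uniformly close to \<open>P\<^sub>\<eta> h\<close> and hence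
  to \<open>h\<close>.

  Analyticity. The maximum principle also gives \<open>P\<^bsub>t+s\<^esub> f = P\<^sub>t P\<^sub>s f\<close> for continuous \<open>f\<close> of compact
  support, hence the \<open>Chapman_Kolmogorov\<close> equation for \<open>p\<close>. In the identity
  \<open>\<partial>\<^sub>t\<^sup>n p(t + s,x,y) = \<integral> \<partial>\<^sub>t\<^sup>n p(t,x,z) p(s,z,y) dz\<close> one more time derivative can be put on the second
  factor. Splitting \<open>t\<close> into \<open>n + 1\<close> steps of length \<open>s = t/(n + 1)\<close>, each derivative costs a factor \<open>C/s\<close>,
  because convolving \<open>\<rho>\<^sub>s\<close> with \<open>\<rho>\<^sub>s\<close> costs \<open>C/s\<close>. This yields
  \<open>\<bar>\<partial>\<^sub>t\<^sup>n p\<bar> t\<^sup>n \<le> C K\<^sup>n n! s \<rho>\<^sub>s(x - y)\<close> with \<open>K\<close> independent of \<open>n\<close>, \<open>x\<close>, \<open>y\<close> and of the bound on \<open>t\<close>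
  (\<open>D_gevrey_bound\<close>). So \<open>t \<mapsto> p(t,x,y)\<close> has a Taylor series at \<open>t\<close> with a radius proportional to \<open>t\<close>, and it
  extends holomorphically to a sector that does not depend on \<open>x\<close> and \<open>y\<close>. The extension is dominated by
  \<open>\<Sum>\<^sub>n 2\<^bsup>-n\<^esup> s\<^sub>n \<rho>\<^bsub>s\<^sub>n\<^esub>(x - y)\<close> with \<open>s\<^sub>n = Re z/(n + 1)\<close>, a function of \<open>x - y\<close> whose integral stays bounded as
  \<open>z\<close> tends to zero.

  A kernel dominated by an integrable function of \<open>x - y\<close> acts boundedly on every \<open>L\<^sup>q\<close> by Young's
  inequality. Cauchy's estimates bound the Taylor remainders of the kernel by the same majorant, so the
  operators are differentiable in operator norm. The semigroup law passes to complex times by the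
  identity theorem. At time zero, convergence along real times follows from the initial condition and
  the density of continuous functions of compact support, and
  \<open>T\<^sub>z f - f = T\<^sub>z (f - T\<^sub>s f) + (T\<^bsub>z+s\<^esub> f - T\<^sub>s f) + (T\<^sub>s f - f)\<close> with a small real \<open>s\<close> extends it to complex
  times.
\<close>

section \<open>Differentiation of integrals and radial integrals\<close>

text \<open>
  The mean value inequality bounds the difference quotients by the majorant \<open>g\<close> of the derivative, so
  dominated convergence applies to them.
\<close>

lemma has_field_derivative_integral_dominated:
  fixes f :: "'k::{real_normed_field,banach,second_countable_topology} \<Rightarrow> 'b \<Rightarrow> 'k"
  assumes r: "0 < r"
    and int: "\<And>t. t \<in> ball t0 r \<Longrightarrow> integrable M (f t)"
    and meas: "f' t0 \<in> borel_measurable M"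
    and der: "AE y in M. \<forall>t\<in>ball t0 r. ((\<lambda>t. f t y) has_field_derivative f' t y) (at t) \<and> norm (f' t y) \<le> g y"
    and g: "integrable M g"
  shows "integrable M (f' t0)" (is ?A)
    and "((\<lambda>t. \<integral>y. f t y \<partial>M) has_field_derivative (\<integral>y. f' t0 y \<partial>M)) (at t0)" (is ?B)
proof -
  have t0: "t0 \<in> ball t0 r" using r by simp
  show ?A
  proof (rule Bochner_Integration.integrable_bound[OF g meas])
    show "AE y in M. norm (f' t0 y) \<le> norm (g y)"
      using der
    proof eventually_elim
      case (elim y)
      then have "norm (f' t0 y) \<le> g y" using t0 by blast
      then show ?case by simp
    qed
  qed
  show ?B
    unfolding has_field_derivative_iff
  proof (subst tendsto_at_iff_sequentially, intro allI impI)
    fix X :: "nat \<Rightarrow> 'k" assume X: "\<forall>i. X i \<in> UNIV - {t0}" and lim: "X \<longlonglongrightarrow> t0"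
    obtain N where N: "\<And>n. n \<ge> N \<Longrightarrow> X n \<in> ball t0 r"
      using lim r by (metis lim_sequentially mem_ball dist_commute)
    let ?Y = "\<lambda>n. X (n + N)"
    have Y: "?Y n \<in> ball t0 r" "?Y n \<noteq> t0" for n using N X by auto
    have limY: "?Y \<longlonglongrightarrow> t0" using lim by (rule LIMSEQ_ignore_initial_segment)
    have eq: "((\<integral>y. f (?Y n) y \<partial>M) - (\<integral>y. f t0 y \<partial>M)) / (?Y n - t0)
        = (\<integral>y. (f (?Y n) y - f t0 y) / (?Y n - t0) \<partial>M)" for n
      using int[OF Y(1)[of n]] int[of t0] r by simp
    have "(\<lambda>n. \<integral>y. (f (?Y n) y - f t0 y) / (?Y n - t0) \<partial>M) \<longlonglongrightarrow> (\<integral>y. f' t0 y \<partial>M)"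
    proof (rule integral_dominated_convergence[where w=g])
      show "f' t0 \<in> borel_measurable M" by (rule meas)
      show "(\<lambda>y. (f (?Y n) y - f t0 y) / (?Y n - t0)) \<in> borel_measurable M" for n
        using int[OF Y(1)[of n]] int[of t0] r by auto
      show "integrable M g" by (rule g)
      show "AE y in M. (\<lambda>n. (f (?Y n) y - f t0 y) / (?Y n - t0)) \<longlonglongrightarrow> f' t0 y"
        using der
      proof eventually_elim
        case (elim y)
        have "((\<lambda>t. (f t y - f t0 y) / (t - t0)) \<longlongrightarrow> f' t0 y) (at t0)"
          using elim t0 unfolding has_field_derivative_iff by blast
        then have "((\<lambda>t. (f t y - f t0 y) / (t - t0)) \<circ> ?Y) \<longlonglongrightarrow> f' t0 y"
          using limY Y(2) unfolding tendsto_at_iff_sequentially by simp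
        then show ?case by (simp add: o_def)
      qed
      show "AE y in M. norm ((f (?Y n) y - f t0 y) / (?Y n - t0)) \<le> g y" for n
        using der
      proof eventually_elim
        case (elim y)
        have "norm (f (?Y n) y - f t0 y) \<le> g y * norm (?Y n - t0)"
        proof (rule field_differentiable_bound[where S="ball t0 r" and f'="\<lambda>t. f' t y"])
          show "((\<lambda>t. f t y) has_field_derivative f' t y) (at t within ball t0 r)" if "t \<in> ball t0 r" for t
            using elim that by (blast intro: has_field_derivative_at_within)
          show "norm (f' t y) \<le> g y" if "t \<in> ball t0 r" for t using elim that by blast
        qed (use Y r in auto)
        then show ?case using Y(2)[of n]
          by (simp add: norm_divide divide_simps mult.commute)
      qed
    qed
    then have "(\<lambda>n. ((\<integral>y. f (X (n+N)) y \<partial>M) - (\<integral>y. f t0 y \<partial>M)) / (X (n+N) - t0)) \<longlonglongrightarrow> (\<integral>y. f' t0 y \<partial>M)"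
      unfolding eq .
    then show "((\<lambda>x. ((\<integral>y. f x y \<partial>M) - (\<integral>y. f t0 y \<partial>M)) / (x - t0)) \<circ> X) \<longlonglongrightarrow> (\<integral>y. f' t0 y \<partial>M)"
      unfolding o_def by (rule LIMSEQ_offset)
  qed
qed

text \<open>
  Two locally finite measures on the line agree if they agree on all \<open>{..a}\<close>; here these values are
  volumes of balls.
\<close>

lemma distr_norm_lborel:
  "distr (lborel :: 'a::euclidean_space measure) borel norm =
   density lborel (\<lambda>r. ennreal (indicator {0..} r * (real DIM('a) * unit_ball_vol DIM('a) * r ^ (DIM('a) - 1))))"
  (is "?M = ?N")
proof (rule measure_eqI_generator_eq[where E="range (\<lambda>a::real. {..a})" and \<Omega>=UNIV and A="\<lambda>i. {..real i}"])
  let ?d = "DIM('a)"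
  have M: "emeasure ?M {..a} = ennreal (if a \<ge> 0 then unit_ball_vol ?d * a ^ ?d else 0)" for a
  proof -
    have "emeasure ?M {..a} = emeasure lborel (cball (0::'a) a)"
      by (subst emeasure_distr) (auto intro!: arg_cong[where f="emeasure lborel"])
    also have "\<dots> = ennreal (if a \<ge> 0 then unit_ball_vol ?d * a ^ ?d else 0)"
      by (cases "a \<ge> 0") (auto simp: emeasure_cball)
    finally show ?thesis .
  qed
  have N: "emeasure ?N {..a} = ennreal (if a \<ge> 0 then unit_ball_vol ?d * a ^ ?d else 0)" for a
  proof (cases "a \<ge> 0")
    case True
    have "emeasure ?N {..a} = (\<integral>\<^sup>+ r. ennreal (real ?d * unit_ball_vol ?d * r ^ (?d - 1)) * indicator {0..a} r \<partial>lborel)"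
    proof (subst emeasure_density)
      show "(\<integral>\<^sup>+ r. ennreal (indicator {0..} r * (real ?d * unit_ball_vol ?d * r ^ (?d - 1))) * indicator {..a} r \<partial>lborel)
         = (\<integral>\<^sup>+ r. ennreal (real ?d * unit_ball_vol ?d * r ^ (?d - 1)) * indicator {0..a} r \<partial>lborel)"
        by (rule nn_integral_cong) (simp split: split_indicator)
    qed simp_all
    also have "\<dots> = ennreal (unit_ball_vol ?d * a ^ ?d - unit_ball_vol ?d * 0 ^ ?d)"
    proof (rule nn_integral_FTC_Icc[where F="\<lambda>r. unit_ball_vol ?d * r ^ ?d"])
      show "((\<lambda>r. unit_ball_vol (real DIM('a)) * r ^ DIM('a)) has_real_derivative
           real DIM('a) * unit_ball_vol (real DIM('a)) * x ^ (DIM('a) - 1)) (at x)" for x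
        by (rule derivative_eq_intros refl | simp)+
    qed (use True in auto)
    finally show ?thesis using True by simp
  next
    case False
    have "emeasure ?N {..a} = (\<integral>\<^sup>+ r. ennreal (indicator {0..} r * (real ?d * unit_ball_vol ?d * r ^ (?d - 1))) * indicator {..a} r \<partial>lborel)"
      by (rule emeasure_density) simp_all
    also have "\<dots> = (\<integral>\<^sup>+ r. 0 \<partial>(lborel :: real measure))"
      using False by (intro nn_integral_cong) (simp split: split_indicator)
    finally show ?thesis using False by simp
  qed
  show "emeasure ?M X = emeasure ?N X" if "X \<in> range (\<lambda>a::real. {..a})" for X
  proof -
    from that obtain a where X: "X = {..a}" by (rule rangeE)
    show ?thesis unfolding X M N ..
  qed
  show "emeasure ?M {..real i} \<noteq> \<infinity>" for i unfolding M by simp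
  show "Int_stable (range (\<lambda>a::real. {..a}))" by (auto simp: Int_stable_def)
  show "sets ?M = sigma_sets UNIV (range (\<lambda>a::real. {..a}))"
    by (simp add: borel_eq_atMost)
  show "sets ?N = sigma_sets UNIV (range (\<lambda>a::real. {..a}))"
    by (simp add: borel_eq_atMost)
  show "(\<Union>i. {..real i}) = UNIV" by (simp add: set_eq_iff real_arch_simple)
qed auto

lemma nn_integral_radial:
  assumes [measurable]: "F \<in> borel_measurable borel"
  shows "(\<integral>\<^sup>+ x. F (norm (x::'a::euclidean_space)) \<partial>lborel) =
    (\<integral>\<^sup>+ r. ennreal (indicator {0..} r * (real DIM('a) * unit_ball_vol DIM('a) * r ^ (DIM('a) - 1))) * F r \<partial>lborel)"
proof -
  have "(\<integral>\<^sup>+ x. F (norm (x::'a)) \<partial>lborel) = (\<integral>\<^sup>+ r. F r \<partial>distr (lborel :: 'a measure) borel norm)"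
    by (simp add: nn_integral_distr)
  also have "\<dots> = (\<integral>\<^sup>+ r. ennreal (indicator {0..} r * (real DIM('a) * unit_ball_vol DIM('a) * r ^ (DIM('a) - 1))) * F r \<partial>lborel)"
    unfolding distr_norm_lborel by (subst nn_integral_density) simp_all
  finally show ?thesis .
qed

section \<open>Bernstein functions\<close>

text \<open>
  Concavity of \<open>s \<mapsto> 1 - exp (- s)\<close>. Integrated against \<open>\<mu>\<close> it becomes \<open>phi_scale_le\<close>, the source of all
  doubling properties below.
\<close>

lemma one_minus_exp_scale_le:
  fixes l s :: real
  assumes "1 \<le> l" "0 \<le> s"
  shows "1 - exp (- (l * s)) \<le> l * (1 - exp (- s))"
proof -
  have "exp ((1 - 1/l) *\<^sub>R 0 + (1/l) *\<^sub>R (- (l * s))) \<le> (1 - 1/l) * exp 0 + (1/l) * exp (- (l * s))"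
    by (rule convex_onD[OF exp_convex]) (use assms in auto)
  then have "exp (- s) \<le> 1 - 1/l + exp (- (l * s)) / l" using assms by simp
  then have "l * exp (- s) \<le> l * (1 - 1/l + exp (- (l * s)) / l)" using assms by (intro mult_left_mono) auto
  also have "\<dots> = l - 1 + exp (- (l * s))" using assms by (simp add: field_simps)
  finally show ?thesis by (simp add: algebra_simps)
qed

lemma one_minus_exp_le_min:
  fixes u t :: real
  assumes "0 \<le> u" "0 \<le> t"
  shows "1 - exp (- (u * t)) \<le> max u 1 * min t 1"
proof -
  have "1 - exp (- (u * t)) \<le> u * t" using exp_ge_add_one_self[of "-(u*t)"] by simp
  moreover have "1 - exp (- (u * t)) \<le> max u 1" by (rule order_trans[of _ 1]) auto
  moreover have "u * t \<le> max u 1 * t" using assms by (intro mult_right_mono) auto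
  ultimately show ?thesis using assms by (cases "t \<le> 1") (auto simp: min_def)
qed

locale bernstein =
  fixes \<phi> :: "real \<Rightarrow> real" and \<mu> :: "real measure"
  assumes repr: "bernstein_repr \<phi> \<mu>" and normalized: "\<phi> 1 = 1"
begin

lemma sets_mu: "sets \<mu> = sets (restrict_space borel {0<..})"
  and integrable_min: "integrable \<mu> (\<lambda>t. min t 1)"
  and phi_eq: "0 < u \<Longrightarrow> \<phi> u = (LINT t|\<mu>. 1 - exp (- (u * t)))"
  using repr by (auto simp: bernstein_repr_def)

lemma space_mu: "space \<mu> = {0<..}"
  using sets_eq_imp_space_eq[OF sets_mu] by (simp add: space_restrict_space)

lemma borel_measurable_mu: "f \<in> borel_measurable borel \<Longrightarrow> f \<in> borel_measurable \<mu>"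
  by (subst measurable_cong_sets[OF sets_mu refl]) (rule measurable_restrict_space1)

lemma integrable_one_minus_exp:
  assumes "0 \<le> u" shows "integrable \<mu> (\<lambda>t. 1 - exp (- (u * t)))"
proof (rule Bochner_Integration.integrable_bound)
  show "integrable \<mu> (\<lambda>t. max u 1 * min t 1)" using integrable_min by simp
  show "(\<lambda>t. 1 - exp (- (u * t))) \<in> borel_measurable \<mu>" by (rule borel_measurable_mu) simp
  show "AE t in \<mu>. norm (1 - exp (- (u * t))) \<le> norm (max u 1 * min t 1)"
  proof (rule AE_I2)
    fix t assume "t \<in> space \<mu>"
    then have t: "0 < t" by (simp add: space_mu)
    have "0 \<le> 1 - exp (- (u * t))" using assms t by simp
    moreover have "0 \<le> max u 1 * min t 1" using t by simp
    ultimately show "norm (1 - exp (- (u * t))) \<le> norm (max u 1 * min t 1)"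
      using one_minus_exp_le_min[of u t] assms t by simp
  qed
qed

lemma phi_mono: assumes "0 < u" "u \<le> v" shows "\<phi> u \<le> \<phi> v"
  unfolding phi_eq[OF assms(1)] phi_eq[OF less_le_trans[OF assms]]
  using assms by (intro integral_mono integrable_one_minus_exp) (auto simp: space_mu intro!: mult_right_mono)

lemma phi_scale_le: assumes "0 < u" "1 \<le> l" shows "\<phi> (l * u) \<le> l * \<phi> u"
proof -
  have "\<phi> (l * u) = (LINT t|\<mu>. 1 - exp (- ((l * u) * t)))" using assms by (intro phi_eq) auto
  also have "\<dots> \<le> (LINT t|\<mu>. l * (1 - exp (- (u * t))))"
    using assms one_minus_exp_scale_le[of l "u * _"]
    by (intro integral_mono integrable_one_minus_exp Bochner_Integration.integrable_mult_right)
       (auto simp: space_mu mult.assoc)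
  also have "\<dots> = l * \<phi> u" using assms by (simp add: phi_eq)
  finally show ?thesis .
qed

lemma phi_pos: assumes "0 < u" shows "0 < \<phi> u"
proof (cases "1 \<le> u")
  case True
  then show ?thesis using phi_mono[of 1 u] normalized by simp
next
  case False
  have "\<phi> ((1/u) * u) \<le> (1/u) * \<phi> u" using assms False by (intro phi_scale_le) auto
  then have "1 \<le> \<phi> u / u" using assms normalized by simp
  then show ?thesis using assms by (simp add: field_simps)
qed

lemma continuous_on_phi: "continuous_on {0<..} \<phi>"
proof (rule continuous_at_imp_continuous_on, rule ballI)
  fix u :: real assume "u \<in> {0<..}"
  then have u: "0 < u" by simp
  have lower: "\<phi> u * min 1 (v / u) \<le> \<phi> v" if v: "0 < v" for v
  proof (cases "v \<le> u")
    case True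
    have "\<phi> ((u/v) * v) \<le> (u/v) * \<phi> v" using v u True by (intro phi_scale_le) auto
    then show ?thesis using u v True by (simp add: field_simps min_def)
  next
    case False
    then show ?thesis using phi_mono[of u v] u by (simp add: min_def)
  qed
  have upper: "\<phi> v \<le> \<phi> u * max 1 (v / u)" if v: "0 < v" for v
  proof (cases "v \<le> u")
    case True
    then show ?thesis using phi_mono[of v u] u v by (simp add: max_def)
  next
    case False
    have "\<phi> ((v/u) * u) \<le> (v/u) * \<phi> u" using v u False by (intro phi_scale_le) auto
    then show ?thesis using u v False by (simp add: field_simps max_def)
  qed
  have "(\<phi> \<longlongrightarrow> \<phi> u) (at u)"
  proof (rule tendsto_sandwich)
    have ev: "\<forall>\<^sub>F v in at u. 0 < v" using u by (intro order_tendstoD(1)[OF tendsto_ident_at])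
    show "\<forall>\<^sub>F v in at u. \<phi> u * min 1 (v / u) \<le> \<phi> v" using ev by eventually_elim (rule lower)
    show "\<forall>\<^sub>F v in at u. \<phi> v \<le> \<phi> u * max 1 (v / u)" using ev by eventually_elim (rule upper)
    have "((\<lambda>v. \<phi> u * min 1 (v / u)) \<longlongrightarrow> \<phi> u * min 1 (u / u)) (at u)" using u by (intro tendsto_intros) auto
    then show "((\<lambda>v. \<phi> u * min 1 (v / u)) \<longlongrightarrow> \<phi> u) (at u)" using u by simp
    have "((\<lambda>v. \<phi> u * max 1 (v / u)) \<longlongrightarrow> \<phi> u * max 1 (u / u)) (at u)" using u by (intro tendsto_intros) auto
    then show "((\<lambda>v. \<phi> u * max 1 (v / u)) \<longlongrightarrow> \<phi> u) (at u)" using u by simp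
  qed
  then show "isCont \<phi> u" by (simp add: isCont_def)
qed

text \<open>
  If \<open>\<phi>\<close> took the same value twice, \<open>\<mu>\<close> would be the zero measure, contrary to \<open>\<phi> 1 = 1\<close>.
\<close>

lemma phi_strict_mono: assumes u: "0 < u" and uv: "u < v" shows "\<phi> u < \<phi> v"
proof (rule ccontr)
  assume "\<not> \<phi> u < \<phi> v"
  then have eq: "\<phi> v - \<phi> u = 0" using phi_mono[of u v] u uv by simp
  have v: "0 < v" using u uv by simp
  have int: "integrable \<mu> (\<lambda>t. (1 - exp (- (v * t))) - (1 - exp (- (u * t))))"
    using u v by (intro Bochner_Integration.integrable_diff integrable_one_minus_exp) auto
  have pos: "0 < (1 - exp (- (v * t))) - (1 - exp (- (u * t)))" if "t \<in> space \<mu>" for t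
    using that u uv by (simp add: space_mu)
  have "(LINT t|\<mu>. (1 - exp (- (v * t))) - (1 - exp (- (u * t)))) = 0"
    using eq u v by (subst Bochner_Integration.integral_diff) (auto intro!: integrable_one_minus_exp simp: phi_eq)
  then have "AE t in \<mu>. (1 - exp (- (v * t))) - (1 - exp (- (u * t))) = 0"
    by (subst (asm) integral_nonneg_eq_0_iff_AE[OF int]) (rule AE_I2, rule less_imp_le, rule pos)
  moreover have "AE t in \<mu>. 0 < (1 - exp (- (v * t))) - (1 - exp (- (u * t)))"
    by (intro AE_I2 pos)
  ultimately have "AE t in \<mu>. False" by eventually_elim linarith
  then have "\<phi> 1 = (LINT t|\<mu>. 0)"
    unfolding phi_eq[OF zero_less_one]
    by (intro integral_cong_AE borel_measurable_mu) (auto elim: eventually_mono)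
  then show False using normalized by simp
qed

lemma phi_small: assumes "0 < y" shows "\<exists>u>0. \<phi> u < y"
proof -
  have "(\<lambda>n. LINT t|\<mu>. 1 - exp (- (1 / real (Suc n) * t))) \<longlonglongrightarrow> (LINT t|\<mu>. 0)"
  proof (rule integral_dominated_convergence[where w="\<lambda>t. min t 1"])
    show "(\<lambda>t. 1 - exp (- (1 / real (Suc n) * t))) \<in> borel_measurable \<mu>" for n by (rule borel_measurable_mu) simp
    show "integrable \<mu> (\<lambda>t. min t 1)" by (rule integrable_min)
    show "AE t in \<mu>. (\<lambda>n. 1 - exp (- (1 / real (Suc n) * t))) \<longlonglongrightarrow> 0"
    proof (rule AE_I2)
      fix t :: real
      have "(\<lambda>n. 1 / real (Suc n)) \<longlonglongrightarrow> 0" using LIMSEQ_inverse_real_of_nat by (simp add: inverse_eq_divide)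
      then have "(\<lambda>n. 1 - exp (- (1 / real (Suc n) * t))) \<longlonglongrightarrow> 1 - exp (- (0 * t))" by (intro tendsto_intros)
      then show "(\<lambda>n. 1 - exp (- (1 / real (Suc n) * t))) \<longlonglongrightarrow> 0" by simp
    qed
    show "AE t in \<mu>. norm (1 - exp (- (1 / real (Suc n) * t))) \<le> min t 1" for n
    proof (rule AE_I2)
      fix t assume "t \<in> space \<mu>"
      then have t: "0 < t" by (simp add: space_mu)
      have "1 - exp (- (1 / real (Suc n) * t)) \<le> max (1 / real (Suc n)) 1 * min t 1"
        by (rule one_minus_exp_le_min) (use t in auto)
      also have "max (1 / real (Suc n)) 1 = 1" by (simp add: max_def)
      finally show "norm (1 - exp (- (1 / real (Suc n) * t))) \<le> min t 1" using t by simp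
    qed
  qed simp
  then have "(\<lambda>n. \<phi> (1 / real (Suc n))) \<longlonglongrightarrow> 0" by (simp add: phi_eq)
  from order_tendstoD(2)[OF this assms] have "\<exists>n. \<phi> (1 / real (Suc n)) < y"
    by (auto simp: eventually_sequentially)
  then show ?thesis by (metis of_nat_0_less_iff zero_less_Suc zero_less_divide_1_iff)
qed

lemma sigma_finite_mu: "sigma_finite_measure \<mu>"
proof
  let ?A = "\<lambda>n::nat. {1 / real (Suc n) <..}"
  have sub: "?A n \<subseteq> {0<..}" for n
  proof (rule subsetI)
    fix t assume "t \<in> ?A n"
    moreover have "0 < 1 / real (Suc n)" by simp
    ultimately show "t \<in> {0<..}" unfolding greaterThan_iff by linarith
  qed
  have sets: "?A n \<in> sets \<mu>" for n
    unfolding sets_mu sets_restrict_space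
    by (rule image_eqI[of _ _ "?A n"]) (use sub[of n] in \<open>simp_all add: Int_absorb1\<close>)
  have "emeasure \<mu> (?A n) < \<infinity>" for n
  proof -
    have "integrable \<mu> (indicator (?A n) :: _ \<Rightarrow> real)"
    proof (rule Bochner_Integration.integrable_bound)
      show "integrable \<mu> (\<lambda>t. real (Suc n) * min t 1)" using integrable_min by simp
      show "(indicator (?A n) :: _ \<Rightarrow> real) \<in> borel_measurable \<mu>" using sets by simp
      show "AE t in \<mu>. norm (indicator (?A n) t :: real) \<le> norm (real (Suc n) * min t 1)"
        by (rule AE_I2) (auto simp: space_mu indicator_def min_def field_simps)
    qed
    then show ?thesis using sub[of n] by (simp add: integrable_indicator_iff space_mu Int_absorb2)
  qed
  moreover have "(\<Union>n. ?A n) = space \<mu>"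
  proof -
    have "\<exists>n. 1 / real (Suc n) < t" if "0 < t" for t
      using reals_Archimedean[OF that] by (simp add: inverse_eq_divide)
    moreover have "(\<Union>n. ?A n) \<subseteq> {0<..}" using sub by (rule UN_least)
    ultimately show ?thesis unfolding space_mu by (intro equalityI) (simp_all add: subset_eq)
  qed
  ultimately show "\<exists>A. countable A \<and> A \<subseteq> sets \<mu> \<and> \<Union> A = space \<mu> \<and> (\<forall>a\<in>A. emeasure \<mu> a \<noteq> \<infinity>)"
    using sets by (intro exI[of _ "range ?A"]) (auto simp: less_top)
qed

end

section \<open>The scale function \<open>\<Phi>\<close> and the majorant \<open>\<rho>\<close>\<close>

locale scaled_bernstein = bernstein +
  fixes \<delta> a1 :: real
  assumes \<delta>_pos: "0 < \<delta>" and a1_pos: "0 < a1"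
    and scaling: "\<And>l r. 1 \<le> l \<Longrightarrow> 1 \<le> r \<Longrightarrow> a1 * l powr \<delta> * Phi \<phi> r \<le> Phi \<phi> (l * r)"
    and Phi_integral: "set_integrable lebesgue {0<..<1} (\<lambda>r. Phi \<phi> r / r)"
begin

lemma Phi_pos: "0 < r \<Longrightarrow> 0 < Phi \<phi> r"
  by (simp add: Phi_def phi_pos)

lemma Phi_mono: "0 < r \<Longrightarrow> r \<le> s \<Longrightarrow> Phi \<phi> r \<le> Phi \<phi> s"
  unfolding Phi_def by (intro phi_mono power_mono) auto

lemma Phi_double: assumes "0 < r" shows "Phi \<phi> (2 * r) \<le> 4 * Phi \<phi> r"
  using phi_scale_le[of "r\<^sup>2" 4] assms by (simp add: Phi_def power_mult_distrib)

lemma Phi_1: "Phi \<phi> 1 = 1" by (simp add: Phi_def normalized)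

lemma continuous_on_Phi: "continuous_on {0<..} (Phi \<phi>)"
  unfolding Phi_def by (intro continuous_on_compose2[OF continuous_on_phi] continuous_intros) auto

lemma Phi_surj: assumes y: "0 < y" shows "\<exists>r>0. Phi \<phi> r = y"
proof -
  obtain u where u: "0 < u" "\<phi> u < y" using phi_small[OF y] by blast
  define r where "r = sqrt u"
  have r: "0 < r" "Phi \<phi> r < y" using u by (auto simp: r_def Phi_def)
  define l where "l = max 1 ((y / a1) powr (1 / \<delta>))"
  have "y = a1 * ((y / a1) powr (1 / \<delta>)) powr \<delta>" using y a1_pos \<delta>_pos by (simp add: powr_powr)
  also have "\<dots> \<le> a1 * l powr \<delta>" using a1_pos \<delta>_pos y by (intro mult_left_mono powr_mono2) (auto simp: l_def)
  also have "\<dots> \<le> Phi \<phi> l" using scaling[of l 1] by (simp add: Phi_1 l_def)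
  finally have l: "y \<le> Phi \<phi> l" .
  have rl: "r \<le> l"
  proof (rule ccontr)
    assume "\<not> r \<le> l"
    then have "Phi \<phi> l \<le> Phi \<phi> r" by (intro Phi_mono) (auto simp: l_def)
    then show False using l r by simp
  qed
  have "\<exists>x\<ge>r. x \<le> l \<and> Phi \<phi> x = y"
    by (rule IVT') (use r l rl in \<open>auto intro: continuous_on_subset[OF continuous_on_Phi]\<close>)
  then obtain x where "r \<le> x" "Phi \<phi> x = y" by blast
  then show ?thesis using r(1) by (intro exI[of _ x]) simp
qed

lemma inj_on_Phi: "inj_on (Phi \<phi>) {0<..}"
proof (rule linorder_inj_onI)
  fix r s :: real assume "r < s" "r \<in> {0<..}" "s \<in> {0<..}"
  then show "Phi \<phi> r \<noteq> Phi \<phi> s"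
    unfolding Phi_def using phi_strict_mono[of "r\<^sup>2" "s\<^sup>2"] by (simp add: power_strict_mono)
qed auto

lemma Phi_inv: assumes "0 < y" shows "0 < Phi_inv \<phi> y" "Phi \<phi> (Phi_inv \<phi> y) = y"
proof -
  have "y \<in> Phi \<phi> ` {0<..}" using Phi_surj[OF assms] by force
  from f_the_inv_into_f[OF inj_on_Phi this] the_inv_into_into[OF inj_on_Phi this subset_refl]
  show "0 < Phi_inv \<phi> y" "Phi \<phi> (Phi_inv \<phi> y) = y" by (auto simp: Phi_inv_def)
qed

lemma Phi_inv_mono: assumes "0 < y" "y \<le> z" shows "Phi_inv \<phi> y \<le> Phi_inv \<phi> z"
proof (rule ccontr)
  assume less: "\<not> Phi_inv \<phi> y \<le> Phi_inv \<phi> z"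
  have z: "0 < z" using assms by simp
  have "Phi \<phi> (Phi_inv \<phi> z) < Phi \<phi> (Phi_inv \<phi> y)"
    unfolding Phi_def using less Phi_inv(1)[OF z] by (intro phi_strict_mono power_strict_mono) auto
  then show False using Phi_inv(2)[OF z] Phi_inv(2)[OF assms(1)] assms by simp
qed

text \<open>
  The spatial scale of time \<open>t\<close>. The majorant \<open>\<rho>\<close> depends on \<open>t\<close> and \<open>x\<close> only through \<open>radius t + norm x\<close>,
  so its properties are those of the function \<open>profile\<close> of one real variable.
\<close>

definition radius :: "real \<Rightarrow> real" where "radius t = 1 / Phi_inv \<phi> (1 / t)"

lemma radius_pos: "0 < t \<Longrightarrow> 0 < radius t"
  by (simp add: radius_def Phi_inv)

lemma radius_mono: "0 < s \<Longrightarrow> s \<le> t \<Longrightarrow> radius s \<le> radius t"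
  unfolding radius_def
  by (intro divide_left_mono Phi_inv_mono mult_pos_pos Phi_inv(1)) (auto simp: frac_le)

lemma Phi_radius: "0 < t \<Longrightarrow> Phi \<phi> (1 / radius t) = 1 / t"
  by (simp add: radius_def Phi_inv)

definition profile :: "nat \<Rightarrow> real \<Rightarrow> real" where
  "profile d w = Phi \<phi> (1 / w) * w powr (- real d)"

lemma rho_eq_profile: "rho \<phi> t (x::'a::euclidean_space) = profile DIM('a) (radius t + norm x)"
  by (simp add: rho_def profile_def radius_def Let_def)

lemma profile_pos: "0 < w \<Longrightarrow> 0 < profile d w"
  by (simp add: profile_def Phi_pos)

lemma profile_antimono: assumes "0 < v" "v \<le> w" shows "profile d w \<le> profile d v"
  unfolding profile_def
  using assms by (intro mult_mono Phi_mono powr_mono2') (auto intro!: divide_left_mono less_imp_le[OF Phi_pos])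

lemma profile_half: assumes "0 < w" shows "profile d (w / 2) \<le> 4 * 2 ^ d * profile d w"
proof -
  have "Phi \<phi> (1 / (w / 2)) \<le> 4 * Phi \<phi> (1 / w)" using Phi_double[of "1/w"] assms by simp
  moreover have "(w / 2) powr (- real d) = 2 ^ d * w powr (- real d)"
    using assms by (simp add: powr_divide powr_minus powr_realpow divide_simps)
  ultimately have "profile d (w / 2) \<le> (4 * Phi \<phi> (1 / w)) * (2 ^ d * w powr (- real d))"
    unfolding profile_def using assms by (metis mult_right_mono powr_ge_zero)
  then show ?thesis by (simp add: profile_def mult_ac)
qed

lemma continuous_on_profile: "continuous_on {0<..} (profile d)"
  unfolding profile_def
  by (intro continuous_intros continuous_on_compose2[OF continuous_on_Phi]) auto

lemma rho_pos: "0 < t \<Longrightarrow> 0 < rho \<phi> t (x::'a::euclidean_space)"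
  using radius_pos[of t] by (simp add: rho_eq_profile profile_pos add_pos_nonneg)

lemma rho_antimono: "0 < s \<Longrightarrow> s \<le> t \<Longrightarrow> rho \<phi> t (x::'a::euclidean_space) \<le> rho \<phi> s x"
  unfolding rho_eq_profile using radius_pos[of s] radius_mono[of s t]
  by (intro profile_antimono) (auto intro: add_pos_nonneg)

text \<open>
  Doubling: halving the argument of \<open>profile\<close> costs a constant factor, since \<open>\<Phi> (2 r) \<le> 4 \<Phi> r\<close>.
\<close>

lemma rho_le_of_half_le:
  fixes x y :: "'a::euclidean_space"
  assumes "0 < t" "norm x \<le> radius t + 2 * norm y"
  shows "rho \<phi> t y \<le> 4 * 2 ^ DIM('a) * rho \<phi> t x"
proof -
  have w: "0 < radius t + norm x" using radius_pos[of t] assms by (simp add: add_pos_nonneg)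
  have "profile DIM('a) (radius t + norm y) \<le> profile DIM('a) ((radius t + norm x) / 2)"
    using w assms by (intro profile_antimono) auto
  also have "\<dots> \<le> 4 * 2 ^ DIM('a) * profile DIM('a) (radius t + norm x)" by (rule profile_half[OF w])
  finally show ?thesis by (simp add: rho_eq_profile)
qed

lemma rho_le_profile: "0 < t \<Longrightarrow> 0 < r \<Longrightarrow> r \<le> norm x \<Longrightarrow> rho \<phi> t (x::'a::euclidean_space) \<le> profile DIM('a) r"
  unfolding rho_eq_profile using radius_pos[of t] by (intro profile_antimono) auto

lemma rho_le_at_0: "0 < t \<Longrightarrow> rho \<phi> t (x::'a::euclidean_space) \<le> rho \<phi> t (0::'a)"
  unfolding rho_eq_profile using radius_pos[of t] by (intro profile_antimono) auto

lemma profile_tendsto_0: assumes "0 < d" shows "(profile d \<longlongrightarrow> 0) at_top"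
proof (rule tendsto_sandwich[of "\<lambda>_. 0"])
  show "\<forall>\<^sub>F w in at_top. 0 \<le> profile d w"
    using eventually_gt_at_top[of 0] by eventually_elim (simp add: profile_pos less_imp_le)
  show "\<forall>\<^sub>F w in at_top. profile d w \<le> w powr (- real d)"
    using eventually_ge_at_top[of 1]
  proof eventually_elim
    case (elim w)
    have "Phi \<phi> (1 / w) \<le> 1" using Phi_mono[of "1/w" 1] elim by (simp add: Phi_1)
    then show ?case unfolding profile_def by (metis mult_right_mono mult_1 powr_ge_zero)
  qed
  show "((\<lambda>w. w powr (- real d)) \<longlongrightarrow> 0) at_top"
    by (rule tendsto_neg_powr) (use assms in \<open>auto simp: filterlim_ident\<close>)
qed simp

lemma borel_measurable_rho: assumes "0 < t" shows "rho \<phi> t \<in> borel_measurable (borel :: 'a::euclidean_space measure)"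
proof (rule borel_measurable_continuous_onI)
  show "continuous_on UNIV (rho \<phi> t :: 'a \<Rightarrow> real)"
    unfolding rho_eq_profile[abs_def]
    by (intro continuous_on_compose2[OF continuous_on_profile] continuous_intros)
       (use radius_pos[OF assms] in \<open>auto intro: add_pos_nonneg\<close>)
qed

text \<open>
  On \<open>[1, R]\<close> the scaling condition gives \<open>\<Phi> s \<le> \<Phi> R * (s / R) powr \<delta> / a1\<close>. Hence the integral of \<open>\<Phi> r / r\<close> up to
  \<open>R\<close> is of the order of \<open>\<Phi> R\<close> and not of \<open>\<Phi> R * ln R\<close>. For \<open>R = 1 / radius t\<close>, where \<open>\<Phi> R = 1 / t\<close>, this is what
  bounds the mass of \<open>\<rho>\<^sub>t\<close> by a multiple of \<open>1 / t\<close>.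
\<close>

lemma Phi_quotient_bound:
  assumes R: "0 < R"
  shows "set_integrable lebesgue {0<..<R} (\<lambda>r. Phi \<phi> r / r)"
    and "(LINT r:{0<..<R}|lebesgue. Phi \<phi> r / r) \<le> (LINT r:{0<..<1}|lebesgue. Phi \<phi> r / r) + max 1 (Phi \<phi> R) / (a1 * \<delta>)"
proof -
  let ?f = "\<lambda>r. Phi \<phi> r / r"
  let ?R = "max 1 R"
  define c where "c = Phi \<phi> ?R / (a1 * ?R powr \<delta>)"
  have c: "0 \<le> c" using a1_pos Phi_pos[of ?R] by (simp add: c_def less_imp_le less_max_iff_disj)
  let ?g = "\<lambda>s. c * s powr (\<delta> - 1)"
  have g: "set_integrable lebesgue {1..?R} ?g" and gi: "(LINT s:{1..?R}|lebesgue. ?g s) \<le> max 1 (Phi \<phi> R) / (a1 * \<delta>)"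
  proof -
    have der: "((\<lambda>s. c * (s powr \<delta> / \<delta>)) has_real_derivative ?g x) (at x)" if "1 \<le> x" for x
      using that \<delta>_pos by (auto intro!: derivative_eq_intros)
    have hb: "has_bochner_integral lborel (\<lambda>x. ?g x * indicator {1..?R} x) (c * (?R powr \<delta> / \<delta>) - c * (1 powr \<delta> / \<delta>))"
      by (rule has_bochner_integral_FTC_Icc_nonneg[where F="\<lambda>s. c * (s powr \<delta> / \<delta>)"])
         (use der c in auto)
    then have hb': "has_bochner_integral lebesgue (\<lambda>x. ?g x * indicator {1..?R} x) (c * (?R powr \<delta> / \<delta>) - c * (1 powr \<delta> / \<delta>))"
      by (simp add: has_bochner_integral_iff integrable_completion integral_completion)
    then show "set_integrable lebesgue {1..?R} ?g"
      unfolding set_integrable_def has_bochner_integral_iff by (simp add: mult.commute)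
    have "(LINT s:{1..?R}|lebesgue. ?g s) = c * (?R powr \<delta> / \<delta>) - c * (1 powr \<delta> / \<delta>)"
      using hb' unfolding set_lebesgue_integral_def has_bochner_integral_iff by (simp add: mult.commute)
    also have "\<dots> \<le> c * (?R powr \<delta> / \<delta>)" using c \<delta>_pos by simp
    also have "\<dots> = Phi \<phi> ?R / (a1 * \<delta>)" by (simp add: c_def)
    also have "Phi \<phi> ?R = max 1 (Phi \<phi> R)"
      using Phi_mono[of 1 R] Phi_mono[of R 1] R by (auto simp: Phi_1 max_def)
    finally show "(LINT s:{1..?R}|lebesgue. ?g s) \<le> max 1 (Phi \<phi> R) / (a1 * \<delta>)" .
  qed
  have le: "?f s \<le> ?g s" if "s \<in> {1..?R}" for s
  proof -
    have s: "1 \<le> s" "s \<le> ?R" using that by auto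
    have "a1 * (?R / s) powr \<delta> * Phi \<phi> s \<le> Phi \<phi> (?R / s * s)" using s by (intro scaling) auto
    then have "a1 * ?R powr \<delta> * Phi \<phi> s \<le> Phi \<phi> ?R * s powr \<delta>" using s by (simp add: powr_divide field_simps)
    then have "Phi \<phi> s \<le> c * s powr \<delta>" using a1_pos s by (simp add: c_def field_simps)
    then have "?f s \<le> c * s powr \<delta> / s" using s by (intro divide_right_mono) auto
    then show ?thesis using s by (simp add: powr_diff)
  qed
  have f1: "set_integrable lebesgue {1..?R} ?f"
    unfolding set_integrable_def
  proof (rule Bochner_Integration.integrable_bound[OF g[unfolded set_integrable_def]])
    have "continuous_on {1..?R} ?f" by (intro continuous_intros continuous_on_subset[OF continuous_on_Phi]) auto
    then show "(\<lambda>x. indicator {1..?R} x *\<^sub>R ?f x) \<in> borel_measurable lebesgue"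
      using borel_measurable_continuous_on_indicator[of "{1..?R}" ?f] by (intro measurable_completion) simp
    show "AE x in lebesgue. norm (indicator {1..?R} x *\<^sub>R ?f x) \<le> norm (indicator {1..?R} x *\<^sub>R ?g x)"
      using le Phi_pos c by (intro AE_I2) (auto simp: indicator_def abs_mult less_imp_le abs_of_nonneg)
  qed
  have U: "{0<..<1} \<union> {1..?R} \<supseteq> {0<..<R}" by auto
  have "set_integrable lebesgue ({0<..<1} \<union> {1..?R}) ?f"
    by (rule set_integrable_Un[OF Phi_integral f1]) auto
  then show int: "set_integrable lebesgue {0<..<R} ?f" by (rule set_integrable_subset) (use U in auto)
  have "(LINT r:{0<..<R}|lebesgue. ?f r) \<le> (LINT r:{0<..<1} \<union> {1..?R}|lebesgue. ?f r)"
    unfolding set_lebesgue_integral_def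
  proof (rule integral_mono)
    show "integrable lebesgue (\<lambda>r. indicator {0<..<R} r *\<^sub>R ?f r)" using int by (simp add: set_integrable_def)
    show "integrable lebesgue (\<lambda>r. indicator ({0<..<1} \<union> {1..?R}) r *\<^sub>R ?f r)"
      using set_integrable_Un[OF Phi_integral f1] by (simp add: set_integrable_def)
    show "indicator {0<..<R} r *\<^sub>R ?f r \<le> indicator ({0<..<1} \<union> {1..?R}) r *\<^sub>R ?f r" for r
      using U Phi_pos[of r] by (auto simp: indicator_def)
  qed
  also have "\<dots> = (LINT r:{0<..<1}|lebesgue. ?f r) + (LINT r:{1..?R}|lebesgue. ?f r)"
    by (rule set_integral_Un[OF _ Phi_integral f1]) auto
  also have "(LINT r:{1..?R}|lebesgue. ?f r) \<le> (LINT r:{1..?R}|lebesgue. ?g r)"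
    by (rule set_integral_mono[OF f1 g le])
  also note gi
  finally show "(LINT r:{0<..<R}|lebesgue. ?f r) \<le> (LINT r:{0<..<1}|lebesgue. ?f r) + max 1 (Phi \<phi> R) / (a1 * \<delta>)" by simp
qed

end

section \<open>Integrability of the jump density\<close>

lemma nn_integral_inverse_square_tail:
  "(\<integral>\<^sup>+ u. ennreal (1 / u\<^sup>2) * indicator {1..} u \<partial>lborel) = 1"
proof -
  have "(\<integral>\<^sup>+ u. ennreal (1 / u\<^sup>2) * indicator {1..} u \<partial>lborel) = ennreal (0 - (- (1 / 1)))"
  proof (rule nn_integral_FTC_atLeast[where F="\<lambda>u. - (1 / u)"])
    show "DERIV (\<lambda>u. - (1 / u)) u :> 1 / u\<^sup>2" if "1 \<le> u" for u :: real
      using that by (auto intro!: derivative_eq_intros simp: power2_eq_square)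
    show "((\<lambda>u::real. - (1 / u)) \<longlongrightarrow> 0) at_top"
      using tendsto_minus[OF tendsto_divide_0[OF tendsto_const filterlim_at_top_imp_at_infinity[OF filterlim_ident], of "1::real"]] by simp
  qed auto
  then show ?thesis by simp
qed

lemma gaussian_moment_finite:
  "(\<integral>\<^sup>+ u. ennreal (indicator {0..} u * ((1 + u\<^sup>2) * u ^ k * exp (- (u\<^sup>2 / 4)))) \<partial>lborel) < \<infinity>"
proof -
  let ?N = "k + 4"
  let ?C = "2 * (4 * real ?N) ^ ?N"
  have bound: "(1 + u\<^sup>2) * u ^ k * exp (- (u\<^sup>2 / 4)) \<le> ?C / u\<^sup>2" if u: "1 \<le> u" for u :: real
  proof -
    have "(u\<^sup>2 / (4 * real ?N)) ^ ?N \<le> (1 + (u\<^sup>2 / 4) / real ?N) ^ ?N" by (intro power_mono) auto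
    also have "\<dots> \<le> exp (u\<^sup>2 / 4)"
      by (rule exp_ge_one_plus_x_over_n_power_n) (auto intro: order_trans[of _ 0])
    finally have "u ^ (2 * ?N) / (4 * real ?N) ^ ?N \<le> exp (u\<^sup>2 / 4)"
      by (simp add: power_divide power_mult[symmetric])
    then have e: "exp (- (u\<^sup>2 / 4)) \<le> (4 * real ?N) ^ ?N / u ^ (2 * ?N)"
      using u by (simp add: exp_minus field_simps)
    have "(1 + u\<^sup>2) * u ^ k \<le> (2 * u\<^sup>2) * u ^ k" using u by (intro mult_right_mono) auto
    then have "(1 + u\<^sup>2) * u ^ k * exp (- (u\<^sup>2 / 4)) \<le> (2 * u\<^sup>2) * u ^ k * ((4 * real ?N) ^ ?N / u ^ (2 * ?N))"
      using e u by (intro mult_mono) auto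
    also have "\<dots> = ?C * (u ^ (k + 2) / u ^ (2 * ?N))" by (simp add: power_add power2_eq_square)
    also have "u ^ (k + 2) / u ^ (2 * ?N) \<le> 1 / u\<^sup>2"
    proof -
      have "u ^ (k + 2) * u\<^sup>2 \<le> u ^ (2 * ?N)" unfolding power_add[symmetric] using u by (intro power_increasing) auto
      then show ?thesis using u by (simp add: field_simps)
    qed
    finally show ?thesis by (simp add: mult_left_mono)
  qed
  have "(\<integral>\<^sup>+ u. ennreal (indicator {0..} u * ((1 + u\<^sup>2) * u ^ k * exp (- (u\<^sup>2 / 4)))) \<partial>lborel)
     \<le> (\<integral>\<^sup>+ u. 2 * indicator {0..1} u + ennreal ?C * (ennreal (1 / u\<^sup>2) * indicator {1..} u) \<partial>lborel)"
  proof (rule nn_integral_mono)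
    fix u :: real
    consider "u < 0" | "0 \<le> u" "u < 1" | "1 \<le> u" by linarith
    then show "ennreal (indicator {0..} u * ((1 + u\<^sup>2) * u ^ k * exp (- (u\<^sup>2 / 4))))
      \<le> 2 * indicator {0..1} u + ennreal ?C * (ennreal (1 / u\<^sup>2) * indicator {1..} u)"
    proof cases
      case 2
      have "(1 + u\<^sup>2) * u ^ k * exp (- (u\<^sup>2 / 4)) \<le> 2 * 1 * 1"
        using 2 by (intro mult_mono) (auto simp: power_le_one)
      then have "ennreal ((1 + u\<^sup>2) * u ^ k * exp (- (u\<^sup>2 / 4))) \<le> ennreal 2" by (intro ennreal_leI) simp
      then show ?thesis using 2 by simp
    next
      case 3
      have "ennreal ((1 + u\<^sup>2) * u ^ k * exp (- (u\<^sup>2 / 4))) \<le> ennreal (?C / u\<^sup>2)"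
        by (intro ennreal_leI bound 3)
      also have "\<dots> = ennreal ?C * ennreal (1 / u\<^sup>2)" by (subst ennreal_mult[symmetric]) auto
      finally show ?thesis using 3 by (auto simp: indicator_def intro: order_trans[OF _ le_add2] add_increasing)
    qed simp
  qed
  also have "\<dots> = 2 + ennreal ?C"
    by (subst nn_integral_add) (auto simp: nn_integral_cmult nn_integral_inverse_square_tail)
  also have "\<dots> < \<infinity>" by simp
  finally show ?thesis .
qed

text \<open>
  The substitution \<open>z = sqrt t * u\<close> turns the integral into a Gaussian moment of \<open>min 1 (t * u\<^sup>2)\<close>, which is at
  most a multiple of \<open>min t 1\<close>: the weight for which \<open>\<mu>\<close> has finite mass.
\<close>

lemma nn_integral_gaussian_min:
  "\<exists>K. \<forall>t>0. (\<integral>\<^sup>+ z. ennreal (min 1 ((norm (z::'a::euclidean_space))\<^sup>2) *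
       ((4 * pi * t) powr (- (real DIM('a) / 2)) * exp (- ((norm z)\<^sup>2 / (4 * t))))) \<partial>lborel) \<le> ennreal (K * min t 1)"
proof -
  let ?d = "DIM('a)"
  let ?c = "real ?d * unit_ball_vol ?d * (4 * pi) powr (- (real ?d / 2))"
  define I where "I = (\<integral>\<^sup>+ u. ennreal (indicator {0..} u * ((1 + u\<^sup>2) * u ^ (?d - 1) * exp (- (u\<^sup>2 / 4)))) \<partial>lborel)"
  have I: "I < \<infinity>" unfolding I_def by (rule gaussian_moment_finite)
  have "(\<integral>\<^sup>+ z. ennreal (min 1 ((norm (z::'a))\<^sup>2) *
       ((4 * pi * t) powr (- (real ?d / 2)) * exp (- ((norm z)\<^sup>2 / (4 * t))))) \<partial>lborel) \<le> ennreal (?c * enn2real I * min t 1)"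
    if t: "0 < t" for t
  proof -
    let ?F = "\<lambda>r. ennreal (min 1 (r\<^sup>2) * ((4 * pi * t) powr (- (real ?d / 2)) * exp (- (r\<^sup>2 / (4 * t)))))"
    let ?w = "\<lambda>r. ennreal (indicator {0..} r * (real ?d * unit_ball_vol ?d * r ^ (?d - 1)))"
    have "(\<integral>\<^sup>+ z. ?F (norm (z::'a)) \<partial>lborel) = (\<integral>\<^sup>+ r. ?w r * ?F r \<partial>lborel)"
      by (rule nn_integral_radial) simp
    also have "\<dots> = ennreal (sqrt t) * (\<integral>\<^sup>+ u. ?w (0 + sqrt t * u) * ?F (0 + sqrt t * u) \<partial>lborel)"
      using t by (subst nn_integral_real_affine[of _ "sqrt t" 0]) auto
    also have "\<dots> = (\<integral>\<^sup>+ u. ennreal (sqrt t) * (?w (sqrt t * u) * ?F (sqrt t * u)) \<partial>lborel)"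
      by (subst nn_integral_cmult) auto
    also have "\<dots> \<le> (\<integral>\<^sup>+ u. ennreal (?c * min t 1) * ennreal (indicator {0..} u * ((1 + u\<^sup>2) * u ^ (?d - 1) * exp (- (u\<^sup>2 / 4)))) \<partial>lborel)"
    proof (rule nn_integral_mono)
      fix u :: real
      show "ennreal (sqrt t) * (?w (sqrt t * u) * ?F (sqrt t * u))
        \<le> ennreal (?c * min t 1) * ennreal (indicator {0..} u * ((1 + u\<^sup>2) * u ^ (?d - 1) * exp (- (u\<^sup>2 / 4))))"
      proof (cases "0 \<le> u")
        case False
        then have "sqrt t * u < 0" using t by (simp add: mult_pos_neg)
        then show ?thesis using False by simp
      next
        case True
        have sq: "(sqrt t * u)\<^sup>2 = t * u\<^sup>2" using t by (simp add: power_mult_distrib)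
        have st: "sqrt t * (sqrt t * u) ^ (?d - 1) * (4 * pi * t) powr (- (real ?d / 2)) = u ^ (?d - 1) * (4 * pi) powr (- (real ?d / 2))"
        proof -
          have "sqrt t * (sqrt t) ^ (?d - 1) = sqrt t ^ ?d" by (metis power_minus_mult DIM_positive mult.commute)
          also have "\<dots> = t powr (real ?d / 2)" using t by (simp add: powr_half_sqrt[symmetric] powr_realpow[symmetric] powr_powr)
          finally have "sqrt t * (sqrt t) ^ (?d - 1) * t powr (- (real ?d / 2)) = 1"
            using t by (simp add: powr_minus)
          then show ?thesis using t by (simp add: powr_mult power_mult_distrib mult_ac)
        qed
        have m: "min 1 (t * u\<^sup>2) \<le> min t 1 * (1 + u\<^sup>2)"
        proof (cases "t \<le> 1")
          case True
          have "min 1 (t * u\<^sup>2) \<le> t * u\<^sup>2" by simp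
          also have "\<dots> \<le> t * (1 + u\<^sup>2)" using t by (intro mult_left_mono) auto
          finally show ?thesis using True by simp
        next
          case False
          have "min 1 (t * u\<^sup>2) \<le> 1" by simp
          also have "1 \<le> 1 + u\<^sup>2" by simp
          finally show ?thesis using False by simp
        qed
        have "ennreal (sqrt t) * (?w (sqrt t * u) * ?F (sqrt t * u))
          = ennreal (sqrt t * ((real ?d * unit_ball_vol ?d * (sqrt t * u) ^ (?d - 1)) *
             (min 1 (t * u\<^sup>2) * ((4 * pi * t) powr (- (real ?d / 2)) * exp (- (u\<^sup>2 / 4))))))"
          using True t by (simp add: sq ennreal_mult[symmetric])
        also have "sqrt t * ((real ?d * unit_ball_vol ?d * (sqrt t * u) ^ (?d - 1)) *
             (min 1 (t * u\<^sup>2) * ((4 * pi * t) powr (- (real ?d / 2)) * exp (- (u\<^sup>2 / 4)))))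
          = (sqrt t * (sqrt t * u) ^ (?d - 1) * (4 * pi * t) powr (- (real ?d / 2))) * (real ?d * unit_ball_vol ?d * min 1 (t * u\<^sup>2) * exp (- (u\<^sup>2 / 4)))"
          by (simp add: mult_ac)
        also have "\<dots> = ?c * (u ^ (?d - 1) * exp (- (u\<^sup>2 / 4))) * min 1 (t * u\<^sup>2)" unfolding st by (simp add: mult_ac)
        also have "\<dots> \<le> ?c * (u ^ (?d - 1) * exp (- (u\<^sup>2 / 4))) * (min t 1 * (1 + u\<^sup>2))"
          using True by (intro mult_left_mono m) auto
        also have "\<dots> = (?c * min t 1) * ((1 + u\<^sup>2) * u ^ (?d - 1) * exp (- (u\<^sup>2 / 4)))" by (simp add: mult_ac)
        also have "ennreal \<dots> = ennreal (?c * min t 1) * ennreal (indicator {0..} u * ((1 + u\<^sup>2) * u ^ (?d - 1) * exp (- (u\<^sup>2 / 4))))"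
          using True t by (subst ennreal_mult) (auto intro!: mult_nonneg_nonneg)
        finally show ?thesis by (simp add: ennreal_leI)
      qed
    qed
    also have "\<dots> = ennreal (?c * min t 1) * I" unfolding I_def by (subst nn_integral_cmult) auto
    also have "\<dots> = ennreal (?c * min t 1) * ennreal (enn2real I)" using I by simp
    also have "\<dots> = ennreal ((?c * min t 1) * enn2real I)"
      using t by (intro ennreal_mult[symmetric]) (auto intro!: mult_nonneg_nonneg)
    also have "(?c * min t 1) * enn2real I = ?c * enn2real I * min t 1" by simp
    finally show ?thesis .
  qed
  then show ?thesis by (intro exI[of _ "?c * enn2real I"] allI impI)
qed

context bernstein begin

lemma levy_density_integrable:
  "\<exists>K. (\<integral>\<^sup>+ z. ennreal (min 1 ((norm (z::'a::euclidean_space))\<^sup>2) * levy_density DIM('a) \<mu> (norm z)) \<partial>lborel) \<le> ennreal K"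
proof -
  interpret sigma_finite_measure \<mu> by (rule sigma_finite_mu)
  interpret pair_sigma_finite \<mu> "lborel :: 'a measure" ..
  let ?G = "\<lambda>t z. (4 * pi * t) powr (- (real DIM('a) / 2)) * exp (- ((norm (z::'a))\<^sup>2 / (4 * t)))"
  let ?H = "\<lambda>t z. ennreal (min 1 ((norm (z::'a))\<^sup>2) * ?G t z)"
  obtain K where K: "\<And>t. 0 < t \<Longrightarrow> (\<integral>\<^sup>+ z. ?H t z \<partial>lborel) \<le> ennreal (K * min t 1)"
    using nn_integral_gaussian_min[where 'a='a] by auto
  have id: "(\<lambda>t. t) \<in> borel_measurable \<mu>" by (rule borel_measurable_mu) simp
  have [measurable]: "fst \<in> borel_measurable (\<mu> \<Otimes>\<^sub>M (lborel :: 'a measure))"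
    by (rule measurable_compose[OF measurable_fst id])
  have meas: "(\<lambda>(t, z). ?H t z) \<in> borel_measurable (\<mu> \<Otimes>\<^sub>M lborel)"
    unfolding case_prod_beta by measurable
  have "(\<integral>\<^sup>+ z. ennreal (min 1 ((norm (z::'a))\<^sup>2) * levy_density DIM('a) \<mu> (norm z)) \<partial>lborel)
      \<le> (\<integral>\<^sup>+ z. (\<integral>\<^sup>+ t. ?H t z \<partial>\<mu>) \<partial>lborel)"
  proof (rule nn_integral_mono)
    fix z :: 'a
    have "levy_density DIM('a) \<mu> (norm z) = (LINT t|\<mu>. ?G t z)" by (simp add: levy_density_def)
    then have eq: "min 1 ((norm z)\<^sup>2) * levy_density DIM('a) \<mu> (norm z) = (LINT t|\<mu>. min 1 ((norm z)\<^sup>2) * ?G t z)" by simp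
    show "ennreal (min 1 ((norm z)\<^sup>2) * levy_density DIM('a) \<mu> (norm z)) \<le> (\<integral>\<^sup>+ t. ?H t z \<partial>\<mu>)"
    proof (cases "integrable \<mu> (\<lambda>t. min 1 ((norm z)\<^sup>2) * ?G t z)")
      case True
      have "(\<integral>\<^sup>+ t. ?H t z \<partial>\<mu>) = ennreal (LINT t|\<mu>. min 1 ((norm z)\<^sup>2) * ?G t z)"
        by (rule nn_integral_eq_integral[OF True]) auto
      then show ?thesis by (simp only: eq order_refl)
    next
      case False
      from not_integrable_integral_eq[OF this] show ?thesis by (simp only: eq ennreal_0 zero_le)
    qed
  qed
  also have "\<dots> = (\<integral>\<^sup>+ t. (\<integral>\<^sup>+ z. ?H t z \<partial>lborel) \<partial>\<mu>)" using Fubini'[where f="?H", OF meas] by (simp only:)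
  also have "\<dots> \<le> (\<integral>\<^sup>+ t. ennreal (\<bar>K\<bar> * min t 1) \<partial>\<mu>)"
  proof (rule nn_integral_mono)
    fix t assume "t \<in> space \<mu>"
    then have t: "0 < t" by (simp add: space_mu)
    have "(\<integral>\<^sup>+ z. ?H t z \<partial>lborel) \<le> ennreal (K * min t 1)" by (rule K[OF t])
    also have "\<dots> \<le> ennreal (\<bar>K\<bar> * min t 1)" using t by (intro ennreal_leI mult_right_mono) auto
    finally show "(\<integral>\<^sup>+ z. ?H t z \<partial>lborel) \<le> ennreal (\<bar>K\<bar> * min t 1)" .
  qed
  also have "\<dots> = ennreal (LINT t|\<mu>. \<bar>K\<bar> * min t 1)"
    by (rule nn_integral_eq_integral) (auto intro!: AE_I2 integrable_min simp: space_mu)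
  finally show ?thesis by blast
qed

end

context scaled_bernstein begin

section \<open>The mass of \<open>\<rho>\<close>\<close>

text \<open>
  The substitution \<open>s = 1 / (a + r)\<close>, for which \<open>dr / (a + r) = - ds / s\<close>.
\<close>

lemma Phi_quotient_substitution:
  assumes a: "0 < a" and m: "0 \<le> m"
  shows "set_integrable lebesgue {m<..} (\<lambda>r. Phi \<phi> (1 / (a + r)) / (a + r))"
    and "(LINT r:{m<..}|lebesgue. Phi \<phi> (1 / (a + r)) / (a + r)) = (LINT s:{0<..<1 / (a + m)}|lebesgue. Phi \<phi> s / s)"
proof -
  let ?g = "\<lambda>r. 1 / (a + r)" and ?g' = "\<lambda>r. - (1 / (a + r)\<^sup>2)" and ?f = "\<lambda>s. Phi \<phi> s / s"
  have der: "(?g has_field_derivative ?g' r) (at r within {m<..})" if "r \<in> {m<..}" for r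
    using that a m by (auto intro!: derivative_eq_intros simp: power2_eq_square)
  have inj: "inj_on ?g {m<..}" using a m by (auto intro!: inj_onI)
  have im: "?g ` {m<..} = {0<..<1 / (a + m)}"
  proof (intro equalityI subsetI)
    fix s assume "s \<in> {0<..<1 / (a + m)}"
    then have s: "0 < s" "s < 1 / (a + m)" by auto
    have "s * (a + m) < 1" using s a m by (simp add: field_simps)
    then have "m < 1 / s - a" using s by (simp add: field_simps)
    moreover have "s = ?g (1 / s - a)" using s by simp
    ultimately show "s \<in> ?g ` {m<..}" by blast
  qed (use a m in \<open>auto simp: frac_less2\<close>)
  have R: "0 < 1 / (a + m)" using a m by simp
  note int = Phi_quotient_bound(1)[OF R]
  have eq: "\<bar>?g' r\<bar> * ?f (?g r) = Phi \<phi> (1 / (a + r)) / (a + r)" if "r \<in> {m<..}" for r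
  proof -
    have "0 < a + r" using that a m by simp
    then show ?thesis by (simp add: power2_eq_square)
  qed
  have cv: "(\<lambda>r. \<bar>?g' r\<bar> * ?f (?g r)) absolutely_integrable_on {m<..} \<and>
    integral {m<..} (\<lambda>r. \<bar>?g' r\<bar> * ?f (?g r)) = integral {0<..<1 / (a + m)} ?f"
    using has_absolute_integral_change_of_variables_1'[where S="{m<..}" and g="?g" and g'="?g'" and f="?f" and b="integral {0<..<1 / (a + m)} ?f", OF _ der inj] int
    unfolding im by simp
  have "(\<lambda>r. \<bar>?g' r\<bar> * ?f (?g r)) absolutely_integrable_on {m<..}" using cv by blast
  moreover have "(\<lambda>r. \<bar>?g' r\<bar> * ?f (?g r)) absolutely_integrable_on {m<..} \<longleftrightarrow>
      set_integrable lebesgue {m<..} (\<lambda>r. Phi \<phi> (1 / (a + r)) / (a + r))"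
    by (rule set_integrable_cong) (simp_all only: eq)
  ultimately show i: "set_integrable lebesgue {m<..} (\<lambda>r. Phi \<phi> (1 / (a + r)) / (a + r))" by blast
  have "(LINT r:{m<..}|lebesgue. Phi \<phi> (1 / (a + r)) / (a + r)) = integral {m<..} (\<lambda>r. Phi \<phi> (1 / (a + r)) / (a + r))"
    by (rule set_lebesgue_integral_eq_integral(2)[OF i])
  also have "\<dots> = integral {m<..} (\<lambda>r. \<bar>?g' r\<bar> * ?f (?g r))"
    by (rule Henstock_Kurzweil_Integration.integral_cong) (simp only: eq)
  also have "\<dots> = integral {0<..<1 / (a + m)} ?f" using cv by blast
  also have "\<dots> = (LINT s:{0<..<1 / (a + m)}|lebesgue. ?f s)"
    by (rule set_lebesgue_integral_eq_integral(2)[OF int, symmetric])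
  finally show "(LINT r:{m<..}|lebesgue. Phi \<phi> (1 / (a + r)) / (a + r)) = (LINT s:{0<..<1 / (a + m)}|lebesgue. Phi \<phi> s / s)" .
qed

text \<open>
  In polar coordinates the factor \<open>r ^ (d - 1)\<close> is absorbed by \<open>(a + r) powr (- d)\<close>, with \<open>a = radius t\<close>, up to one
  power. What remains is the integrand of \<open>Phi_quotient_substitution\<close>.
\<close>

lemma nn_integral_rho_le:
  assumes t: "0 < t" and m: "0 \<le> m"
  shows "(\<integral>\<^sup>+ x. ennreal (rho \<phi> t (x::'a::euclidean_space)) * indicator {x. m \<le> norm x} x \<partial>lborel)
     \<le> ennreal (real DIM('a) * unit_ball_vol DIM('a) * (LINT r:{0<..<1 / (radius t + m)}|lebesgue. Phi \<phi> r / r))"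
proof -
  let ?d = "DIM('a)" and ?a = "radius t"
  let ?c = "real ?d * unit_ball_vol ?d"
  have a: "0 < ?a" by (rule radius_pos[OF t])
  let ?h = "\<lambda>r. Phi \<phi> (1 / (?a + r)) / (?a + r)"
  let ?F = "\<lambda>r. ennreal (indicator {0..} r * profile ?d (?a + r)) * indicator {m..} r"
  have [measurable]: "(\<lambda>r. indicator {0..} r * profile ?d (?a + r)) \<in> borel_measurable borel"
  proof -
    have "continuous_on {0..} (\<lambda>r. profile ?d (?a + r))"
      by (intro continuous_on_compose2[OF continuous_on_profile] continuous_intros) (use a in auto)
    then show ?thesis using borel_measurable_continuous_on_indicator[of "{0..}" "\<lambda>r. profile ?d (?a + r)"] by simp
  qed
  have "(\<integral>\<^sup>+ x. ennreal (rho \<phi> t (x::'a)) * indicator {x. m \<le> norm x} x \<partial>lborel) = (\<integral>\<^sup>+ x. ?F (norm (x::'a)) \<partial>lborel)"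
    by (intro nn_integral_cong) (simp add: rho_eq_profile indicator_def)
  also have "\<dots> = (\<integral>\<^sup>+ r. ennreal (indicator {0..} r * (?c * r ^ (?d - 1))) * ?F r \<partial>lborel)"
    by (rule nn_integral_radial) measurable
  also have "\<dots> \<le> (\<integral>\<^sup>+ r. ennreal ?c * ennreal (indicator {m<..} r *\<^sub>R ?h r) \<partial>lborel)"
  proof (rule nn_integral_mono_AE)
    have "AE r in lborel. r \<noteq> m" by (rule AE_lborel_singleton)
    then show "AE r in lborel. ennreal (indicator {0..} r * (?c * r ^ (?d - 1))) * ?F r
        \<le> ennreal ?c * ennreal (indicator {m<..} r *\<^sub>R ?h r)"
    proof eventually_elim
      case (elim r)
      show ?case
      proof (cases "m < r")
        case False
        then show ?thesis using elim by (simp add: indicator_def)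
      next
        case True
        then have r: "0 < r" using m by simp
        have w: "0 < ?a + r" using a r by simp
        have "r ^ (?d - 1) * (?a + r) powr (- real ?d) \<le> (?a + r) ^ (?d - 1) * (?a + r) powr (- real ?d)"
          using a r by (intro mult_right_mono power_mono) auto
        also have "\<dots> = (?a + r) powr (real (?d - 1) - real ?d)" using w by (simp add: powr_realpow[symmetric] powr_add[symmetric])
        also have "real (?d - 1) - real ?d = - 1" using DIM_positive[where 'a='a] by (simp add: of_nat_diff)
        also have "(?a + r) powr (- 1) = 1 / (?a + r)" using w by (simp add: powr_minus_divide)
        finally have k: "r ^ (?d - 1) * (?a + r) powr (- real ?d) \<le> 1 / (?a + r)" .
        have "ennreal (indicator {0..} r * (?c * r ^ (?d - 1))) * ?F r = ennreal (?c * (Phi \<phi> (1 / (?a + r)) * (r ^ (?d - 1) * (?a + r) powr (- real ?d))))"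
          using True r w by (simp add: profile_def ennreal_mult[symmetric] Phi_pos less_imp_le mult_ac)
        also have "\<dots> \<le> ennreal (?c * (Phi \<phi> (1 / (?a + r)) * (1 / (?a + r))))"
          using k w Phi_pos by (intro ennreal_leI mult_left_mono) (auto simp: less_imp_le)
        also have "\<dots> = ennreal ?c * ennreal (indicator {m<..} r *\<^sub>R ?h r)"
          using True w Phi_pos[of "1 / (?a + r)"] by (subst ennreal_mult[symmetric]) (auto simp: less_imp_le)
        finally show ?thesis .
      qed
    qed
  qed
  also have "\<dots> = (\<integral>\<^sup>+ r. ennreal (?c * (indicator {m<..} r *\<^sub>R ?h r)) \<partial>lebesgue)"
    unfolding nn_integral_completion using a m Phi_pos
    by (intro nn_integral_cong ennreal_mult[symmetric]) (auto simp: indicator_def less_imp_le)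
  also have "\<dots> = ennreal (LINT r|lebesgue. ?c * (indicator {m<..} r *\<^sub>R ?h r))"
  proof (rule nn_integral_eq_integral)
    show "integrable lebesgue (\<lambda>r. ?c * (indicator {m<..} r *\<^sub>R ?h r))"
      using Phi_quotient_substitution(1)[OF a m] unfolding set_integrable_def by (rule Bochner_Integration.integrable_mult_right)
    show "AE r in lebesgue. 0 \<le> ?c * (indicator {m<..} r *\<^sub>R ?h r)"
      using a m Phi_pos by (intro AE_I2) (auto simp: indicator_def less_imp_le)
  qed
  also have "(LINT r|lebesgue. ?c * (indicator {m<..} r *\<^sub>R ?h r)) = ?c * (LINT r:{m<..}|lebesgue. ?h r)"
    unfolding set_lebesgue_integral_def by (rule integral_mult_right_zero)
  also note Phi_quotient_substitution(2)[OF a m]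
  finally show ?thesis .
qed

lemma nn_integral_rho:
  "\<exists>M>0. \<forall>T>0. \<forall>t\<in>{0<..T}. (\<integral>\<^sup>+ x. ennreal (rho \<phi> t (x::'a::euclidean_space)) \<partial>lborel) \<le> ennreal (M * (T + 1) / t)"
proof -
  let ?c = "real DIM('a) * unit_ball_vol DIM('a)" and ?I = "(LINT r:{0<..<1}|lebesgue. Phi \<phi> r / r)"
  have I: "0 \<le> ?I" unfolding set_lebesgue_integral_def
    by (rule integral_nonneg_AE, rule AE_I2) (auto simp: indicator_def Phi_pos less_imp_le)
  define M where "M = ?c * (?I + 1 / (a1 * \<delta>))"
  have ad: "0 < 1 / (a1 * \<delta>)" using a1_pos \<delta>_pos by simp
  have M: "0 < M" unfolding M_def using I ad by (intro mult_pos_pos add_nonneg_pos) auto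
  have "(\<integral>\<^sup>+ x. ennreal (rho \<phi> t (x::'a)) \<partial>lborel) \<le> ennreal (M * (T + 1) / t)" if t: "0 < t" "t \<le> T" for t T
  proof -
    have R: "0 < 1 / (radius t + 0)" using radius_pos[OF t(1)] by simp
    have "(\<integral>\<^sup>+ x. ennreal (rho \<phi> t (x::'a)) \<partial>lborel) \<le> ennreal (?c * (LINT r:{0<..<1 / (radius t + 0)}|lebesgue. Phi \<phi> r / r))"
      using nn_integral_rho_le[OF t(1), of 0, where 'a='a] by simp
    also have "\<dots> \<le> ennreal (?c * (?I + max 1 (Phi \<phi> (1 / (radius t + 0))) / (a1 * \<delta>)))"
      by (intro ennreal_leI mult_left_mono Phi_quotient_bound(2)[OF R]) auto
    also have "Phi \<phi> (1 / (radius t + 0)) = 1 / t" using Phi_radius[OF t(1)] by simp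
    also have "?c * (?I + max 1 (1 / t) / (a1 * \<delta>)) \<le> M * (T + 1) / t"
    proof -
      have 1: "1 \<le> (T + 1) / t" using t by (simp add: field_simps)
      have 2: "max 1 (1 / t) \<le> (T + 1) / t" using 1 t by (auto simp: divide_right_mono)
      have "?I + max 1 (1 / t) / (a1 * \<delta>) = ?I * 1 + 1 / (a1 * \<delta>) * max 1 (1 / t)" by simp
      also have "\<dots> \<le> ?I * ((T + 1) / t) + 1 / (a1 * \<delta>) * ((T + 1) / t)"
        using I ad 1 2 by (intro add_mono mult_left_mono) auto
      also have "\<dots> = (?I + 1 / (a1 * \<delta>)) * ((T + 1) / t)" by (simp only: distrib_right)
      finally have "?c * (?I + max 1 (1 / t) / (a1 * \<delta>)) \<le> ?c * ((?I + 1 / (a1 * \<delta>)) * ((T + 1) / t))"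
        by (intro mult_left_mono) auto
      then show ?thesis by (simp only: M_def mult.assoc times_divide_eq_right)
    qed
    finally show ?thesis by (simp add: ennreal_leI)
  qed
  then show ?thesis using M by (intro exI[of _ M]) auto
qed

text \<open>
  Away from the origin the mass of \<open>\<rho>\<^sub>t\<close> does not blow up as \<open>t\<close> tends to zero. Together with the factor \<open>t\<close> in
  the bound for \<open>p\<close> this makes the mass that the heat kernel transports over distance one vanish.
\<close>

lemma nn_integral_rho_tail:
  assumes t: "0 < t"
  shows "(\<integral>\<^sup>+ x. ennreal (rho \<phi> t (x::'a::euclidean_space)) * indicator {x. 1 \<le> norm x} x \<partial>lborel)
     \<le> ennreal (real DIM('a) * unit_ball_vol DIM('a) * (LINT r:{0<..<1}|lebesgue. Phi \<phi> r / r))"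
proof -
  have R: "1 / (radius t + 1) \<le> 1" using radius_pos[OF t] by simp
  have "(LINT r:{0<..<1 / (radius t + 1)}|lebesgue. Phi \<phi> r / r) \<le> (LINT r:{0<..<1}|lebesgue. Phi \<phi> r / r)"
    unfolding set_lebesgue_integral_def
  proof (rule integral_mono)
    show "integrable lebesgue (\<lambda>r. indicator {0<..<1 / (radius t + 1)} r *\<^sub>R (Phi \<phi> r / r))"
      using Phi_quotient_bound(1)[of "1 / (radius t + 1)"] radius_pos[OF t] by (simp add: set_integrable_def)
    show "integrable lebesgue (\<lambda>r. indicator {0<..<1} r *\<^sub>R (Phi \<phi> r / r))"
      using Phi_integral by (simp add: set_integrable_def)
    show "indicator {0<..<1 / (radius t + 1)} r *\<^sub>R (Phi \<phi> r / r) \<le> indicator {0<..<1} r *\<^sub>R (Phi \<phi> r / r)" for r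
      using R Phi_pos[of r] by (auto simp: indicator_def)
  qed
  then show ?thesis using nn_integral_rho_le[OF t, of 1, where 'a='a]
    by (auto elim!: order_trans intro!: ennreal_leI mult_left_mono)
qed

end

section \<open>The nonlocal operator\<close>

lemma distr_lebesgue_uminus: "distr lebesgue lebesgue uminus = (lebesgue :: 'a::euclidean_space measure)"
proof -
  have T: "(\<lambda>x::'a. 0 + (\<Sum>j\<in>Basis. ((- 1) * (x \<bullet> j)) *\<^sub>R j)) = uminus"
    by (rule ext) (simp add: sum_negf euclidean_representation)
  show ?thesis
    using lebesgue_affine_euclidean[of "\<lambda>_::'a. -1" 0] unfolding T by (simp add: density_1)
qed

lemma measurable_uminus_lebesgue: "uminus \<in> (lebesgue :: 'a::euclidean_space measure) \<rightarrow>\<^sub>M lebesgue"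
proof -
  have T: "(\<lambda>x::'a. 0 + (\<Sum>j\<in>Basis. ((- 1) * (x \<bullet> j)) *\<^sub>R j)) = uminus"
    by (rule ext) (simp add: sum_negf euclidean_representation)
  show ?thesis using lebesgue_affine_measurable[of "\<lambda>_::'a. -1" 0] unfolding T by simp
qed

lemma integral_lebesgue_reflect:
  fixes g :: "'a::euclidean_space \<Rightarrow> real"
  assumes "integrable lebesgue g"
  shows "integrable lebesgue (\<lambda>z. g (- z))" "(LINT z|lebesgue. g (- z)) = (LINT z|lebesgue. g z)"
proof -
  have g: "g \<in> borel_measurable lebesgue" using assms by simp
  show "integrable lebesgue (\<lambda>z. g (- z))"
    using assms by (subst (asm) distr_lebesgue_uminus[symmetric], subst (asm) integrable_distr_eq)
      (auto simp: measurable_uminus_lebesgue g)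
  show "(LINT z|lebesgue. g (- z)) = (LINT z|lebesgue. g z)"
    using integral_distr[OF measurable_uminus_lebesgue g] by (simp add: distr_lebesgue_uminus)
qed

lemma tendsto_integral_at_right:
  fixes f :: "real \<Rightarrow> 'b \<Rightarrow> 'c::{banach,second_countable_topology}"
  assumes meas: "f0 \<in> borel_measurable M" "\<And>e. 0 < e \<Longrightarrow> e < r \<Longrightarrow> f e \<in> borel_measurable M"
    and w: "integrable M w" and r: "0 < r"
    and lim: "AE y in M. ((\<lambda>e. f e y) \<longlongrightarrow> f0 y) (at_right 0)"
    and bound: "\<And>e. 0 < e \<Longrightarrow> e < r \<Longrightarrow> AE y in M. norm (f e y) \<le> w y"
  shows "((\<lambda>e. integral\<^sup>L M (f e)) \<longlongrightarrow> integral\<^sup>L M f0) (at_right 0)"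
proof (subst tendsto_at_iff_sequentially, intro allI impI)
  fix X :: "nat \<Rightarrow> real" assume X: "\<forall>i. X i \<in> {0<..} - {0}" and l: "X \<longlonglongrightarrow> 0"
  have "\<forall>\<^sub>F i in sequentially. X i < r" using order_tendstoD(2)[OF l r] .
  then obtain N where N: "\<And>n. n \<ge> N \<Longrightarrow> X n < r" by (auto simp: eventually_sequentially)
  have "(\<lambda>n. integral\<^sup>L M (f (X (n + N)))) \<longlonglongrightarrow> integral\<^sup>L M f0"
  proof (rule integral_dominated_convergence[where w=w])
    show "AE y in M. (\<lambda>n. f (X (n + N)) y) \<longlonglongrightarrow> f0 y"
      using lim
    proof eventually_elim
      case (elim y)
      then have "((\<lambda>e. f e y) \<circ> X) \<longlonglongrightarrow> f0 y" using X l unfolding tendsto_at_iff_sequentially by blast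
      then show ?case unfolding o_def by (rule LIMSEQ_ignore_initial_segment)
    qed
  qed (use X N meas w bound in auto)
  then show "((\<lambda>e. integral\<^sup>L M (f e)) \<circ> X) \<longlonglongrightarrow> integral\<^sup>L M f0" unfolding o_def by (rule LIMSEQ_offset)
qed

lemma borel_measurable_borel_lebesgue: "g \<in> borel_measurable borel \<Longrightarrow> g \<in> borel_measurable lebesgue"
  by (rule measurable_completion) simp

locale jump_operator =
  fixes J :: "'a::euclidean_space \<Rightarrow> real" and \<kappa> :: "'a \<Rightarrow> 'a \<Rightarrow> real" and \<kappa>\<^sub>1 :: real
  assumes J_measurable: "J \<in> borel_measurable lebesgue"
    and J_pos: "\<And>z. 0 < J z" and J_symmetric: "\<And>z. J z = J (- z)"
    and J_finite: "(\<integral>\<^sup>+ z. ennreal (min 1 ((norm z)\<^sup>2) * J z) \<partial>lebesgue) < \<infinity>"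
    and \<kappa>_measurable: "(\<lambda>(x, z). \<kappa> x z) \<in> borel_measurable borel"
    and \<kappa>_bounds: "\<And>x z. 0 \<le> \<kappa> x z \<and> \<kappa> x z \<le> \<kappa>\<^sub>1" and \<kappa>_symmetric: "\<And>x z. \<kappa> x z = \<kappa> x (- z)"
begin

definition jump_weight :: "'a \<Rightarrow> real" where "jump_weight z = min 1 ((norm z)\<^sup>2) * J z"
definition jump_mass :: real where "jump_mass = (LINT z|lebesgue. jump_weight z)"

lemma jump_weight_nonneg: "0 \<le> jump_weight z"
  using J_pos[of z] by (simp add: jump_weight_def)

lemma integrable_jump_weight: "integrable lebesgue jump_weight"
proof (rule integrableI_bounded)
  have "(\<lambda>z::'a. min 1 ((norm z)\<^sup>2)) \<in> borel_measurable lebesgue" by (rule borel_measurable_borel_lebesgue) simp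
  then show "jump_weight \<in> borel_measurable lebesgue" unfolding jump_weight_def[abs_def] by (intro borel_measurable_times J_measurable)
  show "(\<integral>\<^sup>+ z. ennreal (norm (jump_weight z)) \<partial>lebesgue) < \<infinity>"
    using J_finite jump_weight_nonneg by (simp add: jump_weight_def)
qed

lemma \<kappa>\<^sub>1_nonneg: "0 \<le> \<kappa>\<^sub>1"
  using \<kappa>_bounds[of 0 0] by linarith

lemma \<kappa>_measurable_right: "\<kappa> x \<in> borel_measurable lebesgue"
proof (rule borel_measurable_borel_lebesgue)
  have "(\<lambda>z. (\<lambda>(x, z). \<kappa> x z) (x, z)) \<in> borel_measurable borel"
    by (rule measurable_compose[OF _ \<kappa>_measurable]) (simp add: borel_measurable_continuous_onI continuous_on_Pair)
  then show "\<kappa> x \<in> borel_measurable borel" by simp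
qed

lemma jump_weight_dominates: assumes "0 < e" "e < norm z" shows "J z \<le> jump_weight z / min 1 (e\<^sup>2)"
proof -
  have "min 1 (e\<^sup>2) * J z \<le> min 1 ((norm z)\<^sup>2) * J z"
    using assms J_pos[of z] by (intro mult_right_mono min.mono power_mono) auto
  then show ?thesis using assms by (simp add: jump_weight_def field_simps)
qed

lemma set_integrable_J: assumes "0 < e" shows "set_integrable lebesgue {z. e < norm z} J"
  unfolding set_integrable_def
proof (rule Bochner_Integration.integrable_bound)
  show "integrable lebesgue (\<lambda>z. jump_weight z / min 1 (e\<^sup>2))" using integrable_jump_weight by simp
  have "(\<lambda>z::'a. indicator {z. e < norm z} z :: real) \<in> borel_measurable lebesgue"
    by (rule borel_measurable_borel_lebesgue) simp
  then show "(\<lambda>z. indicator {z. e < norm z} z *\<^sub>R J z) \<in> borel_measurable lebesgue" using J_measurable by simp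
  show "AE z in lebesgue. norm (indicator {z. e < norm z} z *\<^sub>R J z) \<le> norm (jump_weight z / min 1 (e\<^sup>2))"
    using jump_weight_dominates[OF assms] J_pos assms jump_weight_nonneg
    by (intro AE_I2) (auto simp: indicator_def less_imp_le abs_of_nonneg)
qed

text \<open>
  The relation "the principal value defining \<open>\<L> f(x)\<close> exists and equals \<open>l\<close>". As a relation it is additive,
  whereas \<open>nonlocal_op\<close> is so only where the limits exist.
\<close>

definition has_gen :: "('a \<Rightarrow> real) \<Rightarrow> 'a \<Rightarrow> real \<Rightarrow> bool" where
  "has_gen f x l \<longleftrightarrow> (\<forall>e>0. set_integrable lebesgue {z. e < norm z} (jump_integrand \<kappa> J f x)) \<and>
     ((\<lambda>e. trunc_op \<kappa> J e f x) \<longlongrightarrow> l) (at_right 0)"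

lemma has_gen_nonlocal_op: "nonlocal_defined \<kappa> J 0 f x \<Longrightarrow> has_gen f x (nonlocal_op \<kappa> J 0 f x)"
  unfolding has_gen_def nonlocal_defined_def nonlocal_op_def
  by (auto intro: tendsto_Lim[THEN ssubst] simp: tendsto_Lim)

lemma has_gen_imp: assumes "has_gen f x l" shows "nonlocal_defined \<kappa> J 0 f x" "nonlocal_op \<kappa> J 0 f x = l"
  using assms unfolding has_gen_def nonlocal_defined_def nonlocal_op_def by (auto simp: tendsto_Lim)

lemma has_gen_add: assumes "has_gen f x l" "has_gen g x m" shows "has_gen (\<lambda>u. f u + g u) x (l + m)"
proof -
  have eq: "jump_integrand \<kappa> J (\<lambda>u. f u + g u) x = (\<lambda>z. jump_integrand \<kappa> J f x z + jump_integrand \<kappa> J g x z)"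
    by (auto simp: jump_integrand_def algebra_simps)
  have int: "set_integrable lebesgue {z. e < norm z} (jump_integrand \<kappa> J (\<lambda>u. f u + g u) x)" if "0 < e" for e
    unfolding eq using assms that by (auto simp: has_gen_def)
  have "((\<lambda>e. trunc_op \<kappa> J e f x + trunc_op \<kappa> J e g x) \<longlongrightarrow> l + m) (at_right 0)"
    using assms by (intro tendsto_add) (auto simp: has_gen_def)
  moreover have "\<forall>\<^sub>F e in at_right 0. trunc_op \<kappa> J e f x + trunc_op \<kappa> J e g x = trunc_op \<kappa> J e (\<lambda>u. f u + g u) x"
    using eventually_at_right_less[of 0]
  proof eventually_elim
    case (elim e)
    then show ?case unfolding trunc_op_def eq using assms by (subst set_integral_add) (auto simp: has_gen_def)
  qed
  ultimately show ?thesis using int by (auto simp: has_gen_def intro: Lim_transform_eventually)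
qed

lemma has_gen_cmult: assumes "has_gen f x l" shows "has_gen (\<lambda>u. c * f u) x (c * l)"
proof -
  have eq: "jump_integrand \<kappa> J (\<lambda>u. c * f u) x = (\<lambda>z. c * jump_integrand \<kappa> J f x z)"
    by (auto simp: jump_integrand_def algebra_simps)
  have "trunc_op \<kappa> J e (\<lambda>u. c * f u) x = c * trunc_op \<kappa> J e f x" for e
    unfolding trunc_op_def eq by simp
  then show ?thesis using assms unfolding has_gen_def eq by (auto intro!: tendsto_mult_left)
qed

lemma has_gen_const: "has_gen (\<lambda>_. c) x 0"
  by (simp add: has_gen_def trunc_op_def jump_integrand_def set_integrable_def set_lebesgue_integral_def)

lemma has_gen_diff: "has_gen f x l \<Longrightarrow> has_gen g x m \<Longrightarrow> has_gen (\<lambda>u. f u - g u) x (l - m)"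
  using has_gen_add[OF _ has_gen_cmult[where c="-1"], of f x l g m] by simp

text \<open>
  All increments of \<open>f\<close> from a maximum point are nonpositive.
\<close>

lemma has_gen_nonpos_at_max: assumes "has_gen f x l" "\<And>u. f u \<le> f x" shows "l \<le> 0"
proof (rule tendsto_upperbound)
  show "((\<lambda>e. trunc_op \<kappa> J e f x) \<longlongrightarrow> l) (at_right 0)" using assms by (simp add: has_gen_def)
  have "jump_integrand \<kappa> J f x z \<le> 0" for z
    using assms(2)[of "x + z"] \<kappa>_bounds[of x z] J_pos[of z]
    by (auto simp: jump_integrand_def intro!: mult_nonpos_nonneg)
  then have "0 \<le> (LINT z|lebesgue. - (indicator {z. e < norm z} z *\<^sub>R jump_integrand \<kappa> J f x z))" for e
    by (intro integral_nonneg_AE AE_I2) (auto simp: indicator_def)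
  then show "\<forall>\<^sub>F e in at_right 0. trunc_op \<kappa> J e f x \<le> 0"
    unfolding trunc_op_def set_lebesgue_integral_def by simp
qed simp

definition second_diff :: "('a \<Rightarrow> real) \<Rightarrow> 'a \<Rightarrow> 'a \<Rightarrow> real" where
  "second_diff f x z = f (x + z) + f (x - z) - 2 * f x"

text \<open>
  Averaging the integral over \<open>z\<close> and \<open>- z\<close>, which the symmetry of \<open>J\<close> and \<open>\<kappa> x\<close> permits, replaces the
  increment of \<open>f\<close> by half its second difference. That one is \<open>O(norm z ^ 2)\<close>, so the principal value becomes an
  absolutely convergent integral.
\<close>

lemma
  assumes f: "f \<in> borel_measurable borel" and B: "\<And>u. \<bar>f u\<bar> \<le> B" and C: "\<And>z. \<bar>second_diff f x z\<bar> \<le> C * (norm z)\<^sup>2"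
  shows integrable_second_diff: "integrable lebesgue (\<lambda>z. second_diff f x z * \<kappa> x z * J z)"
    and has_gen_second_diff: "has_gen f x ((LINT z|lebesgue. second_diff f x z * \<kappa> x z * J z) / 2)"
    and has_gen_second_diff_le: "\<bar>(LINT z|lebesgue. second_diff f x z * \<kappa> x z * J z) / 2\<bar> \<le> max C (4 * B) * \<kappa>\<^sub>1 * jump_mass"
proof -
  let ?s = "\<lambda>z. second_diff f x z * \<kappa> x z * J z"
  let ?K = "max C (4 * B) * \<kappa>\<^sub>1"
  have shift: "(\<lambda>z. f (x + z)) \<in> borel_measurable lebesgue"
    by (rule borel_measurable_borel_lebesgue) (use f in measurable)
  have shift': "(\<lambda>z. f (x - z)) \<in> borel_measurable lebesgue"
    by (rule borel_measurable_borel_lebesgue) (use f in measurable)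
  have B0: "0 \<le> B" using B[of 0] by linarith
  have K0: "0 \<le> max C (4 * B)" using B0 by simp
  have sd: "\<bar>second_diff f x z\<bar> \<le> max C (4 * B) * min 1 ((norm z)\<^sup>2)" for z
  proof (cases "norm z \<le> 1")
    case True
    have "\<bar>second_diff f x z\<bar> \<le> C * (norm z)\<^sup>2" by (rule C)
    also have "\<dots> \<le> max C (4 * B) * (norm z)\<^sup>2" by (intro mult_right_mono) auto
    finally show ?thesis using power_le_one[of "norm z" 2] True by (simp add: min_absorb2)
  next
    case False
    have "\<bar>second_diff f x z\<bar> \<le> 4 * B" using B[of "x+z"] B[of "x-z"] B[of x] unfolding second_diff_def by linarith
    moreover have "1 \<le> (norm z)\<^sup>2" using False by simp
    ultimately show ?thesis by (simp add: min_def)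
  qed
  have bound: "\<bar>?s z\<bar> \<le> ?K * jump_weight z" for z
  proof -
    have "\<bar>?s z\<bar> = \<bar>second_diff f x z\<bar> * \<kappa> x z * J z" using \<kappa>_bounds[of x z] J_pos[of z] by (simp add: abs_mult)
    also have "\<dots> \<le> (max C (4 * B) * min 1 ((norm z)\<^sup>2)) * \<kappa>\<^sub>1 * J z"
      using sd[of z] \<kappa>_bounds[of x z] J_pos[of z] K0 by (intro mult_mono mult_nonneg_nonneg) (auto simp: less_imp_le)
    finally show ?thesis by (simp add: jump_weight_def mult_ac)
  qed
  have meas: "?s \<in> borel_measurable lebesgue"
    unfolding second_diff_def using shift shift' by (intro borel_measurable_times \<kappa>_measurable_right J_measurable) simp
  show int: "integrable lebesgue ?s"
    by (rule Bochner_Integration.integrable_bound[OF Bochner_Integration.integrable_mult_right[OF integrable_jump_weight, of ?K] meas])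
       (use bound \<kappa>\<^sub>1_nonneg K0 jump_weight_nonneg in \<open>auto intro!: AE_I2 simp: abs_of_nonneg\<close>)
  show "\<bar>(LINT z|lebesgue. ?s z) / 2\<bar> \<le> ?K * jump_mass"
  proof -
    have "\<bar>LINT z|lebesgue. ?s z\<bar> \<le> (LINT z|lebesgue. \<bar>?s z\<bar>)" by (rule integral_abs_bound)
    also have "\<dots> \<le> (LINT z|lebesgue. ?K * jump_weight z)"
      by (intro integral_mono bound integrable_abs[OF int] Bochner_Integration.integrable_mult_right integrable_jump_weight)
    finally have "\<bar>LINT z|lebesgue. ?s z\<bar> \<le> ?K * jump_mass" by (simp add: jump_mass_def)
    then show ?thesis by simp
  qed
  have jint: "set_integrable lebesgue {z. e < norm z} (jump_integrand \<kappa> J f x)" if e: "0 < e" for e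
    unfolding set_integrable_def
  proof (rule Bochner_Integration.integrable_bound)
    show "integrable lebesgue (\<lambda>z. (2 * B * \<kappa>\<^sub>1) * (indicator {z. e < norm z} z *\<^sub>R J z))"
      using set_integrable_J[OF e] unfolding set_integrable_def by (rule Bochner_Integration.integrable_mult_right)
    have "(\<lambda>z::'a. indicator {z. e < norm z} z :: real) \<in> borel_measurable lebesgue"
      by (rule borel_measurable_borel_lebesgue) simp
    then show "(\<lambda>z. indicator {z. e < norm z} z *\<^sub>R jump_integrand \<kappa> J f x z) \<in> borel_measurable lebesgue"
      unfolding jump_integrand_def using shift
      by (intro borel_measurable_scaleR borel_measurable_times \<kappa>_measurable_right J_measurable) simp_all
    show "AE z in lebesgue. norm (indicator {z. e < norm z} z *\<^sub>R jump_integrand \<kappa> J f x z)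
       \<le> norm ((2 * B * \<kappa>\<^sub>1) * (indicator {z. e < norm z} z *\<^sub>R J z))"
    proof (rule AE_I2)
      fix z :: 'a
      have "\<bar>f (x + z) - f x\<bar> * \<bar>\<kappa> x z\<bar> * \<bar>J z\<bar> \<le> (2 * B) * \<kappa>\<^sub>1 * \<bar>J z\<bar>"
        using B[of "x+z"] B[of x] \<kappa>_bounds[of x z] B0 by (intro mult_mono mult_nonneg_nonneg) auto
      then show "norm (indicator {z. e < norm z} z *\<^sub>R jump_integrand \<kappa> J f x z)
       \<le> norm ((2 * B * \<kappa>\<^sub>1) * (indicator {z. e < norm z} z *\<^sub>R J z))"
        using B0 \<kappa>\<^sub>1_nonneg by (auto simp: indicator_def jump_integrand_def abs_mult)
    qed
  qed
  have trunc: "trunc_op \<kappa> J e f x = (LINT z|lebesgue. indicator {z. e < norm z} z * ?s z) / 2" if e: "0 < e" for e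
  proof -
    let ?i = "\<lambda>z. indicator {z. e < norm z} z *\<^sub>R jump_integrand \<kappa> J f x z"
    have i: "integrable lebesgue ?i" using jint[OF e] by (simp add: set_integrable_def)
    note r = integral_lebesgue_reflect[OF i]
    have "2 * trunc_op \<kappa> J e f x = (LINT z|lebesgue. ?i z) + (LINT z|lebesgue. ?i (- z))"
      unfolding r(2) by (simp add: trunc_op_def set_lebesgue_integral_def)
    also have "\<dots> = (LINT z|lebesgue. ?i z + ?i (- z))" by (rule Bochner_Integration.integral_add[OF i r(1), symmetric])
    also have "\<dots> = (LINT z|lebesgue. indicator {z. e < norm z} z * ?s z)"
    proof (rule Bochner_Integration.integral_cong[OF refl])
      fix z
      show "?i z + ?i (- z) = indicator {z. e < norm z} z * ?s z"
        using \<kappa>_symmetric[of x z] J_symmetric[of z]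
        by (simp add: jump_integrand_def indicator_def second_diff_def algebra_simps)
    qed
    finally show ?thesis by simp
  qed
  have "((\<lambda>e. LINT z|lebesgue. indicator {z. e < norm z} z * ?s z) \<longlongrightarrow> (LINT z|lebesgue. ?s z)) (at_right 0)"
  proof (rule tendsto_integral_at_right[where r=1 and w="\<lambda>z. ?K * jump_weight z"])
    show "?s \<in> borel_measurable lebesgue" by (rule meas)
    show "(\<lambda>z. indicator {z. e < norm z} z * ?s z) \<in> borel_measurable lebesgue" for e
    proof -
      have "(\<lambda>z::'a. indicator {z. e < norm z} z :: real) \<in> borel_measurable lebesgue"
        by (rule borel_measurable_borel_lebesgue) simp
      then show ?thesis using meas by (rule borel_measurable_times)
    qed
    show "integrable lebesgue (\<lambda>z. ?K * jump_weight z)" using integrable_jump_weight by (rule Bochner_Integration.integrable_mult_right)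
    show "AE z in lebesgue. ((\<lambda>e. indicator {z. e < norm z} z * ?s z) \<longlongrightarrow> ?s z) (at_right 0)"
    proof (rule AE_I2)
      fix z :: 'a
      show "((\<lambda>e. indicator {z. e < norm z} z * ?s z) \<longlongrightarrow> ?s z) (at_right 0)"
      proof (cases "z = 0")
        case True
        then show ?thesis by (simp add: second_diff_def)
      next
        case False
        have "\<forall>\<^sub>F e in at_right 0. e < norm z" using False by (intro eventually_at_right_field[THEN iffD2]) (auto intro: exI[of _ "norm z"])
        then have "\<forall>\<^sub>F e in at_right 0. ?s z = indicator {z. e < norm z} z * ?s z" by eventually_elim simp
        then show ?thesis by (rule Lim_transform_eventually[OF tendsto_const])
      qed
    qed
    show "AE z in lebesgue. norm (indicator {z. e < norm z} z * ?s z) \<le> ?K * jump_weight z" for e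
      using bound \<kappa>\<^sub>1_nonneg K0 jump_weight_nonneg by (intro AE_I2) (auto simp: indicator_def intro: order_trans[rotated])
  qed simp
  then have "((\<lambda>e. (LINT z|lebesgue. indicator {z. e < norm z} z * ?s z) / 2) \<longlongrightarrow> (LINT z|lebesgue. ?s z) / 2) (at_right 0)"
    by (intro tendsto_divide tendsto_const) auto
  moreover have "\<forall>\<^sub>F e in at_right 0. (LINT z|lebesgue. indicator {z. e < norm z} z * ?s z) / 2 = trunc_op \<kappa> J e f x"
    using eventually_at_right_less[of 0] by eventually_elim (simp add: trunc)
  ultimately have "((\<lambda>e. trunc_op \<kappa> J e f x) \<longlongrightarrow> (LINT z|lebesgue. ?s z) / 2) (at_right 0)" by (rule Lim_transform_eventually)
  then show "has_gen f x ((LINT z|lebesgue. ?s z) / 2)" using jint by (simp add: has_gen_def)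
qed

end

section \<open>Maximum principle on the whole space\<close>

lemma barrier_second_difference:
  fixes x z :: "'a::real_inner"
  defines "\<psi> \<equiv> \<lambda>y::'a. 1 / (1 + (norm y)\<^sup>2)"
  shows "\<bar>\<psi> (x + z) + \<psi> (x - z) - 2 * \<psi> x\<bar> \<le> 10 * (norm z)\<^sup>2"
proof -
  define b A B where "b = 1 + (norm x)\<^sup>2" and "A = b + (norm z)\<^sup>2" and "B = 2 * (x \<bullet> z)"
  have plus: "1 + (norm (x + z))\<^sup>2 = A + B" and minus: "1 + (norm (x - z))\<^sup>2 = A - B"
    by (simp_all add: A_def B_def b_def power2_norm_eq_inner inner_add inner_diff inner_commute)
  have b1: "1 \<le> b" and bx: "(norm x)\<^sup>2 \<le> b" and bA: "b \<le> A" by (simp_all add: b_def A_def)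
  have p1: "1 \<le> A + B" and m1: "1 \<le> A - B" by (simp_all add: plus[symmetric] minus[symmetric])
  have prod: "A \<le> (A + B) * (A - B)"
  proof (cases "0 \<le> B")
    case True
    have "A * 1 \<le> (A + B) * (A - B)" using True m1 p1 b1 bA by (intro mult_mono) auto
    then show ?thesis by simp
  next
    case False
    have "1 * A \<le> (A + B) * (A - B)" using False m1 p1 b1 bA by (intro mult_mono) auto
    then show ?thesis by simp
  qed
  have BB: "B\<^sup>2 \<le> 4 * (b * (norm z)\<^sup>2)"
  proof -
    have "(x \<bullet> z)\<^sup>2 \<le> (norm x * norm z)\<^sup>2" using Cauchy_Schwarz_ineq2[of x z] by (intro power2_le_iff_abs_le[THEN iffD2]) auto
    also have "\<dots> \<le> b * (norm z)\<^sup>2" unfolding power_mult_distrib by (intro mult_right_mono bx) auto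
    finally show ?thesis by (simp add: B_def power_mult_distrib)
  qed
  let ?P = "(A + B) * (A - B)"
  have P0: "0 < ?P" using p1 m1 by (intro mult_pos_pos) auto
  have b0: "0 < b" and A0: "0 < A" using b1 bA by auto
  have zA: "(norm z)\<^sup>2 = A - b" by (simp add: A_def)
  have id: "1 / (A + B) + 1 / (A - B) - 2 / b = 2 * (B\<^sup>2 - A * (norm z)\<^sup>2) / (?P * b)"
  proof -
    have "1 / (A + B) + 1 / (A - B) = 2 * A / ?P" using p1 m1 by (simp add: field_simps)
    moreover have "2 * A / ?P - 2 / b = (2 * A * b - 2 * ?P) / (?P * b)" using P0 b0 by (subst diff_frac_eq) auto
    moreover have "2 * A * b - 2 * ?P = 2 * (B\<^sup>2 - A * (norm z)\<^sup>2)" unfolding zA by (simp add: algebra_simps power2_eq_square)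
    ultimately show ?thesis by simp
  qed
  have "\<bar>B\<^sup>2 - A * (norm z)\<^sup>2\<bar> \<le> B\<^sup>2 + A * (norm z)\<^sup>2" using A0 by (intro order_trans[OF abs_triangle_ineq4]) simp
  also have "\<dots> \<le> (4 * b + A) * (norm z)\<^sup>2" using BB by (simp add: algebra_simps)
  also have "\<dots> \<le> (5 * (?P * b)) * (norm z)\<^sup>2"
  proof (rule mult_right_mono)
    have "b * 1 \<le> b * ?P" using b0 prod bA b1 by (intro mult_left_mono) auto
    moreover have "A * 1 \<le> ?P * b" using prod b1 A0 by (intro mult_mono) auto
    ultimately show "4 * b + A \<le> 5 * (?P * b)" by (simp add: mult.commute)
  qed simp
  finally have le: "\<bar>B\<^sup>2 - A * (norm z)\<^sup>2\<bar> \<le> (5 * (?P * b)) * (norm z)\<^sup>2" .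
  have "\<bar>2 * (B\<^sup>2 - A * (norm z)\<^sup>2)\<bar> = 2 * \<bar>B\<^sup>2 - A * (norm z)\<^sup>2\<bar>" by (simp only: abs_mult abs_numeral)
  also have "\<dots> \<le> 2 * ((5 * (?P * b)) * (norm z)\<^sup>2)" using le by (intro mult_left_mono) auto
  also have "\<dots> = 10 * (norm z)\<^sup>2 * (?P * b)" by (simp only: mult_ac)
  finally have "\<bar>2 * (B\<^sup>2 - A * (norm z)\<^sup>2)\<bar> \<le> 10 * (norm z)\<^sup>2 * (?P * b)" .
  moreover have Pb: "0 < ?P * b" using P0 b0 by (rule mult_pos_pos)
  ultimately have "\<bar>2 * (B\<^sup>2 - A * (norm z)\<^sup>2) / (?P * b)\<bar> \<le> 10 * (norm z)\<^sup>2"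
    unfolding abs_divide abs_of_pos[OF Pb] pos_divide_le_eq[OF Pb] by blast
  then show ?thesis unfolding \<psi>_def plus minus id[symmetric] b_def[symmetric] by simp
qed

context jump_operator begin

text \<open>
  Bump functions centred at arbitrary points to which the operator applies with a bound uniform in the
  centre. They localise a supremum that need not be attained.
\<close>

lemma barrier:
  "\<exists>C. \<forall>x0 x. \<exists>l. has_gen (\<lambda>y. 1 / (1 + (norm (y - x0))\<^sup>2)) x l \<and> - C \<le> l"
proof -
  have "\<exists>l. has_gen (\<lambda>y. 1 / (1 + (norm (y - x0))\<^sup>2)) x l \<and> - (max 10 (4 * 1) * \<kappa>\<^sub>1 * jump_mass) \<le> l" for x0 x
  proof -
    let ?f = "\<lambda>y. 1 / (1 + (norm (y - x0))\<^sup>2)"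
    have m: "?f \<in> borel_measurable borel" by measurable
    have b: "\<bar>?f u\<bar> \<le> 1" for u
      using zero_le_power2[of "norm (u - x0)"] by (simp add: abs_divide divide_le_eq_1_pos add_pos_nonneg)
    have c: "\<bar>second_diff ?f x z\<bar> \<le> 10 * (norm z)\<^sup>2" for z
      using barrier_second_difference[of "x - x0" z] by (simp add: second_diff_def algebra_simps)
    from has_gen_second_diff[OF m b c] has_gen_second_diff_le[OF m b c] show ?thesis
      by (intro exI conjI) (assumption, linarith)
  qed
  then show ?thesis by blast
qed

text \<open>
  The supremum of \<open>v - (r + d) t\<close> over the unbounded strip need not be attained. Adding a small multiple of a
  bump centred at an almost optimal point produces a function that attains its maximum, at a positive time. There
  the left time derivative is nonnegative, while the operator applied to the function is nonpositive up to the
  contribution of the bump, which is smaller than the slack \<open>d\<close>. The initial condition enters as an upper bound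
  that is uniform in space.
\<close>

theorem maximum_principle:
  fixes v v' l :: "real \<Rightarrow> 'a \<Rightarrow> real"
  assumes cont: "continuous_on ({0<..T} \<times> UNIV) (\<lambda>(t, x). v t x)"
    and bdd: "\<And>t x. 0 < t \<Longrightarrow> t \<le> T \<Longrightarrow> v t x \<le> B"
    and der: "\<And>t x. 0 < t \<Longrightarrow> t \<le> T \<Longrightarrow> ((\<lambda>s. v s x) has_real_derivative v' t x) (at t)"
    and gen: "\<And>t x. 0 < t \<Longrightarrow> t \<le> T \<Longrightarrow> has_gen (v t) x (l t x)"
    and ineq: "\<And>t x. 0 < t \<Longrightarrow> t \<le> T \<Longrightarrow> v' t x \<le> l t x + r"
    and init: "\<And>\<eta>. 0 < \<eta> \<Longrightarrow> \<exists>\<tau>>0. \<forall>t x. 0 < t \<longrightarrow> t < \<tau> \<longrightarrow> v t x \<le> m + \<eta>"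
    and r: "0 \<le> r" and t: "0 < t" "t \<le> T"
  shows "v t x \<le> m + r * t"
proof (rule ccontr)
  assume "\<not> v t x \<le> m + r * t"
  define g where "g = v t x - m - r * t"
  have g: "0 < g" using \<open>\<not> v t x \<le> m + r * t\<close> by (simp add: g_def)
  have T: "0 < T" using t by simp
  (* The drift d makes the differential inequality strict; on (0,T] it lowers v by at most g / 2,
     which leaves an excess of g / 2 over m. *)
  define d where "d = g / (2 * T)"
  have d: "0 < d" using g T by (simp add: d_def)
  define W where "W s y = v s y - (r + d) * s" for s y
  define M where "M = (SUP p\<in>{0<..T} \<times> UNIV. W (fst p) (snd p))"
  have Wv: "W s y \<le> v s y" if "0 < s" for s y using that r d by (simp add: W_def)
  have bW: "bdd_above ((\<lambda>p. W (fst p) (snd p)) ` ({0<..T} \<times> UNIV))"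
  proof (rule bdd_aboveI2)
    fix p assume "p \<in> {0<..T} \<times> (UNIV :: 'a set)"
    then show "W (fst p) (snd p) \<le> B" using Wv[of "fst p" "snd p"] bdd[of "fst p" "snd p"] by auto
  qed
  have WM: "W s y \<le> M" if "0 < s" "s \<le> T" for s y
    unfolding M_def using cSUP_upper[OF _ bW, of "(s, y)"] that by simp
  have "d * t \<le> d * T" using d t by (intro mult_left_mono) auto
  also have "d * T = g / 2" using T by (simp add: d_def)
  finally have "d * t \<le> g / 2" .
  moreover have "W t x = v t x - r * t - d * t" by (simp add: W_def distrib_right)
  ultimately have "m + g / 2 \<le> W t x" unfolding g_def by (simp add: field_simps)
  then have Mg: "m + g / 2 \<le> M" using WM[OF t, of x] by simp
  obtain C where C: "\<And>x0 x. \<exists>l. has_gen (\<lambda>y. 1 / (1 + (norm (y - x0))\<^sup>2)) x l \<and> - C \<le> l"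
    using barrier by blast
  (* th is small against g, so that the bump cannot lift early times to the maximum, and small
     against d / C, so that the operator applied to the bump does not use up the drift. *)
  define th where "th = min (g / 16) (d / (4 * (\<bar>C\<bar> + 1)))"
  have th: "0 < th" using g d by (simp add: th_def)
  have th': "th \<le> g / 16" unfolding th_def by (rule min.cobounded1)
  have thC: "2 * th * C < d"
  proof -
    have "th * (4 * (\<bar>C\<bar> + 1)) \<le> d" using pos_le_divide_eq[of "4 * (\<bar>C\<bar> + 1)" th d] by (simp add: th_def)
    moreover have "2 * th * C \<le> th * (2 * \<bar>C\<bar>)" using th by (simp add: mult_left_mono)
    moreover have "th * (2 * \<bar>C\<bar>) < th * (4 * (\<bar>C\<bar> + 1))" using th by (intro mult_strict_left_mono) auto
    ultimately show ?thesis by linarith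
  qed
  have "M - th < (SUP p\<in>{0<..T} \<times> UNIV. W (fst p) (snd p))" using th by (simp add: M_def)
  then obtain p0 where p0: "p0 \<in> {0<..T} \<times> UNIV" "M - th < W (fst p0) (snd p0)"
    by (subst (asm) less_cSUP_iff[OF _ bW]) (use T in auto)
  obtain t0 x0 where tx0: "p0 = (t0, x0)" by fastforce
  have t0: "0 < t0" "t0 \<le> T" "M - th < W t0 x0" using p0 by (auto simp: tx0)
  (* The bump adds 2 * th at x0, where W is within th of its supremum M, and at most th outside the
     unit ball around x0. So values of Z above M + th occur only near x0. *)
  define Z where "Z s y = W s y + 2 * th * (1 / (1 + (norm (y - x0))\<^sup>2))" for s y
  have Z0: "M + th < Z t0 x0" using t0 by (simp add: Z_def)
  obtain \<tau> where \<tau>: "0 < \<tau>" "\<And>s y. 0 < s \<Longrightarrow> s < \<tau> \<Longrightarrow> v s y \<le> m + g / 4"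
    using init[of "g/4"] g by auto
  have psi1: "1 / (1 + (norm (y - x0))\<^sup>2) \<le> 1" for y
    by (simp add: divide_le_eq_1_pos add_pos_nonneg)
  have Zearly: "Z s y \<le> M + th" if "0 < s" "s < \<tau>" for s y
  proof -
    have "Z s y \<le> v s y + 2 * th * 1" unfolding Z_def using th by (intro add_mono Wv that mult_left_mono psi1) auto
    also have "\<dots> \<le> M + th" using \<tau>(2)[OF that, of y] Mg th th' g by linarith
    finally show ?thesis .
  qed
  have Zfar: "Z s y \<le> M + th" if "0 < s" "s \<le> T" "1 \<le> norm (y - x0)" for s y
  proof -
    have "1 \<le> (norm (y - x0))\<^sup>2" using that by simp
    then have "1 / (1 + (norm (y - x0))\<^sup>2) \<le> 1 / 2" by (intro divide_left_mono) auto
    then have "2 * th * (1 / (1 + (norm (y - x0))\<^sup>2)) \<le> 2 * th * (1 / 2)" using th by (intro mult_left_mono) auto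
    then show ?thesis using WM[OF that(1,2), of y] by (simp add: Z_def)
  qed
  have t0\<tau>: "\<tau> \<le> t0" using Zearly[of t0 x0] Z0 t0 by (meson not_le)
  let ?K = "{\<tau>..T} \<times> cball x0 1"
  have cW: "continuous_on ?K (\<lambda>p. v (fst p) (snd p))"
    by (rule continuous_on_subset[OF cont[unfolded case_prod_beta]]) (use \<tau> in auto)
  have nz: "1 + (norm (y - x0))\<^sup>2 \<noteq> 0" for y
    using zero_le_power2[of "norm (y - x0)"] by linarith
  have "continuous_on ?K (\<lambda>p. Z (fst p) (snd p))"
    unfolding Z_def W_def by (intro continuous_intros cW) (use nz in auto)
  moreover have "compact ?K" by (intro compact_Times) auto
  moreover have "?K \<noteq> {}" using t0\<tau> t0 by auto
  ultimately obtain p1 where p1: "p1 \<in> ?K" "\<And>p. p \<in> ?K \<Longrightarrow> Z (fst p) (snd p) \<le> Z (fst p1) (snd p1)"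
    using continuous_attains_sup[of ?K "\<lambda>p. Z (fst p) (snd p)"] by auto
  obtain t1 x1 where tx1: "p1 = (t1, x1)" by fastforce
  have t1: "0 < t1" "t1 \<le> T" using p1 \<tau> by (auto simp: tx1)
  have Z1: "Z t0 x0 \<le> Z t1 x1" using p1(2)[of "(t0, x0)"] t0 t0\<tau> by (simp add: tx1)
  have max: "Z s y \<le> Z t1 x1" if s: "0 < s" "s \<le> T" for s y
  proof (cases "\<tau> \<le> s \<and> norm (y - x0) \<le> 1")
    case True
    then show ?thesis using p1(2)[of "(s, y)"] s by (simp add: tx1 dist_norm norm_minus_commute)
  next
    case False
    then have "Z s y \<le> M + th" using Zearly[of s y] Zfar[of s y] s by fastforce
    then show ?thesis using Z0 Z1 by simp
  qed
  have "((\<lambda>s. Z s x1) has_real_derivative v' t1 x1 - (r + d)) (at t1)"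
    unfolding Z_def W_def by (auto intro!: derivative_eq_intros der t1)
  then have dpos: "0 \<le> v' t1 x1 - (r + d)"
  proof (rule contrapos_pp)
    assume neg: "\<not> 0 \<le> v' t1 x1 - (r + d)"
    show "\<not> ((\<lambda>s. Z s x1) has_real_derivative v' t1 x1 - (r + d)) (at t1)"
    proof
      assume D: "((\<lambda>s. Z s x1) has_real_derivative v' t1 x1 - (r + d)) (at t1)"
      from DERIV_neg_dec_left[OF D] neg obtain e where e: "0 < e" "\<And>h. 0 < h \<Longrightarrow> h < e \<Longrightarrow> Z t1 x1 < Z (t1 - h) x1" by auto
      define h where "h = min (e / 2) (t1 / 2)"
      have h: "0 < h" "h < e" "h < t1" using e t1 by (auto simp: h_def)
      show False using e(2)[OF h(1,2)] max[of "t1 - h" x1] h t1 by auto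
    qed
  qed
  obtain lp where lp: "has_gen (\<lambda>y. 1 / (1 + (norm (y - x0))\<^sup>2)) x1 lp" "- C \<le> lp" using C by blast
  have "has_gen (\<lambda>y. v t1 y + (- ((r + d) * t1)) + (2 * th) * (1 / (1 + (norm (y - x0))\<^sup>2))) x1 (l t1 x1 + 0 + (2 * th) * lp)"
    by (intro has_gen_add gen t1 has_gen_const has_gen_cmult lp)
  then have "has_gen (Z t1) x1 (l t1 x1 + (2 * th) * lp)" by (simp add: Z_def[abs_def] W_def)
  then have "l t1 x1 + (2 * th) * lp \<le> 0"
    by (rule has_gen_nonpos_at_max) (rule max[OF t1])
  moreover have "(2 * th) * (- C) \<le> (2 * th) * lp" using lp th by (intro mult_left_mono) auto
  ultimately have "l t1 x1 \<le> 2 * th * C" by linarith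
  then show False using dpos ineq[OF t1, of x1] thC by linarith
qed

end

section \<open>The operator on smooth functions\<close>

lemma tendsto_powr_at_right_0: "0 < a \<Longrightarrow> ((\<lambda>u::real. u powr a) \<longlongrightarrow> 0) (at_right 0)"
  by (rule tendsto_zero_powrI[OF tendsto_ident_at tendsto_const])
     (simp_all add: eventually_mono[OF eventually_at_right_less])

lemma taylor_second_order_bound:
  fixes F F' F'' :: "real \<Rightarrow> real"
  assumes F: "\<And>s. (F has_real_derivative F' s) (at s)"
    and F': "\<And>s. (F' has_real_derivative F'' s) (at s)"
    and K: "\<And>s. 0 \<le> s \<Longrightarrow> s \<le> 1 \<Longrightarrow> \<bar>F'' s\<bar> \<le> K"
  shows "\<bar>F 1 - F 0 - F' 0\<bar> \<le> K"
proof -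
  obtain x where x: "0 < x" "x < 1" "F 1 - F 0 = (1 - 0) * F' x"
    using MVT2[of 0 1 F F'] F by auto
  obtain y where y: "0 < y" "y < x" "F' x - F' 0 = (x - 0) * F'' y"
    using MVT2[of 0 x F' F''] F' x by auto
  have "\<bar>F 1 - F 0 - F' 0\<bar> = x * \<bar>F'' y\<bar>" using x y by (simp add: abs_mult)
  also have "\<dots> \<le> 1 * K" using x y K[of y] by (intro mult_mono) auto
  finally show ?thesis by simp
qed

text \<open>
  Boundedness of the second derivative is not part of the definition of the space. It follows from the
  boundedness of \<open>f\<close>: for \<open>norm z = 1\<close> the second difference of \<open>f\<close> differs from the second derivative in
  direction \<open>z\<close> by at most twice the Hoelder constant.
\<close>

lemma C_b2_estimates:
  fixes f :: "'a::euclidean_space \<Rightarrow> real"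
  assumes f: "f \<in> C_b2 \<epsilon>" and \<epsilon>: "0 < \<epsilon>"
  shows "\<exists>B C. 0 \<le> B \<and> 0 \<le> C \<and> (\<forall>x. \<bar>f x\<bar> \<le> B) \<and>
     (\<forall>x z. \<bar>f (x + z) + f (x - z) - 2 * f x\<bar> \<le> C * (norm z)\<^sup>2) \<and>
     (\<forall>x y z. \<bar>(f (x + z) + f (x - z) - 2 * f x) - (f (y + z) + f (y - z) - 2 * f y)\<bar>
         \<le> C * norm (x - y) powr \<epsilon> * (norm z)\<^sup>2) \<and>
     (\<forall>x z. \<bar>f (x + z) - f x\<bar> \<le> C * norm z)"
proof -
  obtain D1 :: "'a \<Rightarrow> 'a \<Rightarrow>\<^sub>L real" and D2 :: "'a \<Rightarrow> 'a \<Rightarrow>\<^sub>L 'a \<Rightarrow>\<^sub>L real" and C0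
    where bdd: "bounded (range f)" and D1: "\<And>x. (f has_derivative blinfun_apply (D1 x)) (at x)"
    and D2: "\<And>x. (D1 has_derivative blinfun_apply (D2 x)) (at x)"
    and C0: "\<And>x y. norm (D2 x - D2 y) \<le> C0 * norm (x - y) powr \<epsilon>"
    using f unfolding C_b2_def by blast
  define C where "C = \<bar>C0\<bar>"
  have C0': "norm (D2 x - D2 y) \<le> C * norm (x - y) powr \<epsilon>" for x y
    by (rule order_trans[OF C0]) (simp add: C_def mult_right_mono)
  have C: "0 \<le> C" "\<And>x y. norm (D2 x - D2 y) \<le> C * norm (x - y) powr \<epsilon>"
    using C0' by (simp_all add: C_def)
  obtain B where B: "\<And>x. \<bar>f x\<bar> \<le> B" using bdd by (auto simp: bounded_iff)
  have B0: "0 \<le> B" using B[of 0] by linarith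
  define Q where "Q x z = D2 x z z" for x z
  have Qdiff: "\<bar>Q x z - Q y z\<bar> \<le> C * norm (x - y) powr \<epsilon> * (norm z)\<^sup>2" for x y z
  proof -
    have "\<bar>Q x z - Q y z\<bar> = norm (blinfun_apply (blinfun_apply (D2 x - D2 y) z) z)"
      by (simp add: Q_def blinfun.diff_left)
    also have "\<dots> \<le> norm (blinfun_apply (D2 x - D2 y) z) * norm z" by (rule norm_blinfun)
    also have "\<dots> \<le> (norm (D2 x - D2 y) * norm z) * norm z" by (intro mult_right_mono norm_blinfun) auto
    also have "\<dots> = norm (D2 x - D2 y) * (norm z)\<^sup>2" by (simp add: power2_eq_square)
    also have "\<dots> \<le> C * norm (x - y) powr \<epsilon> * (norm z)\<^sup>2" by (intro mult_right_mono C) auto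
    finally show ?thesis .
  qed
  have der1: "((\<lambda>s. f (x + s *\<^sub>R z)) has_real_derivative D1 (x + s *\<^sub>R z) z) (at s)" for x z s
  proof -
    have "((\<lambda>s. f (x + s *\<^sub>R z)) has_derivative (\<lambda>h. D1 (x + s *\<^sub>R z) (h *\<^sub>R z))) (at s)"
      by (rule has_derivative_compose[OF _ D1]) (auto intro!: derivative_eq_intros)
    then show ?thesis by (simp add: has_field_derivative_def blinfun.scaleR_right mult_commute_abs)
  qed
  have der2: "((\<lambda>s. D1 (x + s *\<^sub>R z) z) has_real_derivative Q (x + s *\<^sub>R z) z) (at s)" for x z s
  proof -
    have "((\<lambda>s. D1 (x + s *\<^sub>R z)) has_derivative (\<lambda>h. D2 (x + s *\<^sub>R z) (h *\<^sub>R z))) (at s)"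
      by (rule has_derivative_compose[OF _ D2]) (auto intro!: derivative_eq_intros)
    then have "((\<lambda>s. D1 (x + s *\<^sub>R z) z) has_derivative (\<lambda>h. D2 (x + s *\<^sub>R z) (h *\<^sub>R z) z)) (at s)"
      by (rule bounded_linear.has_derivative[OF blinfun.bounded_linear_left])
    then show ?thesis by (simp add: has_field_derivative_def blinfun.scaleR_right blinfun.scaleR_left mult_commute_abs Q_def)
  qed
  have der1m: "((\<lambda>s. f (x - s *\<^sub>R z)) has_real_derivative - D1 (x - s *\<^sub>R z) z) (at s)" for x z s
    using der1[of x "- z" s] by (simp add: blinfun.minus_right)
  have der2m: "((\<lambda>s. - D1 (x - s *\<^sub>R z) z) has_real_derivative Q (x - s *\<^sub>R z) z) (at s)" for x z s
    using der2[of x "- z" s] by (simp add: blinfun.minus_right blinfun.minus_left Q_def)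
  have sn: "norm (s *\<^sub>R z) powr \<epsilon> \<le> norm z powr \<epsilon>" if "0 \<le> s" "s \<le> 1" for s and z :: 'a
    using that \<epsilon> mult_right_mono[of s 1 "norm z"] by (intro powr_mono2) auto
  have sdQ: "\<bar>(f (x + z) + f (x - z) - 2 * f x) - Q x z\<bar> \<le> 2 * C * norm z powr \<epsilon> * (norm z)\<^sup>2" for x z
  proof -
    let ?F = "\<lambda>s. f (x + s *\<^sub>R z) + f (x - s *\<^sub>R z) - s\<^sup>2 * Q x z"
    let ?F' = "\<lambda>s. D1 (x + s *\<^sub>R z) z + - D1 (x - s *\<^sub>R z) z - 2 * s * Q x z"
    let ?F'' = "\<lambda>s. Q (x + s *\<^sub>R z) z + Q (x - s *\<^sub>R z) z - 2 * Q x z"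
    have "\<bar>?F 1 - ?F 0 - ?F' 0\<bar> \<le> 2 * C * norm z powr \<epsilon> * (norm z)\<^sup>2"
    proof (rule taylor_second_order_bound)
      show "(?F has_real_derivative ?F' s) (at s)" for s
        by (intro DERIV_add DERIV_diff der1 der1m) (auto intro!: derivative_eq_intros)
      show "(?F' has_real_derivative ?F'' s) (at s)" for s
        by (intro DERIV_add DERIV_diff der2 der2m) (auto intro!: derivative_eq_intros)
      fix s :: real assume s: "0 \<le> s" "s \<le> 1"
      have "C * norm (s *\<^sub>R z) powr \<epsilon> * (norm z)\<^sup>2 \<le> C * norm z powr \<epsilon> * (norm z)\<^sup>2"
        by (intro mult_right_mono mult_left_mono sn s C) auto
      then show "\<bar>?F'' s\<bar> \<le> 2 * C * norm z powr \<epsilon> * (norm z)\<^sup>2"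
        using Qdiff[of "x + s *\<^sub>R z" z x] Qdiff[of "x - s *\<^sub>R z" z x] by simp
    qed
    then show ?thesis by (simp add: algebra_simps)
  qed
  have Q1: "\<bar>Q x z\<bar> \<le> 4 * B + 2 * C" if "norm z = 1" for x z
    using sdQ[of x z] that B[of "x+z"] B[of "x-z"] B[of x] by simp
  have Qb: "\<bar>Q x z\<bar> \<le> (4 * B + 2 * C) * (norm z)\<^sup>2" for x z
  proof (cases "z = 0")
    case False
    have "Q x z = (norm z)\<^sup>2 * Q x (z /\<^sub>R norm z)"
      using False by (simp add: Q_def blinfun.scaleR_right blinfun.scaleR_left power2_eq_square field_simps)
    then show ?thesis using Q1[of "z /\<^sub>R norm z" x] False by (simp add: abs_mult mult.commute mult_left_mono)
  qed (simp add: Q_def)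
  have sd: "\<bar>f (x + z) + f (x - z) - 2 * f x\<bar> \<le> 2 * ((4 * B + 2 * C) * (norm z)\<^sup>2)" for x z
  proof -
    let ?F = "\<lambda>s. f (x + s *\<^sub>R z) + f (x - s *\<^sub>R z)"
    let ?F' = "\<lambda>s. D1 (x + s *\<^sub>R z) z + - D1 (x - s *\<^sub>R z) z"
    have "\<bar>?F 1 - ?F 0 - ?F' 0\<bar> \<le> 2 * ((4 * B + 2 * C) * (norm z)\<^sup>2)"
    proof (rule taylor_second_order_bound)
      show "(?F has_real_derivative ?F' s) (at s)" for s by (intro DERIV_add der1 der1m)
      show "(?F' has_real_derivative Q (x + s *\<^sub>R z) z + Q (x - s *\<^sub>R z) z) (at s)" for s by (intro DERIV_add der2 der2m)
      show "\<bar>Q (x + s *\<^sub>R z) z + Q (x - s *\<^sub>R z) z\<bar> \<le> 2 * ((4 * B + 2 * C) * (norm z)\<^sup>2)" for s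
        using Qb[of "x + s *\<^sub>R z" z] Qb[of "x - s *\<^sub>R z" z] by linarith
    qed
    then show ?thesis by (simp add: algebra_simps)
  qed
  have sddiff: "\<bar>(f (x + z) + f (x - z) - 2 * f x) - (f (y + z) + f (y - z) - 2 * f y)\<bar>
         \<le> 2 * C * norm (x - y) powr \<epsilon> * (norm z)\<^sup>2" for x y z
  proof -
    let ?F = "\<lambda>s. (f (x + s *\<^sub>R z) + f (x - s *\<^sub>R z)) - (f (y + s *\<^sub>R z) + f (y - s *\<^sub>R z))"
    let ?F' = "\<lambda>s. (D1 (x + s *\<^sub>R z) z + - D1 (x - s *\<^sub>R z) z) - (D1 (y + s *\<^sub>R z) z + - D1 (y - s *\<^sub>R z) z)"
    let ?F'' = "\<lambda>s. (Q (x + s *\<^sub>R z) z + Q (x - s *\<^sub>R z) z) - (Q (y + s *\<^sub>R z) z + Q (y - s *\<^sub>R z) z)"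
    have "\<bar>?F 1 - ?F 0 - ?F' 0\<bar> \<le> 2 * C * norm (x - y) powr \<epsilon> * (norm z)\<^sup>2"
    proof (rule taylor_second_order_bound)
      show "(?F has_real_derivative ?F' s) (at s)" for s by (intro DERIV_diff DERIV_add der1 der1m)
      show "(?F' has_real_derivative ?F'' s) (at s)" for s by (intro DERIV_diff DERIV_add der2 der2m)
      show "\<bar>?F'' s\<bar> \<le> 2 * C * norm (x - y) powr \<epsilon> * (norm z)\<^sup>2" for s
        using Qdiff[of "x + s *\<^sub>R z" z "y + s *\<^sub>R z"] Qdiff[of "x - s *\<^sub>R z" z "y - s *\<^sub>R z"] by simp
    qed
    then show ?thesis by (simp add: algebra_simps)
  qed
  let ?K = "6 * B + 2 * C"
  have D1b: "\<bar>D1 x z\<bar> \<le> ?K * norm z" for x z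
  proof (cases "z = 0")
    case False
    let ?u = "z /\<^sub>R norm z"
    have u: "norm ?u = 1" using False by simp
    have "\<bar>f (x + 1 *\<^sub>R ?u) - f (x + 0 *\<^sub>R ?u) - D1 (x + 0 *\<^sub>R ?u) ?u\<bar> \<le> 4 * B + 2 * C"
      by (rule taylor_second_order_bound[OF der1 der2]) (rule Q1[OF u])
    then have "\<bar>D1 x ?u\<bar> \<le> ?K" using B[of "x + ?u"] B[of x] by simp
    moreover have "D1 x z = norm z * D1 x ?u" using False by (simp add: blinfun.scaleR_right)
    ultimately show ?thesis by (simp add: abs_mult mult.commute mult_left_mono)
  qed simp
  have lip: "\<bar>f (x + z) - f x\<bar> \<le> ?K * norm z" for x z
  proof -
    obtain s where "f (x + 1 *\<^sub>R z) - f (x + 0 *\<^sub>R z) = (1 - 0) * D1 (x + s *\<^sub>R z) z"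
      using MVT2[of 0 1 "\<lambda>s. f (x + s *\<^sub>R z)" "\<lambda>s. D1 (x + s *\<^sub>R z) z"] der1 by auto
    then show ?thesis using D1b[of "x + s *\<^sub>R z" z] by simp
  qed
  let ?M = "8 * B + 4 * C"
  have "\<bar>(f (x + z) + f (x - z) - 2 * f x) - (f (y + z) + f (y - z) - 2 * f y)\<bar> \<le> ?M * norm (x - y) powr \<epsilon> * (norm z)\<^sup>2" for x y z
    by (rule order_trans[OF sddiff]) (use B0 C in \<open>intro mult_right_mono, auto\<close>)
  moreover have "\<bar>f (x + z) - f x\<bar> \<le> ?M * norm z" for x z
    by (rule order_trans[OF lip]) (use B0 C in \<open>intro mult_right_mono, auto\<close>)
  moreover have "\<bar>f (x + z) + f (x - z) - 2 * f x\<bar> \<le> ?M * (norm z)\<^sup>2" for x z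
    using sd[of x z] by (simp add: algebra_simps)
  ultimately show ?thesis using B B0 C by (intro exI[of _ B] exI[of _ ?M]) auto
qed

locale hoelder_jump_operator = jump_operator +
  fixes \<kappa>\<^sub>2 \<beta> :: real
  assumes \<beta>_pos: "0 < \<beta>" and \<kappa>_hoelder: "\<And>x y z. \<bar>\<kappa> x z - \<kappa> y z\<bar> \<le> \<kappa>\<^sub>2 * norm (x - y) powr \<beta>"
begin

text \<open>
  The modulus of continuity of \<open>\<L> f\<close> has two sources. The change of the second differences is at most
  \<open>min (C * norm (x - y) powr \<epsilon> * norm z ^ 2) (8 * B)\<close> and is integrated against \<open>J\<close> by dominated convergence; the
  change of \<open>\<kappa>\<close> is at most \<open>\<kappa>\<^sub>2 * norm (x - y) powr \<beta>\<close>.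
\<close>

lemma C_b2_generator:
  assumes f: "f \<in> C_b2 \<epsilon>" and \<epsilon>: "0 < \<epsilon>"
  shows "\<exists>h. (\<forall>x. has_gen f x (h x)) \<and> bounded (range h) \<and> uniformly_continuous_on UNIV h"
    and "bounded (range f)" and "uniformly_continuous_on UNIV f"
proof -
  obtain B C where B: "0 \<le> B" "\<And>x. \<bar>f x\<bar> \<le> B" and C: "0 \<le> C"
    and sd: "\<And>x z. \<bar>second_diff f x z\<bar> \<le> C * (norm z)\<^sup>2"
    and sdd: "\<And>x y z. \<bar>second_diff f x z - second_diff f y z\<bar> \<le> C * norm (x - y) powr \<epsilon> * (norm z)\<^sup>2"
    and lip: "\<And>x z. \<bar>f (x + z) - f x\<bar> \<le> C * norm z"
    using C_b2_estimates[OF f \<epsilon>] unfolding second_diff_def by blast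
  show "bounded (range f)" using B by (auto simp: bounded_iff)
  show unif: "uniformly_continuous_on UNIV f"
    unfolding uniformly_continuous_on_def
  proof (intro allI impI)
    fix e :: real assume e: "0 < e"
    have "dist (f x') (f x) < e" if "dist x' x < e / (C + 1)" for x x'
    proof -
      have "dist (f x') (f x) \<le> C * norm (x' - x)" using lip[of x "x' - x"] by (simp add: dist_real_def)
      also have "\<dots> \<le> (C + 1) * norm (x' - x)" by (simp add: mult_right_mono)
      also have "\<dots> < e" using that C e by (simp add: dist_norm field_simps)
      finally show ?thesis .
    qed
    then show "\<exists>d>0. \<forall>x\<in>UNIV. \<forall>x'\<in>UNIV. dist x' x < d \<longrightarrow> dist (f x') (f x) < e"
      using e C by (intro exI[of _ "e / (C + 1)"]) auto
  qed
  have fm: "f \<in> borel_measurable borel"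
    by (intro borel_measurable_continuous_onI uniformly_continuous_imp_continuous unif)
  define h where "h x = (LINT z|lebesgue. second_diff f x z * \<kappa> x z * J z) / 2" for x
  note I = integrable_second_diff[OF fm B(2) sd]
  have gen: "has_gen f x (h x)" for x unfolding h_def by (rule has_gen_second_diff[OF fm B(2) sd])
  have bh: "bounded (range h)"
    using has_gen_second_diff_le[OF fm B(2) sd] unfolding h_def by (auto simp: bounded_iff)
  let ?K = "max C (4 * B)"
  let ?m = "\<lambda>u z. min (C * u powr \<epsilon> * (norm z)\<^sup>2) (8 * B) * J z"
  have m_le: "?m u z \<le> (C + 8 * B) * jump_weight z" and m_nn: "0 \<le> ?m u z" if "0 \<le> u" "u < 1" for u z
  proof -
    have "C * u powr \<epsilon> * (norm z)\<^sup>2 \<le> C * 1 * (norm z)\<^sup>2"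
      using that \<epsilon> C powr_mono2[of \<epsilon> u 1] by (intro mult_right_mono mult_left_mono) auto
    then have le: "C * u powr \<epsilon> * (norm z)\<^sup>2 \<le> C * (norm z)\<^sup>2" by simp
    have "min (C * u powr \<epsilon> * (norm z)\<^sup>2) (8 * B) \<le> (C + 8 * B) * min 1 ((norm z)\<^sup>2)"
    proof (cases "(norm z)\<^sup>2 \<le> 1")
      case True
      have "min (C * u powr \<epsilon> * (norm z)\<^sup>2) (8 * B) \<le> C * (norm z)\<^sup>2" using le by linarith
      also have "\<dots> \<le> (C + 8 * B) * (norm z)\<^sup>2" using B by (intro mult_right_mono) auto
      finally show ?thesis using True by (simp add: min_absorb2)
    next
      case False
      have "min (C * u powr \<epsilon> * (norm z)\<^sup>2) (8 * B) \<le> 8 * B" by simp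
      also have "\<dots> \<le> (C + 8 * B) * 1" using C by simp
      finally show ?thesis using False by (simp add: min_absorb1)
    qed
    then show "?m u z \<le> (C + 8 * B) * jump_weight z"
      using J_pos[of z] by (simp add: jump_weight_def mult_right_mono mult.assoc[symmetric])
    show "0 \<le> ?m u z" using J_pos[of z] B C that by (intro mult_nonneg_nonneg) auto
  qed
  have m_meas: "?m u \<in> borel_measurable lebesgue" for u
    by (intro borel_measurable_times J_measurable borel_measurable_borel_lebesgue) simp
  have w_int: "integrable lebesgue (\<lambda>z. (C + 8 * B) * jump_weight z)"
    by (intro Bochner_Integration.integrable_mult_right integrable_jump_weight)
  have m_int: "integrable lebesgue (?m u)" if "0 \<le> u" "u < 1" for u
    by (rule Bochner_Integration.integrable_bound[OF w_int m_meas])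
       (use m_le[OF that] m_nn[OF that] in \<open>auto intro!: AE_I2 intro: order_trans[OF _ abs_ge_self]\<close>)
  define R where "R u = \<kappa>\<^sub>1 * (LINT z|lebesgue. ?m u z) + ?K * \<bar>\<kappa>\<^sub>2\<bar> * u powr \<beta> * jump_mass" for u
  have "((\<lambda>u. LINT z|lebesgue. ?m u z) \<longlongrightarrow> (LINT z|(lebesgue :: 'a measure). 0)) (at_right 0)"
  proof (rule tendsto_integral_at_right[where r=1 and w="\<lambda>z. (C + 8 * B) * jump_weight z"])
    show "?m u \<in> borel_measurable lebesgue" for u by (rule m_meas)
    show "integrable lebesgue (\<lambda>z. (C + 8 * B) * jump_weight z)" by (rule w_int)
    show "AE z in lebesgue. ((\<lambda>u. ?m u z) \<longlongrightarrow> 0) (at_right 0)"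
    proof (rule AE_I2)
      fix z :: 'a
      have "((\<lambda>u. ?m u z) \<longlongrightarrow> min (C * 0 * (norm z)\<^sup>2) (8 * B) * J z) (at_right 0)"
        by (intro tendsto_intros tendsto_powr_at_right_0 \<epsilon>)
      then show "((\<lambda>u. ?m u z) \<longlongrightarrow> 0) (at_right 0)" using B by simp
    qed
    show "AE z in lebesgue. norm (?m u z) \<le> (C + 8 * B) * jump_weight z" if "0 < u" "u < 1" for u
      using m_le[of u] m_nn[of u] that by (intro AE_I2) auto
  qed auto
  moreover have "((\<lambda>u. u powr \<beta>) \<longlongrightarrow> 0) (at_right 0)"
    by (rule tendsto_powr_at_right_0[OF \<beta>_pos])
  ultimately have "(R \<longlongrightarrow> \<kappa>\<^sub>1 * 0 + ?K * \<bar>\<kappa>\<^sub>2\<bar> * 0 * jump_mass) (at_right 0)"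
    unfolding R_def by (intro tendsto_intros) auto
  then have R0: "(R \<longlongrightarrow> 0) (at_right 0)" by simp
  have hR: "\<bar>h x - h y\<bar> \<le> R (norm (x - y))" if u: "norm (x - y) < 1" for x y
  proof -
    let ?u = "norm (x - y)"
    have pt: "\<bar>second_diff f x z * \<kappa> x z * J z - second_diff f y z * \<kappa> y z * J z\<bar>
        \<le> \<kappa>\<^sub>1 * ?m ?u z + ?K * \<bar>\<kappa>\<^sub>2\<bar> * ?u powr \<beta> * jump_weight z" for z
    proof -
      have 1: "\<bar>second_diff f x z - second_diff f y z\<bar> \<le> min (C * ?u powr \<epsilon> * (norm z)\<^sup>2) (8 * B)"
      proof -
        have "\<bar>second_diff f x z - second_diff f y z\<bar> \<le> 8 * B"
          using B(2)[of "x+z"] B(2)[of "x-z"] B(2)[of x] B(2)[of "y+z"] B(2)[of "y-z"] B(2)[of y]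
          unfolding second_diff_def by linarith
        then show ?thesis using sdd[of x z y] by simp
      qed
      have 2: "\<bar>second_diff f y z\<bar> \<le> ?K * min 1 ((norm z)\<^sup>2)"
      proof -
        have "\<bar>second_diff f y z\<bar> \<le> 4 * B"
          using B(2)[of "y+z"] B(2)[of "y-z"] B(2)[of y] unfolding second_diff_def by linarith
        moreover have "C * (norm z)\<^sup>2 \<le> ?K * (norm z)\<^sup>2" by (intro mult_right_mono) auto
        ultimately show ?thesis using sd[of y z] by (cases "(norm z)\<^sup>2 \<le> 1") (auto simp: min_absorb1 min_absorb2)
      qed
      have 3: "\<bar>\<kappa> x z - \<kappa> y z\<bar> \<le> \<bar>\<kappa>\<^sub>2\<bar> * ?u powr \<beta>"
        using \<kappa>_hoelder[of x z y] by (auto elim!: order_trans intro!: mult_right_mono)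
      have "\<bar>second_diff f x z * \<kappa> x z * J z - second_diff f y z * \<kappa> y z * J z\<bar>
        = \<bar>(second_diff f x z - second_diff f y z) * \<kappa> x z + second_diff f y z * (\<kappa> x z - \<kappa> y z)\<bar> * J z"
      proof -
        have "second_diff f x z * \<kappa> x z * J z - second_diff f y z * \<kappa> y z * J z
          = ((second_diff f x z - second_diff f y z) * \<kappa> x z + second_diff f y z * (\<kappa> x z - \<kappa> y z)) * J z"
          by (simp add: algebra_simps)
        then show ?thesis using J_pos[of z] by (simp only: abs_mult abs_of_pos)
      qed
      also have "\<dots> \<le> (\<bar>second_diff f x z - second_diff f y z\<bar> * \<kappa> x z + \<bar>second_diff f y z\<bar> * \<bar>\<kappa> x z - \<kappa> y z\<bar>) * J z"
        using J_pos[of z] \<kappa>_bounds[of x z]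
        by (intro mult_right_mono order_trans[OF abs_triangle_ineq]) (auto simp: abs_mult)
      also have "\<dots> \<le> (min (C * ?u powr \<epsilon> * (norm z)\<^sup>2) (8 * B) * \<kappa>\<^sub>1 + (?K * min 1 ((norm z)\<^sup>2)) * (\<bar>\<kappa>\<^sub>2\<bar> * ?u powr \<beta>)) * J z"
      proof (rule mult_right_mono[OF add_mono])
        show "\<bar>second_diff f x z - second_diff f y z\<bar> * \<kappa> x z \<le> min (C * ?u powr \<epsilon> * (norm z)\<^sup>2) (8 * B) * \<kappa>\<^sub>1"
          by (rule mult_mono[OF 1]) (use \<kappa>_bounds[of x z] B C in auto)
        show "\<bar>second_diff f y z\<bar> * \<bar>\<kappa> x z - \<kappa> y z\<bar> \<le> (?K * min 1 ((norm z)\<^sup>2)) * (\<bar>\<kappa>\<^sub>2\<bar> * ?u powr \<beta>)"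
          by (rule mult_mono[OF 2 3]) (use B C in auto)
        show "0 \<le> J z" using J_pos[of z] by simp
      qed
      also have "\<dots> = \<kappa>\<^sub>1 * ?m ?u z + ?K * \<bar>\<kappa>\<^sub>2\<bar> * ?u powr \<beta> * jump_weight z"
      proof -
        have "(m * k + (K * w) * (c * u)) * j = k * (m * j) + K * c * u * (w * j)" for m k K w c u j :: real
          by (simp add: algebra_simps)
        then show ?thesis unfolding jump_weight_def .
      qed
      finally show ?thesis .
    qed
    have mi: "integrable lebesgue (?m ?u)" by (rule m_int) (use u in auto)
    have "2 * (h x - h y) = (LINT z|lebesgue. second_diff f x z * \<kappa> x z * J z - second_diff f y z * \<kappa> y z * J z)"
      unfolding h_def by (subst Bochner_Integration.integral_diff[OF I I]) simp
    then have "2 * \<bar>h x - h y\<bar> = \<bar>LINT z|lebesgue. second_diff f x z * \<kappa> x z * J z - second_diff f y z * \<kappa> y z * J z\<bar>" by (metis abs_mult abs_numeral)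
    also have "\<dots> \<le> (LINT z|lebesgue. \<bar>second_diff f x z * \<kappa> x z * J z - second_diff f y z * \<kappa> y z * J z\<bar>)" by (rule integral_abs_bound)
    also have "\<dots> \<le> (LINT z|lebesgue. \<kappa>\<^sub>1 * ?m ?u z + ?K * \<bar>\<kappa>\<^sub>2\<bar> * ?u powr \<beta> * jump_weight z)"
      by (intro integral_mono pt integrable_abs Bochner_Integration.integrable_diff[OF I I] Bochner_Integration.integrable_add
          Bochner_Integration.integrable_mult_right mi integrable_jump_weight)
    also have "\<dots> = R ?u"
      unfolding R_def jump_mass_def
      by (subst Bochner_Integration.integral_add)
         (simp_all add: Bochner_Integration.integrable_mult_right mi integrable_jump_weight)
    finally have "2 * \<bar>h x - h y\<bar> \<le> R ?u" .
    moreover have "\<bar>h x - h y\<bar> \<le> 2 * \<bar>h x - h y\<bar>" by simp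
    ultimately show ?thesis by (rule order_trans[rotated])
  qed
  have "uniformly_continuous_on UNIV h"
    unfolding uniformly_continuous_on_def
  proof (intro allI impI)
    fix e :: real assume e: "0 < e"
    obtain d where d: "0 < d" "\<And>u. 0 < u \<Longrightarrow> u < d \<Longrightarrow> R u < e"
      using order_tendstoD(2)[OF R0 e] by (auto simp: eventually_at_right_field)
    have "dist (h x') (h x) < e" if "dist x' x < min d 1" for x x'
    proof (cases "x' = x")
      case False
      then show ?thesis using hR[of x' x] d(2)[of "norm (x' - x)"] that by (simp add: dist_norm)
    qed (use e in simp)
    then show "\<exists>d>0. \<forall>x\<in>UNIV. \<forall>x'\<in>UNIV. dist x' x < d \<longrightarrow> dist (h x') (h x) < e"
      using d by (intro exI[of _ "min d 1"]) auto
  qed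
  then show "\<exists>h. (\<forall>x. has_gen f x (h x)) \<and> bounded (range h) \<and> uniformly_continuous_on UNIV h" using gen bh by blast
qed

end

section \<open>The heat kernel as an integral operator\<close>

lemma sigma_finite_lebesgue: "sigma_finite_measure (lebesgue :: 'a::euclidean_space measure)"
proof -
  obtain A :: "'a set set" where A: "countable A" "A \<subseteq> sets lborel" "\<Union> A = space lborel" "\<forall>a\<in>A. emeasure lborel a \<noteq> \<infinity>"
    using lborel.sigma_finite_countable by blast
  show ?thesis
    by standard (use A in \<open>auto intro!: exI[of _ A]\<close>)
qed

lemma nn_integral_lborel_reflect_shift:
  fixes g :: "'a::euclidean_space \<Rightarrow> ennreal"
  assumes [measurable]: "g \<in> borel_measurable borel"
  shows "(\<integral>\<^sup>+ y. g (x - y) \<partial>lborel) = (\<integral>\<^sup>+ y. g y \<partial>lborel)"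
proof -
  have "(lborel :: 'a measure) = distr lborel borel (\<lambda>y. x + (- 1) *\<^sub>R y)"
    using lborel_affine[of "-1" x] by (simp add: density_1)
  then have "(\<integral>\<^sup>+ y. g y \<partial>lborel) = (\<integral>\<^sup>+ y. g y \<partial>distr lborel borel (\<lambda>y. x + (- 1) *\<^sub>R y))" by simp
  also have "\<dots> = (\<integral>\<^sup>+ y. g (x - y) \<partial>lborel)" by (subst nn_integral_distr) simp_all
  finally show ?thesis ..
qed

lemma nn_integral_lborel_shift:
  fixes g :: "'a::euclidean_space \<Rightarrow> ennreal"
  assumes [measurable]: "g \<in> borel_measurable borel"
  shows "(\<integral>\<^sup>+ x. g (x - y) \<partial>lborel) = (\<integral>\<^sup>+ x. g x \<partial>lborel)"
proof -
  have "(\<integral>\<^sup>+ x. g x \<partial>lborel) = (\<integral>\<^sup>+ x. g x \<partial>distr lborel borel ((+) (- y)))" by (simp add: lborel_distr_plus)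
  also have "\<dots> = (\<integral>\<^sup>+ x. g (x - y) \<partial>lborel)" by (subst nn_integral_distr) simp_all
  finally show ?thesis ..
qed

lemma tendsto_at_right_inverse_Suc:
  fixes f :: "real \<Rightarrow> real"
  assumes "(f \<longlongrightarrow> l) (at_right 0)" shows "(\<lambda>n. f (1 / real (Suc n))) \<longlonglongrightarrow> l"
proof -
  have "filterlim (\<lambda>n. 1 / real (Suc n)) (at_right 0) sequentially"
    unfolding filterlim_at using LIMSEQ_inverse_real_of_nat
    by (auto simp: inverse_eq_divide)
  then show ?thesis by (rule filterlim_compose[OF assms])
qed

locale heat_kernel = scaled_bernstein \<phi> \<mu> \<delta> a1 + hoelder_jump_operator J \<kappa> \<kappa>\<^sub>1 \<kappa>\<^sub>2 \<beta>
  for \<phi> \<mu> \<delta> a1 and J :: "'a::euclidean_space \<Rightarrow> real" and \<kappa> \<kappa>\<^sub>1 \<kappa>\<^sub>2 \<beta> +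
  fixes p :: "real \<Rightarrow> 'a \<Rightarrow> 'a \<Rightarrow> real"
  assumes is_heat_kernel: "is_heat_kernel \<phi> \<kappa> J p"
begin

abbreviation \<rho> :: "real \<Rightarrow> 'a \<Rightarrow> real" where "\<rho> \<equiv> rho \<phi>"

definition q :: "real \<Rightarrow> 'a \<Rightarrow> 'a \<Rightarrow> real" where "q t x y = nonlocal_op \<kappa> J 0 (\<lambda>u. p t u y) x"

lemma p_nonneg: "0 < t \<Longrightarrow> 0 \<le> p t x y"
  and p_continuous: "continuous_on ({0<..} \<times> UNIV \<times> UNIV) (\<lambda>(t, x, y). p t x y)"
  and p_derivative: "0 < t \<Longrightarrow> x \<noteq> y \<Longrightarrow> ((\<lambda>s. p s x y) has_real_derivative q t x y) (at t)"
  and p_initial: "\<And>f :: 'a \<Rightarrow> real. bounded (range f) \<Longrightarrow> uniformly_continuous_on UNIV f \<Longrightarrow> uniform_limit UNIV (\<lambda>t. kernel_semigroup p t f) f (at_right 0)"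
  using is_heat_kernel by (auto simp: is_heat_kernel_def q_def)

lemma heat_kernel_bounds:
  "\<exists>c>0. \<forall>t x y. 0 < t \<longrightarrow> t \<le> T \<longrightarrow> p t x y \<le> c * t * \<rho> t (x - y) \<and> has_gen (\<lambda>u. p t u y) x (q t x y) \<and>
     \<bar>q t x y\<bar> \<le> c * \<rho> t (x - y) \<and> (\<forall>e. 0 < e \<longrightarrow> e \<le> 1 \<longrightarrow> \<bar>trunc_op \<kappa> J e (\<lambda>u. p t u y) x\<bar> \<le> c * \<rho> t (x - y))"
proof -
  let ?T = "max 1 T"
  have "\<exists>c>0. \<forall>t\<in>{0<..?T}. \<forall>x y. p t x y \<le> c * t * \<rho> t (x - y)"
    using is_heat_kernel unfolding is_heat_kernel_def by (meson max.cobounded1)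
  then obtain c1 where c1: "0 < c1" "\<And>t x y. 0 < t \<Longrightarrow> t \<le> ?T \<Longrightarrow> p t x y \<le> c1 * t * \<rho> t (x - y)" by auto
  have "\<exists>c>0. \<forall>t\<in>{0<..?T}. \<forall>\<epsilon>\<in>{0..1}. \<forall>x y. nonlocal_defined \<kappa> J \<epsilon> (\<lambda>u. p t u y) x \<and>
        \<bar>nonlocal_op \<kappa> J \<epsilon> (\<lambda>u. p t u y) x\<bar> \<le> c * \<rho> t (x - y)"
    using is_heat_kernel unfolding is_heat_kernel_def by (meson max.cobounded1)
  then obtain c2 where c2: "0 < c2" and c2': "\<And>t \<epsilon> x y. 0 < t \<Longrightarrow> t \<le> ?T \<Longrightarrow> 0 \<le> \<epsilon> \<Longrightarrow> \<epsilon> \<le> 1 \<Longrightarrow> nonlocal_defined \<kappa> J \<epsilon> (\<lambda>u. p t u y) x \<and>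
        \<bar>nonlocal_op \<kappa> J \<epsilon> (\<lambda>u. p t u y) x\<bar> \<le> c2 * \<rho> t (x - y)" by auto
  let ?c = "c1 + c2"
  have "p t x y \<le> ?c * t * \<rho> t (x - y) \<and> has_gen (\<lambda>u. p t u y) x (q t x y) \<and>
     \<bar>q t x y\<bar> \<le> ?c * \<rho> t (x - y) \<and> (\<forall>e. 0 < e \<longrightarrow> e \<le> 1 \<longrightarrow> \<bar>trunc_op \<kappa> J e (\<lambda>u. p t u y) x\<bar> \<le> ?c * \<rho> t (x - y))"
    if t: "0 < t" "t \<le> T" for t x y
  proof -
    have t': "t \<le> ?T" using t by simp
    have r: "0 \<le> \<rho> t (x - y)" using rho_pos[OF t(1), of "x - y"] by simp
    have "p t x y \<le> c1 * t * \<rho> t (x - y)" by (rule c1(2)[OF t(1) t'])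
    also have "\<dots> \<le> ?c * t * \<rho> t (x - y)" using c2 t r by (intro mult_right_mono) auto
    finally have 1: "p t x y \<le> ?c * t * \<rho> t (x - y)" .
    have le: "c2 * \<rho> t (x - y) \<le> ?c * \<rho> t (x - y)" using c1 r by (intro mult_right_mono) auto
    have 2: "has_gen (\<lambda>u. p t u y) x (q t x y)" unfolding q_def
      by (rule has_gen_nonlocal_op) (use c2'[OF t(1) t', of 0 y x] in auto)
    have 3: "\<bar>q t x y\<bar> \<le> ?c * \<rho> t (x - y)"
      unfolding q_def using c2'[OF t(1) t', of 0 y x] le by linarith
    have 4: "\<bar>trunc_op \<kappa> J e (\<lambda>u. p t u y) x\<bar> \<le> ?c * \<rho> t (x - y)" if "0 < e" "e \<le> 1" for e
    proof -
      have "nonlocal_op \<kappa> J e (\<lambda>u. p t u y) x = trunc_op \<kappa> J e (\<lambda>u. p t u y) x" using that by (simp add: nonlocal_op_def)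
      then show ?thesis using c2'[OF t(1) t', of e y x] le that by simp
    qed
    show ?thesis using 1 2 3 4 by blast
  qed
  then show ?thesis using c1(1) c2(1) by (intro exI[of _ ?c]) auto
qed

definition hk_const :: "real \<Rightarrow> real" where
  "hk_const T = (SOME c. 0 < c \<and> (\<forall>t x y. 0 < t \<longrightarrow> t \<le> T \<longrightarrow> p t x y \<le> c * t * \<rho> t (x - y) \<and> has_gen (\<lambda>u. p t u y) x (q t x y) \<and>
     \<bar>q t x y\<bar> \<le> c * \<rho> t (x - y) \<and> (\<forall>e. 0 < e \<longrightarrow> e \<le> 1 \<longrightarrow> \<bar>trunc_op \<kappa> J e (\<lambda>u. p t u y) x\<bar> \<le> c * \<rho> t (x - y))))"

lemma hk_const_pos: "0 < hk_const T"
  and p_le: "0 < t \<Longrightarrow> t \<le> T \<Longrightarrow> p t x y \<le> hk_const T * t * \<rho> t (x - y)"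
  and has_gen_p: "0 < t \<Longrightarrow> has_gen (\<lambda>u. p t u y) x (q t x y)"
  and q_le: "0 < t \<Longrightarrow> t \<le> T \<Longrightarrow> \<bar>q t x y\<bar> \<le> hk_const T * \<rho> t (x - y)"
  and trunc_op_p_le: "0 < t \<Longrightarrow> t \<le> T \<Longrightarrow> 0 < e \<Longrightarrow> e \<le> 1 \<Longrightarrow> \<bar>trunc_op \<kappa> J e (\<lambda>u. p t u y) x\<bar> \<le> hk_const T * \<rho> t (x - y)"
proof -
  note s = someI_ex[OF heat_kernel_bounds, folded hk_const_def]
  show "0 < hk_const T" using s[of T] by blast
  show "0 < t \<Longrightarrow> t \<le> T \<Longrightarrow> p t x y \<le> hk_const T * t * \<rho> t (x - y)" using s[of T] by blast
  show "0 < t \<Longrightarrow> has_gen (\<lambda>u. p t u y) x (q t x y)" using s[of t] by blast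
  show "0 < t \<Longrightarrow> t \<le> T \<Longrightarrow> \<bar>q t x y\<bar> \<le> hk_const T * \<rho> t (x - y)" using s[of T] by blast
  show "0 < t \<Longrightarrow> t \<le> T \<Longrightarrow> 0 < e \<Longrightarrow> e \<le> 1 \<Longrightarrow> \<bar>trunc_op \<kappa> J e (\<lambda>u. p t u y) x\<bar> \<le> hk_const T * \<rho> t (x - y)" using s[of T] by blast
qed

definition rho_mass :: real where
  "rho_mass = (SOME M. 0 < M \<and> (\<forall>T>0. \<forall>t\<in>{0<..T}. (\<integral>\<^sup>+ x. ennreal (\<rho> t x) \<partial>lborel) \<le> ennreal (M * (T + 1) / t)))"

lemma rho_mass_pos: "0 < rho_mass"
  and nn_integral_rho_le_mass: "0 < t \<Longrightarrow> t \<le> T \<Longrightarrow> (\<integral>\<^sup>+ x. ennreal (\<rho> t x) \<partial>lborel) \<le> ennreal (rho_mass * (T + 1) / t)"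
  using someI_ex[OF nn_integral_rho[where 'a='a], folded rho_mass_def] by auto

lemma rho_nonneg: "0 < t \<Longrightarrow> 0 \<le> \<rho> t x"
  using rho_pos[of t x] by simp

lemma rho_measurable: "0 < t \<Longrightarrow> \<rho> t \<in> borel_measurable borel"
  by (rule borel_measurable_rho)

lemma rho_minus: "\<rho> t (- x) = \<rho> t x"
  by (simp add: rho_eq_profile)

lemma rho_commute: "\<rho> t (x - y) = \<rho> t (y - x)"
  using rho_minus[of t "x - y"] by simp

lemma nn_integral_rho_right: "0 < t \<Longrightarrow> (\<integral>\<^sup>+ y. ennreal (\<rho> t (x - y)) \<partial>lborel) = (\<integral>\<^sup>+ x. ennreal (\<rho> t x) \<partial>lborel)"
  using nn_integral_lborel_reflect_shift[of "\<lambda>x. ennreal (\<rho> t x)" x] rho_measurable[of t] by simp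

lemma integrable_rho_right: assumes "0 < t" shows "integrable lborel (\<lambda>y. \<rho> t (x - y))"
proof (rule integrableI_bounded)
  show "(\<lambda>y. \<rho> t (x - y)) \<in> borel_measurable lborel"
    using measurable_compose[OF _ rho_measurable[OF assms], of "\<lambda>y. x - y" borel] by simp
  show "(\<integral>\<^sup>+ y. ennreal (norm (\<rho> t (x - y))) \<partial>lborel) < \<infinity>"
    using nn_integral_rho_le_mass[OF assms order_refl] nn_integral_rho_right[OF assms, of x] rho_nonneg[OF assms]
    by (simp add: le_less_trans)
qed

lemma integral_rho_right_le: assumes "0 < t" "t \<le> T" shows "(LINT y|lborel. \<rho> t (x - y)) \<le> rho_mass * (T + 1) / t"
proof -
  have "ennreal (LINT y|lborel. \<rho> t (x - y)) = (\<integral>\<^sup>+ y. ennreal (\<rho> t (x - y)) \<partial>lborel)"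
    by (rule nn_integral_eq_integral[symmetric, OF integrable_rho_right[OF assms(1)]]) (simp add: rho_nonneg assms)
  also have "\<dots> \<le> ennreal (rho_mass * (T + 1) / t)"
    unfolding nn_integral_rho_right[OF assms(1)] by (rule nn_integral_rho_le_mass[OF assms])
  finally show ?thesis using assms rho_mass_pos by (subst (asm) ennreal_le_iff) auto
qed

lemma p_continuous_at:
  assumes "0 < t" "s \<longlonglongrightarrow> t" "u \<longlonglongrightarrow> x" "w \<longlonglongrightarrow> y" "\<And>n::nat. 0 < s n"
  shows "(\<lambda>n. p (s n) (u n) (w n)) \<longlonglongrightarrow> p t x y"
proof -
  have "((\<lambda>z. (\<lambda>(t, x, y). p t x y) z) \<circ> (\<lambda>n. (s n, u n, w n))) \<longlonglongrightarrow> (\<lambda>(t, x, y). p t x y) (t, x, y)"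
    using continuous_on_sequentially[THEN iffD1, OF p_continuous, rule_format, of "(t, x, y)" "\<lambda>n. (s n, u n, w n)"] assms
    by (simp add: tendsto_Pair)
  then show ?thesis by (simp add: o_def)
qed

lemma p_continuous2: assumes "0 < t" shows "continuous_on UNIV (\<lambda>(x, y). p t x y)"
proof -
  have "continuous_on UNIV ((\<lambda>(t, x, y). p t x y) \<circ> (\<lambda>(x, y). (t, x, y)))"
    by (rule continuous_on_compose[OF _ continuous_on_subset[OF p_continuous]])
       (use assms in \<open>auto simp: case_prod_beta intro!: continuous_intros\<close>)
  then show ?thesis by (simp add: o_def case_prod_beta)
qed

lemma p_measurable2: "0 < t \<Longrightarrow> (\<lambda>(x, y). p t x y) \<in> borel_measurable borel"
  by (rule borel_measurable_continuous_onI[OF p_continuous2])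

lemma p_measurable_right: assumes "0 < t" shows "p t x \<in> borel_measurable borel"
  and "(\<lambda>x. p t x y) \<in> borel_measurable borel"
proof -
  have "continuous_on UNIV ((\<lambda>(x, y). p t x y) \<circ> (\<lambda>y. (x, y)))"
    by (rule continuous_on_compose[OF _ continuous_on_subset[OF p_continuous2[OF assms]]]) (auto intro!: continuous_intros)
  then show "p t x \<in> borel_measurable borel" by (auto simp: o_def intro: borel_measurable_continuous_onI)
  have "continuous_on UNIV ((\<lambda>(x, y). p t x y) \<circ> (\<lambda>x. (x, y)))"
    by (rule continuous_on_compose[OF _ continuous_on_subset[OF p_continuous2[OF assms]]]) (auto intro!: continuous_intros)
  then show "(\<lambda>x. p t x y) \<in> borel_measurable borel" by (auto simp: o_def intro: borel_measurable_continuous_onI)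
qed

definition P :: "real \<Rightarrow> ('a \<Rightarrow> real) \<Rightarrow> 'a \<Rightarrow> real" where "P t f x = (LINT y|lborel. p t x y * f y)"

lemma kernel_semigroup_eq_P:
  assumes "0 < t" "f \<in> borel_measurable borel" shows "kernel_semigroup p t f x = P t f x"
  unfolding kernel_semigroup_def P_def using assms p_measurable_right[OF assms(1)]
  by (subst integral_completion) auto

lemma integrable_p_mult:
  assumes t: "0 < t" and [measurable]: "f \<in> borel_measurable borel" and B: "\<And>y. \<bar>f y\<bar> \<le> B"
  shows "integrable lborel (\<lambda>y. p t x y * f y)"
proof (rule Bochner_Integration.integrable_bound)
  show "integrable lborel (\<lambda>y. (hk_const t * t * B) * \<rho> t (x - y))" by (intro Bochner_Integration.integrable_mult_right integrable_rho_right t)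
  show "(\<lambda>y. p t x y * f y) \<in> borel_measurable lborel" using p_measurable_right[OF t, of x] by simp
  have B0: "0 \<le> B" using B[of 0] by linarith
  show "AE y in lborel. norm (p t x y * f y) \<le> norm ((hk_const t * t * B) * \<rho> t (x - y))"
  proof (rule AE_I2)
    fix y
    have "\<bar>p t x y\<bar> * \<bar>f y\<bar> \<le> (hk_const t * t * \<rho> t (x - y)) * B"
      using p_le[OF t order_refl, of x y] p_nonneg[OF t, of x y] B[of y] B0 by (intro mult_mono) auto
    then show "norm (p t x y * f y) \<le> norm ((hk_const t * t * B) * \<rho> t (x - y))"
      using hk_const_pos[of t] t B0 rho_nonneg[OF t] by (simp add: abs_mult abs_of_nonneg mult_ac)
  qed
qed

lemma integrable_p: "0 < t \<Longrightarrow> integrable lborel (p t x)"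
  using integrable_p_mult[of t "\<lambda>_. 1" 1 x] by simp

lemma integral_p_le: assumes "0 < t" "t \<le> T" shows "(LINT y|lborel. p t x y) \<le> hk_const T * rho_mass * (T + 1)"
proof -
  have "(LINT y|lborel. p t x y) \<le> (LINT y|lborel. (hk_const T * t) * \<rho> t (x - y))"
    by (intro integral_mono integrable_p Bochner_Integration.integrable_mult_right integrable_rho_right p_le assms)
  also have "\<dots> = (hk_const T * t) * (LINT y|lborel. \<rho> t (x - y))" by simp
  also have "\<dots> \<le> (hk_const T * t) * (rho_mass * (T + 1) / t)"
    using hk_const_pos[of T] assms by (intro mult_left_mono integral_rho_right_le) auto
  finally show ?thesis using assms by (simp add: mult_ac)
qed

lemma P_bound:
  assumes t: "0 < t" "t \<le> T" and f: "f \<in> borel_measurable borel" and B: "\<And>y. \<bar>f y\<bar> \<le> B"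
  shows "\<bar>P t f x\<bar> \<le> hk_const T * rho_mass * (T + 1) * B"
proof -
  have B0: "0 \<le> B" using B[of 0] by linarith
  have "\<bar>P t f x\<bar> \<le> (LINT y|lborel. \<bar>p t x y * f y\<bar>)" unfolding P_def by (rule integral_abs_bound)
  also have "\<dots> \<le> (LINT y|lborel. p t x y * B)"
    using p_nonneg[OF t(1)] B
    by (intro integral_mono integrable_abs integrable_p_mult[OF t(1) f B] Bochner_Integration.integrable_mult_left integrable_p t)
       (auto simp: abs_mult intro!: mult_left_mono)
  also have "\<dots> = (LINT y|lborel. p t x y) * B" by simp
  also have "\<dots> \<le> (hk_const T * rho_mass * (T + 1)) * B" by (intro mult_right_mono integral_p_le t B0)
  finally show ?thesis .
qed

lemma P_jointly_continuous:
  assumes f: "f \<in> borel_measurable borel" and B: "\<And>y. \<bar>f y\<bar> \<le> B"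
  shows "continuous_on ({0<..} \<times> UNIV) (\<lambda>(t, x). P t f x)"
proof (rule continuous_on_sequentiallyI)
  fix u :: "nat \<Rightarrow> real \<times> 'a" and a assume u: "\<forall>n. u n \<in> {0<..} \<times> UNIV" "a \<in> {0<..} \<times> UNIV" "u \<longlonglongrightarrow> a"
  obtain t x where a: "a = (t, x)" by fastforce
  have t: "0 < t" using u by (simp add: a)
  have B0: "0 \<le> B" using B[of 0] by linarith
  define s where "s n = fst (u n)" for n
  define w where "w n = snd (u n)" for n
  have s: "s \<longlonglongrightarrow> t" "\<And>n. 0 < s n" and w: "w \<longlonglongrightarrow> x"
    using tendsto_fst[OF u(3)] tendsto_snd[OF u(3)] u(1) by (auto simp: s_def[abs_def] w_def[abs_def] a mem_Times_iff)
  have "0 < radius (t/2)" using t by (intro radius_pos) simp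
  then have "\<forall>\<^sub>F n in sequentially. t/2 < s n \<and> s n < 2 * t \<and> dist (w n) x < radius (t/2)"
    using t by (intro eventually_conj order_tendstoD[OF s(1)] tendstoD[OF w]) auto
  then obtain N where N: "\<And>n. N \<le> n \<Longrightarrow> t/2 < s n \<and> s n < 2 * t \<and> dist (w n) x < radius (t/2)" by (auto simp: eventually_sequentially)
  let ?c = "hk_const (2*t)"
  let ?K = "4 * 2 ^ DIM('a) :: real"
  have "(\<lambda>n. P (s (n+N)) f (w (n+N))) \<longlonglongrightarrow> P t f x"
    unfolding P_def
  proof (rule integral_dominated_convergence[where w="\<lambda>y. (?c * (2*t) * ?K * B) * \<rho> (t/2) (x - y)"])
    show "(\<lambda>y. p t x y * f y) \<in> borel_measurable lborel" using p_measurable_right[OF t, of x] f by simp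
    show "(\<lambda>y. p (s (n+N)) (w (n+N)) y * f y) \<in> borel_measurable lborel" for n using p_measurable_right[OF s(2), of "n+N" "w (n+N)"] f by simp
    show "integrable lborel (\<lambda>y. (?c * (2*t) * ?K * B) * \<rho> (t/2) (x - y))" using t by (intro Bochner_Integration.integrable_mult_right integrable_rho_right) simp
    show "AE y in lborel. (\<lambda>n. p (s (n+N)) (w (n+N)) y * f y) \<longlonglongrightarrow> p t x y * f y"
      by (intro AE_I2 tendsto_mult tendsto_const p_continuous_at t LIMSEQ_ignore_initial_segment s w)
    show "AE y in lborel. norm (p (s (n+N)) (w (n+N)) y * f y) \<le> (?c * (2*t) * ?K * B) * \<rho> (t/2) (x - y)" for n
    proof (rule AE_I2)
      fix y
      let ?s = "s (n+N)" and ?w = "w (n+N)"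
      have n: "t/2 < ?s" "?s < 2*t" "dist ?w x < radius (t/2)" using N[of "n+N"] by auto
      have sp: "0 < ?s" using s(2) .
      have "norm (x - y) \<le> norm (?w - y) + norm (x - ?w)" by (metis norm_triangle_ineq diff_add_cancel add.commute add_diff_eq)
      also have "\<dots> \<le> radius (t/2) + 2 * norm (?w - y)" 
        using n(3) norm_ge_zero[of "?w - y"] unfolding dist_norm norm_minus_commute[of x] by linarith
      finally have "\<rho> (t/2) (?w - y) \<le> ?K * \<rho> (t/2) (x - y)" using t by (intro rho_le_of_half_le) auto
      moreover have "\<rho> ?s (?w - y) \<le> \<rho> (t/2) (?w - y)" using n t by (intro rho_antimono) auto
      ultimately have r: "\<rho> ?s (?w - y) \<le> ?K * \<rho> (t/2) (x - y)" by simp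
      have "p ?s ?w y \<le> ?c * ?s * \<rho> ?s (?w - y)" using n by (intro p_le sp) auto
      also have "\<dots> \<le> (?c * (2 * t)) * (?K * \<rho> (t/2) (x - y))"
        using r n sp hk_const_pos[of "2*t"] rho_nonneg[OF sp] by (intro mult_mono) auto
      finally have "\<bar>p ?s ?w y\<bar> * \<bar>f y\<bar> \<le> ((?c * (2 * t)) * (?K * \<rho> (t/2) (x - y))) * B"
        using p_nonneg[OF sp, of ?w y] B[of y] B0 by (intro mult_mono) auto
      then show "norm (p ?s ?w y * f y) \<le> (?c * (2*t) * ?K * B) * \<rho> (t/2) (x - y)" by (simp add: abs_mult mult_ac)
    qed
  qed
  then have "(\<lambda>n. P (s n) f (w n)) \<longlonglongrightarrow> P t f x" by (rule LIMSEQ_offset)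
  then show "(\<lambda>n. case u n of (t, x) \<Rightarrow> P t f x) \<longlonglongrightarrow> (case a of (t, x) \<Rightarrow> P t f x)"
    by (simp add: s_def w_def a case_prod_beta)
qed


lemma jump_measurable_pair:
  assumes t: "0 < t"
  shows "(\<lambda>(z, y). indicator {z. e < norm z} z * (jump_integrand \<kappa> J (\<lambda>u. p t u y) x z * c)) \<in> borel_measurable (lebesgue \<Otimes>\<^sub>M lborel)"
proof -
  have id: "(\<lambda>z::'a. z) \<in> lebesgue \<rightarrow>\<^sub>M borel" by (rule measurable_completion) simp
  have fst: "fst \<in> (lebesgue :: 'a measure) \<Otimes>\<^sub>M (lborel :: 'a measure) \<rightarrow>\<^sub>M borel"
    by (rule measurable_compose[OF measurable_fst id])
  have snd: "snd \<in> (lebesgue :: 'a measure) \<Otimes>\<^sub>M (lborel :: 'a measure) \<rightarrow>\<^sub>M borel"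
    using measurable_snd[of "lebesgue :: 'a measure" "lborel :: 'a measure"] by simp
  have sh: "(\<lambda>w. x + fst w) \<in> (lebesgue :: 'a measure) \<Otimes>\<^sub>M (lborel :: 'a measure) \<rightarrow>\<^sub>M borel" using fst by simp
  have "(\<lambda>w. (x + fst w, snd w)) \<in> (lebesgue :: 'a measure) \<Otimes>\<^sub>M (lborel :: 'a measure) \<rightarrow>\<^sub>M borel"
    unfolding borel_prod[symmetric] by (rule measurable_Pair[OF sh snd])
  from measurable_compose[OF this p_measurable2[OF t]]
  have 1: "(\<lambda>w. p t (x + fst w) (snd w)) \<in> borel_measurable ((lebesgue :: 'a measure) \<Otimes>\<^sub>M (lborel :: 'a measure))" by simp
  have 2: "(\<lambda>w. p t x (snd w)) \<in> borel_measurable ((lebesgue :: 'a measure) \<Otimes>\<^sub>M (lborel :: 'a measure))"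
    by (rule measurable_compose[OF snd p_measurable_right(1)[OF t]])
  have 3: "(\<lambda>w. \<kappa> x (fst w)) \<in> borel_measurable ((lebesgue :: 'a measure) \<Otimes>\<^sub>M (lborel :: 'a measure))"
    by (rule measurable_compose[OF measurable_fst \<kappa>_measurable_right])
  have 4: "(\<lambda>w. J (fst w)) \<in> borel_measurable ((lebesgue :: 'a measure) \<Otimes>\<^sub>M (lborel :: 'a measure))"
    by (rule measurable_compose[OF measurable_fst J_measurable])
  have 5: "(\<lambda>w. indicator {z. e < norm z} (fst w) :: real) \<in> borel_measurable ((lebesgue :: 'a measure) \<Otimes>\<^sub>M (lborel :: 'a measure))"
    by (rule measurable_compose[OF fst]) simp
  show ?thesis unfolding jump_integrand_def case_prod_beta
    by (intro borel_measurable_times borel_measurable_diff 1 2 3 4 5 borel_measurable_const)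
qed

lemma trunc_op_p_measurable:
  assumes t: "0 < t" shows "(\<lambda>y. trunc_op \<kappa> J e (\<lambda>u. p t u y) x) \<in> borel_measurable borel"
proof -
  interpret L: sigma_finite_measure "lebesgue :: 'a measure" by (rule sigma_finite_lebesgue)
  have "(\<lambda>w. (\<lambda>(z, y). indicator {z. e < norm z} z * (jump_integrand \<kappa> J (\<lambda>u. p t u y) x z * 1)) (snd w, fst w))
      \<in> borel_measurable (lborel \<Otimes>\<^sub>M lebesgue)"
    using measurable_compose[OF measurable_pair_swap' jump_measurable_pair[OF t, of e x 1]] by (simp add: case_prod_beta)
  then have "(\<lambda>(y, z). indicator {z. e < norm z} z * jump_integrand \<kappa> J (\<lambda>u. p t u y) x z) \<in> borel_measurable (lborel \<Otimes>\<^sub>M lebesgue)"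
    by (simp add: case_prod_beta)
  from L.borel_measurable_lebesgue_integral[OF this] show ?thesis
    by (simp add: trunc_op_def set_lebesgue_integral_def)
qed

lemma q_measurable_right: assumes t: "0 < t" shows "q t x \<in> borel_measurable borel"
proof (rule borel_measurable_LIMSEQ_real)
  show "(\<lambda>n. trunc_op \<kappa> J (1 / real (Suc n)) (\<lambda>u. p t u y) x) \<longlonglongrightarrow> q t x y" for y
    by (rule tendsto_at_right_inverse_Suc) (use has_gen_p[OF t, of y x] in \<open>simp add: has_gen_def\<close>)
  show "(\<lambda>y. trunc_op \<kappa> J (1 / real (Suc n)) (\<lambda>u. p t u y) x) \<in> borel_measurable borel" for n
    by (rule trunc_op_p_measurable[OF t])
qed

text \<open>
  Fubini's theorem; away from the origin \<open>J\<close> is integrable.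
\<close>

lemma truncated_P:
  assumes t: "0 < t" and fm: "f \<in> borel_measurable borel" and B: "\<And>y. \<bar>f y\<bar> \<le> B" and e: "0 < e"
  shows "set_integrable lebesgue {z. e < norm z} (jump_integrand \<kappa> J (P t f) x)"
    and "trunc_op \<kappa> J e (P t f) x = (LINT y|lborel. trunc_op \<kappa> J e (\<lambda>u. p t u y) x * f y)"
proof -
  interpret L: sigma_finite_measure "lebesgue :: 'a measure" by (rule sigma_finite_lebesgue)
  interpret LB: pair_sigma_finite "lebesgue :: 'a measure" "lborel :: 'a measure" ..
  let ?G = "\<lambda>z y. indicator {z. e < norm z} z * (jump_integrand \<kappa> J (\<lambda>u. p t u y) x z * f y)"
  have B0: "0 \<le> B" using B[of 0] by linarith
  let ?A = "hk_const t * rho_mass * (t + 1)"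
  have A0: "0 \<le> ?A" using hk_const_pos[of t] rho_mass_pos t by simp
  have meas: "(\<lambda>(z, y). ?G z y) \<in> borel_measurable (lebesgue \<Otimes>\<^sub>M lborel)"
  proof -
    have "(\<lambda>w. f (snd w)) \<in> borel_measurable ((lebesgue :: 'a measure) \<Otimes>\<^sub>M (lborel :: 'a measure))"
      using measurable_compose[OF measurable_snd, of f lborel borel] fm by simp
    from borel_measurable_times[OF jump_measurable_pair[OF t, of e x 1] this]
    show ?thesis by (simp add: case_prod_beta mult.assoc)
  qed
  have Gi: "integrable lborel (?G z)" for z
  proof -
    have "?G z = (\<lambda>y. (indicator {z. e < norm z} z * \<kappa> x z * J z) * (p t (x + z) y * f y - p t x y * f y))"
      by (rule ext) (simp add: jump_integrand_def algebra_simps)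
    then show ?thesis
      using integrable_p_mult[OF t fm B] by (auto intro!: Bochner_Integration.integrable_mult_right Bochner_Integration.integrable_diff)
  qed
  have G_eq: "(LINT y|lborel. ?G z y) = indicator {z. e < norm z} z *\<^sub>R jump_integrand \<kappa> J (P t f) x z" for z
  proof -
    have "(LINT y|lborel. ?G z y) = (LINT y|lborel. (indicator {z. e < norm z} z * \<kappa> x z * J z) * (p t (x + z) y * f y - p t x y * f y))"
      by (intro Bochner_Integration.integral_cong refl) (simp add: jump_integrand_def algebra_simps)
    also have "\<dots> = (indicator {z. e < norm z} z * \<kappa> x z * J z) * (P t f (x + z) - P t f x)"
      unfolding P_def by (simp add: Bochner_Integration.integral_diff[OF integrable_p_mult[OF t fm B] integrable_p_mult[OF t fm B]])
    finally show ?thesis by (simp add: jump_integrand_def mult_ac)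
  qed
  have G_norm: "(LINT y|lborel. norm (?G z y)) \<le> (2 * ?A * B * \<kappa>\<^sub>1) * (indicator {z. e < norm z} z *\<^sub>R J z)" for z
  proof -
    have pt: "norm (?G z y) \<le> (indicator {z. e < norm z} z * \<kappa>\<^sub>1 * J z * B) * (p t (x + z) y + p t x y)" for y
    proof -
      have "norm (?G z y) = indicator {z. e < norm z} z * (\<bar>p t (x + z) y - p t x y\<bar> * \<kappa> x z * J z * \<bar>f y\<bar>)"
        using J_pos[of z] \<kappa>_bounds[of x z] by (simp add: jump_integrand_def abs_mult)
      also have "\<dots> \<le> indicator {z. e < norm z} z * ((p t (x + z) y + p t x y) * \<kappa>\<^sub>1 * J z * B)"
        using p_nonneg[OF t, of "x+z" y] p_nonneg[OF t, of x y] J_pos[of z] \<kappa>_bounds[of x z] B[of y] \<kappa>\<^sub>1_nonneg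
        by (intro mult_left_mono mult_mono mult_nonneg_nonneg) (auto simp: less_imp_le)
      finally show ?thesis by (simp add: mult_ac)
    qed
    have "(LINT y|lborel. norm (?G z y)) \<le> (LINT y|lborel. (indicator {z. e < norm z} z * \<kappa>\<^sub>1 * J z * B) * (p t (x + z) y + p t x y))"
      by (intro integral_mono integrable_norm Gi Bochner_Integration.integrable_mult_right Bochner_Integration.integrable_add integrable_p t pt)
    also have "\<dots> = (indicator {z. e < norm z} z * \<kappa>\<^sub>1 * J z * B) * ((LINT y|lborel. p t (x + z) y) + (LINT y|lborel. p t x y))"
      by (simp add: Bochner_Integration.integral_add[OF integrable_p integrable_p] t)
    also have "\<dots> \<le> (indicator {z. e < norm z} z * \<kappa>\<^sub>1 * J z * B) * (?A + ?A)"
      using J_pos[of z] \<kappa>\<^sub>1_nonneg B0 by (intro mult_left_mono add_mono integral_p_le t order_refl mult_nonneg_nonneg) (auto simp: less_imp_le)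
    finally show ?thesis by (simp add: mult_ac)
  qed
  have int: "integrable (lebesgue \<Otimes>\<^sub>M lborel) (\<lambda>(z, y). ?G z y)"
  proof (rule LB.Fubini_integrable[OF meas])
    show "integrable lebesgue (\<lambda>z. LINT y|lborel. norm ((\<lambda>(z, y). ?G z y) (z, y)))"
    proof (rule Bochner_Integration.integrable_bound)
      show "integrable lebesgue (\<lambda>z. (2 * ?A * B * \<kappa>\<^sub>1) * (indicator {z. e < norm z} z *\<^sub>R J z))"
        using set_integrable_J[OF e] unfolding set_integrable_def by (rule Bochner_Integration.integrable_mult_right)
      have "(\<lambda>(z, y). norm (?G z y)) \<in> borel_measurable (lebesgue \<Otimes>\<^sub>M lborel)"
        using measurable_compose[OF meas borel_measurable_norm] by (simp add: case_prod_beta)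
      from lborel.borel_measurable_lebesgue_integral[OF this]
      show "(\<lambda>z. LINT y|lborel. norm ((\<lambda>(z, y). ?G z y) (z, y))) \<in> borel_measurable lebesgue" by simp
      show "AE z in lebesgue. norm (LINT y|lborel. norm ((\<lambda>(z, y). ?G z y) (z, y)))
          \<le> norm ((2 * ?A * B * \<kappa>\<^sub>1) * (indicator {z. e < norm z} z *\<^sub>R J z))"
      proof (rule AE_I2)
        fix z
        have "0 \<le> (LINT y|lborel. norm (?G z y))" by (rule integral_nonneg_AE) simp
        then show "norm (LINT y|lborel. norm ((\<lambda>(z, y). ?G z y) (z, y)))
          \<le> norm ((2 * ?A * B * \<kappa>\<^sub>1) * (indicator {z. e < norm z} z *\<^sub>R J z))"
          using G_norm[of z] by (simp only: real_norm_def prod.case)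
      qed
    qed
    show "AE z in lebesgue. integrable lborel (\<lambda>y. (\<lambda>(z, y). ?G z y) (z, y))" using Gi by simp
  qed
  from LB.integrable_fst[OF int] show "set_integrable lebesgue {z. e < norm z} (jump_integrand \<kappa> J (P t f) x)"
    unfolding set_integrable_def G_eq .
  have "trunc_op \<kappa> J e (P t f) x = (LINT z|lebesgue. LINT y|lborel. ?G z y)"
    unfolding G_eq trunc_op_def set_lebesgue_integral_def ..
  also have "\<dots> = (LINT y|lborel. LINT z|lebesgue. ?G z y)"
    using LB.Fubini_integral[OF int] by simp
  also have "\<dots> = (LINT y|lborel. trunc_op \<kappa> J e (\<lambda>u. p t u y) x * f y)"
    unfolding trunc_op_def set_lebesgue_integral_def
    by (intro Bochner_Integration.integral_cong refl) (simp add: mult.assoc[symmetric])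
  finally show "trunc_op \<kappa> J e (P t f) x = (LINT y|lborel. trunc_op \<kappa> J e (\<lambda>u. p t u y) x * f y)" .
qed

text \<open>
  The kernel \<open>q\<close> is the time derivative of \<open>p\<close> and also \<open>\<L>\<close> applied to \<open>p\<close>, so \<open>Q\<close> plays both roles for \<open>P\<close>.
\<close>

definition Q :: "real \<Rightarrow> ('a \<Rightarrow> real) \<Rightarrow> 'a \<Rightarrow> real" where "Q t f x = (LINT y|lborel. q t x y * f y)"

text \<open>
  The truncated operators applied to \<open>p\<close>, and the time derivative of \<open>p\<close>, are dominated by multiples of \<open>\<rho>\<close>, which
  is integrable in \<open>y\<close>. So both limits pass under the integral sign.
\<close>

lemma
  assumes t: "0 < t" and fm: "f \<in> borel_measurable borel" and B: "\<And>y. \<bar>f y\<bar> \<le> B"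
  shows has_gen_P: "has_gen (P t f) x (Q t f x)"
    and P_has_derivative: "((\<lambda>s. P s f x) has_real_derivative Q t f x) (at t)"
    and Q_bound: "t \<le> T \<Longrightarrow> \<bar>Q t f x\<bar> \<le> hk_const T * (rho_mass * (T + 1) / t) * B"
proof -
  have B0: "0 \<le> B" using B[of 0] by linarith
  have prod_le: "\<bar>a * f y\<bar> \<le> (hk_const S * B) * \<rho> s (x - y)" if "\<bar>a\<bar> \<le> hk_const S * \<rho> s (x - y)" "0 < s" for a s S y
  proof -
    have "\<bar>a\<bar> * \<bar>f y\<bar> \<le> (hk_const S * \<rho> s (x - y)) * B"
      using that B[of y] B0 hk_const_pos[of S] rho_nonneg[of s] by (intro mult_mono) auto
    then show ?thesis by (simp add: abs_mult mult_ac)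
  qed
  have wi: "integrable lborel (\<lambda>y. (hk_const S * B) * \<rho> s (x - y))" if "0 < s" for s S
    using that by (intro Bochner_Integration.integrable_mult_right integrable_rho_right)
  have qfm: "(\<lambda>y. q s x y * f y) \<in> borel_measurable lborel" if "0 < s" for s
    using q_measurable_right[OF that, of x] fm by simp
  have "((\<lambda>e. LINT y|lborel. trunc_op \<kappa> J e (\<lambda>u. p t u y) x * f y) \<longlongrightarrow> Q t f x) (at_right 0)"
    unfolding Q_def
  proof (rule tendsto_integral_at_right[where r=1 and w="\<lambda>y. (hk_const t * B) * \<rho> t (x - y)"])
    show "(\<lambda>y. q t x y * f y) \<in> borel_measurable lborel" by (rule qfm[OF t])
    show "(\<lambda>y. trunc_op \<kappa> J e (\<lambda>u. p t u y) x * f y) \<in> borel_measurable lborel" for e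
      using trunc_op_p_measurable[OF t, of e x] fm by simp
    show "integrable lborel (\<lambda>y. (hk_const t * B) * \<rho> t (x - y))" by (rule wi[OF t])
    show "AE y in lborel. ((\<lambda>e. trunc_op \<kappa> J e (\<lambda>u. p t u y) x * f y) \<longlongrightarrow> q t x y * f y) (at_right 0)"
      using has_gen_p[OF t] by (intro AE_I2 tendsto_mult tendsto_const) (simp add: has_gen_def)
    show "AE y in lborel. norm (trunc_op \<kappa> J e (\<lambda>u. p t u y) x * f y) \<le> (hk_const t * B) * \<rho> t (x - y)" if "0 < e" "e < 1" for e
      unfolding real_norm_def using that by (intro AE_I2 prod_le trunc_op_p_le t) auto
  qed simp
  moreover have "\<forall>\<^sub>F e in at_right 0. (LINT y|lborel. trunc_op \<kappa> J e (\<lambda>u. p t u y) x * f y) = trunc_op \<kappa> J e (P t f) x"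
    using eventually_at_right_less[of 0] by eventually_elim (simp add: truncated_P(2)[OF t fm B])
  ultimately have "((\<lambda>e. trunc_op \<kappa> J e (P t f) x) \<longlongrightarrow> Q t f x) (at_right 0)" by (rule Lim_transform_eventually)
  then show "has_gen (P t f) x (Q t f x)" unfolding has_gen_def using truncated_P(1)[OF t fm B] by blast
  show "((\<lambda>s. P s f x) has_real_derivative Q t f x) (at t)"
    unfolding P_def Q_def
  proof (rule has_field_derivative_integral_dominated(2)[where r="t/2" and g="\<lambda>y. (hk_const (2*t) * B) * \<rho> (t/2) (x - y)" and f'="\<lambda>s y. q s x y * f y"])
    show "0 < t / 2" using t by simp
    show "integrable lborel (\<lambda>y. p s x y * f y)" if "s \<in> ball t (t/2)" for s
      using that t by (intro integrable_p_mult[OF _ fm B]) (auto simp: dist_real_def abs_real_def split: if_splits)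
    show "(\<lambda>y. q t x y * f y) \<in> borel_measurable lborel" by (rule qfm[OF t])
    show "integrable lborel (\<lambda>y. (hk_const (2*t) * B) * \<rho> (t/2) (x - y))" using t by (intro wi) simp
    have "AE y in lborel. y \<noteq> x" by (rule AE_lborel_singleton)
    then show "AE y in lborel. \<forall>s\<in>ball t (t/2). ((\<lambda>s. p s x y * f y) has_real_derivative q s x y * f y) (at s) \<and>
        norm (q s x y * f y) \<le> (hk_const (2*t) * B) * \<rho> (t/2) (x - y)"
    proof eventually_elim
      case (elim y)
      show ?case
      proof (intro ballI conjI)
        fix s assume "s \<in> ball t (t/2)"
        then have s: "t/2 < s" "s < 2*t" using t by (auto simp: dist_real_def abs_real_def split: if_splits)
        then have s0: "0 < s" using t by simp
        show "((\<lambda>s. p s x y * f y) has_real_derivative q s x y * f y) (at s)"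
          using p_derivative[OF s0, of x y] elim by (intro DERIV_cmult_right) auto
        have "\<bar>q s x y\<bar> \<le> hk_const (2*t) * \<rho> s (x - y)" using s by (intro q_le s0) auto
        also have "\<dots> \<le> hk_const (2*t) * \<rho> (t/2) (x - y)"
          using hk_const_pos[of "2*t"] s t by (intro mult_left_mono rho_antimono) auto
        finally show "norm (q s x y * f y) \<le> (hk_const (2*t) * B) * \<rho> (t/2) (x - y)"
          unfolding real_norm_def using t by (intro prod_le) auto
      qed
    qed
  qed
  show "\<bar>Q t f x\<bar> \<le> hk_const T * (rho_mass * (T + 1) / t) * B" if T: "t \<le> T"
  proof -
    have qi: "integrable lborel (\<lambda>y. q t x y * f y)"
      by (rule Bochner_Integration.integrable_bound[OF wi[OF t] qfm[OF t], of T])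
         (use prod_le[OF q_le[OF t T] t] in \<open>auto intro!: AE_I2 intro: order_trans[OF _ abs_ge_self]\<close>)
    have "\<bar>Q t f x\<bar> \<le> (LINT y|lborel. \<bar>q t x y * f y\<bar>)" unfolding Q_def by (rule integral_abs_bound)
    also have "\<dots> \<le> (LINT y|lborel. (hk_const T * B) * \<rho> t (x - y))"
      by (intro integral_mono integrable_abs qi wi t prod_le q_le T)
    also have "\<dots> = (hk_const T * B) * (LINT y|lborel. \<rho> t (x - y))" by simp
    also have "\<dots> \<le> (hk_const T * B) * (rho_mass * (T + 1) / t)"
      using hk_const_pos[of T] B0 by (intro mult_left_mono integral_rho_right_le t T) auto
    finally show ?thesis by (simp add: mult_ac)
  qed
qed

section \<open>The generator\<close>

text \<open>
  The function \<open>P \<eta> h\<close> replaces \<open>h = \<L> f\<close> because the operator can be applied to it. The comparison function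
  \<open>P t f - f - t * P \<eta> h\<close> vanishes at time zero and solves the evolution equation with right-hand side
  \<open>(h - P \<eta> h) + t * Q \<eta> h\<close>.
\<close>

theorem generator:
  assumes f: "f \<in> C_b2 \<epsilon>" and \<epsilon>: "0 < \<epsilon>"
  shows "nonlocal_defined \<kappa> J 0 f x"
    and "uniform_limit UNIV (\<lambda>t x. (kernel_semigroup p t f x - f x) / t) (nonlocal_op \<kappa> J 0 f) (at_right 0)"
proof -
  obtain h where h: "\<And>x. has_gen f x (h x)" and hb: "bounded (range h)" and hu: "uniformly_continuous_on UNIV h"
    using C_b2_generator(1)[OF f \<epsilon>] by blast
  note fb = C_b2_generator(2)[OF f \<epsilon>] and fu = C_b2_generator(3)[OF f \<epsilon>]
  show "nonlocal_defined \<kappa> J 0 f x" by (rule has_gen_imp(1)[OF h])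
  have hop: "nonlocal_op \<kappa> J 0 f = h" using has_gen_imp(2)[OF h] by (intro ext)
  have fm: "f \<in> borel_measurable borel" and fc: "continuous_on UNIV f"
    using uniformly_continuous_imp_continuous[OF fu] by (auto intro: borel_measurable_continuous_onI)
  have hm: "h \<in> borel_measurable borel" and hc: "continuous_on UNIV h"
    using uniformly_continuous_imp_continuous[OF hu] by (auto intro: borel_measurable_continuous_onI)
  obtain Bf where Bf: "\<And>x. \<bar>f x\<bar> \<le> Bf" using fb by (auto simp: bounded_iff)
  obtain Bh where Bh: "\<And>x. \<bar>h x\<bar> \<le> Bh" using hb by (auto simp: bounded_iff)
  have Pf0: "\<And>e. 0 < e \<Longrightarrow> \<exists>\<tau>>0. \<forall>t. 0 < t \<longrightarrow> t < \<tau> \<longrightarrow> (\<forall>x. \<bar>P t f x - f x\<bar> < e)"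
    using p_initial[OF fb fu] by (auto simp: uniform_limit_iff eventually_at_right_field dist_real_def kernel_semigroup_eq_P fm)
  have Ph0: "\<And>e. 0 < e \<Longrightarrow> \<exists>\<tau>>0. \<forall>t. 0 < t \<longrightarrow> t < \<tau> \<longrightarrow> (\<forall>x. \<bar>P t h x - h x\<bar> < e)"
    using p_initial[OF hb hu] by (auto simp: uniform_limit_iff eventually_at_right_field dist_real_def kernel_semigroup_eq_P hm)
  show "uniform_limit UNIV (\<lambda>t x. (kernel_semigroup p t f x - f x) / t) (nonlocal_op \<kappa> J 0 f) (at_right 0)"
    unfolding hop uniform_limit_iff
  proof (intro allI impI)
    fix e :: real assume e: "0 < e"
    obtain \<tau> where \<tau>: "0 < \<tau>" "\<And>t x. 0 < t \<Longrightarrow> t < \<tau> \<Longrightarrow> \<bar>P t h x - h x\<bar> < e / 4" using Ph0[of "e/4"] e by auto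
    define \<eta> where "\<eta> = \<tau> / 2"
    have \<eta>: "0 < \<eta>" "\<eta> < \<tau>" using \<tau> by (auto simp: \<eta>_def)
    define C where "C = hk_const \<eta> * (rho_mass * (\<eta> + 1) / \<eta>) * Bh"
    define D where "D = hk_const \<eta> * rho_mass * (\<eta> + 1) * Bh"
    define A where "A = hk_const 1 * rho_mass * (1 + 1) * Bf"
    have C: "\<bar>Q \<eta> h x\<bar> \<le> C" for x unfolding C_def by (rule Q_bound[OF \<eta>(1) hm Bh]) simp
    have C0: "0 \<le> C" using C[of 0] by linarith
    have D: "\<bar>P \<eta> h x\<bar> \<le> D" for x unfolding D_def by (rule P_bound[OF \<eta>(1) _ hm Bh]) simp
    have D0: "0 \<le> D" using D[of 0] by linarith
    (* C bounds Q \<eta> h and blows up as \<eta> tends to zero; since \<eta> is fixed, t * C is small for t \<le> T. *)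
    define T where "T = min 1 (e / (4 * (C + 1)))"
    have T: "0 < T" "T \<le> 1" using e C0 by (auto simp: T_def)
    have A: "\<bar>P t f x\<bar> \<le> A" if "0 < t" "t \<le> T" for t x unfolding A_def using that T by (intro P_bound[OF _ _ fm Bf]) auto
    have TC: "T * C \<le> e / 4"
    proof -
      have "T * C \<le> T * (C + 1)" using T by simp
      also have "\<dots> \<le> (e / (4 * (C + 1))) * (C + 1)" using C0 by (intro mult_right_mono) (auto simp: T_def)
      also have "\<dots> = e / 4" using C0 by (simp add: divide_simps)
      finally show ?thesis .
    qed
    have key: "s * (P t f x - f x - t * P \<eta> h x) \<le> 0 + (e / 2) * t" if s: "s = 1 \<or> s = -1" and t: "0 < t" "t \<le> T" for s t x
    proof (rule maximum_principle[where v="\<lambda>t x. s * (P t f x - f x - t * P \<eta> h x)" and T=T and B="A + Bf + T * D"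
          and v'="\<lambda>t x. s * (Q t f x - P \<eta> h x)" and l="\<lambda>t x. s * (Q t f x - h x - t * Q \<eta> h x)"])
      have "continuous_on ({0<..T} \<times> UNIV) (\<lambda>(t, x). P t f x)"
        by (rule continuous_on_subset[OF P_jointly_continuous[OF fm Bf]]) auto
      moreover have "continuous_on UNIV (P \<eta> h)"
      proof -
        have "continuous_on UNIV ((\<lambda>(t, x). P t h x) \<circ> (\<lambda>x. (\<eta>, x)))"
          by (rule continuous_on_compose[OF _ continuous_on_subset[OF P_jointly_continuous[OF hm Bh]]])
             (use \<eta> in \<open>auto intro!: continuous_intros\<close>)
        then show ?thesis by (simp add: o_def)
      qed
      then have "continuous_on ({0<..T} \<times> UNIV) (\<lambda>w. P \<eta> h (snd w))"
        by (rule continuous_on_compose2) (auto intro!: continuous_intros)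
      moreover have "continuous_on ({0<..T} \<times> UNIV) (\<lambda>w. f (snd w))"
        by (rule continuous_on_compose2[OF fc]) (auto intro!: continuous_intros)
      ultimately show "continuous_on ({0<..T} \<times> UNIV) (\<lambda>(t, x). s * (P t f x - f x - t * P \<eta> h x))"
        unfolding case_prod_beta by (intro continuous_intros)
      show "s * (P t f x - f x - t * P \<eta> h x) \<le> A + Bf + T * D" if "0 < t" "t \<le> T" for t x
      proof -
        have "\<bar>t * P \<eta> h x\<bar> \<le> T * D" unfolding abs_mult using that D[of x] T by (intro mult_mono) auto
        then show ?thesis using A[OF that, of x] Bf[of x] s by auto
      qed
      show "((\<lambda>t. s * (P t f x - f x - t * P \<eta> h x)) has_real_derivative s * (Q t f x - P \<eta> h x)) (at t)" if "0 < t" for t x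
        by (auto intro!: derivative_eq_intros P_has_derivative[OF that fm Bf])
      show "has_gen (\<lambda>x. s * (P t f x - f x - t * P \<eta> h x)) x (s * (Q t f x - h x - t * Q \<eta> h x))" if "0 < t" for t x
        by (intro has_gen_cmult has_gen_diff has_gen_P[OF that fm Bf] has_gen_P[OF \<eta>(1) hm Bh] h)
      show "s * (Q t f x - P \<eta> h x) \<le> s * (Q t f x - h x - t * Q \<eta> h x) + e / 2" if "0 < t" "t \<le> T" for t x
      proof -
        have "\<bar>t * Q \<eta> h x\<bar> \<le> T * C" unfolding abs_mult using that C[of x] T by (intro mult_mono) auto
        then have b: "\<bar>t * Q \<eta> h x\<bar> \<le> e / 4" using TC by linarith
        have a: "\<bar>P \<eta> h x - h x\<bar> < e / 4" by (rule \<tau>(2)[OF \<eta>])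
        have "s * (u - v) \<le> s * (u - w - y) + e / 2" if "\<bar>v - w\<bar> < e / 4" "\<bar>y\<bar> \<le> e / 4" for u v w y :: real
        proof -
          have "u - v \<le> u - w - y + e / 2" "- (u - v) \<le> - (u - w - y) + e / 2" using that by linarith+
          then show ?thesis using s by auto
        qed
        from this[OF a b] show ?thesis .
      qed
      show "\<exists>\<tau>>0. \<forall>t x. 0 < t \<longrightarrow> t < \<tau> \<longrightarrow> s * (P t f x - f x - t * P \<eta> h x) \<le> 0 + \<eta>'" if "0 < \<eta>'" for \<eta>'
      proof -
        obtain \<tau>1 where \<tau>1: "0 < \<tau>1" "\<And>t x. 0 < t \<Longrightarrow> t < \<tau>1 \<Longrightarrow> \<bar>P t f x - f x\<bar> < \<eta>' / 2" using Pf0[of "\<eta>'/2"] \<open>0 < \<eta>'\<close> by auto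
        let ?\<tau> = "min \<tau>1 (\<eta>' / (2 * (D + 1)))"
        have "s * (P t f x - f x - t * P \<eta> h x) \<le> 0 + \<eta>'" if t: "0 < t" "t < ?\<tau>" for t x
        proof -
          have "\<bar>t * P \<eta> h x\<bar> \<le> (\<eta>' / (2 * (D + 1))) * (D + 1)" unfolding abs_mult using t D[of x] D0 by (intro mult_mono) auto
          also have "\<dots> = \<eta>' / 2" using D0 by (simp add: divide_simps)
          finally have "\<bar>t * P \<eta> h x\<bar> \<le> \<eta>' / 2" .
          moreover have "\<bar>P t f x - f x\<bar> < \<eta>' / 2" using t by (intro \<tau>1(2)) auto
          ultimately have "P t f x - f x - t * P \<eta> h x \<le> \<eta>'" "- (P t f x - f x - t * P \<eta> h x) \<le> \<eta>'" by linarith+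
          then show ?thesis using s by auto
        qed
        then show ?thesis using \<tau>1(1) that D0 by (intro exI[of _ ?\<tau>]) auto
      qed
    qed (use e t in auto)
    have "dist ((kernel_semigroup p t f x - f x) / t) (h x) < e" if t: "0 < t" "t < T" for t x
    proof -
      have "\<bar>P t f x - f x - t * P \<eta> h x\<bar> \<le> (e / 2) * t" using key[of 1 t x] key[of "-1" t x] t by (intro abs_leI) simp_all
      then have "\<bar>(P t f x - f x - t * P \<eta> h x) / t\<bar> \<le> e / 2" using t by (simp add: abs_divide divide_le_eq)
      moreover have "(P t f x - f x - t * P \<eta> h x) / t = (P t f x - f x) / t - P \<eta> h x" using t by (simp add: diff_divide_distrib)
      ultimately have "\<bar>(P t f x - f x) / t - h x\<bar> < e" using \<tau>(2)[OF \<eta>, of x] e by linarith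
      then show ?thesis using t by (simp add: kernel_semigroup_eq_P fm dist_real_def)
    qed
    then show "\<forall>\<^sub>F t in at_right 0. \<forall>x\<in>UNIV. dist ((kernel_semigroup p t f x - f x) / t) (h x) < e"
      using T by (auto simp: eventually_at_right_field)
  qed
qed

end

section \<open>The Chapman-Kolmogorov equation\<close>

lemma uniformly_continuous_vanishing:
  fixes g :: "'a::euclidean_space \<Rightarrow> real"
  assumes c: "continuous_on UNIV g" and v: "\<And>e. 0 < e \<Longrightarrow> \<exists>R. \<forall>x. R \<le> norm x \<longrightarrow> \<bar>g x\<bar> < e"
  shows "uniformly_continuous_on UNIV g"
  unfolding uniformly_continuous_on_def
proof (intro allI impI)
  fix e :: real assume e: "0 < e"
  obtain R where R: "\<And>x. R \<le> norm x \<Longrightarrow> \<bar>g x\<bar> < e / 2" using v[of "e/2"] e by auto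
  have "uniformly_continuous_on (cball 0 (R + 1)) g"
    by (rule compact_uniformly_continuous[OF continuous_on_subset[OF c]]) auto
  then obtain d where d: "0 < d" "\<And>x x'. norm x \<le> R + 1 \<Longrightarrow> norm x' \<le> R + 1 \<Longrightarrow> dist x' x < d \<Longrightarrow> dist (g x') (g x) < e"
    unfolding uniformly_continuous_on_def using e by (auto simp: dist_norm)
  have "dist (g x') (g x) < e" if xx: "dist x' x < min d 1" for x x'
  proof (cases "norm x \<le> R \<or> norm x' \<le> R")
    case True
    have "norm x \<le> norm x' + dist x' x" "norm x' \<le> norm x + dist x' x"
      using norm_triangle_ineq2[of x x'] norm_triangle_ineq2[of x' x] by (simp_all add: dist_norm norm_minus_commute)
    then have "norm x \<le> R + 1" "norm x' \<le> R + 1" using True xx by auto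
    then show ?thesis using d(2) xx by simp
  next
    case False
    then have "\<bar>g x\<bar> < e / 2" "\<bar>g x'\<bar> < e / 2" using R by auto
    then show ?thesis unfolding dist_real_def by linarith
  qed
  then show "\<exists>d>0. \<forall>x\<in>UNIV. \<forall>x'\<in>UNIV. dist x' x < d \<longrightarrow> dist (g x') (g x) < e"
    using d(1) by (intro exI[of _ "min d 1"]) auto
qed

context heat_kernel begin

text \<open>
  With continuity, vanishing at infinity makes \<open>P t f\<close> uniformly continuous, so that the initial condition,
  which concerns uniformly continuous functions, applies to \<open>P t f\<close> itself.
\<close>

lemma P_vanishes:
  assumes t: "0 < t" and fm: "f \<in> borel_measurable borel" and B: "\<And>y. \<bar>f y\<bar> \<le> B"
    and supp: "\<And>y. R0 < norm y \<Longrightarrow> f y = 0" and e: "0 < e"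
  shows "\<exists>R. \<forall>x. R \<le> norm x \<longrightarrow> \<bar>P t f x\<bar> < e"
proof -
  have B0: "0 \<le> B" using B[of 0] by linarith
  define V where "V = hk_const t * t * B * measure lborel (cball (0::'a) R0)"
  have V: "0 \<le> V" using hk_const_pos[of t] t B0 by (simp add: V_def)
  have "\<forall>\<^sub>F r in at_top. profile DIM('a) r < e / (V + 1)"
    using order_tendstoD(2)[OF profile_tendsto_0[OF DIM_positive[where 'a='a]], of "e / (V + 1)"] e V by simp
  then obtain r0 where r0: "\<And>r. r0 \<le> r \<Longrightarrow> profile DIM('a) r < e / (V + 1)" by (auto simp: eventually_at_top_linorder)
  define r where "r = max r0 1"
  have r: "0 < r" "profile DIM('a) r < e / (V + 1)" using r0[of r] by (auto simp: r_def)
  have "\<bar>P t f x\<bar> < e" if x: "R0 + r \<le> norm x" for x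
  proof -
    have pt: "\<bar>p t x y * f y\<bar> \<le> (hk_const t * t * B * profile DIM('a) r) * indicator (cball (0::'a) R0) y" for y
    proof (cases "norm y \<le> R0")
      case True
      have "r \<le> norm (x - y)" using norm_triangle_ineq2[of x y] x True by linarith
      then have "\<rho> t (x - y) \<le> profile DIM('a) r" using r t by (intro rho_le_profile) auto
      then have "hk_const t * t * \<rho> t (x - y) \<le> hk_const t * t * profile DIM('a) r"
        using hk_const_pos[of t] t by (intro mult_left_mono) auto
      then have "p t x y \<le> hk_const t * t * profile DIM('a) r" using p_le[OF t order_refl, of x y] by simp
      then have "\<bar>p t x y\<bar> * \<bar>f y\<bar> \<le> (hk_const t * t * profile DIM('a) r) * B"
        using p_nonneg[OF t, of x y] B[of y] B0 by (intro mult_mono) auto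
      then show ?thesis using True by (simp add: abs_mult mult_ac)
    next
      case False
      then show ?thesis using supp[of y] by simp
    qed
    have "\<bar>P t f x\<bar> \<le> (LINT y|lborel. \<bar>p t x y * f y\<bar>)" unfolding P_def by (rule integral_abs_bound)
    also have "\<dots> \<le> (LINT y|lborel. (hk_const t * t * B * profile DIM('a) r) * indicator (cball (0::'a) R0) y)"
    proof (rule integral_mono)
      show "integrable lborel (\<lambda>y. \<bar>p t x y * f y\<bar>)" by (rule integrable_abs[OF integrable_p_mult[OF t fm B]])
      have "integrable lborel (indicator (cball 0 R0) :: 'a \<Rightarrow> real)"
        by (rule integrable_real_indicator) (simp, rule emeasure_lborel_cball_finite)
      then show "integrable lborel (\<lambda>y. (hk_const t * t * B * profile DIM('a) r) * indicator (cball (0::'a) R0) y)"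
        by (rule Bochner_Integration.integrable_mult_right)
      show "\<bar>p t x y * f y\<bar> \<le> (hk_const t * t * B * profile DIM('a) r) * indicator (cball (0::'a) R0) y" for y by (rule pt)
    qed
    also have "\<dots> = V * profile DIM('a) r" by (simp add: V_def mult_ac)
    also have "\<dots> \<le> V * (e / (V + 1))" using r V by (intro mult_left_mono) auto
    also have "\<dots> < e"
    proof -
      have "V * e < e * (V + 1)" using e V by (simp add: algebra_simps)
      then show ?thesis using V by (simp add: divide_simps)
    qed
    finally show ?thesis .
  qed
  then show ?thesis by blast
qed

lemma P_continuous:
  assumes "0 < t" "f \<in> borel_measurable borel" "\<And>y. \<bar>f y\<bar> \<le> B"
  shows "continuous_on UNIV (P t f)"
proof -
  have "continuous_on UNIV ((\<lambda>(t, x). P t f x) \<circ> (\<lambda>x. (t, x)))"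
    by (rule continuous_on_compose[OF _ continuous_on_subset[OF P_jointly_continuous[OF assms(2,3)]]])
       (use assms(1) in \<open>auto intro!: continuous_intros\<close>)
  then show ?thesis by (simp add: o_def)
qed

lemma P_increment:
  assumes s: "0 < s" and t: "0 < t" "t \<le> 1" and fm: "f \<in> borel_measurable borel" and B: "\<And>y. \<bar>f y\<bar> \<le> B"
  shows "\<bar>P (t + s) f x - P s f x\<bar> \<le> t * (hk_const (s + 1) * (rho_mass * (s + 2) / s) * B)"
proof -
  have B0: "0 \<le> B" using B[of 0] by linarith
  obtain z where z: "s < z" "z < t + s" "P (t + s) f x - P s f x = (t + s - s) * Q z f x"
    using MVT2[of s "t + s" "\<lambda>t. P t f x" "\<lambda>t. Q t f x"] P_has_derivative[OF _ fm B] s t by auto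
  have "\<bar>Q z f x\<bar> \<le> hk_const (s + 1) * (rho_mass * ((s + 1) + 1) / z) * B"
    using z s t by (intro Q_bound[OF _ fm B]) auto
  also have "\<dots> \<le> hk_const (s + 1) * (rho_mass * (s + 2) / s) * B"
    using z s hk_const_pos[of "s+1"] rho_mass_pos B0 by (intro mult_right_mono mult_left_mono frac_le) auto
  finally have "t * \<bar>Q z f x\<bar> \<le> t * (hk_const (s + 1) * (rho_mass * (s + 2) / s) * B)" using t by (intro mult_left_mono) auto
  moreover have "\<bar>P (t + s) f x - P s f x\<bar> = t * \<bar>Q z f x\<bar>" using z t by (simp add: abs_mult)
  ultimately show ?thesis by simp
qed

text \<open>
  As functions of \<open>(t, x)\<close> both sides are bounded solutions with initial value \<open>P s f\<close>; the maximum principle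
  applies to their difference and to its negative.
\<close>

lemma semigroup_compact_support:
  assumes t: "0 < t" and s: "0 < s" and fc: "continuous_on UNIV f" and B: "\<And>y. \<bar>f y\<bar> \<le> B"
    and supp: "\<And>y. R0 < norm y \<Longrightarrow> f y = 0"
  shows "P (t + s) f x = P t (P s f) x"
proof -
  have fm: "f \<in> borel_measurable borel" by (rule borel_measurable_continuous_onI[OF fc])
  let ?g = "P s f"
  define D where "D = hk_const s * rho_mass * (s + 1) * B"
  have D: "\<bar>?g y\<bar> \<le> D" for y unfolding D_def by (rule P_bound[OF s order_refl fm B])
  have gc: "continuous_on UNIV ?g" by (rule P_continuous[OF s fm B])
  have gm: "?g \<in> borel_measurable borel" by (rule borel_measurable_continuous_onI[OF gc])
  have gu: "uniformly_continuous_on UNIV ?g" by (rule uniformly_continuous_vanishing[OF gc P_vanishes[OF s fm B supp]])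
  have gb: "bounded (range ?g)" using D by (auto simp: bounded_iff)
  have Pg0: "\<exists>\<tau>>0. \<forall>t. 0 < t \<longrightarrow> t < \<tau> \<longrightarrow> (\<forall>x. \<bar>P t ?g x - ?g x\<bar> < e)" if "0 < e" for e
    using p_initial[OF gb gu] that by (auto simp: uniform_limit_iff eventually_at_right_field dist_real_def kernel_semigroup_eq_P gm)
  define E where "E = hk_const (s + 1) * (rho_mass * (s + 2) / s) * B"
  have inc: "\<bar>P (t + s) f x - ?g x\<bar> \<le> t * E" if "0 < t" "t \<le> 1" for t x
    unfolding E_def by (rule P_increment[OF s that fm B])
  have E0: "0 \<le> E" using inc[of 1 0] by linarith
  have key: "\<sigma> * (P (t + s) f x - P t ?g x) \<le> 0 + 0 * t" if \<sigma>: "\<sigma> = 1 \<or> \<sigma> = -1" for \<sigma> x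
  proof (rule maximum_principle[where v="\<lambda>t x. \<sigma> * (P (t + s) f x - P t ?g x)" and T=t
        and B="hk_const (t + s) * rho_mass * (t + s + 1) * B + hk_const t * rho_mass * (t + 1) * D"
        and v'="\<lambda>t x. \<sigma> * (Q (t + s) f x - Q t ?g x)" and l="\<lambda>t x. \<sigma> * (Q (t + s) f x - Q t ?g x)"])
    have "continuous_on ({0<..t} \<times> UNIV) (\<lambda>w. (\<lambda>(t, x). P t f x) (fst w + s, snd w))"
      by (rule continuous_on_compose2[OF P_jointly_continuous[OF fm B]]) (use s in \<open>auto intro!: continuous_intros\<close>)
    moreover have "continuous_on ({0<..t} \<times> UNIV) (\<lambda>(t, x). P t ?g x)"
      by (rule continuous_on_subset[OF P_jointly_continuous[OF gm D]]) auto
    ultimately show "continuous_on ({0<..t} \<times> UNIV) (\<lambda>(t, x). \<sigma> * (P (t + s) f x - P t ?g x))"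
      unfolding case_prod_beta by (intro continuous_intros) auto
    show "\<sigma> * (P (u + s) f x - P u ?g x) \<le> hk_const (t + s) * rho_mass * (t + s + 1) * B + hk_const t * rho_mass * (t + 1) * D"
      if "0 < u" "u \<le> t" for u x
    proof -
      have "\<bar>P (u + s) f x\<bar> \<le> hk_const (t + s) * rho_mass * (t + s + 1) * B" using that s by (intro P_bound[OF _ _ fm B]) auto
      moreover have "\<bar>P u ?g x\<bar> \<le> hk_const t * rho_mass * (t + 1) * D" using that by (intro P_bound[OF _ _ gm D]) auto
      ultimately have "\<bar>P (u + s) f x - P u ?g x\<bar> \<le> hk_const (t + s) * rho_mass * (t + s + 1) * B + hk_const t * rho_mass * (t + 1) * D"
        by linarith
      then show ?thesis using \<sigma> by auto
    qed
    show "((\<lambda>u. \<sigma> * (P (u + s) f x - P u ?g x)) has_real_derivative \<sigma> * (Q (u + s) f x - Q u ?g x)) (at u)" if "0 < u" for u x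
    proof -
      have "((\<lambda>u. P (u + s) f x) has_real_derivative Q (u + s) f x) (at u)"
        using P_has_derivative[OF _ fm B, of "u + s" x] that s by (subst DERIV_shift[symmetric]) auto
      then show ?thesis by (intro DERIV_cmult DERIV_diff P_has_derivative[OF that gm D])
    qed
    show "has_gen (\<lambda>x. \<sigma> * (P (u + s) f x - P u ?g x)) x (\<sigma> * (Q (u + s) f x - Q u ?g x))" if "0 < u" for u x
      using that s by (intro has_gen_cmult has_gen_diff has_gen_P[OF _ fm B] has_gen_P[OF _ gm D]) auto
    show "\<exists>\<tau>>0. \<forall>u x. 0 < u \<longrightarrow> u < \<tau> \<longrightarrow> \<sigma> * (P (u + s) f x - P u ?g x) \<le> 0 + e" if e: "0 < e" for e
    proof -
      obtain \<tau>1 where \<tau>1: "0 < \<tau>1" "\<And>u x. 0 < u \<Longrightarrow> u < \<tau>1 \<Longrightarrow> \<bar>P u ?g x - ?g x\<bar> < e / 2" using Pg0[of "e/2"] e by auto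
      let ?\<tau> = "min \<tau>1 (min 1 (e / (2 * (E + 1))))"
      have "\<sigma> * (P (u + s) f x - P u ?g x) \<le> 0 + e" if u: "0 < u" "u < ?\<tau>" for u x
      proof -
        have "u * E \<le> (e / (2 * (E + 1))) * (E + 1)" using u E0 by (intro mult_mono) auto
        also have "\<dots> = e / 2" using E0 by (simp add: divide_simps)
        finally have "\<bar>P (u + s) f x - ?g x\<bar> \<le> e / 2" using inc[of u x] u by simp
        moreover have "\<bar>P u ?g x - ?g x\<bar> < e / 2" using u by (intro \<tau>1(2)) auto
        ultimately have "\<bar>P (u + s) f x - P u ?g x\<bar> \<le> e" by linarith
        then show ?thesis using \<sigma> by auto
      qed
      then show ?thesis using \<tau>1(1) e E0 by (intro exI[of _ ?\<tau>]) auto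
    qed
  qed (use t in auto)
  show ?thesis using key[of 1 x] key[of "-1" x] by simp
qed

definition p_max :: "real \<Rightarrow> real" where "p_max s = hk_const s * s * \<rho> s 0"

lemma p_le_max: assumes "0 < s" shows "p s z y \<le> p_max s"
proof -
  have "p s z y \<le> hk_const s * s * \<rho> s (z - y)" by (rule p_le[OF assms order_refl])
  also have "\<dots> \<le> p_max s" unfolding p_max_def using assms hk_const_pos[of s] by (intro mult_left_mono rho_le_at_0) auto
  finally show ?thesis .
qed

lemma integral_bump_pos:
  fixes y0 :: 'a
  assumes "0 < r"
  shows "integrable lborel (\<lambda>y. max 0 (r - dist y y0))" and "0 < (LINT y|lborel. max 0 (r - dist y y0))"
proof -
  have ball: "emeasure lborel (cball y0 s) < \<infinity>" for s by (rule emeasure_lborel_cball_finite)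
  show i: "integrable lborel (\<lambda>y. max 0 (r - dist y y0))"
  proof (rule Bochner_Integration.integrable_bound)
    show "integrable lborel (\<lambda>y. r * indicator (cball y0 r) y)" using ball by (intro Bochner_Integration.integrable_mult_right) simp
    show "(\<lambda>y. max 0 (r - dist y y0)) \<in> borel_measurable lborel" by simp
    show "AE y in lborel. norm (max 0 (r - dist y y0)) \<le> norm (r * indicator (cball y0 r) y)"
      using assms by (intro AE_I2) (auto simp: indicator_def dist_commute)
  qed
  have "0 < (r / 2) * measure lborel (cball y0 (r / 2))" using assms by (simp add: content_cball_pos)
  also have "\<dots> = (LINT y|lborel. (r / 2) * indicator (cball y0 (r / 2)) y)" by simp
  also have "\<dots> \<le> (LINT y|lborel. max 0 (r - dist y y0))"
  proof (rule integral_mono[OF _ i])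
    have "integrable lborel (indicator (cball y0 (r / 2)) :: 'a \<Rightarrow> real)" by (rule integrable_real_indicator) (simp, rule ball)
    then show "integrable lborel (\<lambda>y. (r / 2) * indicator (cball y0 (r / 2)) y)" by (rule Bochner_Integration.integrable_mult_right)
    show "(r / 2) * indicator (cball y0 (r / 2)) y \<le> max 0 (r - dist y y0)" for y
      using assms by (auto simp: indicator_def dist_commute)
  qed
  finally show "0 < (LINT y|lborel. max 0 (r - dist y y0))" .
qed

text \<open>
  Both sides of the equation are continuous in \<open>y\<close> and have the same integral against continuous functions of
  compact support.
\<close>

theorem Chapman_Kolmogorov:
  assumes t: "0 < t" and s: "0 < s"
  shows "integrable lborel (\<lambda>z. p t x z * p s z y)" and "p (t + s) x y = (LINT z|lborel. p t x z * p s z y)"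
proof -
  have ts: "0 < t + s" using t s by simp
  have int: "integrable lborel (\<lambda>z. p t x z * p s z y)" for y
    by (rule integrable_p_mult[OF t p_measurable_right(2)[OF s], of _ "p_max s"])
       (use p_nonneg[OF s] p_le_max[OF s] in \<open>simp add: abs_of_nonneg\<close>)
  show "integrable lborel (\<lambda>z. p t x z * p s z y)" by (rule int)
  define h where "h y = (LINT z|lborel. p t x z * p s z y)" for y
  have hc: "continuous_on UNIV h"
  proof (rule continuous_on_sequentiallyI)
    fix u :: "nat \<Rightarrow> 'a" and a assume u: "u \<longlonglongrightarrow> a"
    show "(\<lambda>n. h (u n)) \<longlonglongrightarrow> h a"
      unfolding h_def
    proof (rule integral_dominated_convergence[where w="\<lambda>z. p t x z * p_max s"])
      show "(\<lambda>z. p t x z * p s z a) \<in> borel_measurable lborel" using int[of a] by simp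
      show "(\<lambda>z. p t x z * p s z (u n)) \<in> borel_measurable lborel" for n using int[of "u n"] by simp
      show "integrable lborel (\<lambda>z. p t x z * p_max s)" by (intro Bochner_Integration.integrable_mult_left integrable_p t)
      show "AE z in lborel. (\<lambda>n. p t x z * p s z (u n)) \<longlonglongrightarrow> p t x z * p s z a"
        by (intro AE_I2 tendsto_mult tendsto_const p_continuous_at s u)
      show "AE z in lborel. norm (p t x z * p s z (u n)) \<le> p t x z * p_max s" for n
        using p_nonneg[OF t] p_nonneg[OF s] p_le_max[OF s]
        by (intro AE_I2) (auto simp: abs_mult intro!: mult_left_mono)
    qed
  qed
  have pc: "continuous_on UNIV (p (t + s) x)"
  proof -
    have "continuous_on UNIV ((\<lambda>(x, y). p (t + s) x y) \<circ> (\<lambda>y. (x, y)))"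
      by (rule continuous_on_compose[OF _ continuous_on_subset[OF p_continuous2[OF ts]]]) (auto intro!: continuous_intros)
    then show ?thesis by (simp add: o_def)
  qed
  have hint: "integrable lborel (\<lambda>y. h y * f y)" "(LINT y|lborel. h y * f y) = P t (P s f) x"
    if fm: "f \<in> borel_measurable borel" and B: "\<And>y. \<bar>f y\<bar> \<le> B" for f B
  proof -
    have B0: "0 \<le> B" using B[of 0] by linarith
    let ?G = "\<lambda>z y. p t x z * (p s z y * f y)"
    have m: "(\<lambda>(z, y). ?G z y) \<in> borel_measurable (lborel \<Otimes>\<^sub>M lborel)"
    proof -
      have 1: "(\<lambda>w. p t x (fst w)) \<in> borel_measurable ((lborel :: 'a measure) \<Otimes>\<^sub>M (lborel :: 'a measure))"
        using measurable_compose[OF measurable_fst, of "p t x" lborel borel] p_measurable_right[OF t] by simp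
      have 2: "(\<lambda>w. f (snd w)) \<in> borel_measurable ((lborel :: 'a measure) \<Otimes>\<^sub>M (lborel :: 'a measure))"
        using measurable_compose[OF measurable_snd, of f lborel borel] fm by simp
      have 3: "(\<lambda>(z, y). p s z y) \<in> borel_measurable ((lborel :: 'a measure) \<Otimes>\<^sub>M (lborel :: 'a measure))"
        using p_measurable2[OF s] by (simp add: lborel_prod)
      show ?thesis using 1 2 3 by (simp add: case_prod_beta)
    qed
    have gi: "integrable lborel (?G z)" for z using integrable_p_mult[OF s fm B] by (rule Bochner_Integration.integrable_mult_right)
    let ?A = "hk_const s * rho_mass * (s + 1) * B"
    have le: "(LINT y|lborel. norm (?G z y)) \<le> p t x z * ?A" for z
    proof -
      have "(LINT y|lborel. norm (?G z y)) = (LINT y|lborel. p t x z * (p s z y * \<bar>f y\<bar>))"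
        using p_nonneg[OF t] p_nonneg[OF s] by (intro Bochner_Integration.integral_cong) (auto simp: abs_mult)
      also have "\<dots> = p t x z * P s (\<lambda>y. \<bar>f y\<bar>) z" by (simp add: P_def)
      also have "\<dots> \<le> p t x z * ?A"
        using P_bound[OF s order_refl, of "\<lambda>y. \<bar>f y\<bar>" B z] fm B p_nonneg[OF t, of x z] by (intro mult_left_mono) auto
      finally show ?thesis .
    qed
    have int2: "integrable (lborel \<Otimes>\<^sub>M lborel) (\<lambda>(z, y). ?G z y)"
    proof (rule lborel_pair.Fubini_integrable[OF m])
      show "AE z in lborel. integrable lborel (\<lambda>y. (\<lambda>(z, y). ?G z y) (z, y))" using gi by simp
      show "integrable lborel (\<lambda>z. LINT y|lborel. norm ((\<lambda>(z, y). ?G z y) (z, y)))"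
      proof (rule Bochner_Integration.integrable_bound)
        show "integrable lborel (\<lambda>z. p t x z * ?A)" by (intro Bochner_Integration.integrable_mult_left integrable_p t)
        have "(\<lambda>(z, y). norm (?G z y)) \<in> borel_measurable (lborel \<Otimes>\<^sub>M lborel)"
          using measurable_compose[OF m borel_measurable_norm] by (simp add: case_prod_beta)
        from lborel.borel_measurable_lebesgue_integral[OF this]
        show "(\<lambda>z. LINT y|lborel. norm ((\<lambda>(z, y). ?G z y) (z, y))) \<in> borel_measurable lborel" by simp
        show "AE z in lborel. norm (LINT y|lborel. norm ((\<lambda>(z, y). ?G z y) (z, y))) \<le> norm (p t x z * ?A)"
        proof (rule AE_I2)
          fix z
          have "0 \<le> (LINT y|lborel. norm (?G z y))" by (rule integral_nonneg_AE) simp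
          then show "norm (LINT y|lborel. norm ((\<lambda>(z, y). ?G z y) (z, y))) \<le> norm (p t x z * ?A)"
            using le[of z] by (simp only: real_norm_def prod.case)
        qed
      qed
    qed
    have eq: "(LINT z|lborel. ?G z y) = h y * f y" for y
      unfolding h_def using int[of y] by (simp add: mult.assoc[symmetric])
    show "integrable lborel (\<lambda>y. h y * f y)" using lborel_pair.integrable_snd[OF int2] unfolding eq .
    have "P t (P s f) x = (LINT z|lborel. LINT y|lborel. ?G z y)" by (simp add: P_def)
    also have "\<dots> = (LINT y|lborel. LINT z|lborel. ?G z y)" using lborel_pair.Fubini_integral[OF int2] by simp
    finally show "(LINT y|lborel. h y * f y) = P t (P s f) x" unfolding eq ..
  qed
  have "h y0 = p (t + s) x y0" for y0
  proof (rule ccontr)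
    assume ne: "h y0 \<noteq> p (t + s) x y0"
    (* If the two sides differ at y0, a tent function concentrated near y0 distinguishes them. *)
    define \<sigma> :: real where "\<sigma> = sgn (h y0 - p (t + s) x y0)"
    define d where "d y = \<sigma> * (h y - p (t + s) x y)" for y
    have d0: "0 < d y0" using ne by (simp add: d_def \<sigma>_def sgn_if)
    have "continuous_on UNIV d" unfolding d_def by (intro continuous_intros hc pc)
    then have "isCont d y0" by (simp add: continuous_on_eq_continuous_at)
    then obtain r where r: "0 < r" "\<And>y. dist y y0 < r \<Longrightarrow> dist (d y) (d y0) < d y0 / 2"
      unfolding continuous_at_eps_delta using d0 by (metis half_gt_zero)
    define f where "f = (\<lambda>y. max 0 (r - dist y y0))"
    have f0: "0 \<le> f y" for y by (simp add: f_def)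
    have fc: "continuous_on UNIV f" unfolding f_def by (intro continuous_intros)
    have fm: "f \<in> borel_measurable borel" by (rule borel_measurable_continuous_onI[OF fc])
    have fB: "\<bar>f y\<bar> \<le> r" for y using r by (auto simp: f_def)
    have supp: "f y = 0" if "norm y0 + r < norm y" for y
    proof -
      have "r < dist y y0" using norm_triangle_ineq2[of y y0] that by (simp add: dist_norm)
      then show ?thesis by (simp add: f_def)
    qed
    have df: "integrable lborel (\<lambda>y. d y * f y)"
    proof -
      have "integrable lborel (\<lambda>y. \<sigma> * (h y * f y - p (t + s) x y * f y))"
        by (intro Bochner_Integration.integrable_mult_right Bochner_Integration.integrable_diff hint(1)[OF fm fB] integrable_p_mult[OF ts fm fB])
      then show ?thesis by (simp add: d_def algebra_simps)
    qed
    have "(LINT y|lborel. d y * f y) = (LINT y|lborel. \<sigma> * (h y * f y - p (t + s) x y * f y))"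
      by (intro Bochner_Integration.integral_cong refl) (simp add: d_def algebra_simps)
    also have "\<dots> = \<sigma> * (P t (P s f) x - P (t + s) f x)"
      by (simp add: Bochner_Integration.integral_diff[OF hint(1)[OF fm fB] integrable_p_mult[OF ts fm fB]] hint(2)[OF fm fB] P_def[of "t + s"])
    also have "\<dots> = 0" using semigroup_compact_support[OF t s fc fB supp] by simp
    finally have zero: "(LINT y|lborel. d y * f y) = 0" .
    have "0 < (d y0 / 2) * (LINT y|lborel. f y)" using d0 integral_bump_pos(2)[OF r(1), of y0] by (simp add: f_def)
    also have "\<dots> = (LINT y|lborel. (d y0 / 2) * f y)" by simp
    also have "\<dots> \<le> (LINT y|lborel. d y * f y)"
    proof (intro integral_mono df Bochner_Integration.integrable_mult_right)
      show "integrable lborel f" using integral_bump_pos(1)[OF r(1), of y0] by (simp add: f_def)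
      fix y
      show "(d y0 / 2) * f y \<le> d y * f y"
      proof (cases "dist y y0 < r")
        case True
        then have "d y0 / 2 \<le> d y" using r(2)[OF True] unfolding dist_real_def by linarith
        then show ?thesis by (intro mult_right_mono f0)
      next
        case False
        then show ?thesis by (simp add: f_def)
      qed
    qed
    finally show False using zero by simp
  qed
  then show "p (t + s) x y = (LINT z|lborel. p t x z * p s z y)" by (simp add: h_def)
qed


section \<open>Time derivatives of the heat kernel\<close>

lemma integrable_rho_left: "0 < t \<Longrightarrow> integrable lborel (\<lambda>z. \<rho> t (z - y))"
  using integrable_rho_right[of t y] by (simp add: rho_commute[of t _ y])

lemma integral_rho_left_le: "0 < t \<Longrightarrow> t \<le> T \<Longrightarrow> (LINT z|lborel. \<rho> t (z - y)) \<le> rho_mass * (T + 1) / t"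
  using integral_rho_right_le[of t T y] by (simp add: rho_commute[of t _ y])

text \<open>
  One of \<open>x - z\<close> and \<open>z - y\<close> has at least half the length of \<open>x - y\<close>; doubling replaces \<open>\<rho>\<close> at that point by
  \<open>\<rho>\<close> at \<open>x - y\<close>.
\<close>

lemma rho_mult_le:
  assumes s: "0 < s"
  shows "\<rho> s (x - z) * \<rho> s (z - y) \<le> (4 * 2 ^ DIM('a)) * \<rho> s (x - y) * (\<rho> s (x - z) + \<rho> s (z - y))"
proof -
  have nn: "0 \<le> \<rho> s w" for w by (rule rho_nonneg[OF s])
  have a: "0 < radius s" by (rule radius_pos[OF s])
  have tri: "norm (x - y) \<le> norm (x - z) + norm (z - y)" using norm_triangle_ineq[of "x - z" "z - y"] by simp
  show ?thesis
  proof (cases "norm (z - y) \<le> norm (x - z)")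
    case True
    then have "\<rho> s (x - z) \<le> (4 * 2 ^ DIM('a)) * \<rho> s (x - y)" using tri a by (intro rho_le_of_half_le s) linarith
    then have "\<rho> s (x - z) * \<rho> s (z - y) \<le> (4 * 2 ^ DIM('a)) * \<rho> s (x - y) * \<rho> s (z - y)" by (rule mult_right_mono) (rule nn)
    also have "\<dots> \<le> (4 * 2 ^ DIM('a)) * \<rho> s (x - y) * (\<rho> s (x - z) + \<rho> s (z - y))" using nn by (intro mult_left_mono mult_nonneg_nonneg) auto
    finally show ?thesis .
  next
    case False
    then have "\<rho> s (z - y) \<le> (4 * 2 ^ DIM('a)) * \<rho> s (x - y)" using tri a by (intro rho_le_of_half_le s) linarith
    then have "\<rho> s (x - z) * \<rho> s (z - y) \<le> \<rho> s (x - z) * ((4 * 2 ^ DIM('a)) * \<rho> s (x - y))" by (rule mult_left_mono) (rule nn)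
    also have "\<dots> = (4 * 2 ^ DIM('a)) * \<rho> s (x - y) * \<rho> s (x - z)" by (simp add: mult_ac)
    also have "\<dots> \<le> (4 * 2 ^ DIM('a)) * \<rho> s (x - y) * (\<rho> s (x - z) + \<rho> s (z - y))" using nn by (intro mult_left_mono mult_nonneg_nonneg) auto
    finally show ?thesis .
  qed
qed

lemma rho_convolution:
  assumes s: "0 < s" "s \<le> T"
  shows "integrable lborel (\<lambda>z. \<rho> s (x - z) * \<rho> s (z - y))"
    and "(LINT z|lborel. \<rho> s (x - z) * \<rho> s (z - y)) \<le> (2 * (4 * 2 ^ DIM('a)) * rho_mass * (T + 1) / s) * \<rho> s (x - y)"
proof -
  let ?b = "\<lambda>z. (4 * 2 ^ DIM('a)) * \<rho> s (x - y) * (\<rho> s (x - z) + \<rho> s (z - y))"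
  have bi: "integrable lborel ?b"
    by (intro Bochner_Integration.integrable_mult_right Bochner_Integration.integrable_add integrable_rho_right integrable_rho_left s)
  have m: "(\<lambda>z. \<rho> s (x - z) * \<rho> s (z - y)) \<in> borel_measurable lborel"
    using integrable_rho_right[OF s(1), of x] integrable_rho_left[OF s(1), of y] by (intro borel_measurable_times) auto
  show i: "integrable lborel (\<lambda>z. \<rho> s (x - z) * \<rho> s (z - y))"
  proof (rule Bochner_Integration.integrable_bound[OF bi m], rule AE_I2)
    fix z
    have "0 \<le> \<rho> s (x - z) * \<rho> s (z - y)" by (intro mult_nonneg_nonneg rho_nonneg s)
    then show "norm (\<rho> s (x - z) * \<rho> s (z - y)) \<le> norm (?b z)"
      using rho_mult_le[OF s(1), of x z y] by (simp only: real_norm_def)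
  qed
  have "(LINT z|lborel. \<rho> s (x - z) * \<rho> s (z - y)) \<le> (LINT z|lborel. ?b z)"
    by (rule integral_mono[OF i bi rho_mult_le[OF s(1)]])
  also have "\<dots> = (4 * 2 ^ DIM('a)) * \<rho> s (x - y) * ((LINT z|lborel. \<rho> s (x - z)) + (LINT z|lborel. \<rho> s (z - y)))"
    using s by (simp add: Bochner_Integration.integral_add[OF integrable_rho_right integrable_rho_left])
  also have "\<dots> \<le> (4 * 2 ^ DIM('a)) * \<rho> s (x - y) * (rho_mass * (T + 1) / s + rho_mass * (T + 1) / s)"
    using rho_nonneg[OF s(1)] by (intro mult_left_mono add_mono integral_rho_right_le integral_rho_left_le s) auto
  finally show "(LINT z|lborel. \<rho> s (x - z) * \<rho> s (z - y)) \<le> (2 * (4 * 2 ^ DIM('a)) * rho_mass * (T + 1) / s) * \<rho> s (x - y)"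
    by (simp add: algebra_simps)
qed

lemma q_measurable_left: assumes s: "0 < s" shows "(\<lambda>z. q s z y) \<in> borel_measurable borel"
proof (rule borel_measurable_LIMSEQ_real)
  let ?u = "\<lambda>n z. if z = y then q s y y else (p (s + 1 / real (Suc n)) z y - p s z y) / (1 / real (Suc n))"
  show "(\<lambda>n. ?u n z) \<longlonglongrightarrow> q s z y" for z
  proof (cases "z = y")
    case False
    have l: "((\<lambda>h. (p (s + h) z y - p s z y) / h) \<longlongrightarrow> q s z y) (at 0)"
      using p_derivative[OF s False] by (simp add: DERIV_def)
    have "filterlim (\<lambda>n. 1 / real (Suc n)) (at 0) sequentially"
      unfolding filterlim_at using LIMSEQ_inverse_real_of_nat by (auto simp: inverse_eq_divide)
    from filterlim_compose[OF l this] show ?thesis using False by simp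
  qed simp
  show "?u n \<in> borel_measurable borel" for n
  proof (rule measurable_If)
    have "0 < s + 1 / real (Suc n)" using s by (simp add: add_pos_pos)
    then show "(\<lambda>z. (p (s + 1 / real (Suc n)) z y - p s z y) / (1 / real (Suc n))) \<in> borel_measurable borel"
      using p_measurable_right(2)[OF s] p_measurable_right(2)[of "s + 1 / real (Suc n)" y] by simp
  qed auto
qed

definition D :: "nat \<Rightarrow> real \<Rightarrow> 'a \<Rightarrow> 'a \<Rightarrow> real" where
  "D n t x y = (deriv ^^ n) (\<lambda>t. p t x y) t"

lemma D_0: "D 0 t x y = p t x y" by (simp add: D_def)
lemma D_Suc: "D (Suc n) t x y = deriv (\<lambda>t. D n t x y) t" by (simp add: D_def)

text \<open>
  The factor that each further derivative costs: \<open>hk_const\<close> bounds \<open>q\<close> by \<open>\<rho>\<close>, and the second summand carries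
  the constant of \<open>rho_convolution\<close>.
\<close>

definition D_const :: "real \<Rightarrow> real" where
  "D_const T = hk_const T * (1 + 2 * (4 * 2 ^ DIM('a)) * rho_mass * (T + 1))"

lemma D_const_ge: "0 < T \<Longrightarrow> hk_const T \<le> D_const T" "0 < T \<Longrightarrow> hk_const T * (2 * (4 * 2 ^ DIM('a)) * rho_mass * (T + 1)) \<le> D_const T"
  "0 < T \<Longrightarrow> 0 < D_const T"
  using hk_const_pos[of T] rho_mass_pos by (auto simp: D_const_def intro!: mult_pos_pos add_pos_pos)

text \<open>
  What the induction on the order of the derivative carries along. The bound at time \<open>(n + 1) * s\<close> comes from
  splitting this time into \<open>n + 1\<close> steps of length \<open>s\<close>, one for each of the \<open>n\<close> derivatives and one for \<open>p\<close>.
\<close>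

definition D_invariant :: "nat \<Rightarrow> bool" where
  "D_invariant n \<longleftrightarrow>
     (\<forall>t>0. (\<lambda>(x, y). D n t x y) \<in> borel_measurable borel) \<and>
     (\<forall>T s x y. 0 < s \<longrightarrow> s \<le> T \<longrightarrow> \<bar>D n (real (n + 1) * s) x y\<bar> * s ^ n \<le> D_const T ^ (n + 1) * s * \<rho> s (x - y)) \<and>
     (\<forall>t>0. \<forall>s>0. \<forall>x y. D n (t + s) x y = (LINT z|lborel. D n t x z * p s z y))"

lemma D_invariant_measurable: "D_invariant n \<Longrightarrow> 0 < t \<Longrightarrow> (\<lambda>(x, y). D n t x y) \<in> borel_measurable borel"
  by (simp add: D_invariant_def)

lemma D_invariant_measurable_right: assumes "D_invariant n" "0 < t" shows "D n t x \<in> borel_measurable borel"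
proof -
  have "(\<lambda>y. (x, y)) \<in> (borel :: 'a measure) \<rightarrow>\<^sub>M (borel :: ('a \<times> 'a) measure)"
    by (intro borel_measurable_continuous_onI continuous_intros)
  from measurable_compose[OF this D_invariant_measurable[OF assms]] show ?thesis by simp
qed

lemma D_invariant_bound:
  assumes "D_invariant n" "0 < s" "s \<le> T"
  shows "\<bar>D n (real (n + 1) * s) x y\<bar> * s ^ n \<le> D_const T ^ (n + 1) * s * \<rho> s (x - y)"
  using assms by (simp add: D_invariant_def)

definition D_bound :: "nat \<Rightarrow> real \<Rightarrow> real \<Rightarrow> real" where
  "D_bound n a T = D_const T ^ (n + 1) * T / (a / real (n + 1)) ^ n"

text \<open>
  The majorant in the bound of \<open>D_invariant\<close> depends on \<open>t\<close>. Dominated convergence needs one majorant for all \<open>t\<close>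
  in a compact interval.
\<close>

lemma D_local_bound:
  assumes bnd: "\<And>s. 0 < s \<Longrightarrow> s \<le> T \<Longrightarrow> \<bar>D n (real (n + 1) * s) x y\<bar> * s ^ n \<le> D_const T ^ (n + 1) * s * \<rho> s (x - y)"
    and a: "0 < a" "a \<le> t" "t \<le> T"
  shows "\<bar>D n t x y\<bar> \<le> D_bound n a T * \<rho> (a / real (n + 1)) (x - y)"
proof -
  let ?s = "t / real (n + 1)" and ?a = "a / real (n + 1)"
  have a0: "0 < ?a" and as: "?a \<le> ?s" and s0: "0 < ?s" using a by (auto intro!: divide_right_mono)
  have "t / real (n + 1) \<le> t / 1" using a by (intro divide_left_mono) auto
  then have sT: "?s \<le> T" using a by simp
  have eq: "real (n + 1) * ?s = t" by simp
  have c: "0 \<le> D_const T ^ (n + 1)" using D_const_ge(3)[of T] a by simp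
  have "\<bar>D n t x y\<bar> * ?a ^ n \<le> \<bar>D n t x y\<bar> * ?s ^ n" using a0 as by (intro mult_left_mono power_mono) auto
  also have "\<dots> \<le> D_const T ^ (n + 1) * ?s * \<rho> ?s (x - y)" using bnd[OF s0 sT] unfolding eq .
  also have "\<dots> \<le> D_const T ^ (n + 1) * T * \<rho> ?a (x - y)"
    using c s0 sT a0 as a rho_nonneg[OF s0] by (intro mult_mono rho_antimono) auto
  finally have "\<bar>D n t x y\<bar> \<le> D_const T ^ (n + 1) * T * \<rho> ?a (x - y) / ?a ^ n"
    by (simp only: pos_le_divide_eq[OF zero_less_power[OF a0]])
  then show ?thesis by (simp only: D_bound_def times_divide_eq_left)
qed

lemma D_invariant_local_bound:
  assumes "D_invariant n" "0 < a" "a \<le> t" "t \<le> T"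
  shows "\<bar>D n t x y\<bar> \<le> D_bound n a T * \<rho> (a / real (n + 1)) (x - y)"
  by (rule D_local_bound[OF D_invariant_bound[OF assms(1)] assms(2-4)])

lemma D_bound_nonneg: "0 < a \<Longrightarrow> a \<le> T \<Longrightarrow> 0 \<le> D_bound n a T"
  using D_const_ge(3)[of T] by (simp add: D_bound_def less_imp_le)

lemma integrable_D_mult:
  assumes g: "D_invariant n" and t: "0 < t" and wm: "w \<in> borel_measurable borel" and w: "AE z in lborel. \<bar>w z\<bar> \<le> W"
  shows "integrable lborel (\<lambda>z. D n t x z * w z)"
proof (rule Bochner_Integration.integrable_bound)
  let ?g = "\<lambda>z. (D_bound n t t * \<bar>W\<bar>) * \<rho> (t / real (n + 1)) (x - z)"
  show "integrable lborel ?g" using t by (intro Bochner_Integration.integrable_mult_right integrable_rho_right) auto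
  show "(\<lambda>z. D n t x z * w z) \<in> borel_measurable lborel" using D_invariant_measurable_right[OF g t] wm by simp
  show "AE z in lborel. norm (D n t x z * w z) \<le> norm (?g z)"
    using w
  proof eventually_elim
    case (elim z)
    have r: "0 \<le> \<rho> (t / real (n + 1)) (x - z)" using t by (intro rho_nonneg) auto
    have b: "0 \<le> D_bound n t t" by (rule D_bound_nonneg[OF t order_refl])
    have "\<bar>D n t x z\<bar> * \<bar>w z\<bar> \<le> (D_bound n t t * \<rho> (t / real (n + 1)) (x - z)) * \<bar>W\<bar>"
      using elim r b by (intro mult_mono D_invariant_local_bound[OF g t]) auto
    then show ?case using r b by (simp add: abs_mult mult_ac)
  qed
qed

lemma AE_q_le: assumes "0 < s" "s \<le> T" shows "\<bar>q s z y\<bar> \<le> hk_const T * \<rho> s 0"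
proof -
  have "\<bar>q s z y\<bar> \<le> hk_const T * \<rho> s (z - y)" by (rule q_le[OF assms])
  also have "\<dots> \<le> hk_const T * \<rho> s 0" using hk_const_pos[of T] assms by (intro mult_left_mono rho_le_at_0) auto
  finally show ?thesis .
qed

text \<open>
  In \<open>D n (t + u) x y = \<integral> D n t x z * p u z y\<close> the derivative with respect to \<open>u\<close> falls on \<open>p\<close>.
\<close>

lemma D_invariant_derivative:
  assumes g: "D_invariant n" and t: "0 < t" and s: "0 < s"
  shows "((\<lambda>u. D n u x y) has_real_derivative D (Suc n) (t + s) x y) (at (t + s))"
    and "D (Suc n) (t + s) x y = (LINT z|lborel. D n t x z * q s z y)"
proof -
  let ?f = "\<lambda>u z. D n t x z * p u z y" and ?f' = "\<lambda>u z. D n t x z * q u z y"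
  let ?W = "hk_const (2 * s) * \<rho> (s/2) 0"
  have W0: "0 \<le> ?W" using hk_const_pos[of "2 * s"] rho_nonneg[of "s / 2" 0] s by auto
  have near: "s/2 < u" "u < 2 * s" if "u \<in> ball s (s/2)" for u
    using that s by (auto simp: dist_real_def abs_real_def split: if_splits)
  have d: "((\<lambda>u. LINT z|lborel. ?f u z) has_real_derivative (LINT z|lborel. ?f' s z)) (at s)"
  proof (rule has_field_derivative_integral_dominated(2)[where r="s/2" and g="\<lambda>z. \<bar>D n t x z\<bar> * ?W" and f'="?f'"])
    show "0 < s/2" using s by simp
    show "integrable lborel (?f u)" if "u \<in> ball s (s/2)" for u
    proof -
      have u: "0 < u" using near[OF that] s by simp
      show ?thesis
        by (rule integrable_D_mult[OF g t p_measurable_right(2)[OF u], where W="p_max u"])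
           (use p_nonneg[OF u] p_le_max[OF u] in simp)
    qed
    show "?f' s \<in> borel_measurable lborel" using D_invariant_measurable_right[OF g t] q_measurable_left[OF s] by simp
    show "integrable lborel (\<lambda>z. \<bar>D n t x z\<bar> * ?W)"
      using integrable_D_mult[OF g t, where w="\<lambda>_. 1" and W=1 and x=x] by (intro Bochner_Integration.integrable_mult_left integrable_abs) simp
    have "AE z in lborel. z \<noteq> y" by (rule AE_lborel_singleton)
    then show "AE z in lborel. \<forall>u\<in>ball s (s/2). ((\<lambda>u. ?f u z) has_real_derivative ?f' u z) (at u) \<and> norm (?f' u z) \<le> \<bar>D n t x z\<bar> * ?W"
    proof eventually_elim
      case (elim z)
      show ?case
      proof (intro ballI conjI)
        fix u assume "u \<in> ball s (s/2)"
        note u = near[OF this]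
        have u0: "0 < u" using u s by simp
        show "((\<lambda>u. ?f u z) has_real_derivative ?f' u z) (at u)" by (intro DERIV_cmult p_derivative u0 elim)
        have "\<bar>q u z y\<bar> \<le> hk_const (2 * s) * \<rho> u 0" using u by (intro AE_q_le u0) auto
        also have "\<dots> \<le> ?W" using hk_const_pos[of "2 * s"] u s by (intro mult_left_mono rho_antimono) auto
        finally show "norm (?f' u z) \<le> \<bar>D n t x z\<bar> * ?W" by (simp add: abs_mult mult_left_mono)
      qed
    qed
  qed
  have "((\<lambda>u. D n (t + u) x y) has_real_derivative (LINT z|lborel. ?f' s z)) (at s)"
  proof (rule has_field_derivative_transform_within_open[OF d, of "{0<..}"])
    show "(LINT z|lborel. ?f u z) = D n (t + u) x y" if "u \<in> {0<..}" for u
      using g t that by (simp add: D_invariant_def)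
  qed (use s in auto)
  then have d2: "((\<lambda>u. D n u x y) has_real_derivative (LINT z|lborel. ?f' s z)) (at (t + s))"
    by (subst (asm) add.commute) (simp add: DERIV_shift add.commute)
  have eq: "D (Suc n) (t + s) x y = (LINT z|lborel. ?f' s z)" unfolding D_Suc by (rule DERIV_imp_deriv[OF d2])
  show "((\<lambda>u. D n u x y) has_real_derivative D (Suc n) (t + s) x y) (at (t + s))" unfolding eq by (rule d2)
  show "D (Suc n) (t + s) x y = (LINT z|lborel. ?f' s z)" by (rule eq)
qed

lemma D_invariant_derivative':
  assumes "D_invariant n" "0 < t"
  shows "((\<lambda>u. D n u x y) has_real_derivative D (Suc n) t x y) (at t)"
  using D_invariant_derivative(1)[OF assms(1), of "t/2" "t/2" x y] assms(2) by simp

lemma D_good_0: "D_invariant 0"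
  unfolding D_invariant_def
proof (intro conjI allI impI)
  show "(\<lambda>(x, y). D 0 t x y) \<in> borel_measurable borel" if "0 < t" for t using p_measurable2[OF that] by (simp add: D_0)
  show "\<bar>D 0 (real (0 + 1) * s) x y\<bar> * s ^ 0 \<le> D_const T ^ (0 + 1) * s * \<rho> s (x - y)" if s: "0 < s" "s \<le> T" for T s x y
  proof -
    have "p s x y \<le> hk_const T * s * \<rho> s (x - y)" by (rule p_le[OF s])
    also have "\<dots> \<le> D_const T * s * \<rho> s (x - y)"
      using s rho_nonneg[OF s(1)] D_const_ge(1)[of T] by (intro mult_right_mono) auto
    finally show ?thesis using p_nonneg[OF s(1), of x y] by (simp add: D_0)
  qed
  show "D 0 (t + s) x y = (LINT z|lborel. D 0 t x z * p s z y)" if "0 < t" "0 < s" for t s x y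
    using Chapman_Kolmogorov(2)[OF that] by (simp add: D_0)
qed

text \<open>
  The bound follows from the convolution formula with time steps \<open>(n + 1) * s\<close> and \<open>s\<close>, in which the product of two
  \<open>\<rho>\<^sub>s\<close> integrates to a multiple of \<open>\<rho>\<^sub>s / s\<close>. The convolution identity is that of \<open>D n\<close> differentiated in the time of
  the first factor; comparing with \<open>D_invariant_derivative\<close> shows that the position of the derivative does not matter.
\<close>

lemma D_invariant_Suc: assumes g: "D_invariant n" shows "D_invariant (Suc n)"
proof -
  have meas: "(\<lambda>(x, y). D (Suc n) t x y) \<in> borel_measurable borel" if t: "0 < t" for t
  proof (rule borel_measurable_LIMSEQ_real)
    let ?u = "\<lambda>m w. ((\<lambda>(x, y). D n (t + 1 / real (Suc m)) x y) w - (\<lambda>(x, y). D n t x y) w) / (1 / real (Suc m))"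
    show "(\<lambda>m. ?u m w) \<longlonglongrightarrow> (\<lambda>(x, y). D (Suc n) t x y) w" for w
    proof -
      obtain x y where w: "w = (x, y)" by fastforce
      have l: "((\<lambda>h. (D n (t + h) x y - D n t x y) / h) \<longlongrightarrow> D (Suc n) t x y) (at 0)"
        using D_invariant_derivative'[OF g t] by (simp add: DERIV_def)
      have "filterlim (\<lambda>n. 1 / real (Suc n)) (at 0) sequentially"
        unfolding filterlim_at using LIMSEQ_inverse_real_of_nat by (auto simp: inverse_eq_divide)
      from filterlim_compose[OF l this] show ?thesis by (simp add: w)
    qed
    show "?u m \<in> borel_measurable borel" for m
      using D_invariant_measurable[OF g t] D_invariant_measurable[OF g, of "t + 1 / real (Suc m)"] t
      by (intro borel_measurable_divide borel_measurable_diff) (auto simp: add_pos_pos)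
  qed
  have bnd: "\<bar>D (Suc n) (real (Suc n + 1) * s) x y\<bar> * s ^ Suc n \<le> D_const T ^ (Suc n + 1) * s * \<rho> s (x - y)"
    if s: "0 < s" "s \<le> T" for s T x y
  proof -
    let ?t = "real (n + 1) * s"
    let ?c = "D_const T ^ (n + 1) * s * hk_const T"
    have T: "0 < T" using s by simp
    have t: "0 < ?t" using s by simp
    have c0: "0 \<le> D_const T ^ (n + 1)" using D_const_ge(3)[OF T] by simp
    have ts: "real (Suc n + 1) * s = ?t + s" by (simp add: algebra_simps)
    have i: "integrable lborel (\<lambda>z. D n ?t x z * q s z y)"
      by (rule integrable_D_mult[OF g t q_measurable_left[OF s(1)], where W="hk_const T * \<rho> s 0"]) (use AE_q_le[OF s] in simp)
    have pt: "\<bar>D n ?t x z * q s z y\<bar> * s ^ n \<le> ?c * (\<rho> s (x - z) * \<rho> s (z - y))" for z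
    proof -
      have "(\<bar>D n ?t x z\<bar> * s ^ n) * \<bar>q s z y\<bar> \<le> (D_const T ^ (n + 1) * s * \<rho> s (x - z)) * (hk_const T * \<rho> s (z - y))"
        using c0 s rho_nonneg[OF s(1)] by (intro mult_mono D_invariant_bound[OF g s] q_le s mult_nonneg_nonneg) auto
      then show ?thesis by (simp add: abs_mult mult_ac)
    qed
    have "\<bar>D (Suc n) (?t + s) x y\<bar> * s ^ n \<le> (LINT z|lborel. \<bar>D n ?t x z * q s z y\<bar>) * s ^ n"
      unfolding D_invariant_derivative(2)[OF g t s(1)] using s by (intro mult_right_mono integral_abs_bound) auto
    also have "\<dots> = (LINT z|lborel. \<bar>D n ?t x z * q s z y\<bar> * s ^ n)" by simp
    also have "\<dots> \<le> (LINT z|lborel. ?c * (\<rho> s (x - z) * \<rho> s (z - y)))"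
      by (intro integral_mono pt Bochner_Integration.integrable_mult_left Bochner_Integration.integrable_mult_right integrable_abs i rho_convolution(1)[OF s])
    also have "\<dots> = ?c * (LINT z|lborel. \<rho> s (x - z) * \<rho> s (z - y))" by simp
    also have "\<dots> \<le> ?c * ((2 * (4 * 2 ^ DIM('a)) * rho_mass * (T + 1) / s) * \<rho> s (x - y))"
      using c0 s hk_const_pos[of T] by (intro mult_left_mono rho_convolution(2)[OF s]) auto
    finally have "(\<bar>D (Suc n) (?t + s) x y\<bar> * s ^ n) * s \<le> (?c * ((2 * (4 * 2 ^ DIM('a)) * rho_mass * (T + 1) / s) * \<rho> s (x - y))) * s"
      using s by (intro mult_right_mono) auto
    also have "\<dots> = (D_const T ^ (n + 1) * (s * \<rho> s (x - y))) * (hk_const T * (2 * (4 * 2 ^ DIM('a)) * rho_mass * (T + 1)))"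
      using s by simp
    also have "\<dots> \<le> (D_const T ^ (n + 1) * (s * \<rho> s (x - y))) * D_const T"
      using c0 s rho_nonneg[OF s(1)] by (intro mult_left_mono D_const_ge(2) T mult_nonneg_nonneg) auto
    finally show ?thesis unfolding ts by (simp add: mult_ac)
  qed
  have local_bound: "\<bar>D (Suc n) t x y\<bar> \<le> D_bound (Suc n) a T * \<rho> (a / real (Suc n + 1)) (x - y)"
    if "0 < a" "a \<le> t" "t \<le> T" for a t T x y
    by (rule D_local_bound[OF bnd that])
  have semi: "D (Suc n) (t + s) x y = (LINT z|lborel. D (Suc n) t x z * p s z y)" if t: "0 < t" and s: "0 < s" for t s x y
  proof -
    let ?f = "\<lambda>u z. D n u x z * p s z y" and ?f' = "\<lambda>u z. D (Suc n) u x z * p s z y"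
    have near: "t/2 < u" "u < 2 * t" if "u \<in> ball t (t/2)" for u
      using that t by (auto simp: dist_real_def abs_real_def split: if_splits)
    let ?C = "D_bound (Suc n) (t/2) (2*t) * p_max s"
    have d: "((\<lambda>u. LINT z|lborel. ?f u z) has_real_derivative (LINT z|lborel. ?f' t z)) (at t)"
    proof (rule has_field_derivative_integral_dominated(2)[where r="t/2" and g="\<lambda>z. ?C * \<rho> (t/2 / real (Suc n + 1)) (x - z)" and f'="?f'"])
      show "0 < t/2" using t by simp
      show "integrable lborel (?f u)" if "u \<in> ball t (t/2)" for u
      proof -
        have u: "0 < u" using near[OF that] t by simp
        show ?thesis
          by (rule integrable_D_mult[OF g u p_measurable_right(2)[OF s], where W="p_max s"])
             (use p_nonneg[OF s] p_le_max[OF s] in simp)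
      qed
      have "(\<lambda>y. (x, y)) \<in> (borel :: 'a measure) \<rightarrow>\<^sub>M (borel :: ('a \<times> 'a) measure)"
        by (intro borel_measurable_continuous_onI continuous_intros)
      from measurable_compose[OF this meas[OF t]] have "D (Suc n) t x \<in> borel_measurable borel" by simp
      then show "?f' t \<in> borel_measurable lborel" using p_measurable_right(2)[OF s] by simp
      show "integrable lborel (\<lambda>z. ?C * \<rho> (t/2 / real (Suc n + 1)) (x - z))"
        using t by (intro Bochner_Integration.integrable_mult_right integrable_rho_right) auto
      show "AE z in lborel. \<forall>u\<in>ball t (t/2). ((\<lambda>u. ?f u z) has_real_derivative ?f' u z) (at u) \<and>
          norm (?f' u z) \<le> ?C * \<rho> (t/2 / real (Suc n + 1)) (x - z)"
      proof (intro AE_I2 ballI conjI)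
        fix z u assume "u \<in> ball t (t/2)"
        note u = near[OF this]
        have u0: "0 < u" using u t by simp
        show "((\<lambda>u. ?f u z) has_real_derivative ?f' u z) (at u)"
          by (intro DERIV_cmult_right D_invariant_derivative'[OF g u0])
        have "\<bar>D (Suc n) u x z\<bar> * \<bar>p s z y\<bar> \<le> (D_bound (Suc n) (t/2) (2*t) * \<rho> (t/2 / real (Suc n + 1)) (x - z)) * p_max s"
        proof (rule mult_mono)
          show "\<bar>D (Suc n) u x z\<bar> \<le> D_bound (Suc n) (t/2) (2*t) * \<rho> (t/2 / real (Suc n + 1)) (x - z)"
            using u t by (intro local_bound) auto
          show "\<bar>p s z y\<bar> \<le> p_max s" using p_nonneg[OF s, of z y] p_le_max[OF s, of z y] by simp
          have "0 \<le> D_bound (Suc n) (t/2) (2*t)" using t by (intro D_bound_nonneg) auto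
          moreover have "0 \<le> \<rho> (t/2 / real (Suc n + 1)) (x - z)" using t by (intro rho_nonneg) auto
          ultimately show "0 \<le> D_bound (Suc n) (t/2) (2*t) * \<rho> (t/2 / real (Suc n + 1)) (x - z)" by (rule mult_nonneg_nonneg)
        qed simp
        then show "norm (?f' u z) \<le> ?C * \<rho> (t/2 / real (Suc n + 1)) (x - z)" by (simp add: abs_mult mult_ac)
      qed
    qed
    have "((\<lambda>u. D n (u + s) x y) has_real_derivative (LINT z|lborel. ?f' t z)) (at t)"
    proof (rule has_field_derivative_transform_within_open[OF d, of "{0<..}"])
      show "(LINT z|lborel. ?f u z) = D n (u + s) x y" if "u \<in> {0<..}" for u
        using g s that by (simp add: D_invariant_def)
    qed (use t in auto)
    then have "((\<lambda>u. D n u x y) has_real_derivative (LINT z|lborel. ?f' t z)) (at (t + s))" by (simp add: DERIV_shift)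
    from DERIV_unique[OF this D_invariant_derivative(1)[OF g t s]] show ?thesis by simp
  qed
  show ?thesis unfolding D_invariant_def using meas bnd semi by blast
qed

lemma D_invariant: "D_invariant n"
  by (induction n) (rule D_good_0, rule D_invariant_Suc)

end

section \<open>Analytic extension of functions with factorial derivative bounds\<close>

text \<open>
  The sector of half-angle \<open>arctan m\<close>, in a form that shows it to be open and convex.
\<close>

definition wedge :: "real \<Rightarrow> complex set" where "wedge m = {z. 0 < Re z \<and> \<bar>Im z\<bar> < m * Re z}"

text \<open>
  The Taylor series is always centred at \<open>Re z\<close>. This fixes the value without a choice of centre, keeps it
  measurable in parameters of \<open>u\<close>, and leaves holomorphy to be shown by comparison with Taylor series at fixed
  centres.
\<close>

definition analytic_extension :: "(nat \<Rightarrow> real \<Rightarrow> real) \<Rightarrow> complex \<Rightarrow> complex" where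
  "analytic_extension u z = (\<Sum>n. of_real (u n (Re z) / fact n) * (\<i> * of_real (Im z)) ^ n)"

text \<open>
  A sequence \<open>u 0, u 1, \<dots>\<close> of successive derivatives whose growth gives the Taylor series of \<open>u 0\<close> at \<open>t\<close> a radius
  of convergence of at least \<open>r * t\<close>.
\<close>

locale gevrey_one =
  fixes u :: "nat \<Rightarrow> real \<Rightarrow> real" and r :: real
  assumes r: "0 < r" "r \<le> 1"
    and der: "\<And>n t. 0 < t \<Longrightarrow> (u n has_real_derivative u (Suc n) t) (at t)"
    and bound: "\<And>a b. 0 < a \<Longrightarrow> a \<le> b \<Longrightarrow> \<exists>M. \<forall>n t. a \<le> t \<longrightarrow> t \<le> b \<longrightarrow> \<bar>u n t\<bar> * (r * t) ^ n \<le> M * fact n"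
begin

definition taylor :: "real \<Rightarrow> complex \<Rightarrow> complex" where
  "taylor t z = (\<Sum>n. of_real (u n t / fact n) * (z - of_real t) ^ n)"

lemma coefficient_bound:
  assumes t: "0 < t" "a \<le> t" "t \<le> b" and M: "\<forall>n t. a \<le> t \<longrightarrow> t \<le> b \<longrightarrow> \<bar>u n t\<bar> * (r * t) ^ n \<le> M * fact n"
  shows "\<bar>u n t / fact n\<bar> \<le> M / (r * t) ^ n"
proof -
  have "0 < (r * t) ^ n" using r t by simp
  moreover have "\<bar>u n t\<bar> * (r * t) ^ n \<le> M * fact n" using M t by blast
  ultimately show ?thesis by (simp add: abs_divide field_simps)
qed

lemma taylor_summable:
  fixes z :: complex
  assumes t: "0 < t" and z: "norm (z - of_real t) < r * t"
  shows "summable (\<lambda>n. norm (of_real (u n t / fact n) * (z - of_real t) ^ n))"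
proof -
  obtain M where M: "\<forall>n t'. t \<le> t' \<longrightarrow> t' \<le> t \<longrightarrow> \<bar>u n t'\<bar> * (r * t') ^ n \<le> M * fact n" using bound[OF t order_refl] by blast
  let ?x = "norm (z - of_real t) / (r * t)"
  have rt: "0 < r * t" using r t by simp
  have x: "0 \<le> ?x" "?x < 1" using z rt by simp_all
  have "summable (\<lambda>n. M * ?x ^ n)" using x by (intro summable_mult summable_geometric) simp
  then show ?thesis
  proof (rule summable_comparison_test')
    fix n :: nat
    have "norm (norm (complex_of_real (u n t / fact n) * (z - of_real t) ^ n)) = \<bar>u n t / fact n\<bar> * norm (z - of_real t) ^ n"
      by (simp only: norm_mult norm_power norm_of_real real_norm_def abs_mult abs_norm_cancel abs_abs power_abs)
    also have "\<dots> \<le> (M / (r * t) ^ n) * norm (z - of_real t) ^ n"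
      by (intro mult_right_mono coefficient_bound[OF t order_refl order_refl M]) simp
    finally show "norm (norm (complex_of_real (u n t / fact n) * (z - of_real t) ^ n)) \<le> M * ?x ^ n" by (simp add: power_divide)
  qed
qed

lemma taylor_holomorphic: assumes t: "0 < t" shows "taylor t holomorphic_on ball (of_real t) (r * t)"
proof (rule power_series_holomorphic)
  fix w assume "w \<in> ball (complex_of_real t) (r * t)"
  then have "norm (w - of_real t) < r * t" by (simp add: dist_norm norm_minus_commute)
  from summable_norm_cancel[OF taylor_summable[OF t this]]
  show "(\<lambda>n. of_real (u n t / fact n) * (w - of_real t) ^ n) sums taylor t w"
    unfolding taylor_def by (rule summable_sums)
qed

text \<open>
  The Lagrange remainder of order \<open>n\<close> is at most a multiple of \<open>(1/2) ^ n\<close>.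
\<close>

lemma taylor_real:
  assumes t: "0 < t" and s: "\<bar>s - t\<bar> \<le> r * t / 4"
  shows "taylor t (of_real s) = of_real (u 0 s)"
proof (cases "s = t")
  case True
  have "(\<Sum>n. complex_of_real (u n t / fact n) * 0 ^ n) = of_real (u 0 t / fact 0)" by (rule powser_zero)
  then show ?thesis unfolding taylor_def True by simp
next
  case False
  let ?a = "3 * t / 4" and ?b = "5 * t / 4"
  have a0: "0 < ?a" "?a \<le> ?b" using t by auto
  obtain M where M: "\<forall>n t. ?a \<le> t \<longrightarrow> t \<le> ?b \<longrightarrow> \<bar>u n t\<bar> * (r * t) ^ n \<le> M * fact n" using bound[OF a0] by blast
  have rt4: "r * t / 4 \<le> t / 4" using r t by simp
  have sab: "?a \<le> s" "s \<le> ?b" using s rt4 by linarith+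
  have M0: "0 \<le> M"
  proof -
    have "\<bar>u 0 t\<bar> * (r * t) ^ 0 \<le> M * fact 0" using M[rule_format, of t 0] t by simp
    then show ?thesis by simp
  qed
  have rem: "\<bar>u 0 s - (\<Sum>m<n. u m t / fact m * (s - t) ^ m)\<bar> \<le> M * (1/2) ^ n" if n: "0 < n" for n
  proof -
    have "\<exists>x. (if s < t then s < x \<and> x < t else t < x \<and> x < s) \<and>
        u 0 s = (\<Sum>m<n. u m t / fact m * (s - t) ^ m) + u n x / fact n * (s - t) ^ n"
    proof (rule Taylor[where a="?a" and b="?b"])
      show "\<forall>m x. m < n \<and> ?a \<le> x \<and> x \<le> ?b \<longrightarrow> DERIV (u m) x :> u (Suc m) x"
        using der a0(1) by (meson less_le_trans)
    qed (use n sab False t in auto)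
    then obtain x where x: "if s < t then s < x \<and> x < t else t < x \<and> x < s"
      and eq: "u 0 s = (\<Sum>m<n. u m t / fact m * (s - t) ^ m) + u n x / fact n * (s - t) ^ n" by blast
    have xab: "?a \<le> x" "x \<le> ?b" using x sab t by (auto split: if_splits)
    then have x0: "0 < x" using a0 by linarith
    have ratio: "\<bar>s - t\<bar> / (r * x) \<le> 1 / 2"
    proof -
      have "r * ?a \<le> r * x" using xab r by (intro mult_left_mono) auto
      moreover have "r * ?a = 3 * (r * t) / 4" by simp
      moreover have "0 < r * t" using r t by simp
      ultimately have "2 * A \<le> r * x" if "A \<le> r * t / 4" for A using that by linarith
      from this[OF s] have "2 * \<bar>s - t\<bar> \<le> r * x" .
      then show ?thesis using r x0 by (simp add: field_simps)
    qed
    have "\<bar>u n x / fact n * (s - t) ^ n\<bar> = \<bar>u n x / fact n\<bar> * \<bar>s - t\<bar> ^ n" by (simp only: abs_mult power_abs)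
    also have "\<dots> \<le> (M / (r * x) ^ n) * \<bar>s - t\<bar> ^ n" by (intro mult_right_mono coefficient_bound[OF x0 xab M]) simp
    also have "\<dots> = M * (\<bar>s - t\<bar> / (r * x)) ^ n" by (simp add: power_divide)
    also have "\<dots> \<le> M * (1/2) ^ n" using ratio r x0 M0 by (intro mult_left_mono power_mono) auto
    finally show ?thesis using eq by simp
  qed
  have lim: "(\<lambda>n. \<Sum>m<n. u m t / fact m * (s - t) ^ m) \<longlonglongrightarrow> u 0 s"
  proof (rule LIM_zero_cancel)
    show "(\<lambda>n. (\<Sum>m<n. u m t / fact m * (s - t) ^ m) - u 0 s) \<longlonglongrightarrow> 0"
    proof (rule Lim_null_comparison)
      show "\<forall>\<^sub>F n in sequentially. norm ((\<Sum>m<n. u m t / fact m * (s - t) ^ m) - u 0 s) \<le> M * (1/2) ^ n"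
        using eventually_gt_at_top[of 0] by eventually_elim (use rem in \<open>simp add: abs_minus_commute\<close>)
      show "(\<lambda>n. M * (1/2) ^ n) \<longlonglongrightarrow> (0::real)" by (intro tendsto_mult_right_zero LIMSEQ_realpow_zero) auto
    qed
  qed
  then have "(\<lambda>m. u m t / fact m * (s - t) ^ m) sums u 0 s" by (simp add: sums_def)
  then have "(\<lambda>m. complex_of_real (u m t / fact m * (s - t) ^ m)) sums of_real (u 0 s)" by (rule sums_of_real)
  then have "(\<lambda>m. complex_of_real (u m t / fact m) * (of_real s - of_real t) ^ m) sums of_real (u 0 s)" by simp
  then show ?thesis unfolding taylor_def by (rule sums_unique[symmetric])
qed

lemma analytic_extension_eq_taylor_Re: "analytic_extension u z = taylor (Re z) z"
proof -
  have "z - of_real (Re z) = \<i> * of_real (Im z)" by (simp add: complex_eq_iff)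
  then show ?thesis by (simp add: analytic_extension_def taylor_def)
qed

text \<open>
  Both series are holomorphic on the intersection of two discs around \<open>t\<close> and \<open>Re z\<close> and agree on its real points,
  so the identity theorem applies.
\<close>

lemma taylor_eq:
  assumes t: "0 < t" and z: "norm (z - of_real t) < r * t / 8"
  shows "0 < Re z" and "taylor (Re z) z = taylor t z"
proof -
  let ?s = "Re z"
  have rt: "r * t \<le> t" "0 < r * t" using r t by auto
  have st: "\<bar>?s - t\<bar> < r * t / 8" using abs_Re_le_cmod[of "z - of_real t"] z by simp
  then have s78: "7 * t / 8 < ?s" using rt by linarith
  then show s: "0 < ?s" using t by linarith
  have im: "norm (z - of_real ?s) < r * t / 8"
  proof -
    have "z - of_real ?s = \<i> * of_real (Im z)" by (simp add: complex_eq_iff)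
    then have "norm (z - of_real ?s) = \<bar>Im z\<bar>" by (simp add: norm_mult)
    also have "\<dots> \<le> norm (z - of_real t)" using abs_Im_le_cmod[of "z - of_real t"] by simp
    finally show ?thesis using z by simp
  qed
  have rs: "7 * (r * t) / 8 < r * ?s" using mult_strict_left_mono[OF s78 r(1)] by (simp add: mult_ac)
  let ?S = "ball (complex_of_real t) (r * t / 4) \<inter> ball (complex_of_real ?s) (r * ?s / 4)"
  have sub: "?S \<subseteq> ball (of_real t) (r * t)" "?S \<subseteq> ball (of_real ?s) (r * ?s)" using rt mult_pos_pos[OF r(1) s] by auto
  have hol: "(\<lambda>w. taylor ?s w - taylor t w) holomorphic_on ?S"
    by (intro holomorphic_on_diff holomorphic_on_subset[OF taylor_holomorphic[OF t] sub(1)] holomorphic_on_subset[OF taylor_holomorphic[OF s] sub(2)])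
  have zS: "z \<in> ?S" using z im rs rt by (auto simp: dist_norm norm_minus_commute)
  have d: "dist t ?s = \<bar>?s - t\<bar>"
    unfolding dist_real_def by (rule abs_minus_commute)
  have sS: "complex_of_real ?s \<in> ?S" using st r s rt by (simp add: d)
  have op: "open ?S" by auto
  obtain \<epsilon> where \<epsilon>: "0 < \<epsilon>" "ball (complex_of_real ?s) \<epsilon> \<subseteq> ?S" using op sS open_contains_ball by blast
  let ?U = "{w \<in> ?S. \<exists>x. w = of_real x}"
  have lp: "complex_of_real ?s islimpt ?U"
    unfolding islimpt_approachable
  proof (intro allI impI)
    fix e :: real assume e: "0 < e"
    define h where "h = min e \<epsilon> / 2"
    have h: "0 < h" "h < e" "h < \<epsilon>" using e \<epsilon> by (auto simp: h_def min_def)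
    have dh: "dist (complex_of_real (?s + h)) (of_real ?s) = h" using h by (simp add: dist_norm)
    then have "complex_of_real (?s + h) \<in> ball (of_real ?s) \<epsilon>" using h by (simp add: dist_commute)
    then have "complex_of_real (?s + h) \<in> ?U" using \<epsilon>(2) by blast
    moreover have "complex_of_real (?s + h) \<noteq> of_real ?s" using h by (simp only: of_real_eq_iff)
    ultimately show "\<exists>x'\<in>?U. x' \<noteq> complex_of_real ?s \<and> dist x' (of_real ?s) < e" using dh h by (intro bexI[of _ "complex_of_real (?s + h)"]) auto
  qed
  have zero: "taylor ?s w - taylor t w = 0" if w: "w \<in> ?U" for w
  proof -
    obtain x where x: "w = of_real x" using w by blast
    have "\<bar>x - t\<bar> \<le> r * t / 4" "\<bar>x - ?s\<bar> \<le> r * ?s / 4"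
      using w unfolding x by (auto simp: dist_norm of_real_diff[symmetric] abs_minus_commute simp del: of_real_diff)
    then show ?thesis unfolding x by (simp add: taylor_real t s)
  qed
  have "taylor ?s z - taylor t z = 0"
    by (rule analytic_continuation[OF hol op _ _ sS lp zero zS]) (auto intro!: convex_connected convex_Int)
  then show "taylor ?s z = taylor t z" by simp
qed

lemma analytic_extension_holomorphic: "analytic_extension u holomorphic_on wedge (r / 8)"
proof (rule holomorphic_onI)
  fix z assume z: "z \<in> wedge (r / 8)"
  let ?t = "Re z"
  have t: "0 < ?t" using z by (simp add: wedge_def)
  have "z - of_real ?t = \<i> * of_real (Im z)" by (simp add: complex_eq_iff)
  then have "norm (z - of_real ?t) = \<bar>Im z\<bar>" by (simp add: norm_mult)
  then have zb: "z \<in> ball (of_real ?t) (r * ?t / 8)" using z by (simp add: wedge_def dist_norm norm_minus_commute)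
  have "r * ?t / 8 \<le> r * ?t" using r t by simp
  then have "taylor ?t holomorphic_on ball (of_real ?t) (r * ?t / 8)"
    by (intro holomorphic_on_subset[OF taylor_holomorphic[OF t]] subset_ball)
  moreover have "taylor ?t w = analytic_extension u w" if "w \<in> ball (of_real ?t) (r * ?t / 8)" for w
    unfolding analytic_extension_eq_taylor_Re using taylor_eq(2)[OF t, of w] that by (simp add: dist_norm norm_minus_commute)
  ultimately have "analytic_extension u holomorphic_on ball (of_real ?t) (r * ?t / 8)"
    by (rule holomorphic_transform)
  then have "analytic_extension u field_differentiable at z"
    by (rule holomorphic_on_imp_differentiable_at[OF _ open_ball zb])
  then show "analytic_extension u field_differentiable at z within wedge (r / 8)" by (rule field_differentiable_at_within)
qed

lemma analytic_extension_real: "0 < t \<Longrightarrow> analytic_extension u (of_real t) = of_real (u 0 t)"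
  unfolding analytic_extension_eq_taylor_Re using taylor_real[of t t] r by simp

lemma analytic_extension_summable:
  assumes "z \<in> wedge r"
  shows "summable (\<lambda>n. norm (of_real (u n (Re z) / fact n) * (\<i> * complex_of_real (Im z)) ^ n))"
proof -
  have eq: "z - of_real (Re z) = \<i> * of_real (Im z)" by (simp add: complex_eq_iff)
  have "norm (z - of_real (Re z)) < r * Re z" using assms unfolding eq by (simp add: wedge_def norm_mult)
  from taylor_summable[OF _ this] show ?thesis using assms unfolding eq by (simp add: wedge_def)
qed

end

section \<open>The heat kernel at complex times\<close>

text \<open>
  A power divided by its factorial is one term of the exponential series.
\<close>

lemma power_self_le_exp_fact: "real (Suc n) ^ n \<le> exp 1 ^ Suc n * fact n"
proof -
  let ?x = "real (Suc n)"
  have "(\<Sum>k\<in>{Suc n}. inverse (fact k) *\<^sub>R ?x ^ k) \<le> (\<Sum>k. inverse (fact k) *\<^sub>R ?x ^ k)"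
  proof (rule sum_le_suminf)
    show "summable (\<lambda>k. inverse (fact k) *\<^sub>R ?x ^ k)" by (rule summable_exp_generic)
  qed auto
  then have "?x ^ Suc n / fact (Suc n) \<le> exp ?x" by (simp add: exp_def divide_inverse mult.commute)
  also have "exp ?x = exp 1 ^ Suc n" by (simp only: exp_of_nat_mult[symmetric] mult_1_right)
  finally have "?x ^ Suc n \<le> exp 1 ^ Suc n * fact (Suc n)" by (simp only: divide_le_eq fact_gt_zero if_True)
  then have "?x * ?x ^ n \<le> ?x * (exp 1 ^ Suc n * fact n)" by (simp add: mult_ac)
  then show ?thesis by (rule mult_left_le_imp_le) simp
qed

context heat_kernel begin

definition gevrey_const :: real where "gevrey_const = exp 1 * D_const 1"

lemma gevrey_const_pos: "0 < gevrey_const"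
  using D_const_ge(3)[of 1] by (simp add: gevrey_const_def)

text \<open>
  Take \<open>s = t / (n + 1)\<close> in \<open>D_invariant\<close> and use \<open>(n + 1) ^ n \<le> exp 1 ^ (n + 1) * fact n\<close>. The geometric rate
  \<open>gevrey_const\<close> must not depend on \<open>T\<close>, since it determines the angle of the sector. This is possible because the
  constant for times up to one can be used as soon as \<open>s \<le> 1\<close>.
\<close>

lemma D_gevrey_bound:
  "\<exists>C>0. \<forall>n t x y. 0 < t \<longrightarrow> t \<le> T \<longrightarrow>
     \<bar>D n t x y\<bar> * t ^ n \<le> C * fact n * gevrey_const ^ n * (t / real (n + 1) * \<rho> (t / real (n + 1)) (x - y))"
proof (cases "0 < T")
  case T: True
  define A1 where "A1 = D_const 1"
  define AT where "AT = D_const T"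
  have A: "0 < A1" "0 < AT" using D_const_ge(3) T by (auto simp: A1_def AT_def)
  define N where "N = nat \<lceil>T\<rceil>"
  (* Only finitely many n have s > 1, namely those with n + 1 < t \<le> T; C0 pays for replacing AT by A1
     in these cases. *)
  define C0 where "C0 = (1 + AT / A1) ^ N"
  have ratio: "1 \<le> 1 + AT / A1" using A by simp
  have C0: "1 \<le> C0" unfolding C0_def by (rule one_le_power[OF ratio])
  have "\<bar>D n t x y\<bar> * t ^ n \<le> (C0 * A1 * exp 1) * fact n * gevrey_const ^ n * (t / real (n + 1) * \<rho> (t / real (n + 1)) (x - y))"
    if t: "0 < t" "t \<le> T" for n t x y
  proof -
    let ?s = "t / real (n + 1)"
    have s0: "0 < ?s" using t by simp
    have r0: "0 \<le> ?s * \<rho> ?s (x - y)" using s0 rho_nonneg[OF s0] by (intro mult_nonneg_nonneg) auto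
    have "t / real (n + 1) \<le> t / 1" using t by (intro divide_left_mono) auto
    then have sT: "?s \<le> T" using t by simp
    have eq: "real (n + 1) * ?s = t" by simp
    have 1: "\<bar>D n t x y\<bar> * ?s ^ n \<le> (C0 * A1 ^ (n + 1)) * (?s * \<rho> ?s (x - y))"
    proof (cases "?s \<le> 1")
      case True
      have "\<bar>D n t x y\<bar> * ?s ^ n \<le> A1 ^ (n + 1) * ?s * \<rho> ?s (x - y)"
        using D_invariant_bound[OF D_invariant s0 True, of n x y] unfolding eq A1_def .
      also have "\<dots> = (1 * A1 ^ (n + 1)) * (?s * \<rho> ?s (x - y))" by simp
      also have "\<dots> \<le> (C0 * A1 ^ (n + 1)) * (?s * \<rho> ?s (x - y))"
        using C0 A r0 by (intro mult_right_mono) auto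
      finally show ?thesis .
    next
      case False
      then have "real (n + 1) < t" by (simp add: field_simps)
      then have "n + 1 \<le> N" using t unfolding N_def by linarith
      have "AT ^ (n + 1) = (AT / A1) ^ (n + 1) * A1 ^ (n + 1)" using A by (simp add: power_divide)
      also have "\<dots> \<le> C0 * A1 ^ (n + 1)"
      proof (rule mult_right_mono)
        have "(AT / A1) ^ (n + 1) \<le> (1 + AT / A1) ^ (n + 1)" using A by (intro power_mono) auto
        also have "\<dots> \<le> C0" unfolding C0_def using \<open>n + 1 \<le> N\<close> by (intro power_increasing ratio)
        finally show "(AT / A1) ^ (n + 1) \<le> C0" .
      qed (use A in simp)
      finally have le: "AT ^ (n + 1) \<le> C0 * A1 ^ (n + 1)" .
      have "\<bar>D n t x y\<bar> * ?s ^ n \<le> AT ^ (n + 1) * ?s * \<rho> ?s (x - y)"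
        using D_invariant_bound[OF D_invariant s0 sT, of n x y] unfolding eq AT_def .
      also have "\<dots> = AT ^ (n + 1) * (?s * \<rho> ?s (x - y))" by simp
      also have "\<dots> \<le> (C0 * A1 ^ (n + 1)) * (?s * \<rho> ?s (x - y))" by (rule mult_right_mono[OF le r0])
      finally show ?thesis .
    qed
    have tn: "t ^ n = ?s ^ n * real (Suc n) ^ n" by (simp add: power_divide)
    have "\<bar>D n t x y\<bar> * t ^ n = (\<bar>D n t x y\<bar> * ?s ^ n) * real (Suc n) ^ n" unfolding tn by (simp only: mult.assoc)
    also have "\<dots> \<le> ((C0 * A1 ^ (n + 1)) * (?s * \<rho> ?s (x - y))) * (exp 1 ^ Suc n * fact n)"
    proof (rule mult_mono[OF 1 power_self_le_exp_fact])
      show "0 \<le> (C0 * A1 ^ (n + 1)) * (?s * \<rho> ?s (x - y))" using r0 C0 A by (intro mult_nonneg_nonneg[OF _ r0]) auto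
    qed simp
    also have "\<dots> = (C0 * A1 * exp 1) * fact n * (exp 1 * A1) ^ n * (?s * \<rho> ?s (x - y))"
      by (simp only: power_add power_Suc power_one_right power_mult_distrib mult_ac)
    finally show ?thesis unfolding gevrey_const_def A1_def .
  qed
  then show ?thesis using C0 A by (intro exI[of _ "C0 * A1 * exp 1"]) auto
next
  case False
  then show ?thesis by (intro exI[of _ 1]) auto
qed

definition ext_const :: "real \<Rightarrow> real" where
  "ext_const T = (SOME C. 0 < C \<and> (\<forall>n t x y. 0 < t \<longrightarrow> t \<le> T \<longrightarrow>
     \<bar>D n t x y\<bar> * t ^ n \<le> C * fact n * gevrey_const ^ n * (t / real (n + 1) * \<rho> (t / real (n + 1)) (x - y))))"

lemma ext_const_pos: "0 < ext_const T"
  and D_le: "0 < t \<Longrightarrow> t \<le> T \<Longrightarrow> \<bar>D n t x y\<bar> * t ^ n \<le> ext_const T * fact n * gevrey_const ^ n * (t / real (n + 1) * \<rho> (t / real (n + 1)) (x - y))"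
  using someI_ex[OF D_gevrey_bound[of T], folded ext_const_def] by blast+

text \<open>
  Small enough for the \<open>n\<close>-th Taylor coefficient times the \<open>n\<close>-th power of \<open>radius_ratio * t\<close> to carry a
  factor \<open>(1/2) ^ n\<close>.
\<close>

definition radius_ratio :: real where "radius_ratio = min 1 (1 / (2 * gevrey_const))"

lemma radius_ratio: "0 < radius_ratio" "radius_ratio \<le> 1" "gevrey_const * radius_ratio \<le> 1 / 2"
proof -
  show "0 < radius_ratio" "radius_ratio \<le> 1" using gevrey_const_pos by (auto simp: radius_ratio_def)
  have "gevrey_const * radius_ratio \<le> gevrey_const * (1 / (2 * gevrey_const))"
    using gevrey_const_pos by (intro mult_left_mono) (auto simp: radius_ratio_def)
  also have "\<dots> = 1 / 2" using gevrey_const_pos by simp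
  finally show "gevrey_const * radius_ratio \<le> 1 / 2" .
qed

definition gevrey_term :: "real \<Rightarrow> nat \<Rightarrow> 'a \<Rightarrow> real" where
  "gevrey_term t n x = (1/2) ^ n * (t / real (n + 1) * \<rho> (t / real (n + 1)) x)"

text \<open>
  The majorant of the heat kernel at complex times with real part \<open>t\<close>. The value at the single point zero is a
  convention, matched by the value of \<open>pc\<close> on the diagonal.
\<close>

definition gevrey_maj :: "real \<Rightarrow> 'a \<Rightarrow> real" where
  "gevrey_maj t x = (if x = 0 then 0 else \<Sum>n. gevrey_term t n x)"

lemma gevrey_term_nonneg: "0 < t \<Longrightarrow> 0 \<le> gevrey_term t n x"
  unfolding gevrey_term_def by (intro mult_nonneg_nonneg rho_nonneg) auto

lemma D_le_gevrey_term:
  assumes t: "0 < t" "t \<le> T"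
  shows "\<bar>D n t x y\<bar> * (radius_ratio * t) ^ n \<le> fact n * (ext_const T * gevrey_term t n (x - y))"
proof -
  define R where "R = t / real (n + 1) * \<rho> (t / real (n + 1)) (x - y)"
  have R: "0 \<le> R" using t unfolding R_def by (intro mult_nonneg_nonneg rho_nonneg) auto
  have "\<bar>D n t x y\<bar> * (radius_ratio * t) ^ n = (\<bar>D n t x y\<bar> * t ^ n) * radius_ratio ^ n"
    by (simp only: power_mult_distrib mult_ac)
  also have "\<dots> \<le> (ext_const T * fact n * gevrey_const ^ n * R) * radius_ratio ^ n"
    using radius_ratio(1) unfolding R_def by (intro mult_right_mono D_le t) auto
  also have "\<dots> = (ext_const T * fact n * R) * (gevrey_const * radius_ratio) ^ n"
    by (simp only: power_mult_distrib mult_ac)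
  also have "\<dots> \<le> (ext_const T * fact n * R) * (1 / 2) ^ n"
    using radius_ratio gevrey_const_pos ext_const_pos[of T] R by (intro mult_left_mono power_mono mult_nonneg_nonneg) auto
  finally show ?thesis by (simp add: gevrey_term_def R_def mult_ac)
qed

lemma gevrey_term_le:
  assumes t: "0 < t" and R: "0 < R" "R \<le> norm x"
  shows "gevrey_term t n x \<le> (1/2) ^ n * (t * profile DIM('a) R)"
proof -
  have s: "0 < t / real (n + 1)" "t / real (n + 1) \<le> t" using t by (auto simp: divide_le_eq mult_le_cancel_left1)
  show ?thesis unfolding gevrey_term_def
    using s R t rho_nonneg[OF s(1)] by (intro mult_left_mono mult_mono rho_le_profile) auto
qed

lemma summable_gevrey_term: assumes t: "0 < t" and x: "x \<noteq> 0" shows "summable (\<lambda>n. gevrey_term t n x)"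
proof (rule summable_comparison_test')
  show "summable (\<lambda>n. (1/2) ^ n * (t * profile DIM('a) (norm x)))" by (intro summable_mult2 summable_geometric) simp
  show "norm (gevrey_term t n x) \<le> (1/2) ^ n * (t * profile DIM('a) (norm x))" for n
    using gevrey_term_le[OF t _ order_refl, of x n] gevrey_term_nonneg[OF t, of n x] x by simp
qed

lemma gevrey_maj_nonneg: "0 < t \<Longrightarrow> 0 \<le> gevrey_maj t x"
  unfolding gevrey_maj_def by (auto intro!: suminf_nonneg summable_gevrey_term gevrey_term_nonneg)

lemma gevrey_maj_minus: "gevrey_maj t (- x) = gevrey_maj t x"
  by (simp add: gevrey_maj_def gevrey_term_def rho_minus)

lemma gevrey_maj_le: assumes t: "0 < t" and R: "0 < R" "R \<le> norm x" shows "gevrey_maj t x \<le> 2 * (t * profile DIM('a) R)"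
proof -
  have x: "x \<noteq> 0" using R by auto
  have "gevrey_maj t x = (\<Sum>n. gevrey_term t n x)" using x by (simp add: gevrey_maj_def)
  also have "\<dots> \<le> (\<Sum>n. (1/2) ^ n * (t * profile DIM('a) R))"
    by (intro suminf_le gevrey_term_le t R summable_gevrey_term x summable_mult2 summable_geometric) simp
  also have "\<dots> = 2 * (t * profile DIM('a) R)" by (subst suminf_mult2[symmetric]) (auto simp: suminf_geometric)
  finally show ?thesis .
qed

lemma gevrey_maj_scale: assumes a: "0 < a" "a \<le> t" "t \<le> b" shows "gevrey_maj t x \<le> (b / a) * gevrey_maj a x"
proof (cases "x = 0")
  case False
  have t: "0 < t" using a by simp
  have "(\<Sum>n. gevrey_term t n x) \<le> (\<Sum>n. (b / a) * gevrey_term a n x)"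
  proof (intro suminf_le summable_gevrey_term summable_mult t a False)
    fix n
    have "t / real (n + 1) * \<rho> (t / real (n + 1)) x \<le> (b / real (n + 1)) * \<rho> (a / real (n + 1)) x"
      using a t by (intro mult_mono rho_antimono rho_nonneg divide_right_mono) auto
    also have "\<dots> = (b / a) * (a / real (n + 1) * \<rho> (a / real (n + 1)) x)" using a by simp
    finally have "(1/2) ^ n * (t / real (n + 1) * \<rho> (t / real (n + 1)) x) \<le> (1/2) ^ n * ((b / a) * (a / real (n + 1) * \<rho> (a / real (n + 1)) x))"
      by (rule mult_left_mono) simp
    then show "gevrey_term t n x \<le> (b / a) * gevrey_term a n x" unfolding gevrey_term_def by (simp only: mult_ac)
  qed
  also have "\<dots> = (b / a) * (\<Sum>n. gevrey_term a n x)" by (rule suminf_mult[OF summable_gevrey_term[OF a(1) False]])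
  finally show ?thesis using False by (simp add: gevrey_maj_def)
qed (simp add: gevrey_maj_def)

lemma gevrey_term_measurable: "0 < t \<Longrightarrow> gevrey_term t n \<in> borel_measurable borel"
  using rho_measurable[of "t / real (n + 1)"] unfolding gevrey_term_def[abs_def] by simp

lemma gevrey_maj_measurable: assumes "0 < t" shows "gevrey_maj t \<in> borel_measurable borel"
proof -
  have "(\<lambda>x. \<Sum>n. gevrey_term t n x) \<in> borel_measurable borel"
    by (rule borel_measurable_suminf) (rule gevrey_term_measurable[OF assms])
  then show ?thesis unfolding gevrey_maj_def[abs_def] by (intro measurable_If) auto
qed

text \<open>
  The mass of \<open>s * \<rho>\<^sub>s\<close> is bounded uniformly in \<open>s \<le> T\<close>, so the masses of the terms form a geometric series. The
  bound does not deteriorate as \<open>t\<close> tends to zero.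
\<close>

lemma nn_integral_gevrey_maj:
  assumes t: "0 < t" "t \<le> T"
  shows "(\<integral>\<^sup>+ x. ennreal (gevrey_maj t x) \<partial>lborel) \<le> ennreal (2 * rho_mass * (T + 1))"
proof -
  let ?c = "rho_mass * (T + 1)"
  have c: "0 \<le> ?c" using rho_mass_pos t by simp
  have "(\<integral>\<^sup>+ x. ennreal (gevrey_maj t x) \<partial>lborel) \<le> (\<integral>\<^sup>+ x. (\<Sum>n. ennreal (gevrey_term t n x)) \<partial>lborel)"
  proof (rule nn_integral_mono)
    fix x :: 'a
    show "ennreal (gevrey_maj t x) \<le> (\<Sum>n. ennreal (gevrey_term t n x))"
    proof (cases "x = 0")
      case False
      then show ?thesis using suminf_ennreal2[OF gevrey_term_nonneg[OF t(1)] summable_gevrey_term[OF t(1) False]] by (simp add: gevrey_maj_def)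
    qed (simp add: gevrey_maj_def)
  qed
  also have "\<dots> = (\<Sum>n. \<integral>\<^sup>+ x. ennreal (gevrey_term t n x) \<partial>lborel)"
    by (rule nn_integral_suminf) (use gevrey_term_measurable[OF t(1)] in simp)
  also have "\<dots> \<le> (\<Sum>n. ennreal ((1/2) ^ n * ?c))"
  proof (rule suminf_le)
    fix n
    let ?s = "t / real (n + 1)"
    have s: "0 < ?s" "?s \<le> T" using t by (auto simp: divide_le_eq intro: order_trans[OF _ mult_left_mono[of 1]])
    have "(\<integral>\<^sup>+ x. ennreal (gevrey_term t n x) \<partial>lborel) = (\<integral>\<^sup>+ x. ennreal ((1/2) ^ n * ?s) * ennreal (\<rho> ?s x) \<partial>lborel)"
    proof (rule nn_integral_cong)
      fix x :: 'a
      have "gevrey_term t n x = ((1/2) ^ n * ?s) * \<rho> ?s x" by (simp only: gevrey_term_def mult.assoc)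
      then show "ennreal (gevrey_term t n x) = ennreal ((1/2) ^ n * ?s) * ennreal (\<rho> ?s x)"
        using s by (simp only:) (intro ennreal_mult rho_nonneg mult_nonneg_nonneg, auto)
    qed
    also have "\<dots> = ennreal ((1/2) ^ n * ?s) * (\<integral>\<^sup>+ x. ennreal (\<rho> ?s x) \<partial>lborel)"
      using rho_measurable[OF s(1)] by (intro nn_integral_cmult) simp
    also have "\<dots> \<le> ennreal ((1/2) ^ n * ?s) * ennreal (?c / ?s)"
      by (intro mult_left_mono nn_integral_rho_le_mass s) simp
    also have "\<dots> = ennreal (((1/2) ^ n * ?s) * (?c / ?s))" using s c t rho_mass_pos by (intro ennreal_mult[symmetric] mult_nonneg_nonneg divide_nonneg_nonneg) auto
    also have "((1/2) ^ n * ?s) * (?c / ?s) = (1/2) ^ n * ?c"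
    proof -
      have "(a * s) * (c / s) = a * c" if "0 < s" for a s c :: real using that by simp
      from this[OF s(1)] show ?thesis .
    qed
    finally show "(\<integral>\<^sup>+ x. ennreal (gevrey_term t n x) \<partial>lborel) \<le> ennreal ((1/2) ^ n * ?c)" .
  qed auto
  also have "\<dots> = ennreal (\<Sum>n. (1/2) ^ n * ?c)"
    by (rule suminf_ennreal2) (use c in \<open>auto intro!: summable_mult2 summable_geometric\<close>)
  also have "(\<Sum>n. (1/2::real) ^ n * ?c) = 2 * rho_mass * (T + 1)" by (subst suminf_mult2[symmetric]) (auto simp: suminf_geometric)
  finally show ?thesis .
qed

lemma gevrey_D:
  assumes xy: "x \<noteq> y" shows "gevrey_one (\<lambda>n t. D n t x y) radius_ratio"
proof
  show "0 < radius_ratio" "radius_ratio \<le> 1" by (rule radius_ratio)+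
  show "((\<lambda>t. D n t x y) has_real_derivative D (Suc n) t x y) (at t)" if "0 < t" for n t
    by (rule D_invariant_derivative'[OF D_invariant that])
  show "\<exists>M. \<forall>n t. a \<le> t \<longrightarrow> t \<le> b \<longrightarrow> \<bar>D n t x y\<bar> * (radius_ratio * t) ^ n \<le> M * fact n" if a: "0 < a" "a \<le> b" for a b
  proof (intro exI allI impI)
    fix n t assume t: "a \<le> t" "t \<le> b"
    let ?p = "profile DIM('a) (norm (x - y))"
    have t0: "0 < t" using a t by simp
    have xy0: "0 < norm (x - y)" using xy by simp
    have p: "0 \<le> ?p" using profile_pos[OF xy0, of "DIM('a)"] by simp
    have "gevrey_term t n (x - y) \<le> (1/2) ^ n * (t * ?p)" by (rule gevrey_term_le[OF t0 xy0 order_refl])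
    also have "\<dots> \<le> 1 * (b * ?p)" using t t0 p by (intro mult_mono mult_right_mono power_le_one) auto
    finally have g: "gevrey_term t n (x - y) \<le> b * ?p" by simp
    have "\<bar>D n t x y\<bar> * (radius_ratio * t) ^ n \<le> fact n * (ext_const b * gevrey_term t n (x - y))" by (rule D_le_gevrey_term[OF t0 t(2)])
    also have "\<dots> \<le> fact n * (ext_const b * (b * ?p))" using g ext_const_pos[of b] by (intro mult_left_mono) auto
    finally show "\<bar>D n t x y\<bar> * (radius_ratio * t) ^ n \<le> (ext_const b * (b * ?p)) * fact n" by (simp only: mult_ac)
  qed
qed

definition slope :: real where "slope = radius_ratio / 8"

lemma slope_pos: "0 < slope" using radius_ratio by (simp add: slope_def)

text \<open>
  The diagonal is a null set for the integral operators. The value zero there keeps the bound \<open>pc_le\<close>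
  and holomorphy valid for all pairs of points.
\<close>

definition pc :: "complex \<Rightarrow> 'a \<Rightarrow> 'a \<Rightarrow> complex" where
  "pc z x y = (if x = y then 0 else analytic_extension (\<lambda>n t. D n t x y) z)"

lemma pc_holomorphic: "x \<noteq> y \<Longrightarrow> (\<lambda>z. pc z x y) holomorphic_on wedge slope"
  using gevrey_one.analytic_extension_holomorphic[OF gevrey_D] by (simp add: pc_def slope_def)

lemma pc_real: "0 < t \<Longrightarrow> x \<noteq> y \<Longrightarrow> pc (of_real t) x y = of_real (p t x y)"
  using gevrey_one.analytic_extension_real[OF gevrey_D] by (simp add: pc_def D_0)

lemma pc_le:
  assumes z: "z \<in> wedge slope" and T: "Re z \<le> T"
  shows "norm (pc z x y) \<le> ext_const T * gevrey_maj (Re z) (x - y)"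
proof (cases "x = y")
  case True
  then show ?thesis by (simp add: pc_def gevrey_maj_def)
next
  case False
  let ?t = "Re z"
  have t: "0 < ?t" and im: "\<bar>Im z\<bar> < slope * ?t" using z by (auto simp: wedge_def)
  have "slope * ?t \<le> radius_ratio * ?t" using t radius_ratio by (intro mult_right_mono) (auto simp: slope_def)
  then have im': "\<bar>Im z\<bar> < radius_ratio * ?t" using im by linarith
  then have zr: "z \<in> wedge radius_ratio" using t by (simp add: wedge_def)
  let ?a = "\<lambda>n. of_real (D n ?t x y / fact n) * (\<i> * complex_of_real (Im z)) ^ n"
  have sn: "summable (\<lambda>n. norm (?a n))" by (rule gevrey_one.analytic_extension_summable[OF gevrey_D[OF False] zr])
  have "norm (pc z x y) = norm (\<Sum>n. ?a n)" using False by (simp add: pc_def analytic_extension_def)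
  also have "\<dots> \<le> (\<Sum>n. norm (?a n))" by (rule summable_norm[OF sn])
  also have "\<dots> \<le> (\<Sum>n. ext_const T * gevrey_term ?t n (x - y))"
  proof (rule suminf_le[OF _ sn])
    show "summable (\<lambda>n. ext_const T * gevrey_term ?t n (x - y))" using t False by (intro summable_mult summable_gevrey_term) auto
    fix n
    have "norm (?a n) = \<bar>D n ?t x y\<bar> * \<bar>Im z\<bar> ^ n / fact n" by (simp add: norm_mult norm_power norm_divide)
    also have "\<dots> \<le> \<bar>D n ?t x y\<bar> * (radius_ratio * ?t) ^ n / fact n"
      using im' by (intro divide_right_mono mult_left_mono power_mono) auto
    also have "\<dots> \<le> fact n * (ext_const T * gevrey_term ?t n (x - y)) / fact n"
      by (intro divide_right_mono D_le_gevrey_term t T) auto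
    finally show "norm (?a n) \<le> ext_const T * gevrey_term ?t n (x - y)" by simp
  qed
  also have "\<dots> = ext_const T * (\<Sum>n. gevrey_term ?t n (x - y))" by (rule suminf_mult) (use t False in \<open>auto intro!: summable_gevrey_term\<close>)
  finally show ?thesis using False by (simp add: gevrey_maj_def)
qed

lemma pc_measurable:
  assumes z: "z \<in> wedge slope" shows "(\<lambda>(x, y). pc z x y) \<in> borel_measurable borel"
proof -
  have t: "0 < Re z" using z by (simp add: wedge_def)
  have "(\<lambda>w. of_real ((case w of (x, y) \<Rightarrow> D n (Re z) x y) / fact n) * (\<i> * complex_of_real (Im z)) ^ n) \<in> borel_measurable borel" for n
    using D_invariant_measurable[OF D_invariant[of n] t] by simp
  then have 1: "(\<lambda>w. \<Sum>n. of_real ((case w of (x, y) \<Rightarrow> D n (Re z) x y) / fact n) * (\<i> * complex_of_real (Im z)) ^ n) \<in> borel_measurable borel"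
    by (rule borel_measurable_suminf)
  have "closed {w :: 'a \<times> 'a. fst w = snd w}" by (intro closed_Collect_eq continuous_intros)
  then have 2: "(\<lambda>w :: 'a \<times> 'a. if fst w = snd w then 0 else \<Sum>n. of_real ((case w of (x, y) \<Rightarrow> D n (Re z) x y) / fact n) * (\<i> * complex_of_real (Im z)) ^ n) \<in> borel_measurable borel"
    by (intro measurable_If 1) auto
  have "(\<lambda>(x, y). pc z x y) = (\<lambda>w :: 'a \<times> 'a. if fst w = snd w then 0 else \<Sum>n. of_real ((case w of (x, y) \<Rightarrow> D n (Re z) x y) / fact n) * (\<i> * complex_of_real (Im z)) ^ n)"
    by (auto simp: fun_eq_iff pc_def analytic_extension_def)
  then show ?thesis using 2 by simp
qed

end

section \<open>Integral operators on \<open>L\<^sup>q\<close>\<close>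

lemma powr_add_le: 
  fixes a b :: real
  assumes "0 \<le> a" "0 \<le> b" "1 \<le> q"
  shows "(a + b) powr q \<le> 2 powr q * (a powr q + b powr q)"
proof -
  have "(a + b) powr q \<le> (2 * max a b) powr q" using assms by (intro powr_mono2) auto
  also have "\<dots> = 2 powr q * (max a b) powr q" using assms by (simp add: powr_mult)
  also have "(max a b) powr q \<le> a powr q + b powr q" by (simp add: max_def)
  finally show ?thesis by (simp add: mult_left_mono)
qed

lemma norm_add_powr_le:
  fixes f g :: "'b::real_normed_vector"
  assumes "1 \<le> q"
  shows "norm (f + g) powr q \<le> 2 powr q * (norm f powr q + norm g powr q)"
proof -
  have "norm (f + g) powr q \<le> (norm f + norm g) powr q" using assms by (intro powr_mono2 norm_triangle_ineq) auto
  also have "\<dots> \<le> 2 powr q * (norm f powr q + norm g powr q)" by (rule powr_add_le) (use assms in auto)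
  finally show ?thesis .
qed

lemma completion_ex_borel_measurable_complex:
  fixes f :: "'a::euclidean_space \<Rightarrow> complex"
  assumes f: "f \<in> borel_measurable lebesgue"
  shows "\<exists>g\<in>borel_measurable borel. AE x in lborel. f x = g x"
proof -
  have "(\<lambda>x. Re (f x)) \<in> borel_measurable lebesgue" "(\<lambda>x. Im (f x)) \<in> borel_measurable lebesgue"
    using f by (auto intro: measurable_compose[OF f])
  from this[THEN completion_ex_borel_measurable_real]
  obtain a b where ab: "a \<in> borel_measurable lborel" "b \<in> borel_measurable lborel"
    "AE x in lborel. Re (f x) = a x" "AE x in lborel. Im (f x) = b x" by blast
  show ?thesis
  proof (intro bexI)
    show "(\<lambda>x. Complex (a x) (b x)) \<in> borel_measurable borel"
      unfolding Complex_eq using ab by simp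
    show "AE x in lborel. f x = Complex (a x) (b x)"
      using ab(3,4) by eventually_elim (simp add: complex_eq_iff)
  qed
qed

text \<open>
  Estimates are made for the \<open>q\<close>-th power of the norm, for which \<open>norm (a + b) powr q \<le> 2 powr q * (norm a powr q + norm b powr q)\<close>
  serves as triangle inequality. The powers of two do not affect boundedness or convergence.
\<close>

definition Lq_mass :: "real \<Rightarrow> ('a::euclidean_space \<Rightarrow> complex) \<Rightarrow> real" where
  "Lq_mass q f = (LINT x|lebesgue. norm (f x) powr q)"

lemma Lq_mass_nonneg: "0 \<le> Lq_mass q f"
  unfolding Lq_mass_def by (rule integral_nonneg_AE) simp

lemma Lp_norm_mass: "Lp_norm q f = Lq_mass q f powr (1 / q)"
  by (simp add: Lp_norm_def Lq_mass_def)

lemma Lp_norm_le: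
  assumes q: "1 \<le> q" and C: "0 \<le> C" and le: "Lq_mass q f \<le> C powr q * Lq_mass q g"
  shows "Lp_norm q f \<le> C * Lp_norm q g"
proof -
  have "Lq_mass q f powr (1 / q) \<le> (C powr q * Lq_mass q g) powr (1 / q)"
    using q le Lq_mass_nonneg[of q f] by (intro powr_mono2) auto
  also have "\<dots> = (C powr q) powr (1 / q) * Lq_mass q g powr (1 / q)" by (rule powr_mult)
  also have "(C powr q) powr (1 / q) = C" using q C by (simp add: powr_powr)
  finally show ?thesis by (simp add: Lp_norm_mass)
qed

lemma Lp_fun_measurable: "f \<in> Lp_fun q \<Longrightarrow> f \<in> borel_measurable lebesgue"
  and Lp_fun_integrable: "f \<in> Lp_fun q \<Longrightarrow> integrable lebesgue (\<lambda>x. norm (f x) powr q)"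
  by (auto simp: Lp_fun_def)

lemma Lp_fun_add:
  assumes q: "1 \<le> q" and f: "f \<in> Lp_fun q" and g: "g \<in> Lp_fun q"
  shows "(\<lambda>x. f x + g x) \<in> Lp_fun q" and "Lq_mass q (\<lambda>x. f x + g x) \<le> 2 powr q * (Lq_mass q f + Lq_mass q g)"
proof -
  have m: "(\<lambda>x. f x + g x) \<in> borel_measurable lebesgue" using f g by (intro borel_measurable_add) (auto simp: Lp_fun_def)
  have i: "integrable lebesgue (\<lambda>x. 2 powr q * (norm (f x) powr q + norm (g x) powr q))"
    using Lp_fun_integrable[OF f] Lp_fun_integrable[OF g] by (intro Bochner_Integration.integrable_mult_right Bochner_Integration.integrable_add)
  have i2: "integrable lebesgue (\<lambda>x. norm (f x + g x) powr q)"
    by (rule Bochner_Integration.integrable_bound[OF i])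
       (use m norm_add_powr_le[OF q] in \<open>auto intro!: AE_I2 intro: order_trans[OF _ abs_ge_self]\<close>)
  show "(\<lambda>x. f x + g x) \<in> Lp_fun q" using m i2 by (simp add: Lp_fun_def)
  have "Lq_mass q (\<lambda>x. f x + g x) \<le> (LINT x|lebesgue. 2 powr q * (norm (f x) powr q + norm (g x) powr q))"
    unfolding Lq_mass_def by (intro integral_mono i i2 norm_add_powr_le q)
  also have "\<dots> = 2 powr q * (Lq_mass q f + Lq_mass q g)"
    unfolding Lq_mass_def by (simp add: Bochner_Integration.integral_add[OF Lp_fun_integrable[OF f] Lp_fun_integrable[OF g]])
  finally show "Lq_mass q (\<lambda>x. f x + g x) \<le> 2 powr q * (Lq_mass q f + Lq_mass q g)" .
qed

lemma Lp_fun_cmult: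
  assumes f: "f \<in> Lp_fun q" shows "(\<lambda>x. c * f x) \<in> Lp_fun q" and "Lq_mass q (\<lambda>x. c * f x) = norm c powr q * Lq_mass q f"
proof -
  have eq: "(\<lambda>x. norm (c * f x) powr q) = (\<lambda>x. norm c powr q * norm (f x) powr q)"
    by (rule ext) (simp add: norm_mult powr_mult)
  have "(\<lambda>x. c * f x) \<in> borel_measurable lebesgue" using f by (intro borel_measurable_times) (auto simp: Lp_fun_def)
  then show "(\<lambda>x. c * f x) \<in> Lp_fun q" using Lp_fun_integrable[OF f] unfolding Lp_fun_def mem_Collect_eq eq by simp
  show "Lq_mass q (\<lambda>x. c * f x) = norm c powr q * Lq_mass q f" unfolding Lq_mass_def eq by simp
qed

lemma Lp_fun_cong_AE:
  assumes g: "g \<in> borel_measurable lebesgue" and f: "f \<in> Lp_fun q" and eq: "AE x in lebesgue. f x = g x"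
  shows "g \<in> Lp_fun q" "Lq_mass q g = Lq_mass q f"
proof -
  have mp: "(\<lambda>x. norm (h x) powr q) \<in> borel_measurable lebesgue" if "h \<in> borel_measurable lebesgue" for h :: "'a \<Rightarrow> complex"
    using that by simp
  have ae: "AE x in lebesgue. norm (f x) powr q = norm (g x) powr q" using eq by eventually_elim simp
  have "integrable lebesgue (\<lambda>x. norm (g x) powr q)"
    using Lp_fun_integrable[OF f] integrable_cong_AE[OF mp[OF Lp_fun_measurable[OF f]] mp[OF g] ae] by blast
  then show "g \<in> Lp_fun q" using g by (simp add: Lp_fun_def)
  show "Lq_mass q g = Lq_mass q f" unfolding Lq_mass_def
    by (rule integral_cong_AE[OF mp[OF g] mp[OF Lp_fun_measurable[OF f]]]) (use ae in eventually_elim, simp)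
qed

text \<open>
  Jensen's inequality for the finite measure with density \<open>k\<close>, up to a factor \<open>2 powr q\<close>: split
  \<open>h \<le> l powr (1 - q) * h powr q + l\<close>, integrate, and choose \<open>l\<close>.
\<close>

lemma young_pointwise:
  fixes k h :: "'b \<Rightarrow> real"
  assumes q: "1 \<le> q" and M: "0 < M" and k: "integrable N k" "\<And>y. 0 \<le> k y" "(LINT y|N. k y) \<le> M"
    and h: "\<And>y. 0 \<le> h y" and hm: "h \<in> borel_measurable N" and kh: "integrable N (\<lambda>y. k y * h y powr q)"
  shows "integrable N (\<lambda>y. k y * h y)"
    and "(LINT y|N. k y * h y) powr q \<le> (2 powr q * M powr (q - 1)) * (LINT y|N. k y * h y powr q)"
proof -
  have split: "h y \<le> l powr (1 - q) * h y powr q + l" if l: "0 < l" for l y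
  proof (cases "h y \<le> l")
    case True
    then show ?thesis by (intro order_trans[OF True]) simp
  next
    case False
    then have hy: "l < h y" "0 < h y" using l by auto
    have "h y = h y powr (1 - q) * h y powr q" using hy by (simp add: powr_add[symmetric])
    also have "\<dots> \<le> l powr (1 - q) * h y powr q" using hy l q by (intro mult_right_mono powr_mono2') auto
    finally show ?thesis using l by simp
  qed
  have bi: "integrable N (\<lambda>y. l powr (1 - q) * (k y * h y powr q) + l * k y)" for l
    by (intro Bochner_Integration.integrable_add Bochner_Integration.integrable_mult_right kh k(1))
  have pt: "k y * h y \<le> l powr (1 - q) * (k y * h y powr q) + l * k y" if "0 < l" for l y
    using mult_left_mono[OF split[OF that] k(2)[of y], of y] by (simp add: algebra_simps)
  have km: "(\<lambda>y. k y * h y) \<in> borel_measurable N" using k(1) hm by simp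
  show i: "integrable N (\<lambda>y. k y * h y)"
    by (rule Bochner_Integration.integrable_bound[OF bi[of 1] km])
       (use pt[of 1] k(2) h in \<open>auto intro!: AE_I2 simp: abs_of_nonneg\<close>)
  let ?I = "LINT y|N. k y * h y" and ?B = "LINT y|N. k y * h y powr q"
  have I0: "0 \<le> ?I" and B0: "0 \<le> ?B" using k(2) h by (auto intro!: integral_nonneg_AE)
  have main: "?I \<le> l powr (1 - q) * ?B + l * M" if l: "0 < l" for l
  proof -
    have "?I \<le> (LINT y|N. l powr (1 - q) * (k y * h y powr q) + l * k y)" by (intro integral_mono i bi pt l)
    also have "\<dots> = l powr (1 - q) * ?B + l * (LINT y|N. k y)"
      by (simp add: Bochner_Integration.integral_add Bochner_Integration.integrable_mult_right kh k(1))
    also have "\<dots> \<le> l powr (1 - q) * ?B + l * M" using l k(3) by simp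
    finally show ?thesis .
  qed
  show "?I powr q \<le> (2 powr q * M powr (q - 1)) * ?B"
  proof (cases "?B = 0")
    case True
    have "?I \<le> 0"
    proof (rule field_le_epsilon)
      fix e :: real assume e: "0 < e"
      show "?I \<le> 0 + e" using main[of "e / M"] e M True by simp
    qed
    then have "?I = 0" using I0 by simp
    then show ?thesis using True by simp
  next
    case False
    then have B: "0 < ?B" using B0 by simp
    (* For this l the two summands in main are equal. *)
    define l where "l = (?B / M) powr (1 / q)"
    have l: "0 < l" using B M by (simp add: l_def)
    have lq: "l powr q = ?B / M" using B M q by (simp add: l_def powr_powr)
    have "l powr (1 - q) * ?B = l * (?B / l powr q)" using l by (simp add: powr_diff)
    also have "\<dots> = l * M" unfolding lq using B M by simp
    finally have "?I \<le> l * M + l * M" using main[OF l] by simp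
    then have "?I \<le> 2 * l * M" by (simp add: mult_ac)
    then have "?I powr q \<le> (2 * l * M) powr q" using I0 q by (intro powr_mono2) auto
    also have "\<dots> = 2 powr q * (?B / M) * M powr q" using l M by (simp add: powr_mult lq)
    also have "\<dots> = (2 powr q * M powr (q - 1)) * ?B" using M by (simp add: powr_diff)
    finally show ?thesis .
  qed
qed

definition kernel_op :: "('a::euclidean_space \<Rightarrow> 'a \<Rightarrow> complex) \<Rightarrow> ('a \<Rightarrow> complex) \<Rightarrow> 'a \<Rightarrow> complex" where
  "kernel_op K f x = (LINT y|lebesgue. K x y * f y)"

text \<open>
  A kernel dominated by an integrable function of \<open>x - y\<close>. The majorant serves all exponents \<open>q\<close> at once.
\<close>

locale dominated_kernel =
  fixes K :: "'a::euclidean_space \<Rightarrow> 'a \<Rightarrow> complex" and k :: "'a \<Rightarrow> real" and M :: real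
  assumes K_measurable: "(\<lambda>(x, y). K x y) \<in> borel_measurable borel"
    and k_measurable: "k \<in> borel_measurable borel" and k_nonneg: "\<And>x. 0 \<le> k x"
    and k_mass: "(\<integral>\<^sup>+ x. ennreal (k x) \<partial>lborel) \<le> ennreal M" and M_pos: "0 < M"
    and K_le: "\<And>x y. norm (K x y) \<le> k (x - y)"
begin

lemma K_measurable_right: "K x \<in> borel_measurable borel"
proof -
  have "(\<lambda>y. (x, y)) \<in> (borel :: 'a measure) \<rightarrow>\<^sub>M (borel :: ('a \<times> 'a) measure)"
    by (intro borel_measurable_continuous_onI continuous_intros)
  from measurable_compose[OF this K_measurable] show ?thesis by simp
qed

lemma k_integrable: "integrable lborel (\<lambda>y. k (x - y))" "(LINT y|lborel. k (x - y)) \<le> M"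
proof -
  have m: "(\<lambda>y. k (x - y)) \<in> borel_measurable borel"
    using measurable_compose[OF _ k_measurable, of "\<lambda>y. x - y" borel] by simp
  have "(\<lambda>x. ennreal (k x)) \<in> borel_measurable borel" using k_measurable by simp
  then have eq: "(\<integral>\<^sup>+ y. ennreal (k (x - y)) \<partial>lborel) = (\<integral>\<^sup>+ x. ennreal (k x) \<partial>lborel)" by (rule nn_integral_lborel_reflect_shift)
  show i: "integrable lborel (\<lambda>y. k (x - y))"
    by (rule integrableI_bounded) (use m k_nonneg k_mass eq in \<open>auto simp: le_less_trans\<close>)
  have "ennreal (LINT y|lborel. k (x - y)) = (\<integral>\<^sup>+ y. ennreal (k (x - y)) \<partial>lborel)"
    by (rule nn_integral_eq_integral[symmetric, OF i]) (simp add: k_nonneg)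
  also have "\<dots> \<le> ennreal M" unfolding eq by (rule k_mass)
  finally show "(LINT y|lborel. k (x - y)) \<le> M" using M_pos by (simp add: ennreal_le_iff)
qed

lemma kernel_op_cong_AE:
  assumes f: "f \<in> borel_measurable lebesgue" and eq: "AE y in lborel. f y = g y" and g: "g \<in> borel_measurable borel"
  shows "kernel_op K f x = (LINT y|lborel. K x y * g y)"
    and "integrable lborel (\<lambda>y. K x y * g y) \<Longrightarrow> integrable lebesgue (\<lambda>y. K x y * f y)"
proof -
  have gm: "(\<lambda>y. K x y * g y) \<in> borel_measurable lborel" using K_measurable_right[of x] g by simp
  then have gm': "(\<lambda>y. K x y * g y) \<in> borel_measurable lebesgue" by (rule measurable_completion)
  have ae: "AE y in lebesgue. K x y * f y = K x y * g y"
    using AE_completion[OF eq] by eventually_elim simp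
  have "K x \<in> borel_measurable lebesgue" using K_measurable_right[of x] by (intro measurable_completion) simp
  then have fm: "(\<lambda>y. K x y * f y) \<in> borel_measurable lebesgue" using f by (rule borel_measurable_times)
  show "kernel_op K f x = (LINT y|lborel. K x y * g y)"
    unfolding kernel_op_def integral_cong_AE[OF fm gm' ae] by (rule integral_completion[OF gm])
  show "integrable lborel (\<lambda>y. K x y * g y) \<Longrightarrow> integrable lebesgue (\<lambda>y. K x y * f y)"
    using integrable_cong_AE[OF fm gm' ae] integrable_completion[OF gm] by simp
qed


lemma k_measurable_pair: "(\<lambda>(x, y). k (x - y)) \<in> borel_measurable borel"
proof -
  have "(\<lambda>w :: 'a \<times> 'a. fst w - snd w) \<in> borel \<rightarrow>\<^sub>M borel"
    by (intro borel_measurable_continuous_onI continuous_intros)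
  from measurable_compose[OF this k_measurable] show ?thesis by (simp add: case_prod_beta)
qed

lemma nn_integral_convolution_le:
  assumes [measurable]: "w \<in> borel_measurable borel" and w: "\<And>y. 0 \<le> w y"
  shows "(\<integral>\<^sup>+ x. (\<integral>\<^sup>+ y. ennreal (k (x - y) * w y) \<partial>lborel) \<partial>lborel) \<le> ennreal M * (\<integral>\<^sup>+ y. ennreal (w y) \<partial>lborel)"
proof -
  note [measurable] = k_measurable
  have m: "(\<lambda>(x, y). ennreal (k (x - y) * w y)) \<in> borel_measurable (lborel \<Otimes>\<^sub>M lborel)"
  proof -
    have 1: "(\<lambda>(x, y). k (x - y)) \<in> borel_measurable ((lborel :: 'a measure) \<Otimes>\<^sub>M (lborel :: 'a measure))"
      using k_measurable_pair by (simp add: lborel_prod)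
    have 2: "(\<lambda>v. w (snd v)) \<in> borel_measurable ((lborel :: 'a measure) \<Otimes>\<^sub>M (lborel :: 'a measure))"
      using measurable_compose[OF measurable_snd, of w lborel borel] by simp
    show ?thesis using 1 2 by (simp add: case_prod_beta)
  qed
  have "(\<integral>\<^sup>+ x. (\<integral>\<^sup>+ y. ennreal (k (x - y) * w y) \<partial>lborel) \<partial>lborel) = (\<integral>\<^sup>+ y. (\<integral>\<^sup>+ x. ennreal (k (x - y) * w y) \<partial>lborel) \<partial>lborel)"
    using lborel_pair.Fubini'[where f="\<lambda>x y. ennreal (k (x - y) * w y)", OF m] by simp
  also have "\<dots> \<le> (\<integral>\<^sup>+ y. ennreal M * ennreal (w y) \<partial>lborel)"
  proof (rule nn_integral_mono)
    fix y
    have "(\<integral>\<^sup>+ x. ennreal (k (x - y) * w y) \<partial>lborel) = (\<integral>\<^sup>+ x. ennreal (k (x - y)) * ennreal (w y) \<partial>lborel)"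
      by (intro nn_integral_cong ennreal_mult k_nonneg w)
    also have "\<dots> = (\<integral>\<^sup>+ x. ennreal (k (x - y)) \<partial>lborel) * ennreal (w y)" by (rule nn_integral_multc) simp
    also have "(\<integral>\<^sup>+ x. ennreal (k (x - y)) \<partial>lborel) = (\<integral>\<^sup>+ x. ennreal (k x) \<partial>lborel)"
      by (rule nn_integral_lborel_shift[of "\<lambda>x. ennreal (k x)"]) simp
    finally show "(\<integral>\<^sup>+ x. ennreal (k (x - y) * w y) \<partial>lborel) \<le> ennreal M * ennreal (w y)"
      using mult_right_mono[OF k_mass, of "ennreal (w y)"] by simp
  qed
  also have "\<dots> = ennreal M * (\<integral>\<^sup>+ y. ennreal (w y) \<partial>lborel)" by (rule nn_integral_cmult) simp
  finally show ?thesis .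
qed

text \<open>
  Young's inequality up to a constant: \<open>young_pointwise\<close> at each \<open>x\<close>, followed by Tonelli's theorem.
\<close>

lemma young_borel:
  assumes q: "1 \<le> q" and g: "g \<in> borel_measurable borel" and gi: "integrable lborel (\<lambda>y. norm (g y) powr q)"
  shows "AE x in lborel. integrable lborel (\<lambda>y. k (x - y) * norm (g y))"
    and "integrable lborel (\<lambda>x. (LINT y|lborel. k (x - y) * norm (g y)) powr q)"
    and "(LINT x|lborel. (LINT y|lborel. k (x - y) * norm (g y)) powr q) \<le> (2 * M) powr q * (LINT y|lborel. norm (g y) powr q)"
proof -
  let ?w = "\<lambda>y. norm (g y) powr q"
  let ?C = "2 powr q * M powr (q - 1)"
  let ?H = "\<lambda>x. LINT y|lborel. k (x - y) * norm (g y)"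
  have wm: "?w \<in> borel_measurable borel" and nm: "(\<lambda>y. norm (g y)) \<in> borel_measurable borel" using g by simp_all
  have kw: "(\<lambda>(x, y). k (x - y) * w y) \<in> borel_measurable (lborel \<Otimes>\<^sub>M lborel)" if "w \<in> borel_measurable borel" for w :: "'a \<Rightarrow> real"
  proof -
    have 1: "(\<lambda>(x, y). k (x - y)) \<in> borel_measurable ((lborel :: 'a measure) \<Otimes>\<^sub>M (lborel :: 'a measure))"
      using k_measurable_pair by (simp add: lborel_prod)
    have 2: "(\<lambda>v. w (snd v)) \<in> borel_measurable ((lborel :: 'a measure) \<Otimes>\<^sub>M (lborel :: 'a measure))"
      using measurable_compose[OF measurable_snd, of w lborel borel] that by simp
    show ?thesis using 1 2 by (simp add: case_prod_beta)
  qed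
  have kxm: "(\<lambda>y. k (x - y) * w y) \<in> borel_measurable lborel" if "w \<in> borel_measurable borel" for w :: "'a \<Rightarrow> real" and x
    using measurable_compose[OF _ k_measurable, of "\<lambda>y. x - y" borel] that by simp
  let ?B = "\<lambda>x. \<integral>\<^sup>+ y. ennreal (k (x - y) * ?w y) \<partial>lborel"
  have wI: "(\<integral>\<^sup>+ y. ennreal (?w y) \<partial>lborel) = ennreal (LINT y|lborel. ?w y)" by (rule nn_integral_eq_integral[OF gi]) simp
  have BI: "(\<integral>\<^sup>+ x. ?B x \<partial>lborel) \<le> ennreal M * ennreal (LINT y|lborel. ?w y)"
    using nn_integral_convolution_le[OF wm] unfolding wI by simp
  have Bm: "?B \<in> borel_measurable lborel"
  proof -
    have "(\<lambda>v. ennreal ((\<lambda>(x, y). k (x - y) * ?w y) v)) \<in> borel_measurable (lborel \<Otimes>\<^sub>M lborel)" using kw[OF wm] by simp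
    then have "(\<lambda>(x, y). ennreal (k (x - y) * ?w y)) \<in> borel_measurable (lborel \<Otimes>\<^sub>M lborel)" by (simp add: case_prod_beta)
    from lborel.borel_measurable_nn_integral[OF this] show ?thesis .
  qed
  have "ennreal M * ennreal (LINT y|lborel. ?w y) < \<infinity>" by (simp add: ennreal_mult_less_top)
  then have "(\<integral>\<^sup>+ x. ?B x \<partial>lborel) \<noteq> \<infinity>" using BI by (metis le_less_trans less_irrefl infinity_ennreal_def)
  then have AEB: "AE x in lborel. ?B x \<noteq> \<infinity>" by (rule nn_integral_PInf_AE[OF Bm])
  have ki: "integrable lborel (\<lambda>y. k (x - y) * ?w y)" if "?B x \<noteq> \<infinity>" for x
    by (rule integrableI_bounded[OF kxm[OF wm]]) (use that k_nonneg in \<open>simp add: abs_mult less_top\<close>)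
  have y: "integrable lborel (\<lambda>y. k (x - y) * norm (g y))"
    "?H x powr q \<le> ?C * (LINT y|lborel. k (x - y) * ?w y)" if "?B x \<noteq> \<infinity>" for x
    using young_pointwise[OF q M_pos k_integrable(1) k_nonneg k_integrable(2), of "\<lambda>y. norm (g y)" x] ki[OF that] nm by simp_all
  show "AE x in lborel. integrable lborel (\<lambda>y. k (x - y) * norm (g y))" using AEB by eventually_elim (rule y(1))
  have Hm: "?H \<in> borel_measurable lborel" using lborel.borel_measurable_lebesgue_integral[OF kw[OF nm]] .
  have "(\<integral>\<^sup>+ x. ennreal (?H x powr q) \<partial>lborel) \<le> (\<integral>\<^sup>+ x. ennreal ?C * ?B x \<partial>lborel)"
  proof (rule nn_integral_mono_AE)
    show "AE x in lborel. ennreal (?H x powr q) \<le> ennreal ?C * ?B x"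
      using AEB
    proof eventually_elim
      case (elim x)
      have "ennreal (?H x powr q) \<le> ennreal (?C * (LINT y|lborel. k (x - y) * ?w y))" by (rule ennreal_leI[OF y(2)[OF elim]])
      also have "\<dots> = ennreal ?C * ennreal (LINT y|lborel. k (x - y) * ?w y)"
        using k_nonneg by (intro ennreal_mult integral_nonneg_AE) auto
      also have "ennreal (LINT y|lborel. k (x - y) * ?w y) = ?B x"
        by (rule nn_integral_eq_integral[OF ki[OF elim], symmetric]) (simp add: k_nonneg)
      finally show ?case .
    qed
  qed
  also have "\<dots> = ennreal ?C * (\<integral>\<^sup>+ x. ?B x \<partial>lborel)" using Bm by (intro nn_integral_cmult) simp
  also have "\<dots> \<le> ennreal ?C * (ennreal M * ennreal (LINT y|lborel. ?w y))" by (intro mult_left_mono BI) simp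
  also have "\<dots> = ennreal ((2 * M) powr q * (LINT y|lborel. ?w y))"
  proof -
    have "M powr (q - 1) * M = M powr q" using M_pos by (simp add: powr_diff)
    then have "?C * M = (2 * M) powr q" using M_pos by (simp add: powr_mult mult.assoc)
    moreover have "0 \<le> (LINT y|lborel. ?w y)" by (intro integral_nonneg_AE) auto
    ultimately show ?thesis using M_pos by (simp add: ennreal_mult[symmetric] mult.assoc[symmetric])
  qed
  finally have fin: "(\<integral>\<^sup>+ x. ennreal (?H x powr q) \<partial>lborel) \<le> ennreal ((2 * M) powr q * (LINT y|lborel. ?w y))" .
  have Hqm: "(\<lambda>x. ?H x powr q) \<in> borel_measurable lborel" using Hm by simp
  show Hi: "integrable lborel (\<lambda>x. ?H x powr q)"
    by (rule integrableI_bounded[OF Hqm]) (use fin in \<open>simp add: le_less_trans\<close>)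
  have "ennreal (LINT x|lborel. ?H x powr q) \<le> ennreal ((2 * M) powr q * (LINT y|lborel. ?w y))"
    using fin by (subst (asm) nn_integral_eq_integral[OF Hi]) auto
  then show "(LINT x|lborel. ?H x powr q) \<le> (2 * M) powr q * (LINT y|lborel. ?w y)"
    by (subst (asm) ennreal_le_iff) (auto intro!: mult_nonneg_nonneg integral_nonneg_AE)
qed

lemma K_mult_integrable:
  assumes g: "g \<in> borel_measurable borel" and i: "integrable lborel (\<lambda>y. k (x - y) * norm (g y))"
  shows "integrable lborel (\<lambda>y. K x y * g y)" and "norm (LINT y|lborel. K x y * g y) \<le> (LINT y|lborel. k (x - y) * norm (g y))"
proof -
  have m: "(\<lambda>y. K x y * g y) \<in> borel_measurable lborel" using K_measurable_right[of x] g by simp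
  have le: "norm (K x y * g y) \<le> k (x - y) * norm (g y)" for y by (simp add: norm_mult mult_right_mono K_le)
  show i2: "integrable lborel (\<lambda>y. K x y * g y)"
    by (rule Bochner_Integration.integrable_bound[OF i m]) (use le in \<open>auto intro!: AE_I2 intro: order_trans[OF _ abs_ge_self]\<close>)
  have "norm (LINT y|lborel. K x y * g y) \<le> (LINT y|lborel. norm (K x y * g y))" by (rule integral_norm_bound)
  also have "\<dots> \<le> (LINT y|lborel. k (x - y) * norm (g y))" by (intro integral_mono integrable_norm i2 i le)
  finally show "norm (LINT y|lborel. K x y * g y) \<le> (LINT y|lborel. k (x - y) * norm (g y))" .
qed

lemma K_mult_measurable:
  assumes g: "g \<in> borel_measurable borel"
  shows "(\<lambda>(x, y). K x y * g y) \<in> borel_measurable (lborel \<Otimes>\<^sub>M lborel)"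
    and "(\<lambda>x. LINT y|lborel. K x y * g y) \<in> borel_measurable borel"
proof -
  have 1: "(\<lambda>(x, y). K x y) \<in> borel_measurable ((lborel :: 'a measure) \<Otimes>\<^sub>M (lborel :: 'a measure))"
    using K_measurable by (simp add: lborel_prod)
  have 2: "(\<lambda>v. g (snd v)) \<in> borel_measurable ((lborel :: 'a measure) \<Otimes>\<^sub>M (lborel :: 'a measure))"
    using measurable_compose[OF measurable_snd, of g lborel borel] g by simp
  show m: "(\<lambda>(x, y). K x y * g y) \<in> borel_measurable (lborel \<Otimes>\<^sub>M lborel)" using 1 2 by (simp add: case_prod_beta)
  show "(\<lambda>x. LINT y|lborel. K x y * g y) \<in> borel_measurable borel"
    using lborel.borel_measurable_lebesgue_integral[OF m] by simp
qed

end

text \<open>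
  Elements of \<open>L\<^sup>q\<close> are only Lebesgue measurable, whereas Fubini's theorem for the product of Borel measures needs
  Borel functions.
\<close>

lemma Lp_fun_borel_representative:
  assumes f: "f \<in> Lp_fun q"
  obtains g where "g \<in> borel_measurable borel" "AE x in lborel. f x = g x" "integrable lborel (\<lambda>x. norm (g x) powr q)"
    "Lq_mass q f = (LINT x|lborel. norm (g x) powr q)"
proof -
  obtain g where g: "g \<in> borel_measurable borel" and ae: "AE x in lborel. f x = g x"
    using completion_ex_borel_measurable_complex[OF Lp_fun_measurable[OF f]] by blast
  have gm: "(\<lambda>x. norm (g x) powr q) \<in> borel_measurable lborel" using g by simp
  have gl: "g \<in> borel_measurable lebesgue" using g by (intro measurable_completion) simp
  note c = Lp_fun_cong_AE[OF gl f AE_completion[OF ae]]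
  have i: "integrable lborel (\<lambda>x. norm (g x) powr q)"
    using Lp_fun_integrable[OF c(1)] integrable_completion[OF gm] by simp
  have "Lq_mass q f = (LINT x|lborel. norm (g x) powr q)"
    using c(2) integral_completion[OF gm] by (simp add: Lq_mass_def)
  with g ae i show ?thesis using that by blast
qed

lemma Lp_fun_borelI:
  assumes "g \<in> borel_measurable borel" "integrable lborel (\<lambda>x. norm (g x) powr q)"
  shows "g \<in> Lp_fun q" "Lq_mass q g = (LINT x|lborel. norm (g x) powr q)"
proof -
  have gm: "(\<lambda>x. norm (g x) powr q) \<in> borel_measurable lborel" using assms by simp
  have "g \<in> borel_measurable lebesgue" using assms by (intro measurable_completion) simp
  then show "g \<in> Lp_fun q" using assms(2) integrable_completion[OF gm] by (simp add: Lp_fun_def)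
  show "Lq_mass q g = (LINT x|lborel. norm (g x) powr q)" using integral_completion[OF gm] by (simp add: Lq_mass_def)
qed

context dominated_kernel begin

lemma
  assumes q: "1 \<le> q" and f: "f \<in> Lp_fun q"
  shows kernel_op_Lp_fun: "kernel_op K f \<in> Lp_fun q" and kernel_op_mass_le: "Lq_mass q (kernel_op K f) \<le> (2 * M) powr q * Lq_mass q f"
    and kernel_op_integrable: "AE x in lebesgue. integrable lebesgue (\<lambda>y. K x y * f y)"
    and kernel_op_norm_le: "Lp_norm q (kernel_op K f) \<le> (2 * M) * Lp_norm q f"
proof -
  obtain g where g: "g \<in> borel_measurable borel" and ae: "AE x in lborel. f x = g x" and gi: "integrable lborel (\<lambda>x. norm (g x) powr q)"
    and mass: "Lq_mass q f = (LINT x|lborel. norm (g x) powr q)" using Lp_fun_borel_representative[OF f] by blast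
  note y = young_borel[OF q g gi]
  have kernel_op: "kernel_op K f = (\<lambda>x. LINT y|lborel. K x y * g y)" by (rule ext) (rule kernel_op_cong_AE(1)[OF Lp_fun_measurable[OF f] ae g])
  have km: "kernel_op K f \<in> borel_measurable borel" unfolding kernel_op by (rule K_mult_measurable(2)[OF g])
  have le: "AE x in lborel. norm (kernel_op K f x) powr q \<le> (LINT y|lborel. k (x - y) * norm (g y)) powr q"
    using y(1)
  proof eventually_elim
    case (elim x)
    show ?case unfolding kernel_op using q by (intro powr_mono2 K_mult_integrable(2)[OF g elim]) auto
  qed
  have ki: "integrable lborel (\<lambda>x. norm (kernel_op K f x) powr q)"
    by (rule Bochner_Integration.integrable_bound[OF y(2)]) (use km le in \<open>auto elim!: eventually_mono\<close>)
  note b = Lp_fun_borelI[OF km ki]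
  show "kernel_op K f \<in> Lp_fun q" by (rule b(1))
  show mle: "Lq_mass q (kernel_op K f) \<le> (2 * M) powr q * Lq_mass q f"
    unfolding b(2) mass using integral_mono_AE[OF ki y(2) le] y(3) by simp
  show "Lp_norm q (kernel_op K f) \<le> (2 * M) * Lp_norm q f" by (rule Lp_norm_le[OF q _ mle]) (use M_pos in simp)
  have "AE x in lborel. integrable lebesgue (\<lambda>y. K x y * f y)"
    using y(1) by eventually_elim (rule kernel_op_cong_AE(2)[OF Lp_fun_measurable[OF f] ae g K_mult_integrable(1)[OF g]])
  then show "AE x in lebesgue. integrable lebesgue (\<lambda>y. K x y * f y)" by (rule AE_completion)
qed

lemma kernel_op_bounded_linear: assumes q: "1 \<le> q" shows "Lp_bounded_linear q (kernel_op K)"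
  unfolding Lp_bounded_linear_def
proof (intro conjI ballI allI)
  show "kernel_op K f \<in> Lp_fun q" if "f \<in> Lp_fun q" for f by (rule kernel_op_Lp_fun[OF q that])
  show "AE x in lebesgue. kernel_op K (\<lambda>y. f y + g y) x = kernel_op K f x + kernel_op K g x" if f: "f \<in> Lp_fun q" and g: "g \<in> Lp_fun q" for f g
    using kernel_op_integrable[OF q f] kernel_op_integrable[OF q g]
    by eventually_elim (simp add: kernel_op_def distrib_left Bochner_Integration.integral_add)
  show "AE x in lebesgue. kernel_op K (\<lambda>y. c * f y) x = c * kernel_op K f x" for c f
  proof (rule AE_I2)
    fix x
    have "(\<lambda>y. K x y * (c * f y)) = (\<lambda>y. c * (K x y * f y))" by (simp add: mult_ac)
    then show "kernel_op K (\<lambda>y. c * f y) x = c * kernel_op K f x" by (simp add: kernel_op_def)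
  qed
  show "\<exists>C. \<forall>f\<in>Lp_fun q. Lp_norm q (kernel_op K f) \<le> C * Lp_norm q f" using kernel_op_norm_le[OF q] by blast
qed

lemma kernel_op_cong: assumes "\<And>x y. x \<noteq> y \<Longrightarrow> K x y = K' x y" and "K' x \<in> borel_measurable borel" and f: "f \<in> borel_measurable lebesgue"
  shows "kernel_op K f x = (LINT y|lebesgue. K' x y * f y)"
  unfolding kernel_op_def
proof (rule integral_cong_AE)
  have "K x \<in> borel_measurable lebesgue" "K' x \<in> borel_measurable lebesgue"
    using K_measurable_right[of x] assms(2) by (auto intro: measurable_completion)
  then show "(\<lambda>y. K x y * f y) \<in> borel_measurable lebesgue" "(\<lambda>y. K' x y * f y) \<in> borel_measurable lebesgue"
    using f by (auto intro: borel_measurable_times)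
  have "AE y in lborel. y \<noteq> x" by (rule AE_lborel_singleton)
  then have "AE y in lborel. K x y * f y = K' x y * f y" by eventually_elim (metis assms(1))
  then show "AE y in lebesgue. K x y * f y = K' x y * f y" by (rule AE_completion)
qed

end

text \<open>
  Expresses the error of a difference quotient of operators as one operator, to which Young's inequality
  applies.
\<close>

lemma kernel_op_linear_combination:
  assumes q: "1 \<le> q" and f: "f \<in> Lp_fun q"
    and 1: "dominated_kernel K1 k1 M1" and 2: "dominated_kernel K2 k2 M2" and 3: "dominated_kernel K3 k3 M3"
    and E: "\<And>x y. E x y = (K1 x y - K2 x y) / h - K3 x y"
  shows "AE x in lebesgue. (kernel_op K1 f x - kernel_op K2 f x) / h - kernel_op K3 f x = kernel_op E f x"
  using dominated_kernel.kernel_op_integrable[OF 1 q f] dominated_kernel.kernel_op_integrable[OF 2 q f] dominated_kernel.kernel_op_integrable[OF 3 q f]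
proof eventually_elim
  case (elim x)
  have eq: "(\<lambda>y. E x y * f y) = (\<lambda>y. (K1 x y * f y - K2 x y * f y) / h - K3 x y * f y)"
    by (rule ext) (simp add: E diff_divide_distrib left_diff_distrib)
  show ?case
    unfolding kernel_op_def eq
    using elim by simp
qed

section \<open>Composition and approximation\<close>

text \<open>
  Fubini's theorem. Absolute convergence at almost every \<open>x\<close> comes from Young's inequality for the majorant of
  the outer kernel, applied to the function that dominates the inner operator. Identity of the kernels off the
  diagonal suffices.
\<close>

lemma kernel_op_composition:
  assumes q: "1 \<le> q" and f: "f \<in> Lp_fun q"
    and D1: "dominated_kernel K1 k1 M1" and D2: "dominated_kernel K2 k2 M2" and D3: "dominated_kernel K3 k3 M3"
    and K3: "\<And>x y. x \<noteq> y \<Longrightarrow> K3 x y = (LINT u|lborel. K1 x u * K2 u y)"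
  shows "AE x in lebesgue. kernel_op K1 (kernel_op K2 f) x = kernel_op K3 f x"
proof -
  interpret D1: dominated_kernel K1 k1 M1 by (rule D1)
  interpret D2: dominated_kernel K2 k2 M2 by (rule D2)
  interpret D3: dominated_kernel K3 k3 M3 by (rule D3)
  obtain g where g: "g \<in> borel_measurable borel" and ae: "AE x in lborel. f x = g x" and gi: "integrable lborel (\<lambda>x. norm (g x) powr q)"
    using Lp_fun_borel_representative[OF f] by blast
  define W where "W u = (LINT y|lborel. k2 (u - y) * norm (g y))" for u
  note y2 = D2.young_borel[OF q g gi]
  have W0: "0 \<le> W u" for u unfolding W_def using D2.k_nonneg by (intro integral_nonneg_AE) auto
  have fl: "f \<in> borel_measurable lebesgue" by (rule Lp_fun_measurable[OF f])
  define h where "h u = (LINT y|lborel. K2 u y * g y)" for u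
  have kop2: "kernel_op K2 f = h" unfolding h_def by (rule ext) (rule D2.kernel_op_cong_AE(1)[OF fl ae g])
  have hm: "h \<in> borel_measurable borel" unfolding h_def by (rule D2.K_mult_measurable(2)[OF g])
  have hl: "h \<in> borel_measurable lebesgue" using hm by (intro measurable_completion) simp
  have kop1: "kernel_op K1 h x = (LINT u|lborel. K1 x u * h u)" for x
    by (rule D1.kernel_op_cong_AE(1)[OF hl _ hm]) simp
  have kop3: "kernel_op K3 f x = (LINT y|lborel. K3 x y * g y)" for x by (rule D3.kernel_op_cong_AE(1)[OF fl ae g])
  have nm: "(\<lambda>(u, y). k2 (u - y) * norm (g y)) \<in> borel_measurable (lborel \<Otimes>\<^sub>M lborel)"
  proof -
    have 1: "(\<lambda>(x, y). k2 (x - y)) \<in> borel_measurable ((lborel :: 'a measure) \<Otimes>\<^sub>M (lborel :: 'a measure))"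
      using D2.k_measurable_pair by (simp add: lborel_prod)
    have 2: "(\<lambda>v. norm (g (snd v))) \<in> borel_measurable ((lborel :: 'a measure) \<Otimes>\<^sub>M (lborel :: 'a measure))"
      using measurable_compose[OF measurable_snd, of "\<lambda>y. norm (g y)" lborel borel] g by simp
    show ?thesis using 1 2 by (simp add: case_prod_beta)
  qed
  have Wm: "W \<in> borel_measurable borel"
    unfolding W_def using lborel.borel_measurable_lebesgue_integral[OF nm] by simp
  define Wc where "Wc u = complex_of_real (W u)" for u
  have Wcm: "Wc \<in> borel_measurable borel" unfolding Wc_def using Wm by simp
  have Wci: "integrable lborel (\<lambda>u. norm (Wc u) powr q)" using y2(2) W0 by (simp add: Wc_def W_def[symmetric])
  have "AE x in lborel. integrable lborel (\<lambda>u. k1 (x - u) * norm (Wc u))" by (rule D1.young_borel(1)[OF q Wcm Wci])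
  then have "AE x in lborel. kernel_op K1 (kernel_op K2 f) x = kernel_op K3 f x"
  proof eventually_elim
    case (elim x)
    then have i1: "integrable lborel (\<lambda>u. k1 (x - u) * W u)" using W0 by (simp add: Wc_def)
    let ?G = "\<lambda>u y. K1 x u * (K2 u y * g y)"
    have m: "(\<lambda>(u, y). ?G u y) \<in> borel_measurable (lborel \<Otimes>\<^sub>M lborel)"
    proof -
      have 1: "(\<lambda>v. K1 x (fst v)) \<in> borel_measurable ((lborel :: 'a measure) \<Otimes>\<^sub>M (lborel :: 'a measure))"
        using measurable_compose[OF measurable_fst, of "K1 x" lborel borel] D1.K_measurable_right[of x] by simp
      show ?thesis using borel_measurable_times[OF 1 D2.K_mult_measurable(1)[OF g]] by (simp add: case_prod_beta)
    qed
    have aeu: "AE u in lborel. integrable lborel (\<lambda>y. k2 (u - y) * norm (g y))" by (rule y2(1))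
    have int: "integrable (lborel \<Otimes>\<^sub>M lborel) (\<lambda>(u, y). ?G u y)"
    proof (rule lborel_pair.Fubini_integrable[OF m])
      show "AE u in lborel. integrable lborel (\<lambda>y. (\<lambda>(u, y). ?G u y) (u, y))"
        using aeu
      proof eventually_elim
        case (elim u)
        show ?case unfolding prod.case by (rule Bochner_Integration.integrable_mult_right[OF D2.K_mult_integrable(1)[OF g elim]])
      qed
      show "integrable lborel (\<lambda>u. LINT y|lborel. norm ((\<lambda>(u, y). ?G u y) (u, y)))"
      proof (rule Bochner_Integration.integrable_bound[OF i1])
        have "(\<lambda>(u, y). norm (?G u y)) \<in> borel_measurable (lborel \<Otimes>\<^sub>M lborel)"
          using measurable_compose[OF m borel_measurable_norm] by (simp add: case_prod_beta)
        from lborel.borel_measurable_lebesgue_integral[OF this]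
        show "(\<lambda>u. LINT y|lborel. norm ((\<lambda>(u, y). ?G u y) (u, y))) \<in> borel_measurable lborel" by simp
        show "AE u in lborel. norm (LINT y|lborel. norm ((\<lambda>(u, y). ?G u y) (u, y))) \<le> norm (k1 (x - u) * W u)"
          using aeu
        proof eventually_elim
          case (elim u)
          have "(LINT y|lborel. norm (?G u y)) \<le> (LINT y|lborel. k1 (x - u) * (k2 (u - y) * norm (g y)))"
          proof (rule integral_mono)
            show "integrable lborel (\<lambda>y. norm (?G u y))"
              by (intro integrable_norm Bochner_Integration.integrable_mult_right D2.K_mult_integrable(1)[OF g elim])
            show "integrable lborel (\<lambda>y. k1 (x - u) * (k2 (u - y) * norm (g y)))" by (rule Bochner_Integration.integrable_mult_right[OF elim])
            show "norm (?G u y) \<le> k1 (x - u) * (k2 (u - y) * norm (g y))" for y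
              unfolding norm_mult by (intro mult_mono D1.K_le D2.K_le mult_nonneg_nonneg D1.k_nonneg D2.k_nonneg) auto
          qed
          also have "\<dots> = k1 (x - u) * W u" by (simp add: W_def)
          finally have le: "(LINT y|lborel. norm (?G u y)) \<le> k1 (x - u) * W u" .
          have "0 \<le> (LINT y|lborel. norm (?G u y))" by (rule integral_nonneg_AE) simp
          then show ?case using le by (simp only: prod.case real_norm_def abs_of_nonneg abs_ge_self order_trans)
        qed
      qed
    qed
    have "kernel_op K1 (kernel_op K2 f) x = (LINT u|lborel. LINT y|lborel. ?G u y)"
      unfolding kop2 kop1 h_def by simp
    also have "\<dots> = (LINT y|lborel. LINT u|lborel. ?G u y)" using lborel_pair.Fubini_integral[OF int] by simp
    also have "\<dots> = (LINT y|lborel. (LINT u|lborel. K1 x u * K2 u y) * g y)"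
      by (simp add: mult.assoc[symmetric])
    also have "\<dots> = (LINT y|lborel. K3 x y * g y)"
    proof (rule integral_cong_AE)
      have "(\<lambda>y. LINT u|lborel. ?G u y) \<in> borel_measurable lborel"
        using borel_measurable_integrable[OF lborel_pair.integrable_snd[OF int]] .
      then show "(\<lambda>y. (LINT u|lborel. K1 x u * K2 u y) * g y) \<in> borel_measurable lborel" by (simp add: mult.assoc[symmetric])
      show "(\<lambda>y. K3 x y * g y) \<in> borel_measurable lborel" using D3.K_measurable_right[of x] g by simp
      have "AE y in lborel. y \<noteq> x" by (rule AE_lborel_singleton)
      then show "AE y in lborel. (LINT u|lborel. K1 x u * K2 u y) * g y = K3 x y * g y"
        by eventually_elim (metis K3)
    qed
    finally show ?case by (simp add: kop3)
  qed
  then show ?thesis by (rule AE_completion)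
qed

text \<open>
  The radial retraction of the plane onto the disc of radius \<open>N\<close>.
\<close>

definition clamp_norm :: "real \<Rightarrow> complex \<Rightarrow> complex" where "clamp_norm N w = (N / max N (norm w)) *\<^sub>R w"

lemma clamp_norm: assumes N: "0 < N"
  shows "continuous_on UNIV (clamp_norm N)" and "norm (clamp_norm N w) \<le> N" and "norm w \<le> N \<Longrightarrow> clamp_norm N w = w"
    and "0 \<le> c \<Longrightarrow> c \<le> 1 \<Longrightarrow> norm (w - c *\<^sub>R clamp_norm N w) \<le> norm w"
proof -
  show "continuous_on UNIV (clamp_norm N)" unfolding clamp_norm_def[abs_def] using N by (intro continuous_intros) auto
  show "norm (clamp_norm N w) \<le> N" using N by (auto simp: clamp_norm_def max_def divide_simps)
  show "norm w \<le> N \<Longrightarrow> clamp_norm N w = w" using N by (simp add: clamp_norm_def max_def)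
  show "norm (w - c *\<^sub>R clamp_norm N w) \<le> norm w" if "0 \<le> c" "c \<le> 1"
  proof -
    let ?s = "c * (N / max N (norm w))"
    have le1: "N / max N (norm w) \<le> 1" "0 \<le> N / max N (norm w)" using N by (auto simp: divide_le_eq_1)
    have s: "0 \<le> ?s" "?s \<le> 1" 
      using mult_nonneg_nonneg[OF that(1) le1(2)] that le1 mult_mono[of c 1 "N / max N (norm w)" 1] by auto
    have "w - c *\<^sub>R clamp_norm N w = (1 - ?s) *\<^sub>R w" by (simp add: clamp_norm_def scaleR_left_diff_distrib)
    then have "norm (w - c *\<^sub>R clamp_norm N w) = (1 - ?s) * norm w" using s by simp
    also have "\<dots> \<le> 1 * norm w" using s by (intro mult_right_mono) auto
    finally show ?thesis by simp
  qed
qed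

lemma Lp_fun_diff:
  assumes q: "1 \<le> q" and f: "f \<in> Lp_fun q" and g: "g \<in> Lp_fun q"
  shows "(\<lambda>x. f x - g x) \<in> Lp_fun q" and "Lq_mass q (\<lambda>x. f x - g x) \<le> 2 powr q * (Lq_mass q f + Lq_mass q g)"
  using Lp_fun_add[OF q f Lp_fun_cmult(1)[OF g, of "-1"]] Lp_fun_cmult(2)[OF g, of "-1"] by simp_all

text \<open>
  Cutting off \<open>f\<close> in space and in size changes it little. A Lebesgue measurable function is an almost everywhere
  limit of continuous functions; cutting those off in the same way gives a dominated sequence of continuous functions
  of compact support.
\<close>

lemma Lp_approx_continuous:
  fixes f :: "'a::euclidean_space \<Rightarrow> complex"
  assumes q: "1 \<le> q" and f: "f \<in> Lp_fun q" and e: "0 < e"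
  shows "\<exists>g R. continuous_on UNIV g \<and> (\<forall>x. R < norm x \<longrightarrow> g x = 0) \<and> g \<in> Lp_fun q \<and> Lq_mass q (\<lambda>x. f x - g x) < e"
proof -
  define cut where "cut n x = max 0 (min 1 (real n + 1 - norm (x::'a)))" for n x
  have cut: "0 \<le> cut n x" "cut n x \<le> 1" for n x by (auto simp: cut_def)
  have cut1: "cut n x = 1" if "norm x \<le> real n" for n x using that by (simp add: cut_def)
  have cut0: "cut n x = 0" if "real n + 1 < norm x" for n x using that by (simp add: cut_def)
  have cutc: "continuous_on UNIV (cut n)" for n unfolding cut_def by (intro continuous_intros)
  have cutm: "cut n \<in> borel_measurable lebesgue" for n
    using borel_measurable_continuous_onI[OF cutc] by (intro measurable_completion) simp
  let ?N = "\<lambda>n. real n + 1"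
  have fm: "f \<in> borel_measurable lebesgue" by (rule Lp_fun_measurable[OF f])
  define h where "h n x = cut n x *\<^sub>R clamp_norm (?N n) (f x)" for n x
  have cm: "clamp_norm (?N n) \<in> borel_measurable borel" for n
    by (rule borel_measurable_continuous_onI[OF clamp_norm(1)]) simp
  have hm: "h n \<in> borel_measurable lebesgue" for n
    unfolding h_def by (intro borel_measurable_scaleR cutm measurable_compose[OF fm cm])
  have "(\<lambda>n. LINT x|lebesgue. norm (f x - h n x) powr q) \<longlonglongrightarrow> (LINT x|(lebesgue :: 'a measure). 0)"
  proof (rule integral_dominated_convergence[where w="\<lambda>x. norm (f x) powr q"])
    show "(\<lambda>x. norm (f x - h n x) powr q) \<in> borel_measurable lebesgue" for n using fm hm by simp
    show "integrable lebesgue (\<lambda>x. norm (f x) powr q)" by (rule Lp_fun_integrable[OF f])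
    show "AE x in lebesgue. (\<lambda>n. norm (f x - h n x) powr q) \<longlonglongrightarrow> 0"
    proof (rule AE_I2)
      fix x
      obtain n0 where n0: "max (norm x) (norm (f x)) \<le> real n0" using real_arch_simple by blast
      have "norm (f x - h n x) powr q = 0" if "n0 \<le> n" for n
      proof -
        have "norm x \<le> real n" "norm (f x) \<le> ?N n" using n0 that by auto
        then show ?thesis by (simp add: h_def cut1 clamp_norm(3))
      qed
      then show "(\<lambda>n. norm (f x - h n x) powr q) \<longlonglongrightarrow> 0"
        by (intro tendsto_eventually) (auto simp: eventually_sequentially)
    qed
    show "AE x in lebesgue. norm (norm (f x - h n x) powr q) \<le> norm (f x) powr q" for n
      using q clamp_norm(4)[of "?N n", OF _ cut] by (intro AE_I2) (auto simp: h_def intro!: powr_mono2)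
  qed simp
  then have "(\<lambda>n. Lq_mass q (\<lambda>x. f x - h n x)) \<longlonglongrightarrow> 0" by (simp add: Lq_mass_def)
  then have "\<forall>\<^sub>F n in sequentially. Lq_mass q (\<lambda>x. f x - h n x) < e / (2 * 2 powr q)"
    using e by (intro order_tendstoD(2)) auto
  then obtain n where n: "Lq_mass q (\<lambda>x. f x - h n x) < e / (2 * 2 powr q)" by (auto simp: eventually_sequentially)
  have "f measurable_on UNIV"
    using lebesgue_measurable_imp_measurable_on[of f UNIV] fm by simp
  then obtain Z G where Z: "negligible Z" and Gc: "\<And>j. continuous_on UNIV (G j)"
    and Gl: "\<And>x. x \<notin> Z \<Longrightarrow> (\<lambda>j. G j x) \<longlonglongrightarrow> f x"
    unfolding measurable_on_def by auto
  define g where "g j x = cut n x *\<^sub>R clamp_norm (?N n) (G j x)" for j x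
  have gc: "continuous_on UNIV (g j)" for j
    unfolding g_def by (intro continuous_on_scaleR cutc continuous_on_compose2[OF clamp_norm(1) Gc]) auto
  have gm: "g j \<in> borel_measurable lebesgue" for j
    using borel_measurable_continuous_onI[OF gc] by (intro measurable_completion) simp
  let ?w = "\<lambda>x. (2 * ?N n) powr q * indicator (cball (0::'a) (?N n)) x"
  have wi: "integrable lebesgue ?w"
    by (intro Bochner_Integration.integrable_mult_right integrable_real_indicator) (use emeasure_lborel_cball_finite[of "0::'a" "?N n"] in auto)
  have small: "norm (cut n x *\<^sub>R clamp_norm (?N n) u) \<le> ?N n * indicator (cball (0::'a) (?N n)) x" for u x
  proof (cases "norm x \<le> ?N n")
    case True
    have "cut n x * norm (clamp_norm (?N n) u) \<le> 1 * ?N n" by (intro mult_mono cut clamp_norm(2)) auto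
    then show ?thesis using True cut(1)[of n x] by simp
  qed (simp add: cut0)
  have hg: "norm (h n x - g j x) powr q \<le> ?w x" for x j
  proof -
    have "norm (h n x - g j x) \<le> norm (h n x) + norm (g j x)" by (rule norm_triangle_ineq4)
    also have "\<dots> \<le> ?N n * indicator (cball (0::'a) (?N n)) x + ?N n * indicator (cball (0::'a) (?N n)) x"
      unfolding h_def g_def by (rule add_mono[OF small small])
    also have "\<dots> = (2 * ?N n) * indicator (cball (0::'a) (?N n)) x" by simp
    finally have "norm (h n x - g j x) powr q \<le> ((2 * ?N n) * indicator (cball (0::'a) (?N n)) x) powr q" using q by (intro powr_mono2) auto
    then show ?thesis by (auto simp: indicator_def split: if_splits)
  qed
  have "(\<lambda>j. LINT x|lebesgue. norm (h n x - g j x) powr q) \<longlonglongrightarrow> (LINT x|(lebesgue :: 'a measure). 0)"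
  proof (rule integral_dominated_convergence[OF _ _ wi])
    show "(\<lambda>x. norm (h n x - g j x) powr q) \<in> borel_measurable lebesgue" for j using gm hm by simp
    have "AE x in lebesgue. x \<notin> Z" using Z by (simp add: negligible_iff_null_sets AE_not_in)
    then show "AE x in lebesgue. (\<lambda>j. norm (h n x - g j x) powr q) \<longlonglongrightarrow> 0"
    proof eventually_elim
      case (elim x)
      have "isCont (clamp_norm (?N n)) (f x)"
        using clamp_norm(1)[of "?N n"] by (simp add: continuous_on_eq_continuous_at)
      from isCont_tendsto_compose[OF this Gl[OF elim]]
      have "(\<lambda>j. h n x - g j x) \<longlonglongrightarrow> h n x - cut n x *\<^sub>R clamp_norm (?N n) (f x)" unfolding g_def by (intro tendsto_intros)
      then have "(\<lambda>j. norm (h n x - g j x)) \<longlonglongrightarrow> 0" by (simp add: h_def[symmetric] tendsto_norm_zero)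
      then show ?case by (rule tendsto_zero_powrI[OF _ tendsto_const]) (use q in auto)
    qed
    show "AE x in lebesgue. norm (norm (h n x - g j x) powr q) \<le> ?w x" for j
      using hg by (intro AE_I2) simp
  qed simp
  then have "(\<lambda>j. Lq_mass q (\<lambda>x. h n x - g j x)) \<longlonglongrightarrow> 0" by (simp add: Lq_mass_def)
  then have "\<forall>\<^sub>F j in sequentially. Lq_mass q (\<lambda>x. h n x - g j x) < e / (2 * 2 powr q)"
    using e by (intro order_tendstoD(2)) auto
  then obtain j where j: "Lq_mass q (\<lambda>x. h n x - g j x) < e / (2 * 2 powr q)" by (auto simp: eventually_sequentially)
  have hi: "h n \<in> Lp_fun q"
  proof -
    have "integrable lebesgue (\<lambda>x. norm (h n x) powr q)"
    proof (rule Bochner_Integration.integrable_bound[OF wi])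
      show "(\<lambda>x. norm (h n x) powr q) \<in> borel_measurable lebesgue" using hm by simp
      show "AE x in lebesgue. norm (norm (h n x) powr q) \<le> norm (?w x)"
      proof (rule AE_I2)
        fix x
        have "norm (h n x) \<le> ?N n * indicator (cball (0::'a) (?N n)) x" unfolding h_def by (rule small)
        then have "norm (h n x) powr q \<le> (2 * ?N n * indicator (cball (0::'a) (?N n)) x) powr q"
          using q by (intro powr_mono2) (auto simp: indicator_def split: if_splits)
        then show "norm (norm (h n x) powr q) \<le> norm (?w x)" by (auto simp: indicator_def split: if_splits)
      qed
    qed
    then show ?thesis using hm by (simp add: Lp_fun_def)
  qed
  have gi: "g j \<in> Lp_fun q"
  proof -
    have "integrable lebesgue (\<lambda>x. norm (g j x) powr q)"
    proof (rule Bochner_Integration.integrable_bound[OF wi])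
      show "(\<lambda>x. norm (g j x) powr q) \<in> borel_measurable lebesgue" using gm by simp
      show "AE x in lebesgue. norm (norm (g j x) powr q) \<le> norm (?w x)"
      proof (rule AE_I2)
        fix x
        have "norm (g j x) \<le> ?N n * indicator (cball (0::'a) (?N n)) x" unfolding g_def by (rule small)
        then have "norm (g j x) powr q \<le> (2 * ?N n * indicator (cball (0::'a) (?N n)) x) powr q"
          using q by (intro powr_mono2) (auto simp: indicator_def split: if_splits)
        then show "norm (norm (g j x) powr q) \<le> norm (?w x)" by (auto simp: indicator_def split: if_splits)
      qed
    qed
    then show ?thesis using gm by (simp add: Lp_fun_def)
  qed
  have "Lq_mass q (\<lambda>x. f x - g j x) = Lq_mass q (\<lambda>x. (f x - h n x) + (h n x - g j x))" by simp
  also have "\<dots> \<le> 2 powr q * (Lq_mass q (\<lambda>x. f x - h n x) + Lq_mass q (\<lambda>x. h n x - g j x))"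
    by (rule Lp_fun_add(2)[OF q Lp_fun_diff(1)[OF q f hi] Lp_fun_diff(1)[OF q hi gi]])
  also have "\<dots> < 2 powr q * (e / (2 * 2 powr q) + e / (2 * 2 powr q))" using n j by (intro mult_strict_left_mono add_strict_mono) auto
  also have "\<dots> = e" by (simp add: field_simps)
  finally have "Lq_mass q (\<lambda>x. f x - g j x) < e" .
  moreover have "\<forall>x. ?N n < norm x \<longrightarrow> g j x = 0" using cut0 by (simp add: g_def)
  ultimately show ?thesis using gc gi by blast
qed

section \<open>The semigroup law at complex times\<close>

text \<open>
  Cauchy's inequality turns a local majorant of the integrand into a majorant of its derivative.
\<close>

lemma holomorphic_integral:
  fixes F :: "complex \<Rightarrow> 'b \<Rightarrow> complex"
  assumes S: "open S" and meas: "\<And>z. z \<in> S \<Longrightarrow> F z \<in> borel_measurable N"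
    and hol: "\<And>u. (\<lambda>z. F z u) holomorphic_on S"
    and dom: "\<And>z. z \<in> S \<Longrightarrow> \<exists>r G. 0 < r \<and> cball z r \<subseteq> S \<and> integrable N G \<and> (\<forall>u. \<forall>w\<in>cball z r. norm (F w u) \<le> G u)"
  shows "(\<lambda>z. integral\<^sup>L N (F z)) holomorphic_on S"
proof (rule holomorphic_onI)
  fix z assume z: "z \<in> S"
  obtain r G where r: "0 < r" "cball z r \<subseteq> S" and G: "integrable N G" "\<And>u w. w \<in> cball z r \<Longrightarrow> norm (F w u) \<le> G u"
    using dom[OF z] by blast
  let ?f' = "\<lambda>w u. deriv (\<lambda>z. F z u) w"
  have fd: "((\<lambda>z. F z u) has_field_derivative ?f' w u) (at w)" if "w \<in> S" for w u
    by (rule holomorphic_derivI[OF hol S that])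
  have sub: "cball w (r/2) \<subseteq> cball z r" if "w \<in> ball z (r/2)" for w
  proof
    fix v assume "v \<in> cball w (r/2)"
    then show "v \<in> cball z r" using that dist_triangle[of z v w] by simp
  qed
  have bd: "norm (?f' w u) \<le> (2 / r) * G u" if w: "w \<in> ball z (r/2)" for w u
  proof -
    have "norm ((deriv ^^ 1) (\<lambda>z. F z u) w) \<le> fact 1 * G u / (r/2) ^ 1"
    proof (rule Cauchy_inequality)
      have "cball w (r/2) \<subseteq> S" using sub[OF w] r by blast
      then have h: "(\<lambda>z. F z u) holomorphic_on cball w (r/2)" by (rule holomorphic_on_subset[OF hol])
      then show "(\<lambda>z. F z u) holomorphic_on ball w (r/2)" by (rule holomorphic_on_subset) auto
      show "continuous_on (cball w (r/2)) (\<lambda>z. F z u)" using h by (rule holomorphic_on_imp_continuous_on)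
      show "norm (F v u) \<le> G u" if "norm (w - v) = r/2" for v
      proof (rule G(2))
        have "v \<in> cball w (r/2)" using that by (simp add: dist_norm)
        then show "v \<in> cball z r" using sub[OF w] by blast
      qed
    qed (use r in simp)
    then show ?thesis by (simp add: mult.commute)
  qed
  have inS: "w \<in> S" if "w \<in> ball z (r/2)" for w
    using that r by (auto dest!: subsetD[OF r(2)] simp: subset_iff)
  have "((\<lambda>w. integral\<^sup>L N (F w)) has_field_derivative (LINT u|N. ?f' z u)) (at z)"
  proof (rule has_field_derivative_integral_dominated(2)[where r="r/2" and g="\<lambda>u. (2 / r) * G u" and f'="?f'"])
    show "0 < r/2" using r by simp
    show "integrable N (F w)" if "w \<in> ball z (r/2)" for w
    proof (rule Bochner_Integration.integrable_bound[OF G(1) meas[OF inS[OF that]]])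
      have "w \<in> cball z r" using that r by simp
      then show "AE u in N. norm (F w u) \<le> norm (G u)" using G(2) by (auto intro!: AE_I2 intro: order_trans[OF _ abs_ge_self])
    qed
    show "?f' z \<in> borel_measurable N"
    proof (rule borel_measurable_LIMSEQ_metric)
      define d where "d n = r / real (n + 3)" for n
      have d: "0 < d n" "d n < r / 2" for n using r unfolding d_def by (simp, intro divide_strict_left_mono) auto
      let ?h = "\<lambda>n. complex_of_real (d n)"
      have h0: "?h n \<noteq> 0" for n using d(1)[of n] by simp
      have hz: "z + ?h n \<in> S" for n
      proof (rule inS)
        show "z + ?h n \<in> ball z (r/2)" using d[of n] by (simp add: dist_norm)
      qed
      show "(\<lambda>u. (F (z + ?h n) u - F z u) / ?h n) \<in> borel_measurable N" for n
        using meas[OF hz[of n]] meas[OF z] by simp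
      fix u
      have "((\<lambda>h. (F (z + h) u - F z u) / h) \<longlongrightarrow> ?f' z u) (at 0)" using fd[OF z, of u] by (simp add: DERIV_def)
      moreover have "filterlim ?h (at 0) sequentially"
        unfolding filterlim_at
      proof
        have "d \<longlonglongrightarrow> 0" unfolding d_def[abs_def] by (rule LIMSEQ_ignore_initial_segment[OF lim_const_over_n])
        then show "?h \<longlonglongrightarrow> 0" using tendsto_of_real[of _ 0 sequentially, where 'a=complex] by fastforce
      qed (use h0 in auto)
      ultimately show "(\<lambda>n. (F (z + ?h n) u - F z u) / ?h n) \<longlonglongrightarrow> ?f' z u" by (rule filterlim_compose)
    qed
    show "AE u in N. \<forall>w\<in>ball z (r/2). ((\<lambda>z. F z u) has_field_derivative ?f' w u) (at w) \<and> norm (?f' w u) \<le> (2 / r) * G u"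
      using fd inS bd by (intro AE_I2) blast
    show "integrable N (\<lambda>u. (2 / r) * G u)" using G(1) by (rule Bochner_Integration.integrable_mult_right)
  qed
  then show "(\<lambda>z. integral\<^sup>L N (F z)) field_differentiable at z within S"
    using field_differentiable_at_within field_differentiable_def by blast
qed

lemma wedge_open: "open (wedge m)"
proof -
  have "open {z. 0 < Re z}" by (simp add: open_halfspace_Re_gt)
  moreover have "open {z. \<bar>Im z\<bar> < m * Re z}" by (intro open_Collect_less continuous_intros)
  ultimately have "open ({z. 0 < Re z} \<inter> {z. \<bar>Im z\<bar> < m * Re z})" by (rule open_Int)
  moreover have "wedge m = {z. 0 < Re z} \<inter> {z. \<bar>Im z\<bar> < m * Re z}" by (auto simp: wedge_def)
  ultimately show ?thesis by simp
qed

lemma wedge_add: assumes "z \<in> wedge m" "w \<in> wedge m" shows "z + w \<in> wedge m"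
proof -
  have "\<bar>Im z + Im w\<bar> \<le> \<bar>Im z\<bar> + \<bar>Im w\<bar>" by (rule abs_triangle_ineq)
  then have "\<bar>Im z + Im w\<bar> < m * Re z + m * Re w" using assms unfolding wedge_def by simp
  then show ?thesis using assms by (simp add: wedge_def distrib_left)
qed

lemma wedge_real: "0 < m \<Longrightarrow> 0 < t \<Longrightarrow> complex_of_real t \<in> wedge m"
  by (simp add: wedge_def)

lemma wedge_connected: "connected (wedge m)"
proof (rule convex_connected, rule convexI)
  fix z w u v assume zw: "z \<in> wedge m" "w \<in> wedge m" and uv: "0 \<le> u" "0 \<le> v" "u + v = (1::real)"
  show "u *\<^sub>R z + v *\<^sub>R w \<in> wedge m"
  proof -
    have sc: "u *\<^sub>R z \<in> wedge m" if "0 < u" "z \<in> wedge m" for u z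
    proof -
      have "u * \<bar>Im z\<bar> < u * (m * Re z)" using that by (intro mult_strict_left_mono) (auto simp: wedge_def)
      then show ?thesis using that by (simp add: wedge_def abs_mult mult_ac)
    qed
    consider "u = 0" "v = 1" | "v = 0" "u = 1" | "0 < u" "0 < v" using uv by fastforce
    then show ?thesis by cases (use zw in \<open>auto intro!: wedge_add sc\<close>)
  qed
qed

lemma wedge_identity:
  assumes m: "0 < m" and f: "f holomorphic_on wedge m" and zero: "\<And>t. 0 < t \<Longrightarrow> f (complex_of_real t) = 0" and z: "z \<in> wedge m"
  shows "f z = 0"
proof (rule analytic_continuation[OF f wedge_open wedge_connected, where U="complex_of_real ` {0<..}" and \<xi>=1])
  show "complex_of_real ` {0<..} \<subseteq> wedge m" using wedge_real[OF m] by auto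
  show "1 \<in> wedge m" using wedge_real[OF m, of 1] by simp
  show "1 islimpt complex_of_real ` {0<..}"
    unfolding islimpt_approachable
  proof (intro allI impI)
    fix e :: real assume e: "0 < e"
    show "\<exists>x'\<in>complex_of_real ` {0<..}. x' \<noteq> 1 \<and> dist x' 1 < e"
    proof (intro bexI[of _ "complex_of_real (1 + e/2)"] conjI)
      show "complex_of_real (1 + e/2) \<in> complex_of_real ` {0<..}" by (rule imageI) (use e in simp)
      show "complex_of_real (1 + e/2) \<noteq> 1" using e by (simp only: of_real_eq_1_iff)
      have "dist (complex_of_real (1 + e/2)) (of_real 1) = e/2" using e by (simp only: dist_of_real) (simp add: dist_real_def)
      then show "dist (complex_of_real (1 + e/2)) 1 < e" using e by simp
    qed
  qed
qed (use zero z in auto)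

context heat_kernel begin

text \<open>
  One convolution majorant for all complex times with real part in \<open>[a, b]\<close>.
\<close>

definition pc_maj :: "real \<Rightarrow> real \<Rightarrow> 'a \<Rightarrow> real" where
  "pc_maj a b x = ext_const b * (b / a) * gevrey_maj a x"

definition pc_mass :: "real \<Rightarrow> real \<Rightarrow> real" where
  "pc_mass a b = ext_const b * (b / a) * (2 * rho_mass * (a + 1))"

lemma pc_le_maj:
  assumes "z \<in> wedge slope" "0 < a" "a \<le> Re z" "Re z \<le> b"
  shows "norm (pc z x y) \<le> pc_maj a b (x - y)"
proof -
  have "norm (pc z x y) \<le> ext_const b * gevrey_maj (Re z) (x - y)" by (rule pc_le) (use assms in auto)
  also have "\<dots> \<le> ext_const b * ((b / a) * gevrey_maj a (x - y))"
    using ext_const_pos[of b] assms by (intro mult_left_mono gevrey_maj_scale) auto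
  finally show ?thesis by (simp add: pc_maj_def mult.assoc)
qed

lemma pc_maj:
  assumes a: "0 < a" "a \<le> b"
  shows pc_maj_measurable: "pc_maj a b \<in> borel_measurable borel" and pc_maj_nonneg: "0 \<le> pc_maj a b x"
    and pc_maj_mass: "(\<integral>\<^sup>+ x. ennreal (pc_maj a b x) \<partial>lborel) \<le> ennreal (pc_mass a b)" and pc_mass_pos: "0 < pc_mass a b"
proof -
  have c: "0 < ext_const b * (b / a)" using ext_const_pos[of b] a by simp
  show "pc_maj a b \<in> borel_measurable borel" unfolding pc_maj_def[abs_def] using gevrey_maj_measurable[OF a(1)] by simp
  show "0 \<le> pc_maj a b x" unfolding pc_maj_def by (rule mult_nonneg_nonneg[OF less_imp_le[OF c] gevrey_maj_nonneg[OF a(1)]])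
  show "0 < pc_mass a b" unfolding pc_mass_def by (rule mult_pos_pos[OF c]) (use rho_mass_pos a in simp)
  have "(\<integral>\<^sup>+ x. ennreal (pc_maj a b x) \<partial>lborel) = (\<integral>\<^sup>+ x. ennreal (ext_const b * (b / a)) * ennreal (gevrey_maj a x) \<partial>lborel)"
    unfolding pc_maj_def using c gevrey_maj_nonneg[OF a(1)] by (intro nn_integral_cong ennreal_mult) auto
  also have "\<dots> = ennreal (ext_const b * (b / a)) * (\<integral>\<^sup>+ x. ennreal (gevrey_maj a x) \<partial>lborel)"
    using gevrey_maj_measurable[OF a(1)] by (intro nn_integral_cmult) simp
  also have "\<dots> \<le> ennreal (ext_const b * (b / a)) * ennreal (2 * rho_mass * (a + 1))"
    by (intro mult_left_mono nn_integral_gevrey_maj a order_refl) simp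
  also have "\<dots> = ennreal (pc_mass a b)" unfolding pc_mass_def using c rho_mass_pos a by (intro ennreal_mult[symmetric]) auto
  finally show "(\<integral>\<^sup>+ x. ennreal (pc_maj a b x) \<partial>lborel) \<le> ennreal (pc_mass a b)" .
qed

lemma pc_dominated:
  assumes "z \<in> wedge slope" "0 < a" "a \<le> Re z" "Re z \<le> b"
  shows "dominated_kernel (pc z) (pc_maj a b) (pc_mass a b)"
proof
  have ab: "a \<le> b" using assms by simp
  show "(\<lambda>(x, y). pc z x y) \<in> borel_measurable borel" by (rule pc_measurable[OF assms(1)])
  show "pc_maj a b \<in> borel_measurable borel" by (rule pc_maj_measurable[OF assms(2) ab])
  show "0 \<le> pc_maj a b x" for x by (rule pc_maj_nonneg[OF assms(2) ab])
  show "(\<integral>\<^sup>+ x. ennreal (pc_maj a b x) \<partial>lborel) \<le> ennreal (pc_mass a b)" by (rule pc_maj_mass[OF assms(2) ab])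
  show "0 < pc_mass a b" by (rule pc_mass_pos[OF assms(2) ab])
  show "norm (pc z x y) \<le> pc_maj a b (x - y)" for x y by (rule pc_le_maj[OF assms])
qed

lemma pc_holomorphic': "(\<lambda>z. pc z x y) holomorphic_on wedge slope"
  by (cases "x = y") (simp_all add: pc_holomorphic, simp add: pc_def)

lemma pc_local:
  assumes z: "z \<in> wedge slope"
  obtains r a b where "0 < r" "cball z r \<subseteq> wedge slope" "0 < a" "a \<le> b" "\<And>w. w \<in> cball z r \<Longrightarrow> a \<le> Re w \<and> Re w \<le> b"
    "\<And>w x y. w \<in> cball z r \<Longrightarrow> norm (pc w x y) \<le> pc_maj a b (x - y)"
proof -
  have Rz: "0 < Re z" using z by (simp add: wedge_def)
  obtain r0 where r0: "0 < r0" "cball z r0 \<subseteq> wedge slope" using open_contains_cball wedge_open z by blast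
  define r where "r = min r0 (Re z / 2)"
  have r: "0 < r" "r \<le> r0" "r \<le> Re z / 2" using r0 Rz by (auto simp: r_def)
  have sub: "cball z r \<subseteq> wedge slope" using r0(2) subset_cball[OF r(2), of z] by blast
  have ab: "Re z / 2 \<le> Re w \<and> Re w \<le> 2 * Re z" if "w \<in> cball z r" for w
  proof -
    have "\<bar>Re z - Re w\<bar> \<le> r" using that abs_Re_le_cmod[of "z - w"] by (simp add: dist_norm)
    then show ?thesis using r Rz by linarith
  qed
  show ?thesis
    by (rule that[OF r(1) sub _ _ ab pc_le_maj]) (use sub ab Rz in auto)
qed

text \<open>
  At each point one of the two factors is evaluated at distance at least \<open>norm (x - y) / 2\<close> from the origin, where
  it is bounded. This is where \<open>x \<noteq> y\<close> enters.
\<close>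

lemma gevrey_maj_convolution_integrable:
  assumes xy: "x \<noteq> y" and a: "0 < a" and b: "0 < b"
  shows "integrable lborel (\<lambda>u. gevrey_maj a (x - u) * gevrey_maj b (u - y))"
proof -
  let ?\<delta> = "norm (x - y) / 2"
  have d: "0 < ?\<delta>" using xy by simp
  let ?c = "\<lambda>t. 2 * (t * profile DIM('a) ?\<delta>)"
  have p: "0 \<le> profile DIM('a) ?\<delta>" using profile_pos[OF d, of "DIM('a)"] by simp
  have gi: "integrable lborel (\<lambda>u. gevrey_maj t (x - u))" if t: "0 < t" for t x
  proof (rule integrableI_bounded)
    have eq: "(\<integral>\<^sup>+ u. ennreal (gevrey_maj t (x - u)) \<partial>lborel) = (\<integral>\<^sup>+ u. ennreal (gevrey_maj t u) \<partial>lborel)"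
      using nn_integral_lborel_reflect_shift[of "\<lambda>u. ennreal (gevrey_maj t u)" x] gevrey_maj_measurable[OF t] by simp
    show "(\<lambda>u. gevrey_maj t (x - u)) \<in> borel_measurable lborel"
      using measurable_compose[OF _ gevrey_maj_measurable[OF t], of "\<lambda>u. x - u" borel] by simp
    show "(\<integral>\<^sup>+ u. ennreal (norm (gevrey_maj t (x - u))) \<partial>lborel) < \<infinity>"
      using nn_integral_gevrey_maj[OF t order_refl] eq gevrey_maj_nonneg[OF t] by (simp add: le_less_trans)
  qed
  have gi': "integrable lborel (\<lambda>u. gevrey_maj b (u - y))" using gi[OF b, of y] gevrey_maj_minus[of b] by (metis (no_types, lifting) Bochner_Integration.integrable_cong minus_diff_eq)
  have bi: "integrable lborel (\<lambda>u. ?c a * gevrey_maj b (u - y) + ?c b * gevrey_maj a (x - u))"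
    by (intro Bochner_Integration.integrable_add Bochner_Integration.integrable_mult_right gi gi' a)
  have le: "gevrey_maj a (x - u) * gevrey_maj b (u - y) \<le> ?c a * gevrey_maj b (u - y) + ?c b * gevrey_maj a (x - u)" for u
  proof -
    have na: "0 \<le> gevrey_maj a v" and nb: "0 \<le> gevrey_maj b v" for v using gevrey_maj_nonneg a b by auto
    have tri: "norm (x - y) \<le> norm (x - u) + norm (u - y)" using norm_triangle_ineq[of "x - u" "u - y"] by simp
    show ?thesis
    proof (cases "?\<delta> \<le> norm (x - u)")
      case True
      have "gevrey_maj a (x - u) * gevrey_maj b (u - y) \<le> ?c a * gevrey_maj b (u - y)" by (intro mult_right_mono gevrey_maj_le a d True nb)
      moreover have "0 \<le> ?c b * gevrey_maj a (x - u)" using na p b by (intro mult_nonneg_nonneg) auto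
      ultimately show ?thesis by linarith
    next
      case False
      then have "?\<delta> \<le> norm (u - y)" using tri by linarith
      then have "gevrey_maj a (x - u) * gevrey_maj b (u - y) \<le> gevrey_maj a (x - u) * ?c b" by (intro mult_left_mono gevrey_maj_le b d na)
      also have "\<dots> = ?c b * gevrey_maj a (x - u)" by (rule mult.commute)
      finally have "gevrey_maj a (x - u) * gevrey_maj b (u - y) \<le> ?c b * gevrey_maj a (x - u)" .
      moreover have "0 \<le> ?c a * gevrey_maj b (u - y)" using nb p a by (intro mult_nonneg_nonneg) auto
      ultimately show ?thesis by linarith
    qed
  qed
  show ?thesis
  proof (rule Bochner_Integration.integrable_bound[OF bi])
    show "(\<lambda>u. gevrey_maj a (x - u) * gevrey_maj b (u - y)) \<in> borel_measurable lborel"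
      using gi[OF a, of x] gi' by (intro borel_measurable_times) auto
    show "AE u in lborel. norm (gevrey_maj a (x - u) * gevrey_maj b (u - y)) \<le> norm (?c a * gevrey_maj b (u - y) + ?c b * gevrey_maj a (x - u))"
      using le gevrey_maj_nonneg a b by (intro AE_I2) (auto intro!: order_trans[OF le abs_ge_self] simp: abs_of_nonneg)
  qed
qed

lemma pc_maj_convolution_integrable:
  assumes "x \<noteq> y" "0 < a" "0 < a'"
  shows "integrable lborel (\<lambda>u. pc_maj a b (x - u) * pc_maj a' b' (u - y))"
proof -
  have "(\<lambda>u. pc_maj a b (x - u) * pc_maj a' b' (u - y)) = (\<lambda>u. (ext_const b * (b / a) * (ext_const b' * (b' / a'))) * (gevrey_maj a (x - u) * gevrey_maj a' (u - y)))"
    by (rule ext) (simp add: pc_maj_def)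
  then show ?thesis using Bochner_Integration.integrable_mult_right[OF gevrey_maj_convolution_integrable[OF assms]] by simp
qed

lemma pc_measurable_right: assumes "z \<in> wedge slope" shows "(\<lambda>u. pc z x u) \<in> borel_measurable borel" "(\<lambda>u. pc z u y) \<in> borel_measurable borel"
proof -
  have "(\<lambda>u. (x, u)) \<in> (borel :: 'a measure) \<rightarrow>\<^sub>M (borel :: ('a \<times> 'a) measure)" "(\<lambda>u. (u, y)) \<in> (borel :: 'a measure) \<rightarrow>\<^sub>M (borel :: ('a \<times> 'a) measure)"
    by (intro borel_measurable_continuous_onI continuous_intros)+
  from this[THEN measurable_compose[OF _ pc_measurable[OF assms]]]
  show "(\<lambda>u. pc z x u) \<in> borel_measurable borel" "(\<lambda>u. pc z u y) \<in> borel_measurable borel" by simp_all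
qed

lemma pc_convolution_holomorphic:
  assumes xy: "x \<noteq> y"
  shows "w \<in> wedge slope \<Longrightarrow> (\<lambda>z. LINT u|lborel. pc z x u * pc w u y) holomorphic_on wedge slope"
    and "w \<in> wedge slope \<Longrightarrow> (\<lambda>z. LINT u|lborel. pc w x u * pc z u y) holomorphic_on wedge slope"
proof -
  assume w: "w \<in> wedge slope"
  obtain aw bw where W: "0 < aw" "aw \<le> bw" "\<And>x y. norm (pc w x y) \<le> pc_maj aw bw (x - y)"
  proof -
    obtain r a b where L: "0 < r" "cball w r \<subseteq> wedge slope" "0 < a" "a \<le> b" "\<And>v. v \<in> cball w r \<Longrightarrow> a \<le> Re v \<and> Re v \<le> b"
      "\<And>v x y. v \<in> cball w r \<Longrightarrow> norm (pc v x y) \<le> pc_maj a b (x - y)" by (rule pc_local[OF w]) blast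
    have "w \<in> cball w r" using L(1) by simp
    then show ?thesis using L(3,4) L(6) by (intro that[of a b]) auto
  qed
  show "(\<lambda>z. LINT u|lborel. pc z x u * pc w u y) holomorphic_on wedge slope"
  proof (rule holomorphic_integral[OF wedge_open])
    show "(\<lambda>u. pc z x u * pc w u y) \<in> borel_measurable lborel" if "z \<in> wedge slope" for z
      using pc_measurable_right[OF that] pc_measurable_right[OF w] by simp
    show "(\<lambda>z. pc z x u * pc w u y) holomorphic_on wedge slope" for u
      by (intro holomorphic_on_mult pc_holomorphic' holomorphic_on_const)
    fix z assume z: "z \<in> wedge slope"
    obtain r a b where Z: "0 < r" "cball z r \<subseteq> wedge slope" "0 < a" "a \<le> b" "\<And>v. v \<in> cball z r \<Longrightarrow> a \<le> Re v \<and> Re v \<le> b"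
      "\<And>v x y. v \<in> cball z r \<Longrightarrow> norm (pc v x y) \<le> pc_maj a b (x - y)" by (rule pc_local[OF z]) blast
    have "norm (pc v x u * pc w u y) \<le> pc_maj a b (x - u) * pc_maj aw bw (u - y)" if "v \<in> cball z r" for v u
      unfolding norm_mult by (intro mult_mono Z(6) W(3) that pc_maj_nonneg Z(3,4)) auto
    then show "\<exists>r G. 0 < r \<and> cball z r \<subseteq> wedge slope \<and> integrable lborel G \<and> (\<forall>u. \<forall>v\<in>cball z r. norm (pc v x u * pc w u y) \<le> G u)"
      using Z(1,2) pc_maj_convolution_integrable[OF xy Z(3) W(1), of b bw] by blast
  qed
  show "(\<lambda>z. LINT u|lborel. pc w x u * pc z u y) holomorphic_on wedge slope"
  proof (rule holomorphic_integral[OF wedge_open])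
    show "(\<lambda>u. pc w x u * pc z u y) \<in> borel_measurable lborel" if "z \<in> wedge slope" for z
      using pc_measurable_right[OF that] pc_measurable_right[OF w] by simp
    show "(\<lambda>z. pc w x u * pc z u y) holomorphic_on wedge slope" for u
      by (intro holomorphic_on_mult pc_holomorphic' holomorphic_on_const)
    fix z assume z: "z \<in> wedge slope"
    obtain r a b where Z: "0 < r" "cball z r \<subseteq> wedge slope" "0 < a" "a \<le> b" "\<And>v. v \<in> cball z r \<Longrightarrow> a \<le> Re v \<and> Re v \<le> b"
      "\<And>v x y. v \<in> cball z r \<Longrightarrow> norm (pc v x y) \<le> pc_maj a b (x - y)" by (rule pc_local[OF z]) blast
    have "norm (pc w x u * pc v u y) \<le> pc_maj aw bw (x - u) * pc_maj a b (u - y)" if "v \<in> cball z r" for v u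
      unfolding norm_mult by (intro mult_mono Z(6) W(3) that pc_maj_nonneg W(1,2)) auto
    then show "\<exists>r G. 0 < r \<and> cball z r \<subseteq> wedge slope \<and> integrable lborel G \<and> (\<forall>u. \<forall>v\<in>cball z r. norm (pc w x u * pc v u y) \<le> G u)"
      using Z(1,2) pc_maj_convolution_integrable[OF xy W(1) Z(3), of bw b] by blast
  qed
qed

lemma pc_shift_holomorphic: "w \<in> wedge slope \<Longrightarrow> (\<lambda>z. pc (z + w) x y) holomorphic_on wedge slope"
proof -
  assume w: "w \<in> wedge slope"
  have "((\<lambda>z. pc z x y) \<circ> (\<lambda>z. z + w)) holomorphic_on wedge slope"
    by (rule holomorphic_on_compose_gen[OF _ pc_holomorphic']) (auto intro!: holomorphic_intros wedge_add w)
  then show ?thesis by (simp add: o_def)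
qed

text \<open>
  Both sides are holomorphic in each of the two times, and they agree for positive real times; the identity
  theorem is applied first in one time and then in the other.
\<close>

theorem pc_semigroup:
  assumes xy: "x \<noteq> y" and z: "z \<in> wedge slope" and w: "w \<in> wedge slope"
  shows "pc (z + w) x y = (LINT u|lborel. pc z x u * pc w u y)"
proof -
  have real: "pc (of_real t + of_real s) x y = (LINT u|lborel. pc (of_real t) x u * pc (of_real s) u y)" if t: "0 < t" and s: "0 < s" for t s
  proof -
    have "pc (of_real t + of_real s) x y = of_real (p (t + s) x y)"
      using pc_real[of "t + s" x y] t s xy by simp
    also have "\<dots> = of_real (LINT u|lborel. p t x u * p s u y)" by (simp only: Chapman_Kolmogorov(2)[OF t s])
    also have "\<dots> = (LINT u|lborel. complex_of_real (p t x u * p s u y))" by (rule integral_of_real[symmetric]) (rule Chapman_Kolmogorov(1)[OF t s])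
    also have "\<dots> = (LINT u|lborel. pc (of_real t) x u * pc (of_real s) u y)"
    proof (rule integral_cong_AE)
      show "(\<lambda>u. complex_of_real (p t x u * p s u y)) \<in> borel_measurable lborel"
        using p_measurable_right(1)[OF t, of x] p_measurable_right(2)[OF s, of y] by simp
      show "(\<lambda>u. pc (of_real t) x u * pc (of_real s) u y) \<in> borel_measurable lborel"
        using pc_measurable_right(1)[OF wedge_real[OF slope_pos t], of x] pc_measurable_right(2)[OF wedge_real[OF slope_pos s], of y] by simp
      have "AE u in lborel. u \<noteq> x" "AE u in lborel. u \<noteq> y" by (rule AE_lborel_singleton)+
      then show "AE u in lborel. complex_of_real (p t x u * p s u y) = pc (of_real t) x u * pc (of_real s) u y"
        by eventually_elim (simp add: pc_real t s)
    qed
    finally show ?thesis .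
  qed
  have half: "pc (z + of_real s) x y = (LINT u|lborel. pc z x u * pc (of_real s) u y)" if s: "0 < s" for s
  proof -
    have sc: "complex_of_real s \<in> wedge slope" by (rule wedge_real[OF slope_pos s])
    have "pc (z + of_real s) x y - (LINT u|lborel. pc z x u * pc (of_real s) u y) = 0"
      by (rule wedge_identity[OF slope_pos holomorphic_on_diff[OF pc_shift_holomorphic[OF sc] pc_convolution_holomorphic(1)[OF xy sc]] _ z])
         (use real[OF _ s] in simp)
    then show ?thesis by simp
  qed
  have "pc (w + z) x y - (LINT u|lborel. pc z x u * pc w u y) = 0"
    by (rule wedge_identity[OF slope_pos holomorphic_on_diff[OF pc_shift_holomorphic[OF z] pc_convolution_holomorphic(2)[OF xy z]] _ w])
       (use half in \<open>simp add: add.commute\<close>)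
  then show ?thesis by (simp add: add.commute)
qed

end

section \<open>The holomorphic semigroup on \<open>L\<^sup>q\<close>\<close>

lemma sector_arctan: assumes m: "0 < m" shows "sector (arctan m) = wedge m"
proof (rule set_eqI)
  fix z
  show "z \<in> sector (arctan m) \<longleftrightarrow> z \<in> wedge m"
  proof (cases "0 < Re z")
    case True
    then have z: "z \<noteq> 0" by auto
    have "z \<in> sector (arctan m) \<longleftrightarrow> \<bar>arctan (Im z / Re z)\<bar> < arctan m"
      using z arg_conv_arctan[OF True] by (simp add: sector_def)
    also have "\<dots> \<longleftrightarrow> arctan (Im z / Re z) < arctan m \<and> arctan (- m) < arctan (Im z / Re z)" by (auto simp: arctan_minus)
    also have "\<dots> \<longleftrightarrow> Im z / Re z < m \<and> - m < Im z / Re z" by (simp only: arctan_less_iff)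
    also have "\<dots> \<longleftrightarrow> \<bar>Im z\<bar> < m * Re z" using True by (auto simp: pos_divide_less_eq pos_less_divide_eq)
    finally show ?thesis using True by (simp add: wedge_def)
  next
    case False
    have "z \<notin> sector (arctan m)"
    proof
      assume "z \<in> sector (arctan m)"
      then have z: "z \<noteq> 0" and "\<bar>Arg z\<bar> < arctan m" by (auto simp: sector_def)
      then have "\<bar>Im (Ln z)\<bar> < pi / 2" using arctan_ubound[of m] by (simp add: Arg_eq_Im_Ln)
      then show False using False Re_Ln_pos_lt[OF z] by simp
    qed
    then show ?thesis using False by (simp add: wedge_def)
  qed
qed

lemma holomorphic_taylor_bounds:
  assumes r: "0 < r" and S: "open S" and F: "F holomorphic_on S" and sub: "cball z (2 * r) \<subseteq> S"
    and B: "\<And>w. w \<in> cball z (2 * r) \<Longrightarrow> norm (F w) \<le> B" and h: "norm h < r"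
  shows "norm (deriv F z) \<le> B / r" and "norm (F (z + h) - F z) \<le> B / r * norm h"
    and "norm (F (z + h) - F z - h * deriv F z) \<le> 2 * B / r\<^sup>2 * (norm h)\<^sup>2"
proof -
  have sub': "cball w r \<subseteq> cball z (2 * r)" if "w \<in> cball z r" for w
  proof
    fix v assume "v \<in> cball w r"
    then show "v \<in> cball z (2 * r)" using that dist_triangle[of z v w] by simp
  qed
  have cauchy: "norm ((deriv ^^ n) F w) \<le> fact n * B / r ^ n" if w: "w \<in> cball z r" for n w
  proof (rule Cauchy_inequality)
    have "F holomorphic_on cball w r" by (rule holomorphic_on_subset[OF F]) (use sub'[OF w] sub in blast)
    then show "F holomorphic_on ball w r" "continuous_on (cball w r) F"
      by (auto intro: holomorphic_on_subset holomorphic_on_imp_continuous_on)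
    show "norm (F v) \<le> B" if "norm (w - v) = r" for v
    proof (rule B)
      have "v \<in> cball w r" using that by (simp add: dist_norm)
      then show "v \<in> cball z (2 * r)" using sub'[OF w] by blast
    qed
  qed (rule r)
  have inS: "w \<in> S" if "w \<in> cball z r" for w using sub'[OF that] sub r by (metis centre_in_cball less_imp_le subsetD)
  have zin: "z \<in> cball z r" "z + h \<in> cball z r" using r h by (auto simp: dist_norm)
  have d1: "(F has_field_derivative deriv F w) (at w within cball z r)" if "w \<in> cball z r" for w
    using holomorphic_derivI[OF F S inS[OF that]] by (rule has_field_derivative_at_within)
  have d2: "(deriv F has_field_derivative deriv (deriv F) w) (at w within cball z r)" if "w \<in> cball z r" for w
    using holomorphic_derivI[OF holomorphic_deriv[OF F S] S inS[OF that]] by (rule has_field_derivative_at_within)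
  have b1: "norm (deriv F w) \<le> B / r" if "w \<in> cball z r" for w using cauchy[OF that, of 1] by simp
  have b2: "norm (deriv (deriv F) w) \<le> 2 * B / r\<^sup>2" if "w \<in> cball z r" for w
    using cauchy[OF that, of 2] by (simp add: numeral_2_eq_2)
  show "norm (deriv F z) \<le> B / r" by (rule b1[OF zin(1)])
  show "norm (F (z + h) - F z) \<le> B / r * norm h"
    using field_differentiable_bound[OF convex_cball d1 b1 zin(1) zin(2)] by (simp add: norm_minus_commute)
  have hs: "cball z (norm h) \<subseteq> cball z r" using h by (intro subset_cball) simp
  have lip: "norm (deriv F w - deriv F z) \<le> 2 * B / r\<^sup>2 * norm h" if "w \<in> cball z (norm h)" for w
  proof -
    have w: "w \<in> cball z r" using that hs by blast
    have "norm (deriv F w - deriv F z) \<le> 2 * B / r\<^sup>2 * norm (w - z)"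
      by (rule field_differentiable_bound[OF convex_cball d2 b2 w zin(1)])
    also have "\<dots> \<le> 2 * B / r\<^sup>2 * norm h"
    proof (rule mult_left_mono)
      show "norm (w - z) \<le> norm h" using that by (simp add: dist_norm norm_minus_commute)
      show "0 \<le> 2 * B / r\<^sup>2" using b2[OF zin(1)] norm_ge_zero order_trans by blast
    qed
    finally show ?thesis .
  qed
  have "norm ((F (z + h) - (z + h) * deriv F z) - (F z - z * deriv F z)) \<le> 2 * B / r\<^sup>2 * norm h * norm ((z + h) - z)"
  proof (rule field_differentiable_bound[OF convex_cball _ lip])
    show "((\<lambda>w. F w - w * deriv F z) has_field_derivative deriv F w - deriv F z) (at w within cball z (norm h))"
      if "w \<in> cball z (norm h)" for w
      by (rule derivative_eq_intros DERIV_subset[OF d1 hs] refl | use that hs in force)+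
  qed (auto simp: dist_norm)
  then show "norm (F (z + h) - F z - h * deriv F z) \<le> 2 * B / r\<^sup>2 * (norm h)\<^sup>2"
    by (simp add: algebra_simps power2_eq_square)
qed

lemma dominated_kernel_scale:
  assumes D: "dominated_kernel K k M" and m: "(\<lambda>(x, y). K' x y) \<in> borel_measurable borel"
    and c: "0 < c" and le: "\<And>x y. norm (K' x y) \<le> c * k (x - y)"
  shows "dominated_kernel K' (\<lambda>x. c * k x) (c * M)"
proof -
  interpret dominated_kernel K k M by (rule D)
  have "(\<integral>\<^sup>+ x. ennreal (c * k x) \<partial>lborel) = (\<integral>\<^sup>+ x. ennreal c * ennreal (k x) \<partial>lborel)"
    using c k_nonneg by (intro nn_integral_cong ennreal_mult) auto
  also have "\<dots> = ennreal c * (\<integral>\<^sup>+ x. ennreal (k x) \<partial>lborel)" using k_measurable by (intro nn_integral_cmult) simp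
  also have "\<dots> \<le> ennreal c * ennreal M" by (intro mult_left_mono k_mass) simp
  also have "\<dots> = ennreal (c * M)" using c M_pos by (intro ennreal_mult[symmetric]) auto
  finally have "(\<integral>\<^sup>+ x. ennreal (c * k x) \<partial>lborel) \<le> ennreal (c * M)" .
  then show ?thesis using c M_pos k_nonneg k_measurable m le by unfold_locales auto
qed

lemma kernel_op_diff:
  assumes q: "1 \<le> q" and f: "f \<in> Lp_fun q"
    and 1: "dominated_kernel K1 k1 M1" and 2: "dominated_kernel K2 k2 M2"
  shows "AE x in lebesgue. kernel_op K1 f x - kernel_op K2 f x = kernel_op (\<lambda>x y. K1 x y - K2 x y) f x"
  using dominated_kernel.kernel_op_integrable[OF 1 q f] dominated_kernel.kernel_op_integrable[OF 2 q f]
proof eventually_elim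
  case (elim x)
  show ?case unfolding kernel_op_def left_diff_distrib using elim by simp
qed

context heat_kernel begin

definition pc_deriv :: "complex \<Rightarrow> 'a \<Rightarrow> 'a \<Rightarrow> complex" where
  "pc_deriv z x y = deriv (\<lambda>z. pc z x y) z"

lemma pc_deriv_measurable: assumes z: "z \<in> wedge slope" shows "(\<lambda>(x, y). pc_deriv z x y) \<in> borel_measurable borel"
proof (rule borel_measurable_LIMSEQ_metric)
  define d where "d n = 1 / real (n + 1)" for n
  have d: "0 < d n" for n by (simp add: d_def)
  have dc: "complex_of_real (d n) \<in> wedge slope" for n by (rule wedge_real[OF slope_pos d])
  have d0: "complex_of_real (d n) \<noteq> 0" for n using d[of n] by simp
  show "(\<lambda>v. (case v of (x, y) \<Rightarrow> (pc (z + of_real (d n)) x y - pc z x y) / of_real (d n))) \<in> borel_measurable borel" for n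
    using pc_measurable[OF wedge_add[OF z dc[of n]]] pc_measurable[OF z] unfolding case_prod_unfold by (intro borel_measurable_divide borel_measurable_diff borel_measurable_const)
  fix v :: "'a \<times> 'a"
  obtain x y where v: "v = (x, y)" by (cases v)
  have "((\<lambda>z. pc z x y) has_field_derivative pc_deriv z x y) (at z)"
    unfolding pc_deriv_def by (rule holomorphic_derivI[OF pc_holomorphic' wedge_open z])
  then have "((\<lambda>h. (pc (z + h) x y - pc z x y) / h) \<longlongrightarrow> pc_deriv z x y) (at 0)" by (simp add: DERIV_def)
  moreover have "filterlim (\<lambda>n. complex_of_real (d n)) (at 0) sequentially"
    unfolding filterlim_at
  proof
    have "d \<longlonglongrightarrow> 0" unfolding d_def[abs_def] by (rule LIMSEQ_ignore_initial_segment[OF lim_const_over_n])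
    then show "(\<lambda>n. complex_of_real (d n)) \<longlonglongrightarrow> 0" using tendsto_of_real[of _ 0 sequentially, where 'a=complex] by fastforce
  qed (use d0 in auto)
  ultimately show "(\<lambda>n. case v of (x, y) \<Rightarrow> (pc (z + of_real (d n)) x y - pc z x y) / of_real (d n)) \<longlonglongrightarrow> (case v of (x, y) \<Rightarrow> pc_deriv z x y)"
    unfolding v prod.case by (rule filterlim_compose)
qed

text \<open>
  Cauchy's estimates apply pointwise in \<open>(x, y)\<close> with the bound \<open>pc_maj a b (x - y)\<close>. Hence increments and
  Taylor remainders of the kernel have convolution majorants that are \<open>O(norm h)\<close> and \<open>O(norm h ^ 2)\<close> multiples of
  one fixed function, which is what differentiability in operator norm requires.
\<close>

lemma pc_expansion:
  assumes z: "z \<in> wedge slope"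
  obtains r C a b where "0 < r" "0 < C" "dominated_kernel (pc z) (pc_maj a b) (pc_mass a b)"
    "\<And>x y. norm (pc_deriv z x y) \<le> C * pc_maj a b (x - y)"
    "\<And>h. norm h < r \<Longrightarrow> z + h \<in> wedge slope"
    "\<And>h x y. norm h < r \<Longrightarrow> norm (pc (z + h) x y - pc z x y) \<le> C * norm h * pc_maj a b (x - y)"
    "\<And>h x y. norm h < r \<Longrightarrow> norm (pc (z + h) x y - pc z x y - h * pc_deriv z x y) \<le> C * (norm h)\<^sup>2 * pc_maj a b (x - y)"
proof -
  obtain s a b where L: "0 < s" "cball z s \<subseteq> wedge slope" "0 < a" "a \<le> b" "\<And>v. v \<in> cball z s \<Longrightarrow> a \<le> Re v \<and> Re v \<le> b"
    "\<And>v x y. v \<in> cball z s \<Longrightarrow> norm (pc v x y) \<le> pc_maj a b (x - y)" by (rule pc_local[OF z]) blast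
  define r where "r = s / 2"
  have r: "0 < r" "2 * r = s" using L(1) by (auto simp: r_def)
  define C where "C = 1 / r + 2 / r\<^sup>2"
  have C: "0 < C" "1 / r \<le> C" "2 / r\<^sup>2 \<le> C" using r by (auto simp: C_def intro!: add_pos_pos)
  have zs: "z \<in> cball z s" using L(1) by simp
  have nn: "0 \<le> pc_maj a b x" for x by (rule pc_maj_nonneg[OF L(3,4)])
  note tb = holomorphic_taylor_bounds[OF r(1) wedge_open pc_holomorphic', unfolded r(2), OF L(2) L(6), folded pc_deriv_def]
  show ?thesis
  proof (rule that[OF r(1) C(1)])
    show "dominated_kernel (pc z) (pc_maj a b) (pc_mass a b)" using pc_dominated[OF z L(3)] L(5)[OF zs] by blast
    show "norm (pc_deriv z x y) \<le> C * pc_maj a b (x - y)" for x y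
    proof -
      have "norm (pc_deriv z x y) \<le> pc_maj a b (x - y) / r" by (rule tb(1)[where h=0]) (use r in auto)
      also have "\<dots> = 1 / r * pc_maj a b (x - y)" by simp
      also have "\<dots> \<le> C * pc_maj a b (x - y)" by (rule mult_right_mono[OF C(2) nn])
      finally show ?thesis .
    qed
    fix h :: complex assume h: "norm h < r"
    have "z + h \<in> cball z s" using h r by (simp add: dist_norm)
    then show "z + h \<in> wedge slope" using L(2) by blast
    fix x y :: 'a
    have "norm (pc (z + h) x y - pc z x y) \<le> pc_maj a b (x - y) / r * norm h" by (rule tb(2)[OF _ h])
    also have "\<dots> = 1 / r * (norm h * pc_maj a b (x - y))" by simp
    also have "\<dots> \<le> C * (norm h * pc_maj a b (x - y))" by (intro mult_right_mono C(2) mult_nonneg_nonneg nn) simp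
    finally show "norm (pc (z + h) x y - pc z x y) \<le> C * norm h * pc_maj a b (x - y)" by (simp add: mult.assoc)
    have "norm (pc (z + h) x y - pc z x y - h * pc_deriv z x y) \<le> 2 * pc_maj a b (x - y) / r\<^sup>2 * (norm h)\<^sup>2" by (rule tb(3)[OF _ h])
    also have "\<dots> = 2 / r\<^sup>2 * ((norm h)\<^sup>2 * pc_maj a b (x - y))" by simp
    also have "\<dots> \<le> C * ((norm h)\<^sup>2 * pc_maj a b (x - y))" by (intro mult_right_mono C(3) mult_nonneg_nonneg nn) simp
    finally show "norm (pc (z + h) x y - pc z x y - h * pc_deriv z x y) \<le> C * (norm h)\<^sup>2 * pc_maj a b (x - y)" by (simp add: mult.assoc)
  qed
qed

lemma pc_dominated_ex: assumes "z \<in> wedge slope" shows "\<exists>k M. dominated_kernel (pc z) k M"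
  using pc_dominated[OF assms, of "Re z" "Re z"] assms by (auto simp: wedge_def)

definition holomorphic_semigroup :: "complex \<Rightarrow> ('a \<Rightarrow> complex) \<Rightarrow> 'a \<Rightarrow> complex" where
  "holomorphic_semigroup z f = (if z = 0 then f else kernel_op (pc z) f)"

lemma wedge_nonzero: "z \<in> wedge m \<Longrightarrow> z \<noteq> 0"
  by (auto simp: wedge_def)

lemma holomorphic_semigroup_wedge: "z \<in> wedge m \<Longrightarrow> holomorphic_semigroup z f = kernel_op (pc z) f"
  using wedge_nonzero by (simp add: holomorphic_semigroup_def)

lemma holomorphic_semigroup_differentiable:
  assumes \<nu>: "1 \<le> \<nu>" and z: "z \<in> wedge slope"
  shows "Lp_complex_differentiable_at \<nu> holomorphic_semigroup z"
proof -
  obtain r C a b where r: "0 < r" and C: "0 < C" and D: "dominated_kernel (pc z) (pc_maj a b) (pc_mass a b)"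
    and dle: "\<And>x y. norm (pc_deriv z x y) \<le> C * pc_maj a b (x - y)"
    and near: "\<And>h. norm h < r \<Longrightarrow> z + h \<in> wedge slope"
    and tay: "\<And>h x y. norm h < r \<Longrightarrow> norm (pc (z + h) x y - pc z x y - h * pc_deriv z x y) \<le> C * (norm h)\<^sup>2 * pc_maj a b (x - y)"
    by (rule pc_expansion[OF z]) blast
  let ?M = "pc_mass a b"
  have M: "0 < ?M" using D by (rule dominated_kernel.M_pos)
  note D' = dominated_kernel_scale[OF D pc_deriv_measurable[OF z] C dle]
  have est: "Lp_norm \<nu> (\<lambda>x. (holomorphic_semigroup (z + h) f x - holomorphic_semigroup z f x) / h - kernel_op (pc_deriv z) f x) \<le> (2 * (C * norm h * ?M)) * Lp_norm \<nu> f"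
    if h: "h \<noteq> 0" "norm h < r" and f: "f \<in> Lp_fun \<nu>" for h f
  proof -
    define E where "E x y = (pc (z + h) x y - pc z x y) / h - pc_deriv z x y" for x y
    have zh: "z + h \<in> wedge slope" by (rule near[OF h(2)])
    obtain k2 M2 where D2: "dominated_kernel (pc (z + h)) k2 M2" using pc_dominated_ex[OF zh] by blast
    have Em: "(\<lambda>(x, y). E x y) \<in> borel_measurable borel"
      using pc_measurable[OF zh] pc_measurable[OF z] pc_deriv_measurable[OF z] unfolding E_def case_prod_unfold by (intro borel_measurable_divide borel_measurable_diff borel_measurable_const)
    have Ele: "norm (E x y) \<le> (C * norm h) * pc_maj a b (x - y)" for x y
    proof -
      have "E x y = (pc (z + h) x y - pc z x y - h * pc_deriv z x y) / h" using h(1) by (simp add: E_def diff_divide_distrib)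
      then have "norm (E x y) = norm (pc (z + h) x y - pc z x y - h * pc_deriv z x y) / norm h" by (simp add: norm_divide)
      also have "\<dots> \<le> (C * (norm h)\<^sup>2 * pc_maj a b (x - y)) / norm h" by (intro divide_right_mono tay h) simp
      also have "\<dots> = (C * norm h) * pc_maj a b (x - y)" using h(1) by (simp add: power2_eq_square)
      finally show ?thesis .
    qed
    have DE: "dominated_kernel E (\<lambda>x. (C * norm h) * pc_maj a b x) (C * norm h * ?M)"
      by (rule dominated_kernel_scale[OF D Em _ Ele]) (use C h in simp)
    have ae: "AE x in lebesgue. kernel_op E f x = (holomorphic_semigroup (z + h) f x - holomorphic_semigroup z f x) / h - kernel_op (pc_deriv z) f x"
      using kernel_op_linear_combination[OF \<nu> f D2 D D' E_def] by eventually_elim (simp add: holomorphic_semigroup_wedge[OF z] holomorphic_semigroup_wedge[OF zh])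
    have m: "(\<lambda>x. (holomorphic_semigroup (z + h) f x - holomorphic_semigroup z f x) / h - kernel_op (pc_deriv z) f x) \<in> borel_measurable lebesgue"
      using dominated_kernel.kernel_op_Lp_fun[OF D2 \<nu> f] dominated_kernel.kernel_op_Lp_fun[OF D \<nu> f] dominated_kernel.kernel_op_Lp_fun[OF D' \<nu> f]
      unfolding holomorphic_semigroup_wedge[OF z] holomorphic_semigroup_wedge[OF zh] Lp_fun_def by auto
    have "Lp_norm \<nu> (\<lambda>x. (holomorphic_semigroup (z + h) f x - holomorphic_semigroup z f x) / h - kernel_op (pc_deriv z) f x) = Lp_norm \<nu> (kernel_op E f)"
      unfolding Lp_norm_mass using Lp_fun_cong_AE(2)[OF m dominated_kernel.kernel_op_Lp_fun[OF DE \<nu> f] ae] by simp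
    then show ?thesis using dominated_kernel.kernel_op_norm_le[OF DE \<nu> f] by simp
  qed
  show ?thesis
    unfolding Lp_complex_differentiable_at_def
  proof (intro exI[of _ "kernel_op (pc_deriv z)"] conjI allI impI)
    show "Lp_bounded_linear \<nu> (kernel_op (pc_deriv z))" by (rule dominated_kernel.kernel_op_bounded_linear[OF D' \<nu>])
    fix e :: real assume e: "0 < e"
    show "\<forall>\<^sub>F h in at 0. \<forall>f\<in>Lp_fun \<nu>. Lp_norm \<nu> (\<lambda>x. (holomorphic_semigroup (z + h) f x - holomorphic_semigroup z f x) / h - kernel_op (pc_deriv z) f x) \<le> e * Lp_norm \<nu> f"
      unfolding eventually_at
    proof (intro exI[of _ "min r (e / (2 * C * ?M))"] conjI ballI impI)
      show "0 < min r (e / (2 * C * ?M))" using r C M e by simp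
      fix h :: complex and f :: "'a \<Rightarrow> complex" assume h: "h \<noteq> 0 \<and> dist h 0 < min r (e / (2 * C * ?M))" and f: "f \<in> Lp_fun \<nu>"
      have hr: "norm h < r" and "norm h < e / (2 * C * ?M)" using h by auto
      then have "2 * (C * norm h * ?M) \<le> e" using C M by (simp add: pos_less_divide_eq mult_ac)
      moreover have "0 \<le> Lp_norm \<nu> f" by (simp add: Lp_norm_def)
      ultimately have "(2 * (C * norm h * ?M)) * Lp_norm \<nu> f \<le> e * Lp_norm \<nu> f" by (rule mult_right_mono)
      then show "Lp_norm \<nu> (\<lambda>x. (holomorphic_semigroup (z + h) f x - holomorphic_semigroup z f x) / h - kernel_op (pc_deriv z) f x) \<le> e * Lp_norm \<nu> f"
        using est[OF _ hr f] h by linarith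
    qed
  qed
qed

text \<open>
  By \<open>pc_expansion\<close> the increment of the kernel has a convolution majorant of mass \<open>O(norm h)\<close>.
\<close>

lemma holomorphic_semigroup_continuous:
  assumes \<nu>: "1 \<le> \<nu>" and z: "z \<in> wedge slope" and f: "f \<in> Lp_fun \<nu>" and e: "0 < e"
  shows "\<exists>d>0. \<forall>h. norm h < d \<longrightarrow> z + h \<in> wedge slope \<longrightarrow> Lq_mass \<nu> (\<lambda>x. kernel_op (pc (z + h)) f x - kernel_op (pc z) f x) \<le> e"
proof -
  obtain r C a b where r: "0 < r" and C: "0 < C" and D: "dominated_kernel (pc z) (pc_maj a b) (pc_mass a b)"
    and lip: "\<And>h x y. norm h < r \<Longrightarrow> norm (pc (z + h) x y - pc z x y) \<le> C * norm h * pc_maj a b (x - y)"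
    by (rule pc_expansion[OF z]) blast
  let ?M = "pc_mass a b"
  have M: "0 < ?M" using D by (rule dominated_kernel.M_pos)
  define c where "c = (e / (Lq_mass \<nu> f + 1)) powr (1 / \<nu>)"
  have m0: "0 < Lq_mass \<nu> f + 1" using Lq_mass_nonneg[of \<nu> f] by simp
  have c: "0 < c" "c powr \<nu> = e / (Lq_mass \<nu> f + 1)" using e m0 \<nu> by (simp_all add: c_def powr_powr)
  show ?thesis
  proof (intro exI[of _ "min r (c / (2 * C * ?M))"] conjI allI impI)
    show "0 < min r (c / (2 * C * ?M))" using r C M c by simp
    fix h assume h: "norm h < min r (c / (2 * C * ?M))" and zh: "z + h \<in> wedge slope"
    have hr: "norm h < r" and "norm h < c / (2 * C * ?M)" using h by auto
    then have hc: "2 * (C * norm h * ?M) \<le> c" using C M by (simp add: pos_less_divide_eq mult_ac)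
    obtain k2 M2 where D2: "dominated_kernel (pc (z + h)) k2 M2" using pc_dominated_ex[OF zh] by blast
    show "Lq_mass \<nu> (\<lambda>x. kernel_op (pc (z + h)) f x - kernel_op (pc z) f x) \<le> e"
    proof (cases "h = 0")
      case True
      then show ?thesis using e by (simp add: Lq_mass_def)
    next
      case False
      define E where "E x y = pc (z + h) x y - pc z x y" for x y
      have Em: "(\<lambda>(x, y). E x y) \<in> borel_measurable borel"
        using pc_measurable[OF zh] pc_measurable[OF z] unfolding E_def case_prod_unfold by (intro borel_measurable_diff)
      have DE: "dominated_kernel E (\<lambda>x. (C * norm h) * pc_maj a b x) (C * norm h * ?M)"
        by (rule dominated_kernel_scale[OF D Em]) (use C False lip[OF hr] in \<open>simp_all add: E_def\<close>)
      have ae: "AE x in lebesgue. kernel_op E f x = kernel_op (pc (z + h)) f x - kernel_op (pc z) f x"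
        using kernel_op_diff[OF \<nu> f D2 D] by eventually_elim (simp add: E_def[abs_def])
      have m: "(\<lambda>x. kernel_op (pc (z + h)) f x - kernel_op (pc z) f x) \<in> borel_measurable lebesgue"
        using dominated_kernel.kernel_op_Lp_fun[OF D2 \<nu> f] dominated_kernel.kernel_op_Lp_fun[OF D \<nu> f] by (auto simp: Lp_fun_def)
      have "Lq_mass \<nu> (\<lambda>x. kernel_op (pc (z + h)) f x - kernel_op (pc z) f x) = Lq_mass \<nu> (kernel_op E f)"
        by (rule Lp_fun_cong_AE(2)[OF m dominated_kernel.kernel_op_Lp_fun[OF DE \<nu> f] ae])
      also have "\<dots> \<le> (2 * (C * norm h * ?M)) powr \<nu> * Lq_mass \<nu> f" by (rule dominated_kernel.kernel_op_mass_le[OF DE \<nu> f])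
      also have "\<dots> \<le> c powr \<nu> * (Lq_mass \<nu> f + 1)"
        using \<nu> hc C M Lq_mass_nonneg[of \<nu> f] by (intro mult_mono powr_mono2) auto
      also have "\<dots> = e" using c(2) m0 by simp
      finally show ?thesis .
    qed
  qed
qed

end

section \<open>Strong continuity at time zero\<close>

lemma (in dominated_kernel) kernel_op_diff_fun:
  assumes q: "1 \<le> q" and f: "f \<in> Lp_fun q" and g: "g \<in> Lp_fun q"
  shows "AE x in lebesgue. kernel_op K (\<lambda>y. f y - g y) x = kernel_op K f x - kernel_op K g x"
  using kernel_op_integrable[OF q f] kernel_op_integrable[OF q g]
proof eventually_elim
  case (elim x)
  show ?case unfolding kernel_op_def right_diff_distrib using elim by simp
qed

lemma Lq_mass_three:
  assumes q: "1 \<le> q" and a: "a \<in> Lp_fun q" and b: "b \<in> Lp_fun q" and c: "c \<in> Lp_fun q"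
    and F: "F \<in> borel_measurable lebesgue" and ae: "AE x in lebesgue. F x = a x + b x + c x"
    and le: "Lq_mass q a \<le> e" "Lq_mass q b \<le> e" "Lq_mass q c \<le> e"
  shows "Lq_mass q F \<le> 3 * (2 powr q)\<^sup>2 * e"
proof -
  let ?K = "2 powr q"
  have K: "1 \<le> ?K" using q by (intro ge_one_powr_ge_zero) auto
  have e: "0 \<le> e" using le(1) Lq_mass_nonneg order_trans by blast
  have ab: "(\<lambda>x. a x + b x) \<in> Lp_fun q" "Lq_mass q (\<lambda>x. a x + b x) \<le> ?K * (Lq_mass q a + Lq_mass q b)"
    by (rule Lp_fun_add[OF q a b])+
  have abc: "(\<lambda>x. a x + b x + c x) \<in> Lp_fun q" "Lq_mass q (\<lambda>x. a x + b x + c x) \<le> ?K * (Lq_mass q (\<lambda>x. a x + b x) + Lq_mass q c)"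
    by (rule Lp_fun_add[OF q ab(1) c])+
  have "AE x in lebesgue. a x + b x + c x = F x" using ae by eventually_elim simp
  then have "Lq_mass q F = Lq_mass q (\<lambda>x. a x + b x + c x)" by (rule Lp_fun_cong_AE(2)[OF F abc(1)])
  also have "\<dots> \<le> ?K * (Lq_mass q (\<lambda>x. a x + b x) + Lq_mass q c)" by (rule abc(2))
  also have "\<dots> \<le> ?K * (?K * (e + e) + ?K * e)"
  proof (intro mult_left_mono add_mono)
    have "Lq_mass q (\<lambda>x. a x + b x) \<le> ?K * (Lq_mass q a + Lq_mass q b)" by (rule ab(2))
    also have "\<dots> \<le> ?K * (e + e)" using le by (intro mult_left_mono add_mono) auto
    finally show "Lq_mass q (\<lambda>x. a x + b x) \<le> ?K * (e + e)" .
    have "1 * e \<le> ?K * e" using K e by (rule mult_right_mono)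
    then show "Lq_mass q c \<le> ?K * e" using le by simp
  qed simp
  also have "\<dots> = 3 * ?K\<^sup>2 * e" by (simp add: power2_eq_square algebra_simps)
  finally show ?thesis .
qed

context heat_kernel begin

definition small_mass :: real where "small_mass = ext_const 1 * (2 * rho_mass * 2)"

lemma small_mass_pos: "0 < small_mass"
  using ext_const_pos[of 1] rho_mass_pos by (simp add: small_mass_def)

text \<open>
  In contrast to the majorants \<open>pc_maj a b\<close>, the mass here is bounded as \<open>Re z\<close> tends to zero.
\<close>

lemma pc_dominated_small:
  assumes z: "z \<in> wedge slope" and Rz: "Re z \<le> 1"
  shows "dominated_kernel (pc z) (\<lambda>x. ext_const 1 * gevrey_maj (Re z) x) small_mass"
proof
  have t: "0 < Re z" using z by (simp add: wedge_def)
  show "(\<lambda>(x, y). pc z x y) \<in> borel_measurable borel" by (rule pc_measurable[OF z])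
  show "(\<lambda>x. ext_const 1 * gevrey_maj (Re z) x) \<in> borel_measurable borel" using gevrey_maj_measurable[OF t] by simp
  show "0 \<le> ext_const 1 * gevrey_maj (Re z) x" for x by (rule mult_nonneg_nonneg[OF less_imp_le[OF ext_const_pos] gevrey_maj_nonneg[OF t]])
  show "0 < small_mass" by (rule small_mass_pos)
  show "norm (pc z x y) \<le> ext_const 1 * gevrey_maj (Re z) (x - y)" for x y by (rule pc_le[OF z Rz])
  have "(\<integral>\<^sup>+ x. ennreal (ext_const 1 * gevrey_maj (Re z) x) \<partial>lborel) = (\<integral>\<^sup>+ x. ennreal (ext_const 1) * ennreal (gevrey_maj (Re z) x) \<partial>lborel)"
    using ext_const_pos[of 1] gevrey_maj_nonneg[OF t] by (intro nn_integral_cong ennreal_mult) auto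
  also have "\<dots> = ennreal (ext_const 1) * (\<integral>\<^sup>+ x. ennreal (gevrey_maj (Re z) x) \<partial>lborel)"
    using gevrey_maj_measurable[OF t] by (intro nn_integral_cmult) simp
  also have "\<dots> \<le> ennreal (ext_const 1) * ennreal (2 * rho_mass * (1 + 1))"
    by (intro mult_left_mono nn_integral_gevrey_maj t Rz) simp
  also have "\<dots> = ennreal small_mass" unfolding small_mass_def
    using ext_const_pos[of 1] rho_mass_pos by (simp add: ennreal_mult[symmetric])
  finally show "(\<integral>\<^sup>+ x. ennreal (ext_const 1 * gevrey_maj (Re z) x) \<partial>lborel) \<le> ennreal small_mass" .
qed

lemma kernel_op_pc_real:
  assumes s: "0 < s" and g: "g \<in> borel_measurable borel"
  shows "kernel_op (pc (of_real s)) g x = (LINT y|lborel. of_real (p s x y) * g y)"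
proof -
  have sc: "complex_of_real s \<in> wedge slope" by (rule wedge_real[OF slope_pos s])
  obtain k M where D: "dominated_kernel (pc (of_real s)) k M" using pc_dominated_ex[OF sc] by blast
  have gl: "g \<in> borel_measurable lebesgue" using g by (intro measurable_completion) simp
  have pm: "(\<lambda>y. complex_of_real (p s x y)) \<in> borel_measurable borel" using p_measurable_right(1)[OF s, of x] by simp
  have "kernel_op (pc (of_real s)) g x = (LINT y|lebesgue. of_real (p s x y) * g y)"
    by (rule dominated_kernel.kernel_op_cong[where K'="\<lambda>x y. of_real (p s x y)", OF D _ pm gl]) (simp add: pc_real s)
  also have "\<dots> = (LINT y|lborel. of_real (p s x y) * g y)"
    by (rule integral_completion) (use pm g in simp)
  finally show ?thesis .
qed

text \<open>
  The initial condition for real functions, applied to the real and imaginary parts.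
\<close>

lemma initial_uniform:
  fixes g :: "'a \<Rightarrow> complex"
  assumes g: "continuous_on UNIV g" and R: "\<And>x. R < norm x \<Longrightarrow> g x = 0" and e: "0 < e"
  shows "\<exists>s0>0. \<forall>s x. 0 < s \<longrightarrow> s < s0 \<longrightarrow> norm (kernel_op (pc (of_real s)) g x - g x) \<le> e"
proof -
  have gm: "g \<in> borel_measurable borel" by (rule borel_measurable_continuous_onI[OF g])
  obtain B where B: "\<And>x. norm (g x) \<le> B"
  proof -
    have "bounded (g ` cball 0 R)" using compact_imp_bounded[OF compact_continuous_image[OF continuous_on_subset[OF g] compact_cball]] by simp
    then obtain B where "\<And>x. x \<in> cball 0 R \<Longrightarrow> norm (g x) \<le> B" unfolding bounded_iff by blast
    then have "norm (g x) \<le> max B 0" for x using R[of x] by (cases "norm x \<le> R") (auto simp: le_max_iff_disj)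
    then show ?thesis using that by blast
  qed
  have conv: "\<exists>s0>0. \<forall>s x. 0 < s \<longrightarrow> s < s0 \<longrightarrow> \<bar>kernel_semigroup p s u x - u x\<bar> < e / 2"
    if u: "continuous_on UNIV u" and u0: "\<And>x. R < norm x \<Longrightarrow> u x = 0" and uB: "\<And>x. \<bar>u x\<bar> \<le> B" for u :: "'a \<Rightarrow> real"
  proof -
    have "bounded (range u)" using uB by (auto simp: bounded_iff)
    moreover have "uniformly_continuous_on UNIV u"
      by (rule uniformly_continuous_vanishing[OF u]) (use u0 in \<open>auto intro!: exI[of _ "R + 1"]\<close>)
    ultimately have "uniform_limit UNIV (\<lambda>t. kernel_semigroup p t u) u (at_right 0)" by (rule p_initial)
    then have "\<forall>\<^sub>F s in at_right 0. \<forall>x\<in>UNIV. dist (kernel_semigroup p s u x) (u x) < e / 2"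
      unfolding uniform_limit_iff using half_gt_zero[OF e] by blast
    then show ?thesis by (auto simp: eventually_at_right_field dist_real_def)
  qed
  have "\<exists>s0>0. \<forall>s x. 0 < s \<longrightarrow> s < s0 \<longrightarrow> \<bar>kernel_semigroup p s (\<lambda>y. Re (g y)) x - Re (g x)\<bar> < e / 2"
    by (rule conv) (use R B in \<open>auto intro!: continuous_intros g intro: order_trans[OF abs_Re_le_cmod]\<close>)
  then obtain s1 where s1: "0 < s1" "\<And>s x. 0 < s \<Longrightarrow> s < s1 \<Longrightarrow> \<bar>kernel_semigroup p s (\<lambda>y. Re (g y)) x - Re (g x)\<bar> < e / 2" by blast
  have "\<exists>s0>0. \<forall>s x. 0 < s \<longrightarrow> s < s0 \<longrightarrow> \<bar>kernel_semigroup p s (\<lambda>y. Im (g y)) x - Im (g x)\<bar> < e / 2"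
    by (rule conv) (use R B in \<open>auto intro!: continuous_intros g intro: order_trans[OF abs_Im_le_cmod]\<close>)
  then obtain s2 where s2: "0 < s2" "\<And>s x. 0 < s \<Longrightarrow> s < s2 \<Longrightarrow> \<bar>kernel_semigroup p s (\<lambda>y. Im (g y)) x - Im (g x)\<bar> < e / 2" by blast
  show ?thesis
  proof (intro exI[of _ "min s1 s2"] conjI allI impI)
    show "0 < min s1 s2" using s1 s2 by simp
    fix s x assume s: "0 < s" "s < min s1 s2"
    have i: "integrable lborel (\<lambda>y. complex_of_real (p s x y) * g y)"
    proof (rule Bochner_Integration.integrable_bound)
      show "integrable lborel (\<lambda>y. p s x y * B)" by (intro Bochner_Integration.integrable_mult_left integrable_p s)
      show "(\<lambda>y. complex_of_real (p s x y) * g y) \<in> borel_measurable lborel" using p_measurable_right(1)[OF s(1), of x] gm by simp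
      have "0 \<le> B" using B norm_ge_zero order_trans by blast
      then show "AE y in lborel. norm (complex_of_real (p s x y) * g y) \<le> norm (p s x y * B)"
        using B p_nonneg[OF s(1)] by (intro AE_I2) (auto simp: norm_mult abs_mult intro!: mult_left_mono)
    qed
    have "Re (kernel_op (pc (of_real s)) g x) = kernel_semigroup p s (\<lambda>y. Re (g y)) x"
      using kernel_semigroup_eq_P[OF s(1), of "\<lambda>y. Re (g y)" x] gm integral_Re[OF i] by (simp add: kernel_op_pc_real[OF s(1) gm] P_def)
    moreover have "Im (kernel_op (pc (of_real s)) g x) = kernel_semigroup p s (\<lambda>y. Im (g y)) x"
      using kernel_semigroup_eq_P[OF s(1), of "\<lambda>y. Im (g y)" x] gm integral_Im[OF i] by (simp add: kernel_op_pc_real[OF s(1) gm] P_def)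
    ultimately show "norm (kernel_op (pc (of_real s)) g x - g x) \<le> e"
      using cmod_le[of "kernel_op (pc (of_real s)) g x - g x"] s1(2)[of s x] s2(2)[of s x] s by simp
  qed
qed

definition tail_const :: real where
  "tail_const = real DIM('a) * unit_ball_vol DIM('a) * (LINT r:{0<..<1}|lebesgue. Phi \<phi> r / r)"

text \<open>
  The mass that \<open>\<rho>\<^sub>s\<close> carries from the ball of radius \<open>R\<close> to \<open>x\<close> over a distance of at least one.
\<close>

definition far_mass :: "real \<Rightarrow> real \<Rightarrow> 'a \<Rightarrow> ennreal" where
  "far_mass s R x = (\<integral>\<^sup>+ y. ennreal (\<rho> s (x - y)) * indicator {v. 1 \<le> norm v} (x - y) * indicator (cball 0 R) y \<partial>lborel)"

lemma far_mass:
  assumes s: "0 < s"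
  shows "far_mass s R \<in> borel_measurable borel" and "(\<integral>\<^sup>+ x. far_mass s R x \<partial>lborel) \<le> ennreal tail_const * emeasure lborel (cball (0::'a) R)"
proof -
  have [measurable]: "\<rho> s \<in> borel_measurable borel" by (rule rho_measurable[OF s])
  have [measurable]: "{v::'a. 1 \<le> norm v} \<in> sets borel" by measurable
  have [measurable]: "cball (0::'a) R \<in> sets borel" by simp
  let ?F = "\<lambda>x y. ennreal (\<rho> s (x - y)) * indicator {v. 1 \<le> norm v} (x - y) * indicator (cball (0::'a) R) y"
  have m: "(\<lambda>(x, y). ?F x y) \<in> borel_measurable (lborel \<Otimes>\<^sub>M lborel)" by measurable
  have m': "(\<lambda>(y, x). ?F x y) \<in> borel_measurable (lborel \<Otimes>\<^sub>M lborel)" by measurable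
  show "far_mass s R \<in> borel_measurable borel"
    unfolding far_mass_def[abs_def] using lborel.borel_measurable_nn_integral[OF m] by simp
  have "(\<integral>\<^sup>+ x. far_mass s R x \<partial>lborel) = (\<integral>\<^sup>+ y. (\<integral>\<^sup>+ x. ?F x y \<partial>lborel) \<partial>lborel)"
    unfolding far_mass_def by (rule lborel_pair.Fubini'[OF m, symmetric])
  also have "(\<integral>\<^sup>+ y. (\<integral>\<^sup>+ x. ?F x y \<partial>lborel) \<partial>lborel) \<le> (\<integral>\<^sup>+ y. ennreal tail_const * indicator (cball (0::'a) R) y \<partial>lborel)"
  proof (rule nn_integral_mono)
    fix y :: 'a
    have "(\<integral>\<^sup>+ x. ?F x y \<partial>lborel) = (\<integral>\<^sup>+ x. ennreal (\<rho> s (x - y)) * indicator {v. 1 \<le> norm v} (x - y) \<partial>lborel) * indicator (cball 0 R) y"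
      by (rule nn_integral_multc) simp
    also have "(\<integral>\<^sup>+ x. ennreal (\<rho> s (x - y)) * indicator {v. 1 \<le> norm v} (x - y) \<partial>lborel) = (\<integral>\<^sup>+ x. ennreal (\<rho> s x) * indicator {v. 1 \<le> norm v} x \<partial>lborel)"
      by (rule nn_integral_lborel_shift[of "\<lambda>x. ennreal (\<rho> s x) * indicator {v. 1 \<le> norm v} x" y]) simp
    also have "(\<integral>\<^sup>+ x. ennreal (\<rho> s x) * indicator {v. 1 \<le> norm v} x \<partial>lborel) * indicator (cball 0 R) y \<le> ennreal tail_const * indicator (cball 0 R) y"
      unfolding tail_const_def by (intro mult_right_mono nn_integral_rho_tail s) simp
    finally show "(\<integral>\<^sup>+ x. ?F x y \<partial>lborel) \<le> ennreal tail_const * indicator (cball 0 R) y" .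
  qed
  also have "(\<integral>\<^sup>+ y. ennreal tail_const * indicator (cball (0::'a) R) y \<partial>lborel) = ennreal tail_const * emeasure lborel (cball (0::'a) R)"
    by (rule nn_integral_cmult_indicator) simp
  finally show "(\<integral>\<^sup>+ x. far_mass s R x \<partial>lborel) \<le> ennreal tail_const * emeasure lborel (cball (0::'a) R)" .
qed


lemma kernel_op_far_le:
  fixes g :: "'a \<Rightarrow> complex"
  assumes s: "0 < s" "s \<le> 1" and gm: "g \<in> borel_measurable borel" and R: "\<And>x. R < norm x \<Longrightarrow> g x = 0"
    and B: "\<And>x. norm (g x) \<le> B" and x: "R + 1 < norm x"
  shows "ennreal (norm (kernel_op (pc (of_real s)) g x)) \<le> ennreal (B * hk_const 1 * s) * far_mass s R x"
proof -
  have B0: "0 \<le> B" using B norm_ge_zero order_trans by blast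
  have hk: "0 < hk_const 1" by (rule hk_const_pos)
  have [measurable]: "\<rho> s \<in> borel_measurable borel" by (rule rho_measurable[OF s(1)])
  have [measurable]: "cball (0::'a) R \<in> sets borel" by simp
  let ?F = "\<lambda>y. ennreal (\<rho> s (x - y)) * indicator {v. 1 \<le> norm v} (x - y) * indicator (cball (0::'a) R) y"
  have i: "integrable lborel (\<lambda>y. complex_of_real (p s x y) * g y)"
  proof (rule Bochner_Integration.integrable_bound)
    show "integrable lborel (\<lambda>y. p s x y * B)" by (intro Bochner_Integration.integrable_mult_left integrable_p s)
    show "(\<lambda>y. complex_of_real (p s x y) * g y) \<in> borel_measurable lborel" using p_measurable_right(1)[OF s(1), of x] gm by simp
    show "AE y in lborel. norm (complex_of_real (p s x y) * g y) \<le> norm (p s x y * B)"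
      using B p_nonneg[OF s(1)] B0 by (intro AE_I2) (auto simp: norm_mult abs_mult intro!: mult_left_mono)
  qed
  have "ennreal (norm (kernel_op (pc (of_real s)) g x)) \<le> (\<integral>\<^sup>+ y. ennreal (norm (complex_of_real (p s x y) * g y)) \<partial>lborel)"
    unfolding kernel_op_pc_real[OF s(1) gm] by (rule integral_norm_bound_ennreal[OF i])
  also have "\<dots> \<le> (\<integral>\<^sup>+ y. ennreal (B * hk_const 1 * s) * ?F y \<partial>lborel)"
  proof (rule nn_integral_mono)
    fix y
    show "ennreal (norm (complex_of_real (p s x y) * g y)) \<le> ennreal (B * hk_const 1 * s) * ?F y"
    proof (cases "norm y \<le> R")
      case True
      have "norm x \<le> norm (x - y) + norm y" using norm_triangle_sub[of x y] by simp
      then have far: "1 \<le> norm (x - y)" using True x by simp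
      have "norm (complex_of_real (p s x y) * g y) = p s x y * norm (g y)" using p_nonneg[OF s(1)] by (simp add: norm_mult)
      also have "\<dots> \<le> (hk_const 1 * s * \<rho> s (x - y)) * B"
        using p_nonneg[OF s(1)] hk s rho_nonneg[OF s(1)] by (intro mult_mono p_le s B mult_nonneg_nonneg) auto
      also have "\<dots> = (B * hk_const 1 * s) * \<rho> s (x - y)" by simp
      finally have "ennreal (norm (complex_of_real (p s x y) * g y)) \<le> ennreal ((B * hk_const 1 * s) * \<rho> s (x - y))" by (rule ennreal_leI)
      then show ?thesis using far True B0 hk s rho_nonneg[OF s(1), of "x - y"] by (simp add: ennreal_mult indicator_def)
    next
      case False
      then show ?thesis using R[of y] by simp
    qed
  qed
  also have "\<dots> = ennreal (B * hk_const 1 * s) * far_mass s R x"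
    unfolding far_mass_def by (rule nn_integral_cmult) measurable
  finally show ?thesis .
qed

lemma Lq_mass_le_nn_integral:
  assumes "u \<in> borel_measurable lebesgue" "(\<integral>\<^sup>+ x. ennreal (norm (u x) powr \<nu>) \<partial>lebesgue) \<le> ennreal c" "0 \<le> c"
  shows "Lq_mass \<nu> u \<le> c"
proof -
  have "Lq_mass \<nu> u = enn2real (\<integral>\<^sup>+ x. ennreal (norm (u x) powr \<nu>) \<partial>lebesgue)"
    unfolding Lq_mass_def by (rule integral_eq_nn_integral) (use assms(1) in auto)
  then show ?thesis using enn2real_leI[OF assms(3,2)] by simp
qed

text \<open>
  Near the support of \<open>g\<close> uniform convergence suffices. Far from it \<open>kernel_op (pc s) g\<close> is at most a
  multiple of \<open>s * far_mass s R\<close>, and the mass of \<open>far_mass s R\<close> is bounded in \<open>s\<close>.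
\<close>

lemma initial_continuous:
  fixes g :: "'a \<Rightarrow> complex"
  assumes \<nu>: "1 \<le> \<nu>" and g: "continuous_on UNIV g" and R: "\<And>x. R < norm x \<Longrightarrow> g x = 0" and gL: "g \<in> Lp_fun \<nu>" and e: "0 < e"
  shows "\<exists>s0>0. \<forall>s. 0 < s \<longrightarrow> s < s0 \<longrightarrow> Lq_mass \<nu> (\<lambda>x. kernel_op (pc (of_real s)) g x - g x) \<le> e"
proof -
  have gm: "g \<in> borel_measurable borel" by (rule borel_measurable_continuous_onI[OF g])
  obtain B where B: "\<And>x. norm (g x) \<le> B"
  proof -
    have "bounded (g ` cball 0 R)" using compact_imp_bounded[OF compact_continuous_image[OF continuous_on_subset[OF g] compact_cball]] by simp
    then obtain B where "\<And>x. x \<in> cball 0 R \<Longrightarrow> norm (g x) \<le> B" unfolding bounded_iff by blast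
    then have "norm (g x) \<le> max B 0" for x using R[of x] by (cases "norm x \<le> R") (auto simp: le_max_iff_disj)
    then show ?thesis using that by blast
  qed
  have B0: "0 \<le> B" using B norm_ge_zero order_trans by blast
  define V1 where "V1 = measure lborel (cball (0::'a) (R + 1))"
  define V where "V = measure lborel (cball (0::'a) R)"
  have V1: "emeasure lborel (cball (0::'a) (R + 1)) = ennreal V1" "0 \<le> V1"
    unfolding V1_def using emeasure_lborel_cball_finite[of "0::'a" "R + 1"] by (auto intro!: emeasure_eq_ennreal_measure)
  have V: "emeasure lborel (cball (0::'a) R) = ennreal V" "0 \<le> V"
    unfolding V_def using emeasure_lborel_cball_finite[of "0::'a" R] by (auto intro!: emeasure_eq_ennreal_measure)
  (* A deviation of at most \<eta> \<le> 1 dominates its own \<nu>-th power, so it suffices to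
     estimate the deviation itself. *)
  define \<eta> where "\<eta> = min 1 (e / (2 * (V1 + 1)))"
  have \<eta>: "0 < \<eta>" "\<eta> \<le> 1" "\<eta> * V1 \<le> e / 2"
  proof -
    show "0 < \<eta>" "\<eta> \<le> 1" using e V1 by (auto simp: \<eta>_def)
    have "\<eta> * V1 \<le> (e / (2 * (V1 + 1))) * V1" using V1 by (intro mult_right_mono) (auto simp: \<eta>_def)
    also have "\<dots> \<le> e / 2" using e V1 by (simp add: divide_le_eq)
    finally show "\<eta> * V1 \<le> e / 2" .
  qed
  obtain s1 where s1: "0 < s1" "\<And>s x. 0 < s \<Longrightarrow> s < s1 \<Longrightarrow> norm (kernel_op (pc (of_real s)) g x - g x) \<le> \<eta>"
    using initial_uniform[OF g R \<eta>(1)] by blast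
  define C where "C = B * hk_const 1 * (max tail_const 0 * V)"
  have C: "0 \<le> C" using B0 hk_const_pos[of 1] V by (simp add: C_def)
  show ?thesis
  proof (intro exI[of _ "min 1 (min s1 (e / (2 * (C + 1))))"] conjI allI impI)
    show "0 < min 1 (min s1 (e / (2 * (C + 1))))" using s1 e C by simp
    fix s assume s: "0 < s" "s < min 1 (min s1 (e / (2 * (C + 1))))"
    have sC: "C * s \<le> e / 2"
    proof -
      have "s * (2 * (C + 1)) < e" using s(2) C by (simp add: pos_less_divide_eq)
      then show ?thesis using s(1) by (simp add: algebra_simps)
    qed
    let ?u = "kernel_op (pc (of_real s)) g"
    let ?H = "\<lambda>x. ennreal \<eta> * indicator (cball (0::'a) (R + 1)) x + ennreal (B * hk_const 1 * s) * far_mass s R x"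
    have bs: "0 \<le> B * hk_const 1 * s" using B0 hk_const_pos[of 1] s by simp
    have [measurable]: "far_mass s R \<in> borel_measurable borel" by (rule far_mass(1)[OF s(1)])
    have [measurable]: "cball (0::'a) (R + 1) \<in> sets borel" by simp
    have sc: "complex_of_real s \<in> wedge slope" by (rule wedge_real[OF slope_pos s(1)])
    obtain k M where D: "dominated_kernel (pc (of_real s)) k M" using pc_dominated_ex[OF sc] by blast
    have um: "(\<lambda>x. ?u x - g x) \<in> borel_measurable lebesgue"
      using dominated_kernel.kernel_op_Lp_fun[OF D \<nu> gL] gL by (auto simp: Lp_fun_def)
    have pw: "ennreal (norm (?u x - g x) powr \<nu>) \<le> ?H x" for x
    proof -
      have n1: "norm (?u x - g x) \<le> \<eta>" using s1(2)[of s x] s by simp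
      have "norm (?u x - g x) powr \<nu> \<le> norm (?u x - g x) powr 1"
        using n1 \<eta>(2) \<nu> by (intro powr_mono') auto
      then have n2: "norm (?u x - g x) powr \<nu> \<le> norm (?u x - g x)" by simp
      show ?thesis
      proof (cases "norm x \<le> R + 1")
        case True
        have "ennreal (norm (?u x - g x) powr \<nu>) \<le> ennreal \<eta>" using n1 n2 by (intro ennreal_leI) simp
        also have "\<dots> \<le> ?H x" using True by (simp add: indicator_def)
        finally show ?thesis .
      next
        case False
        then have "g x = 0" using R by simp
        then have "ennreal (norm (?u x - g x) powr \<nu>) \<le> ennreal (norm (?u x))" using n2 by (intro ennreal_leI) simp
        also have "\<dots> \<le> ennreal (B * hk_const 1 * s) * far_mass s R x"
          by (rule kernel_op_far_le[OF s(1) _ gm R B]) (use False s in auto)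
        finally show ?thesis using False by (simp add: indicator_def)
      qed
    qed
    have "(\<integral>\<^sup>+ x. ennreal (norm (?u x - g x) powr \<nu>) \<partial>lebesgue) \<le> (\<integral>\<^sup>+ x. ?H x \<partial>lebesgue)" by (intro nn_integral_mono pw)
    also have "(\<integral>\<^sup>+ x. ?H x \<partial>lebesgue) = (\<integral>\<^sup>+ x. ?H x \<partial>lborel)" by (rule nn_integral_completion)
    also have "(\<integral>\<^sup>+ x. ?H x \<partial>lborel) = ennreal \<eta> * ennreal V1 + ennreal (B * hk_const 1 * s) * (\<integral>\<^sup>+ x. far_mass s R x \<partial>lborel)"
      using far_mass(1)[OF s(1), of R] V1 by (simp add: nn_integral_add nn_integral_cmult nn_integral_cmult_indicator)
    also have "ennreal \<eta> * ennreal V1 + ennreal (B * hk_const 1 * s) * (\<integral>\<^sup>+ x. far_mass s R x \<partial>lborel) \<le> ennreal (e / 2) + ennreal (e / 2)"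
    proof (rule add_mono)
      show "ennreal \<eta> * ennreal V1 \<le> ennreal (e / 2)"
        using \<eta> V1 by (simp add: ennreal_mult[symmetric] ennreal_leI)
      have "ennreal (B * hk_const 1 * s) * (\<integral>\<^sup>+ x. far_mass s R x \<partial>lborel) \<le> ennreal (B * hk_const 1 * s) * (ennreal (max tail_const 0) * ennreal V)"
      proof (rule mult_left_mono)
        have "(\<integral>\<^sup>+ x. far_mass s R x \<partial>lborel) \<le> ennreal tail_const * ennreal V" using far_mass(2)[OF s(1), of R] V by simp
        also have "ennreal tail_const * ennreal V \<le> ennreal (max tail_const 0) * ennreal V" by (intro mult_right_mono ennreal_leI) auto
        finally show "(\<integral>\<^sup>+ x. far_mass s R x \<partial>lborel) \<le> ennreal (max tail_const 0) * ennreal V" .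
      qed simp
      also have "ennreal (B * hk_const 1 * s) * (ennreal (max tail_const 0) * ennreal V) = ennreal (B * hk_const 1 * s * (max tail_const 0 * V))"
        using bs V by (simp add: ennreal_mult)
      also have "ennreal (B * hk_const 1 * s * (max tail_const 0 * V)) \<le> ennreal (e / 2)"
        using sC by (intro ennreal_leI) (simp add: C_def mult_ac)
      finally show "ennreal (B * hk_const 1 * s) * (\<integral>\<^sup>+ x. far_mass s R x \<partial>lborel) \<le> ennreal (e / 2)" .
    qed
    also have "ennreal (e / 2) + ennreal (e / 2) = ennreal e" using e by (simp add: ennreal_plus[symmetric] del: ennreal_plus)
    finally have "(\<integral>\<^sup>+ x. ennreal (norm (?u x - g x) powr \<nu>) \<partial>lebesgue) \<le> ennreal e" .
    then show "Lq_mass \<nu> (\<lambda>x. ?u x - g x) \<le> e" by (rule Lq_mass_le_nn_integral[OF um]) (use e in simp)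
  qed
qed

lemma initial_Lq:
  assumes \<nu>: "1 \<le> \<nu>" and f: "f \<in> Lp_fun \<nu>" and e: "0 < e"
  shows "\<exists>s>0. s \<le> 1 \<and> Lq_mass \<nu> (\<lambda>x. kernel_op (pc (of_real s)) f x - f x) \<le> e"
proof -
  let ?K = "3 * (2 powr \<nu>)\<^sup>2" and ?m = "(2 * small_mass) powr \<nu> + 1"
  have K: "0 < ?K" "1 \<le> ?m" by auto
  define \<eta> where "\<eta> = e / ?K"
  have \<eta>: "0 < \<eta>" "?K * \<eta> = e" using e K by (auto simp: \<eta>_def)
  obtain g R where g: "continuous_on UNIV g" and R: "\<And>x. R < norm x \<Longrightarrow> g x = 0" and gL: "g \<in> Lp_fun \<nu>"
    and fg: "Lq_mass \<nu> (\<lambda>x. f x - g x) < \<eta> / ?m"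
    using Lp_approx_continuous[OF \<nu> f, of "\<eta> / ?m"] \<eta> K by (smt (verit) divide_pos_pos)
  obtain s0 where s0: "0 < s0" "\<And>s. 0 < s \<Longrightarrow> s < s0 \<Longrightarrow> Lq_mass \<nu> (\<lambda>x. kernel_op (pc (of_real s)) g x - g x) \<le> \<eta>"
    using initial_continuous[OF \<nu> g R gL \<eta>(1)] by blast
  define s where "s = min 1 (s0 / 2)"
  have s: "0 < s" "s \<le> 1" "s < s0" using s0 by (auto simp: s_def)
  have sc: "complex_of_real s \<in> wedge slope" by (rule wedge_real[OF slope_pos s(1)])
  have D: "dominated_kernel (pc (of_real s)) (\<lambda>x. ext_const 1 * gevrey_maj (Re (of_real s)) x) small_mass"
    by (rule pc_dominated_small[OF sc]) (use s in simp)
  let ?T = "kernel_op (pc (of_real s))"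
  have dL: "(\<lambda>x. f x - g x) \<in> Lp_fun \<nu>" by (rule Lp_fun_diff(1)[OF \<nu> f gL])
  have fg': "Lq_mass \<nu> (\<lambda>x. f x - g x) * ?m \<le> \<eta>" using fg K by (simp add: pos_less_divide_eq)
  have a: "Lq_mass \<nu> (?T (\<lambda>x. f x - g x)) \<le> \<eta>"
  proof -
    have "Lq_mass \<nu> (?T (\<lambda>x. f x - g x)) \<le> (2 * small_mass) powr \<nu> * Lq_mass \<nu> (\<lambda>x. f x - g x)"
      by (rule dominated_kernel.kernel_op_mass_le[OF D \<nu> dL])
    also have "\<dots> \<le> ?m * Lq_mass \<nu> (\<lambda>x. f x - g x)" by (intro mult_right_mono Lq_mass_nonneg) simp
    finally show ?thesis using fg' by (simp add: mult.commute)
  qed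
  have c: "Lq_mass \<nu> (\<lambda>x. (-1) * (f x - g x)) \<le> \<eta>"
  proof -
    have "1 * Lq_mass \<nu> (\<lambda>x. f x - g x) \<le> ?m * Lq_mass \<nu> (\<lambda>x. f x - g x)" by (intro mult_right_mono K Lq_mass_nonneg)
    then show ?thesis using fg' unfolding Lp_fun_cmult(2)[OF dL] by (simp add: mult.commute)
  qed
  have fL: "?T f \<in> Lp_fun \<nu>" and gL': "?T g \<in> Lp_fun \<nu>"
    by (rule dominated_kernel.kernel_op_Lp_fun[OF D \<nu> f]) (rule dominated_kernel.kernel_op_Lp_fun[OF D \<nu> gL])
  have "Lq_mass \<nu> (\<lambda>x. ?T f x - f x) \<le> ?K * \<eta>"
  proof (rule Lq_mass_three[OF \<nu> dominated_kernel.kernel_op_Lp_fun[OF D \<nu> dL] Lp_fun_diff(1)[OF \<nu> gL' gL] Lp_fun_cmult(1)[OF dL] _ _ a _ c])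
    show "(\<lambda>x. ?T f x - f x) \<in> borel_measurable lebesgue" using fL f by (auto simp: Lp_fun_def)
    show "AE x in lebesgue. ?T f x - f x = ?T (\<lambda>x. f x - g x) x + (?T g x - g x) + (-1) * (f x - g x)"
      using dominated_kernel.kernel_op_diff_fun[OF D \<nu> f gL] by eventually_elim simp
    show "Lq_mass \<nu> (\<lambda>x. ?T g x - g x) \<le> \<eta>" by (rule s0(2)[OF s(1) s(3)])
  qed
  then show ?thesis using s \<eta>(2) by auto
qed

text \<open>
  For a fixed small real \<open>s\<close>, \<open>T z f - f\<close> is the sum of \<open>T z (f - T s f)\<close>, \<open>T (z + s) f - T s f\<close> and \<open>T s f - f\<close>. The first
  and the last term are small because \<open>s\<close> is, uniformly in \<open>z\<close> by \<open>pc_dominated_small\<close>; the middle one tends to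
  zero with \<open>z\<close> by continuity at \<open>s\<close>.
\<close>

lemma holomorphic_semigroup_strongly_continuous:
  assumes \<nu>: "1 \<le> \<nu>" and f: "f \<in> Lp_fun \<nu>" and e: "0 < e"
  shows "\<exists>d>0. \<forall>z\<in>wedge slope. norm z < d \<longrightarrow> Lq_mass \<nu> (\<lambda>x. kernel_op (pc z) f x - f x) \<le> e"
proof -
  let ?K = "3 * (2 powr \<nu>)\<^sup>2" and ?m = "(2 * small_mass) powr \<nu> + 1"
  have K: "0 < ?K" "1 \<le> ?m" by auto
  define \<eta> where "\<eta> = e / ?K"
  have \<eta>: "0 < \<eta>" "?K * \<eta> = e" using e K by (auto simp: \<eta>_def)
  have "0 < \<eta> / ?m" using K by (intro divide_pos_pos \<eta>) linarith
  from initial_Lq[OF \<nu> f this]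
  obtain s where s: "0 < s" "s \<le> 1" and sm: "Lq_mass \<nu> (\<lambda>x. kernel_op (pc (of_real s)) f x - f x) \<le> \<eta> / ?m" by blast
  have sc: "complex_of_real s \<in> wedge slope" by (rule wedge_real[OF slope_pos s(1)])
  obtain k M where D: "dominated_kernel (pc (of_real s)) k M" using pc_dominated_ex[OF sc] by blast
  obtain d where d: "0 < d" "\<And>h. norm h < d \<Longrightarrow> of_real s + h \<in> wedge slope \<Longrightarrow> Lq_mass \<nu> (\<lambda>x. kernel_op (pc (of_real s + h)) f x - kernel_op (pc (of_real s)) f x) \<le> \<eta>"
    using holomorphic_semigroup_continuous[OF \<nu> sc f \<eta>(1)] by blast
  let ?S = "kernel_op (pc (of_real s))"
  have SL: "?S f \<in> Lp_fun \<nu>" by (rule dominated_kernel.kernel_op_Lp_fun[OF D \<nu> f])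
  have dL: "(\<lambda>x. ?S f x - f x) \<in> Lp_fun \<nu>" by (rule Lp_fun_diff(1)[OF \<nu> SL f])
  have sm': "?m * Lq_mass \<nu> (\<lambda>x. ?S f x - f x) \<le> \<eta>" using sm K by (simp add: pos_le_divide_eq mult.commute)
  show ?thesis
  proof (intro exI[of _ "min 1 d"] conjI ballI impI)
    show "0 < min 1 d" using d by simp
    fix z assume z: "z \<in> wedge slope" and nz: "norm z < min 1 d"
    have "Re z \<le> 1" using nz complex_Re_le_cmod[of z] by simp
    then have Dz: "dominated_kernel (pc z) (\<lambda>x. ext_const 1 * gevrey_maj (Re z) x) small_mass" by (rule pc_dominated_small[OF z])
    have szc: "of_real s + z \<in> wedge slope" by (rule wedge_add[OF sc z])
    obtain k' M' where Ds: "dominated_kernel (pc (of_real s + z)) k' M'" using pc_dominated_ex[OF szc] by blast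
    let ?T = "kernel_op (pc z)"
    have TL: "?T f \<in> Lp_fun \<nu>" "?T (\<lambda>x. ?S f x - f x) \<in> Lp_fun \<nu>"
      by (rule dominated_kernel.kernel_op_Lp_fun[OF Dz \<nu> f]) (rule dominated_kernel.kernel_op_Lp_fun[OF Dz \<nu> dL])
    have a: "Lq_mass \<nu> (\<lambda>x. (-1) * ?T (\<lambda>x. ?S f x - f x) x) \<le> \<eta>"
    proof -
      have "Lq_mass \<nu> (?T (\<lambda>x. ?S f x - f x)) \<le> (2 * small_mass) powr \<nu> * Lq_mass \<nu> (\<lambda>x. ?S f x - f x)"
        by (rule dominated_kernel.kernel_op_mass_le[OF Dz \<nu> dL])
      also have "\<dots> \<le> ?m * Lq_mass \<nu> (\<lambda>x. ?S f x - f x)" by (intro mult_right_mono Lq_mass_nonneg) simp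
      finally show ?thesis using sm' unfolding Lp_fun_cmult(2)[OF TL(2)] by simp
    qed
    have c: "Lq_mass \<nu> (\<lambda>x. ?S f x - f x) \<le> \<eta>"
    proof -
      have "1 * Lq_mass \<nu> (\<lambda>x. ?S f x - f x) \<le> ?m * Lq_mass \<nu> (\<lambda>x. ?S f x - f x)" by (intro mult_right_mono K Lq_mass_nonneg)
      then show ?thesis using sm' by linarith
    qed
    have comp: "AE x in lebesgue. ?T (?S f) x = kernel_op (pc (of_real s + z)) f x"
      by (rule kernel_op_composition[OF \<nu> f Dz D Ds]) (simp add: pc_semigroup[OF _ z sc, symmetric] add.commute)
    have "Lq_mass \<nu> (\<lambda>x. ?T f x - f x) \<le> ?K * \<eta>"
    proof (rule Lq_mass_three[OF \<nu> Lp_fun_cmult(1)[OF TL(2)] Lp_fun_diff(1)[OF \<nu> dominated_kernel.kernel_op_Lp_fun[OF Ds \<nu> f] SL] dL _ _ a _ c])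
      show "(\<lambda>x. ?T f x - f x) \<in> borel_measurable lebesgue" using TL f by (auto simp: Lp_fun_def)
      show "AE x in lebesgue. ?T f x - f x = (-1) * ?T (\<lambda>x. ?S f x - f x) x + (kernel_op (pc (of_real s + z)) f x - ?S f x) + (?S f x - f x)"
        using dominated_kernel.kernel_op_diff_fun[OF Dz \<nu> SL f] comp by eventually_elim simp
      show "Lq_mass \<nu> (\<lambda>x. kernel_op (pc (of_real s + z)) f x - ?S f x) \<le> \<eta>" using d(2)[OF _ szc] nz by simp
    qed
    then show "Lq_mass \<nu> (\<lambda>x. ?T f x - f x) \<le> e" using \<eta>(2) by simp
  qed
qed

lemma holomorphic_semigroup_real: assumes t: "0 \<le> t" and f: "f \<in> Lp_fun \<nu>" shows "holomorphic_semigroup (of_real t) f x = kernel_semigroup p t f x"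
proof (cases "t = 0")
  case False
  then have t: "0 < t" using t by simp
  have tc: "complex_of_real t \<in> wedge slope" by (rule wedge_real[OF slope_pos t])
  obtain k M where D: "dominated_kernel (pc (of_real t)) k M" using pc_dominated_ex[OF tc] by blast
  have pm: "(\<lambda>y. complex_of_real (p t x y)) \<in> borel_measurable borel" using p_measurable_right(1)[OF t, of x] by simp
  have "kernel_op (pc (of_real t)) f x = (LINT y|lebesgue. of_real (p t x y) * f y)"
    by (rule dominated_kernel.kernel_op_cong[where K'="\<lambda>x y. of_real (p t x y)", OF D _ pm Lp_fun_measurable[OF f]]) (simp add: pc_real t)
  then show ?thesis using t by (simp add: holomorphic_semigroup_wedge[OF tc] kernel_semigroup_def scaleR_conv_of_real)
qed (simp add: holomorphic_semigroup_def kernel_semigroup_def)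

theorem analytic_semigroup:
  assumes \<nu>: "1 \<le> \<nu>" shows "Lp_analytic_semigroup \<nu> (kernel_semigroup p)"
  unfolding Lp_analytic_semigroup_def
proof (intro exI[of _ "arctan slope"] exI[of _ holomorphic_semigroup] conjI)
  note sec = sector_arctan[OF slope_pos]
  show "0 < arctan slope" using slope_pos by simp
  show "arctan slope \<le> pi / 2" using arctan_ubound[of slope] by simp
  show "\<forall>t\<ge>0. \<forall>f\<in>Lp_fun \<nu>. AE x in lebesgue. holomorphic_semigroup (complex_of_real t) f x = kernel_semigroup p t f x"
    by (simp add: holomorphic_semigroup_real)
  show "\<forall>z\<in>insert 0 (sector (arctan slope)). Lp_bounded_linear \<nu> (holomorphic_semigroup z)"
  proof (unfold sec, intro ballI)
    fix z assume z: "z \<in> insert 0 (wedge slope)"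
    show "Lp_bounded_linear \<nu> (holomorphic_semigroup z)"
    proof (cases "z = 0")
      case True
      then show ?thesis by (auto simp: holomorphic_semigroup_def Lp_bounded_linear_def intro!: exI[of _ 1])
    next
      case False
      then have zc: "z \<in> wedge slope" using z by simp
      obtain k M where D: "dominated_kernel (pc z) k M" using pc_dominated_ex[OF zc] by blast
      have "holomorphic_semigroup z = kernel_op (pc z)" using False by (auto simp: holomorphic_semigroup_def)
      then show ?thesis using dominated_kernel.kernel_op_bounded_linear[OF D \<nu>] by simp
    qed
  qed
  show "\<forall>f\<in>Lp_fun \<nu>. AE x in lebesgue. holomorphic_semigroup 0 f x = f x" by (simp add: holomorphic_semigroup_def)
  show "\<forall>z\<in>insert 0 (sector (arctan slope)). \<forall>w\<in>insert 0 (sector (arctan slope)). \<forall>f\<in>Lp_fun \<nu>.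
           AE x in lebesgue. holomorphic_semigroup (z + w) f x = holomorphic_semigroup z (holomorphic_semigroup w f) x"
  proof (unfold sec, intro ballI)
    fix z w and f :: "'a \<Rightarrow> complex" assume zw: "z \<in> insert 0 (wedge slope)" "w \<in> insert 0 (wedge slope)" and f: "f \<in> Lp_fun \<nu>"
    show "AE x in lebesgue. holomorphic_semigroup (z + w) f x = holomorphic_semigroup z (holomorphic_semigroup w f) x"
    proof (cases "z = 0 \<or> w = 0")
      case True
      then show ?thesis by (auto simp: holomorphic_semigroup_def)
    next
      case False
      then have z: "z \<in> wedge slope" and w: "w \<in> wedge slope" using zw by auto
      note zw = wedge_add[OF z w]
      obtain k1 M1 where D1: "dominated_kernel (pc z) k1 M1" using pc_dominated_ex[OF z] by blast
      obtain k2 M2 where D2: "dominated_kernel (pc w) k2 M2" using pc_dominated_ex[OF w] by blast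
      obtain k3 M3 where D3: "dominated_kernel (pc (z + w)) k3 M3" using pc_dominated_ex[OF zw] by blast
      have "AE x in lebesgue. kernel_op (pc z) (kernel_op (pc w) f) x = kernel_op (pc (z + w)) f x"
        by (rule kernel_op_composition[OF \<nu> f D1 D2 D3]) (rule pc_semigroup[OF _ z w])
      then show ?thesis unfolding holomorphic_semigroup_wedge[OF z] holomorphic_semigroup_wedge[OF w] holomorphic_semigroup_wedge[OF zw] by eventually_elim simp
    qed
  qed
  show "\<forall>z\<in>sector (arctan slope). Lp_complex_differentiable_at \<nu> holomorphic_semigroup z"
    unfolding sec using holomorphic_semigroup_differentiable[OF \<nu>] by blast
  show "\<forall>\<theta>'\<in>{0<..<arctan slope}. \<forall>f\<in>Lp_fun \<nu>. ((\<lambda>z. Lp_norm \<nu> (\<lambda>x. holomorphic_semigroup z f x - f x)) \<longlongrightarrow> 0) (at 0 within sector \<theta>')"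
  proof (intro ballI)
    fix \<theta>' and f :: "'a \<Rightarrow> complex" assume th: "\<theta>' \<in> {0<..<arctan slope}" and f: "f \<in> Lp_fun \<nu>"
    have sub: "sector \<theta>' \<subseteq> wedge slope" using th by (auto simp: sec[symmetric] sector_def)
    show "((\<lambda>z. Lp_norm \<nu> (\<lambda>x. holomorphic_semigroup z f x - f x)) \<longlongrightarrow> 0) (at 0 within sector \<theta>')"
    proof (rule tendstoI)
      fix e :: real assume e: "0 < e"
      then have e': "0 < (e / 2) powr \<nu>" by simp
      obtain d where d: "0 < d" "\<And>z. z \<in> wedge slope \<Longrightarrow> norm z < d \<Longrightarrow> Lq_mass \<nu> (\<lambda>x. kernel_op (pc z) f x - f x) \<le> (e / 2) powr \<nu>"
        using holomorphic_semigroup_strongly_continuous[OF \<nu> f e'] by blast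
      have "dist (Lp_norm \<nu> (\<lambda>x. holomorphic_semigroup z f x - f x)) 0 < e" if z: "z \<in> sector \<theta>'" "norm z < d" for z
      proof -
        have zc: "z \<in> wedge slope" using z sub by blast
        have "Lp_norm \<nu> (\<lambda>x. holomorphic_semigroup z f x - f x) \<le> ((e / 2) powr \<nu>) powr (1 / \<nu>)"
          unfolding Lp_norm_mass holomorphic_semigroup_wedge[OF zc] using \<nu> d(2)[OF zc z(2)] Lq_mass_nonneg by (intro powr_mono2) auto
        also have "\<dots> = e / 2" using \<nu> e by (simp add: powr_powr)
        finally show ?thesis using e by (simp add: Lp_norm_def)
      qed
      then show "\<forall>\<^sub>F z in at 0 within sector \<theta>'. dist (Lp_norm \<nu> (\<lambda>x. holomorphic_semigroup z f x - f x)) 0 < e"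
        unfolding eventually_at using d(1) by (intro exI[of _ d]) auto
    qed
  qed
qed

end

section \<open>Generator and analyticity\<close>

theorem theorem1p3:
  fixes \<phi> :: "real \<Rightarrow> real" and \<mu> :: "real measure"
    and J :: "'a::euclidean_space \<Rightarrow> real" and \<kappa> :: "'a \<Rightarrow> 'a \<Rightarrow> real"
    and p :: "real \<Rightarrow> 'a \<Rightarrow> 'a \<Rightarrow> real"
    and \<delta>\<^sub>1 a\<^sub>1 \<gamma>\<^sub>0 \<kappa>\<^sub>0 \<kappa>\<^sub>1 \<kappa>\<^sub>2 \<beta> :: real
  assumes bernstein: "bernstein_repr \<phi> \<mu>" and normalized: "\<phi> 1 = 1"
    and A1_exponents: "0 < \<delta>\<^sub>1" "\<delta>\<^sub>1 \<le> 2" "0 < a\<^sub>1" "a\<^sub>1 < 1"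
    and A1_scaling: "\<And>l r. 1 \<le> l \<Longrightarrow> 1 \<le> r \<Longrightarrow> a\<^sub>1 * l powr \<delta>\<^sub>1 * Phi \<phi> r \<le> Phi \<phi> (l * r)"
    and A1_integral: "set_integrable lebesgue {0<..<1} (\<lambda>r. Phi \<phi> r / r)"
    and A2_measurable: "J \<in> borel_measurable lebesgue"
    and A2_pos: "\<And>x. 0 < J x" and A2_symmetric: "\<And>x. J x = J (- x)"
    and A2_gamma: "0 < \<gamma>\<^sub>0"
    and A2_comparable: "\<And>y. y \<noteq> 0 \<Longrightarrow>
          inverse \<gamma>\<^sub>0 * levy_density DIM('a) \<mu> (norm y) \<le> J y \<and>
          J y \<le> \<gamma>\<^sub>0 * levy_density DIM('a) \<mu> (norm y)"
    and A3_measurable: "(\<lambda>(x, z). \<kappa> x z) \<in> borel_measurable borel"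
    and A3_bounds: "0 < \<kappa>\<^sub>0" "\<And>x z. \<kappa>\<^sub>0 \<le> \<kappa> x z \<and> \<kappa> x z \<le> \<kappa>\<^sub>1"
    and A3_symmetric: "\<And>x z. \<kappa> x z = \<kappa> x (- z)"
    and A3_hoelder: "0 < \<beta>" "\<beta> \<le> 1"
          "\<And>x y z. \<bar>\<kappa> x z - \<kappa> y z\<bar> \<le> \<kappa>\<^sub>2 * norm (x - y) powr \<beta>"
    and A4: "\<exists>g :: 'a \<Rightarrow> real. (\<forall>x. 0 < g x) \<and> filterlim g at_top at_infinity \<and>
          (\<forall>x. nonlocal_defined \<kappa> J 0 g x) \<and> (\<exists>C. \<forall>x. nonlocal_op \<kappa> J 0 g x / g x \<le> C)"
    and heat_kernel: "is_heat_kernel \<phi> \<kappa> J p"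
  shows "(\<forall>\<epsilon>>0. \<forall>f\<in>C_b2 \<epsilon>.
            (\<forall>x. nonlocal_defined \<kappa> J 0 f x) \<and>
            uniform_limit UNIV (\<lambda>t x. (kernel_semigroup p t f x - f x) / t)
              (nonlocal_op \<kappa> J 0 f) (at_right 0)) \<and>
         (\<forall>q\<ge>1. Lp_analytic_semigroup q (kernel_semigroup p))"
proof -
  (* J is comparable to the jump density of \<phi>, against which min 1 (norm z ^ 2)
     is integrable. *)
  have J_finite: "(\<integral>\<^sup>+ z. ennreal (min 1 ((norm z)\<^sup>2) * J z) \<partial>lebesgue) < \<infinity>"
  proof -
    interpret bernstein \<phi> \<mu> by unfold_locales (rule bernstein, rule normalized)
    let ?c = "inverse \<gamma>\<^sub>0" and ?m = "\<lambda>z::'a. min 1 ((norm z)\<^sup>2)"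
    obtain K where K: "(\<integral>\<^sup>+ z. ennreal (?m z * levy_density DIM('a) \<mu> (norm z)) \<partial>lborel) \<le> ennreal K"
      using levy_density_integrable[where 'a='a] by blast
    have c: "0 < ?c" using A2_gamma by simp
    have meas: "(\<lambda>z. ennreal (?m z * J z)) \<in> borel_measurable lebesgue"
    proof -
      have "?m \<in> borel_measurable borel" by simp
      then have "?m \<in> borel_measurable lebesgue" by (intro measurable_completion) simp
      then show ?thesis using A2_measurable by simp
    qed
    have "ennreal ?c * (\<integral>\<^sup>+ z. ennreal (?m z * J z) \<partial>lebesgue) = (\<integral>\<^sup>+ z. ennreal ?c * ennreal (?m z * J z) \<partial>lebesgue)"
      by (rule nn_integral_cmult[symmetric, OF meas])
    also have "(\<integral>\<^sup>+ z. ennreal ?c * ennreal (?m z * J z) \<partial>lebesgue) \<le> (\<integral>\<^sup>+ z. ennreal (?m z * levy_density DIM('a) \<mu> (norm z)) \<partial>lebesgue)"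
    proof (rule nn_integral_mono_AE)
      have "AE z in lborel. z \<noteq> (0::'a)" by (rule AE_lborel_singleton)
      then have "AE z in lebesgue. z \<noteq> (0::'a)" by (rule AE_completion)
      then show "AE z in lebesgue. ennreal ?c * ennreal (?m z * J z) \<le> ennreal (?m z * levy_density DIM('a) \<mu> (norm z))"
      proof eventually_elim
        case (elim z)
        have "?c * J z \<le> levy_density DIM('a) \<mu> (norm z)"
          using A2_comparable[OF elim] A2_gamma by (simp add: field_simps)
        then have "?m z * (?c * J z) \<le> ?m z * levy_density DIM('a) \<mu> (norm z)" by (intro mult_left_mono) auto
        then have "ennreal (?c * (?m z * J z)) \<le> ennreal (?m z * levy_density DIM('a) \<mu> (norm z))"
          by (intro ennreal_leI) (simp only: mult.left_commute)
        then show ?case using c A2_pos[of z] by (simp add: ennreal_mult)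
      qed
    qed
    also have "\<dots> = (\<integral>\<^sup>+ z. ennreal (?m z * levy_density DIM('a) \<mu> (norm z)) \<partial>lborel)" by (rule nn_integral_completion)
    finally have "ennreal ?c * (\<integral>\<^sup>+ z. ennreal (?m z * J z) \<partial>lebesgue) \<le> ennreal K" using K by (rule order_trans)
    then have "ennreal ?c * (\<integral>\<^sup>+ z. ennreal (?m z * J z) \<partial>lebesgue) < \<infinity>" by (rule le_less_trans) simp
    then show ?thesis using c by (auto simp: ennreal_mult_less_top)
  qed
  interpret heat_kernel \<phi> \<mu> \<delta>\<^sub>1 a\<^sub>1 J \<kappa> \<kappa>\<^sub>1 \<kappa>\<^sub>2 \<beta> p
  proof
    show "0 \<le> \<kappa> x z \<and> \<kappa> x z \<le> \<kappa>\<^sub>1" for x z using A3_bounds(1) A3_bounds(2)[of x z] by linarith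
  qed (fact bernstein normalized A1_exponents A1_scaling A1_integral A2_measurable A2_pos A2_symmetric J_finite
         A3_measurable A3_symmetric A3_hoelder heat_kernel)+
  show ?thesis using generator analytic_semigroup by blast
qed


end
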